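(* Let $f=z^2$ (the case $\alpha=0$ of $f=z(z+\alpha)$). There is an equivalence of categories $$\operatorname{gr}\text{-}A(f)\equiv\operatorname{gr}\text{-}(B,\mathbb{Z}_{\mathrm{fin}}).$$
   Context: $\Bbbk$ is an algebraically closed field of characteristic zero; equivalences are $\Bbbk$-linear. $\mathbb{Z}_{\mathrm{fin}}$ is the group of finite subsets of $\mathbb{Z}$ under symmetric difference $\oplus$; a singleton $\{n\}$ is written $n$. $A=A(z^2)$ is the $\Bbbk$-algebra generated over $\Bbbk[z]$ by $x,y$ with relations $xz=(z+1)x$, $yz=(z-1)y$, $xy=z^2$, $yx=(z-1)^2$, with $\mathbb{Z}$-grading $\deg x=1$, $\deg y=-1$, $\deg z=0$. $\operatorname{gr}\text{-}A$ is the category of finitely generated $\mathbb{Z}$-graded right $A$-modules with degree-preserving homomorphisms; for a $\Gamma$-graded ring $R$, $\operatorname{gr}\text{-}(R,\Gamma)$ is the category of finitely generated $\Gamma$-graded right $R$-modules with degree-preserving homomorphisms. Shifts: $M\langle n\rangle_i=M_{i-n}$. Put $X=A/(x,z)A$ and $Y=(A/(y,z-1)A)\langle 1\rangle$. The graded quotient ring of $A$ is $Q_{\mathrm{gr}}(A)=\Bbbk(z)[x^{\pm1};\sigma]$, $\sigma(z)=z+1$. Rank one graded projective $A$-modules are regarded as graded submodules of $Q_{\mathrm{gr}}(A)$; graded homomorphisms between them are given by left multiplication by elements of $\Bbbk(z)$. Each rank one graded projective $P$ surjects, for each $n\in\mathbb{Z}$, onto exactly one of $X\langle n\rangle$, $Y\langle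 n\rangle$. For $n\in\mathbb{Z}$, $\iota_n$ is the autoequivalence of $\operatorname{gr}\text{-}A$ (constructed in earlier work of the author) swapping $X\langle n\rangle$ and $Y\langle n\rangle$ up to isomorphism and fixing all other simples. On a rank one graded projective $P$, $\iota_nP\subseteq P$ is the kernel of a surjective graded homomorphism $P\to(A/xA)\langle n\rangle$ if $P$ surjects onto $X\langle n\rangle$, and $P\to(A/yA)\langle n+1\rangle$ if $P$ surjects onto $Y\langle n\rangle$; on morphisms between rank one projectives $\iota_n$ acts by restriction. The $\iota_n$ commute and $\iota_n^2P=(z+n)^2P$. For $J\in\mathbb{Z}_{\mathrm{fin}}$ put $\iota_J=\prod_{j\in J}\iota_j$, $\iota_\emptyset=\operatorname{Id}$, and $h_J=\prod_{j\in J}(z+j)^2$, $h_\emptyset=1$. Let $\sigma_J:\iota_J^2A\to A$ be left multiplication by $h_J^{-1}$. $B$ is the $\mathbb{Z}_{\mathrm{fin}}$-graded ring $$B=\bigoplus_{J\in\mathbb{Z}_{\mathrm{fin}}}B_J,\qquad B_J=\operatorname{Hom}_{\operatorname{gr}\text{-}A}(A,\iota_JA),$$ with multiplication, for $a\in B_I$ and $b\in B_J$, $$a\cdot b=\iota_{I\oplus J}(\sigma_{I\cap J})\circ\iota_J(a)\circ b\in\operatorname{Hom}_{\operatorname{gr}\text{-}A}(A,\iota_{I\oplus J}A),$$ where $\iota_{I\oplus J}(\sigma_{I\cap J}):\iota_I\iota_JA=\iota_{I\oplus J}\iota_{I\cap J}^2A\to\iota_{I\oplus J}A$. *)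

theory Defs
  imports
    "HOL-Algebra.Ring"
    "HOL-Algebra.AbelCoset"
    "HOL-Computational_Algebra.Polynomial"
    "HOL-Computational_Algebra.Fraction_Field"
    "HOL-Library.FuncSet"
begin

section \<open>Linear categories and linear equivalence\<close>

record ('o, 'm, 'k) lincat =
  Ob :: "'o set"
  Mor :: "'o \<Rightarrow> 'o \<Rightarrow> 'm set"
  Cmp :: "'o \<Rightarrow> 'o \<Rightarrow> 'o \<Rightarrow> 'm \<Rightarrow> 'm \<Rightarrow> 'm"
  Idt :: "'o \<Rightarrow> 'm"
  MAdd :: "'o \<Rightarrow> 'o \<Rightarrow> 'm \<Rightarrow> 'm \<Rightarrow> 'm"
  MZero :: "'o \<Rightarrow> 'o \<Rightarrow> 'm"
  MScale :: "'o \<Rightarrow> 'o \<Rightarrow> 'k \<Rightarrow> 'm \<Rightarrow> 'm"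

text \<open>Morphism sets of different pairs of objects need not be disjoint; instead the operations take
  source and target objects as arguments. \<open>Cmp C X Y Z g f\<close> is the composite of
  \<open>f : X \<rightarrow> Y\<close> followed by \<open>g : Y \<rightarrow> Z\<close>.\<close>

locale linear_category =
  fixes C :: "('o, 'm, 'k::field) lincat"
  assumes id_in: "X \<in> Ob C \<Longrightarrow> Idt C X \<in> Mor C X X"
    and cmp_in: "\<lbrakk>X \<in> Ob C; Y \<in> Ob C; Z \<in> Ob C; f \<in> Mor C X Y; g \<in> Mor C Y Z\<rbrakk>
      \<Longrightarrow> Cmp C X Y Z g f \<in> Mor C X Z"
    and id_left: "\<lbrakk>X \<in> Ob C; Y \<in> Ob C; f \<in> Mor C X Y\<rbrakk> \<Longrightarrow> Cmp C X Y Y (Idt C Y) f = f"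
    and id_right: "\<lbrakk>X \<in> Ob C; Y \<in> Ob C; f \<in> Mor C X Y\<rbrakk> \<Longrightarrow> Cmp C X X Y f (Idt C X) = f"
    and cmp_assoc: "\<lbrakk>W \<in> Ob C; X \<in> Ob C; Y \<in> Ob C; Z \<in> Ob C;
        f \<in> Mor C W X; g \<in> Mor C X Y; h \<in> Mor C Y Z\<rbrakk>
      \<Longrightarrow> Cmp C W Y Z h (Cmp C W X Y g f) = Cmp C W X Z (Cmp C X Y Z h g) f"
    and hom_group: "\<lbrakk>X \<in> Ob C; Y \<in> Ob C\<rbrakk> \<Longrightarrow>
        comm_group \<lparr>carrier = Mor C X Y, monoid.mult = MAdd C X Y, one = MZero C X Y\<rparr>"
    and scale_in: "\<lbrakk>X \<in> Ob C; Y \<in> Ob C; f \<in> Mor C X Y\<rbrakk> \<Longrightarrow> MScale C X Y c f \<in> Mor C X Y"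
    and scale_one: "\<lbrakk>X \<in> Ob C; Y \<in> Ob C; f \<in> Mor C X Y\<rbrakk> \<Longrightarrow> MScale C X Y 1 f = f"
    and scale_scale: "\<lbrakk>X \<in> Ob C; Y \<in> Ob C; f \<in> Mor C X Y\<rbrakk>
      \<Longrightarrow> MScale C X Y c (MScale C X Y d f) = MScale C X Y (c * d) f"
    and scale_add_scalar: "\<lbrakk>X \<in> Ob C; Y \<in> Ob C; f \<in> Mor C X Y\<rbrakk>
      \<Longrightarrow> MScale C X Y (c + d) f = MAdd C X Y (MScale C X Y c f) (MScale C X Y d f)"
    and scale_add: "\<lbrakk>X \<in> Ob C; Y \<in> Ob C; f \<in> Mor C X Y; g \<in> Mor C X Y\<rbrakk>
      \<Longrightarrow> MScale C X Y c (MAdd C X Y f g) = MAdd C X Y (MScale C X Y c f) (MScale C X Y c g)"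
    and cmp_add_left: "\<lbrakk>X \<in> Ob C; Y \<in> Ob C; Z \<in> Ob C; f \<in> Mor C X Y; g \<in> Mor C Y Z; h \<in> Mor C Y Z\<rbrakk>
      \<Longrightarrow> Cmp C X Y Z (MAdd C Y Z g h) f = MAdd C X Z (Cmp C X Y Z g f) (Cmp C X Y Z h f)"
    and cmp_add_right: "\<lbrakk>X \<in> Ob C; Y \<in> Ob C; Z \<in> Ob C; e \<in> Mor C X Y; f \<in> Mor C X Y; g \<in> Mor C Y Z\<rbrakk>
      \<Longrightarrow> Cmp C X Y Z g (MAdd C X Y e f) = MAdd C X Z (Cmp C X Y Z g e) (Cmp C X Y Z g f)"
    and cmp_scale_left: "\<lbrakk>X \<in> Ob C; Y \<in> Ob C; Z \<in> Ob C; f \<in> Mor C X Y; g \<in> Mor C Y Z\<rbrakk>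
      \<Longrightarrow> Cmp C X Y Z (MScale C Y Z c g) f = MScale C X Z c (Cmp C X Y Z g f)"
    and cmp_scale_right: "\<lbrakk>X \<in> Ob C; Y \<in> Ob C; Z \<in> Ob C; f \<in> Mor C X Y; g \<in> Mor C Y Z\<rbrakk>
      \<Longrightarrow> Cmp C X Y Z g (MScale C X Y c f) = MScale C X Z c (Cmp C X Y Z g f)"

locale linear_functor =
  fixes C :: "('o, 'm, 'k::field) lincat" and D :: "('p, 'n, 'k) lincat"
    and Fo :: "'o \<Rightarrow> 'p" and Fm :: "'o \<Rightarrow> 'o \<Rightarrow> 'm \<Rightarrow> 'n"
  assumes obj_in: "X \<in> Ob C \<Longrightarrow> Fo X \<in> Ob D"
    and mor_in: "\<lbrakk>X \<in> Ob C; Y \<in> Ob C; f \<in> Mor C X Y\<rbrakk> \<Longrightarrow> Fm X Y f \<in> Mor D (Fo X) (Fo Y)"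
    and map_id: "X \<in> Ob C \<Longrightarrow> Fm X X (Idt C X) = Idt D (Fo X)"
    and map_cmp: "\<lbrakk>X \<in> Ob C; Y \<in> Ob C; Z \<in> Ob C; f \<in> Mor C X Y; g \<in> Mor C Y Z\<rbrakk>
      \<Longrightarrow> Fm X Z (Cmp C X Y Z g f) = Cmp D (Fo X) (Fo Y) (Fo Z) (Fm Y Z g) (Fm X Y f)"
    and map_add: "\<lbrakk>X \<in> Ob C; Y \<in> Ob C; f \<in> Mor C X Y; g \<in> Mor C X Y\<rbrakk>
      \<Longrightarrow> Fm X Y (MAdd C X Y f g) = MAdd D (Fo X) (Fo Y) (Fm X Y f) (Fm X Y g)"
    and map_scale: "\<lbrakk>X \<in> Ob C; Y \<in> Ob C; f \<in> Mor C X Y\<rbrakk>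
      \<Longrightarrow> Fm X Y (MScale C X Y c f) = MScale D (Fo X) (Fo Y) c (Fm X Y f)"

definition isomorphism :: "('o, 'm, 'k) lincat \<Rightarrow> 'o \<Rightarrow> 'o \<Rightarrow> 'm \<Rightarrow> bool" where
  "isomorphism C X Y f \<longleftrightarrow> f \<in> Mor C X Y \<and>
     (\<exists>g \<in> Mor C Y X. Cmp C X Y X g f = Idt C X \<and> Cmp C Y X Y f g = Idt C Y)"

definition natural_isomorphism ::
  "('o, 'm, 'k) lincat \<Rightarrow> ('p, 'n, 'k) lincat \<Rightarrow> ('o \<Rightarrow> 'p) \<Rightarrow> ('o \<Rightarrow> 'o \<Rightarrow> 'm \<Rightarrow> 'n)
     \<Rightarrow> ('o \<Rightarrow> 'p) \<Rightarrow> ('o \<Rightarrow> 'o \<Rightarrow> 'm \<Rightarrow> 'n) \<Rightarrow> ('o \<Rightarrow> 'n) \<Rightarrow> bool" where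
  "natural_isomorphism C D Fo Fm Go Gm \<eta> \<longleftrightarrow>
     (\<forall>X \<in> Ob C. isomorphism D (Fo X) (Go X) (\<eta> X)) \<and>
     (\<forall>X \<in> Ob C. \<forall>Y \<in> Ob C. \<forall>f \<in> Mor C X Y.
        Cmp D (Fo X) (Fo Y) (Go Y) (\<eta> Y) (Fm X Y f) = Cmp D (Fo X) (Go X) (Go Y) (Gm X Y f) (\<eta> X))"

definition linearly_equivalent ::
  "('o, 'm, 'k::field) lincat \<Rightarrow> ('p, 'n, 'k) lincat \<Rightarrow> bool" where
  "linearly_equivalent C D \<longleftrightarrow> linear_category C \<and> linear_category D \<and>
     (\<exists>Fo Fm Go Gm \<eta> \<epsilon>. linear_functor C D Fo Fm \<and> linear_functor D C Go Gm \<and>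
        natural_isomorphism C C (\<lambda>X. X) (\<lambda>X Y f. f)
          (\<lambda>X. Go (Fo X)) (\<lambda>X Y f. Gm (Fo X) (Fo Y) (Fm X Y f)) \<eta> \<and>
        natural_isomorphism D D (\<lambda>X. Fo (Go X)) (\<lambda>X Y f. Fm (Go X) (Go Y) (Gm X Y f))
          (\<lambda>X. X) (\<lambda>X Y f. f) \<epsilon>)"


section \<open>Graded algebras and finitely generated graded right modules\<close>

text \<open>\<open>hpart R g\<close> is the component of degree \<open>g\<close> of a graded algebra; \<open>scal R\<close> is its structure map
  from the ground field.\<close>

record ('k, 'g, 'r) galgebra = "'r ring" +
  hpart :: "'g \<Rightarrow> 'r set"
  scal :: "'k \<Rightarrow> 'r"

text \<open>As for the library's (left) modules, the record extends \<open>ring\<close> in order to inherit the additive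
  structure; the fields \<open>mult\<close> and \<open>one\<close> are irrelevant.\<close>

record ('r, 'g, 'u) gmodule = "'u ring" +
  ract :: "'u \<Rightarrow> 'r \<Rightarrow> 'u"
  hcomp :: "'g \<Rightarrow> 'u set"

locale graded_module =
  fixes R :: "('k, 'g::ab_group_add, 'r) galgebra" and M :: "('r, 'g, 'u) gmodule"
  assumes add_group: "abelian_group M"
    and ract_in: "\<lbrakk>m \<in> carrier M; r \<in> carrier R\<rbrakk> \<Longrightarrow> ract M m r \<in> carrier M"
    and ract_add_left: "\<lbrakk>m \<in> carrier M; n \<in> carrier M; r \<in> carrier R\<rbrakk>
      \<Longrightarrow> ract M (m \<oplus>\<^bsub>M\<^esub> n) r = ract M m r \<oplus>\<^bsub>M\<^esub> ract M n r"
    and ract_add_right: "\<lbrakk>m \<in> carrier M; r \<in> carrier R; s \<in> carrier R\<rbrakk>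
      \<Longrightarrow> ract M m (r \<oplus>\<^bsub>R\<^esub> s) = ract M m r \<oplus>\<^bsub>M\<^esub> ract M m s"
    and ract_mult: "\<lbrakk>m \<in> carrier M; r \<in> carrier R; s \<in> carrier R\<rbrakk>
      \<Longrightarrow> ract M m (r \<otimes>\<^bsub>R\<^esub> s) = ract M (ract M m r) s"
    and ract_one: "m \<in> carrier M \<Longrightarrow> ract M m \<one>\<^bsub>R\<^esub> = m"
    and hcomp_subgroup: "subgroup (hcomp M g) (add_monoid M)"
    and decomposition: "m \<in> carrier M \<Longrightarrow>
      \<exists>!c. (\<forall>g. c g \<in> hcomp M g) \<and> finite {g. c g \<noteq> \<zero>\<^bsub>M\<^esub>} \<and> m = (\<Oplus>\<^bsub>M\<^esub>g\<in>{g. c g \<noteq> \<zero>\<^bsub>M\<^esub>}. c g)"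
    and ract_degree: "\<lbrakk>m \<in> hcomp M g; r \<in> hpart R h\<rbrakk> \<Longrightarrow> ract M m r \<in> hcomp M (g + h)"

definition fin_generated :: "('k, 'g, 'r) galgebra \<Rightarrow> ('r, 'g, 'u) gmodule \<Rightarrow> bool" where
  "fin_generated R M \<longleftrightarrow> (\<exists>S \<subseteq> carrier M. finite S \<and>
     (\<forall>m \<in> carrier M. \<exists>r \<in> S \<rightarrow> carrier R. m = (\<Oplus>\<^bsub>M\<^esub>s\<in>S. ract M s (r s))))"

text \<open>Morphisms are extensional functions, so that equality of morphisms is equality on the source.\<close>

definition ghom :: "('k, 'g, 'r) galgebra \<Rightarrow> ('r, 'g, 'u) gmodule \<Rightarrow> ('r, 'g, 'v) gmodule
    \<Rightarrow> ('u \<Rightarrow> 'v) set" where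
  "ghom R M N = {f \<in> carrier M \<rightarrow>\<^sub>E carrier N.
     (\<forall>m \<in> carrier M. \<forall>n \<in> carrier M. f (m \<oplus>\<^bsub>M\<^esub> n) = f m \<oplus>\<^bsub>N\<^esub> f n) \<and>
     (\<forall>m \<in> carrier M. \<forall>r \<in> carrier R. f (ract M m r) = ract N (f m) r) \<and>
     (\<forall>g. f ` hcomp M g \<subseteq> hcomp N g)}"

text \<open>The category \<open>gr-(R,\<Gamma>)\<close>, with \<open>\<Gamma>\<close> the type \<open>'g\<close>, of modules whose carrier is a subset of
  the type \<open>'u\<close>. If \<open>'u\<close> is infinite and at least as large as \<open>R\<close>, every finitely generated graded
  module is isomorphic to an object of this category. The vector space structure on homomorphisms is the pointwise one, a module over
  \<open>R\<close> being a vector space through \<open>scal R\<close>.\<close>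

definition gr_cat :: "('k, 'g::ab_group_add, 'r) galgebra
    \<Rightarrow> (('r, 'g, 'u) gmodule, 'u \<Rightarrow> 'u, 'k) lincat" where
  "gr_cat R = \<lparr>
     Ob = {M. graded_module R M \<and> fin_generated R M},
     Mor = ghom R,
     Cmp = (\<lambda>L M N g f. compose (carrier L) g f),
     Idt = (\<lambda>M. \<lambda>m\<in>carrier M. m),
     MAdd = (\<lambda>M N f g. \<lambda>m\<in>carrier M. f m \<oplus>\<^bsub>N\<^esub> g m),
     MZero = (\<lambda>M N. \<lambda>m\<in>carrier M. \<zero>\<^bsub>N\<^esub>),
     MScale = (\<lambda>M N c f. \<lambda>m\<in>carrier M. ract N (f m) (scal R c))\<rparr>"

text \<open>\<open>shift n M\<close> is \<open>M\<langle>n\<rangle>\<close>, i.e. \<open>M\<langle>n\<rangle>\<^sub>i = M\<^sub>i\<^sub>-\<^sub>n\<close>.\<close>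

definition shift :: "'g::ab_group_add \<Rightarrow> ('r, 'g, 'u) gmodule \<Rightarrow> ('r, 'g, 'u) gmodule" where
  "shift n M = M\<lparr>hcomp := (\<lambda>i. hcomp M (i - n))\<rparr>"

text \<open>\<open>R/I\<close> for a homogeneous right ideal \<open>I\<close>, as a set of cosets.\<close>

definition quotient_module :: "('k, 'g, 'r) galgebra \<Rightarrow> 'r set \<Rightarrow> ('r, 'g, 'r set) gmodule" where
  "quotient_module R I = \<lparr>
     carrier = a_rcosets\<^bsub>R\<^esub> I, monoid.mult = undefined, one = undefined,
     zero = I, add = set_add R,
     ract = (\<lambda>U r. \<Union>u\<in>U. I +>\<^bsub>R\<^esub> (u \<otimes>\<^bsub>R\<^esub> r)),
     hcomp = (\<lambda>g. (\<lambda>r. I +>\<^bsub>R\<^esub> r) ` hpart R g)\<rparr>"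

definition surjects_onto :: "('k, 'g, 'r) galgebra \<Rightarrow> ('r, 'g, 'u) gmodule \<Rightarrow> ('r, 'g, 'v) gmodule
    \<Rightarrow> bool" where
  "surjects_onto R M N \<longleftrightarrow> (\<exists>f \<in> ghom R M N. f ` carrier M = carrier N)"

definition is_kernel_of_surjection :: "('k, 'g, 'r) galgebra \<Rightarrow> 'u set \<Rightarrow> ('r, 'g, 'u) gmodule
    \<Rightarrow> ('r, 'g, 'v) gmodule \<Rightarrow> bool" where
  "is_kernel_of_surjection R K M N \<longleftrightarrow>
     (\<exists>f \<in> ghom R M N. f ` carrier M = carrier N \<and> K = a_kernel M N f)"


section \<open>The generalized Weyl algebra \<open>A(z\<^sup>2)\<close>\<close>

text \<open>The algebra is constructed from its presentation: formal expressions in \<open>x\<close>, \<open>y\<close> and constants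
  from \<open>k[z]\<close>, modulo the congruence generated by the ring axioms, by the requirements that
  \<open>GConst\<close> be a ring homomorphism from \<open>k[z]\<close> with \<open>k\<close> central, and by the defining relations.\<close>

datatype 'c gwa_expr =
  GConst 'c | GX | GY
  | GNeg "'c gwa_expr"
  | GAdd "'c gwa_expr" "'c gwa_expr"
  | GMul "'c gwa_expr" "'c gwa_expr"

inductive gwa_rel :: "'k::field poly gwa_expr \<Rightarrow> 'k poly gwa_expr \<Rightarrow> bool" where
  gr_refl: "gwa_rel a a"
| gr_sym: "gwa_rel a b \<Longrightarrow> gwa_rel b a"
| gr_trans: "gwa_rel a b \<Longrightarrow> gwa_rel b c \<Longrightarrow> gwa_rel a c"
| gr_neg: "gwa_rel a b \<Longrightarrow> gwa_rel (GNeg a) (GNeg b)"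
| gr_add: "gwa_rel a b \<Longrightarrow> gwa_rel c d \<Longrightarrow> gwa_rel (GAdd a c) (GAdd b d)"
| gr_mul: "gwa_rel a b \<Longrightarrow> gwa_rel c d \<Longrightarrow> gwa_rel (GMul a c) (GMul b d)"
| gr_add_assoc: "gwa_rel (GAdd (GAdd a b) c) (GAdd a (GAdd b c))"
| gr_add_comm: "gwa_rel (GAdd a b) (GAdd b a)"
| gr_add_zero: "gwa_rel (GAdd (GConst 0) a) a"
| gr_add_neg: "gwa_rel (GAdd (GNeg a) a) (GConst 0)"
| gr_mul_assoc: "gwa_rel (GMul (GMul a b) c) (GMul a (GMul b c))"
| gr_one_mul: "gwa_rel (GMul (GConst 1) a) a"
| gr_mul_one: "gwa_rel (GMul a (GConst 1)) a"
| gr_distrib_right: "gwa_rel (GMul (GAdd a b) c) (GAdd (GMul a c) (GMul b c))"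
| gr_distrib_left: "gwa_rel (GMul a (GAdd b c)) (GAdd (GMul a b) (GMul a c))"
| gr_const_add: "gwa_rel (GConst (p + q)) (GAdd (GConst p) (GConst q))"
| gr_const_mul: "gwa_rel (GConst (p * q)) (GMul (GConst p) (GConst q))"
| gr_scalar_central: "gwa_rel (GMul (GConst [:c:]) a) (GMul a (GConst [:c:]))"
| gr_xz: "gwa_rel (GMul GX (GConst [:0, 1:])) (GMul (GConst ([:0, 1:] + 1)) GX)"
| gr_yz: "gwa_rel (GMul GY (GConst [:0, 1:])) (GMul (GConst ([:0, 1:] - 1)) GY)"
| gr_xy: "gwa_rel (GMul GX GY) (GConst ([:0, 1:]\<^sup>2))"
| gr_yx: "gwa_rel (GMul GY GX) (GConst (([:0, 1:] - 1)\<^sup>2))"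

quotient_type (overloaded) 'k gwa = "'k::field poly gwa_expr" / gwa_rel
  by (rule equivpI) (auto intro: reflpI sympI transpI gr_refl gr_sym gr_trans)

lifting_forget poly.lifting

lift_definition gwa_const :: "'k::field poly \<Rightarrow> 'k gwa" is GConst .
lift_definition gwa_x :: "'k::field gwa" is GX .
lift_definition gwa_y :: "'k::field gwa" is GY .

definition gwa_z :: "'k::field gwa" where "gwa_z = gwa_const [:0, 1:]"

instantiation gwa :: (field) "{ring, monoid_mult}"
begin
lift_definition zero_gwa :: "'a gwa" is "GConst 0" .
lift_definition one_gwa :: "'a gwa" is "GConst 1" .
lift_definition uminus_gwa :: "'a gwa \<Rightarrow> 'a gwa" is GNeg by (rule gr_neg)
lift_definition plus_gwa :: "'a gwa \<Rightarrow> 'a gwa \<Rightarrow> 'a gwa" is GAdd by (rule gr_add)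
lift_definition times_gwa :: "'a gwa \<Rightarrow> 'a gwa \<Rightarrow> 'a gwa" is GMul by (rule gr_mul)
definition minus_gwa :: "'a gwa \<Rightarrow> 'a gwa \<Rightarrow> 'a gwa" where "minus_gwa a b = a + - b"
instance
proof
  fix a b c :: "'a gwa"
  show "a + b + c = a + (b + c)" by transfer (rule gr_add_assoc)
  show "a + b = b + a" by transfer (rule gr_add_comm)
  show "0 + a = a" by transfer (rule gr_add_zero)
  show "- a + a = 0" by transfer (rule gr_add_neg)
  show "a - b = a + - b" by (rule minus_gwa_def)
  show "a * b * c = a * (b * c)" by transfer (rule gr_mul_assoc)
  show "1 * a = a" by transfer (rule gr_one_mul)
  show "a * 1 = a" by transfer (rule gr_mul_one)
  show "(a + b) * c = a * c + b * c" by transfer (rule gr_distrib_right)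
  show "a * (b + c) = a * b + a * c" by transfer (rule gr_distrib_left)
qed
end

inductive gwa_homogeneous :: "int \<Rightarrow> 'k::field gwa \<Rightarrow> bool" where
  "gwa_homogeneous 0 (gwa_const p)"
| "gwa_homogeneous 1 gwa_x"
| "gwa_homogeneous (- 1) gwa_y"
| "gwa_homogeneous i a \<Longrightarrow> gwa_homogeneous i b \<Longrightarrow> gwa_homogeneous i (a + b)"
| "gwa_homogeneous i a \<Longrightarrow> gwa_homogeneous j b \<Longrightarrow> gwa_homogeneous (i + j) (a * b)"

definition gwa_algebra :: "('k::field, int, 'k gwa) galgebra" where
  "gwa_algebra = \<lparr>carrier = UNIV, monoid.mult = (*), one = 1, zero = 0, add = (+),
     hpart = (\<lambda>i. Collect (gwa_homogeneous i)), scal = (\<lambda>c. gwa_const [:c:])\<rparr>"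

definition X_simple :: "('k::field gwa, int, 'k gwa set) gmodule" where
  "X_simple = quotient_module gwa_algebra {gwa_x * a + gwa_z * b | a b. True}"

definition Y_simple :: "('k::field gwa, int, 'k gwa set) gmodule" where
  "Y_simple = shift 1 (quotient_module gwa_algebra {gwa_y * a + (gwa_z - 1) * b | a b. True})"

definition A_mod_xA :: "('k::field gwa, int, 'k gwa set) gmodule" where
  "A_mod_xA = quotient_module gwa_algebra {gwa_x * a | a. True}"

definition A_mod_yA :: "('k::field gwa, int, 'k gwa set) gmodule" where
  "A_mod_yA = quotient_module gwa_algebra {gwa_y * a | a. True}"


section \<open>The graded quotient ring \<open>k(z)[x\<^sup>\<plusminus>\<^sup>1; \<sigma>]\<close>\<close>

lemma pcompose_translate_eq_0_iff:
  "pcompose p [:c, 1:] = 0 \<longleftrightarrow> p = (0::'k::field poly)"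
  by (rule iffI) (auto intro: pcompose_eq_0)

text \<open>\<open>zshift i\<close> is \<open>\<sigma>\<^sup>i\<close>, the automorphism \<open>f(z) \<mapsto> f(z + i)\<close> of \<open>k(z)\<close>.\<close>

lift_definition zshift :: "int \<Rightarrow> 'k::field poly fract \<Rightarrow> 'k poly fract" is
  "\<lambda>i (p, q). (pcompose p [:of_int i, 1:], pcompose q [:of_int i, 1:])"
  by (auto simp: pcompose_translate_eq_0_iff pcompose_mult[symmetric])

lemma zshift_Fract:
  "q \<noteq> 0 \<Longrightarrow> zshift i (Fract p q) = Fract (pcompose p [:of_int i, 1:]) (pcompose q [:of_int i, 1:])"
  by transfer (auto simp: pcompose_translate_eq_0_iff)

lemma zshift_0 [simp]: "zshift i 0 = 0"
  and zshift_1 [simp]: "zshift i 1 = 1"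
  by (simp_all add: Zero_fract_def One_fract_def zshift_Fract pcompose_1)

lemma zshift_add: "zshift i (f + g) = zshift i f + zshift i g"
  by (cases f; cases g)
    (simp add: zshift_Fract pcompose_add pcompose_mult pcompose_translate_eq_0_iff)

lemma zshift_mult: "zshift i (f * g) = zshift i f * zshift i g"
  by (cases f; cases g)
    (simp add: zshift_Fract pcompose_mult pcompose_translate_eq_0_iff)

lemma zshift_zshift: "zshift i (zshift j f) = zshift (i + j) f"
  by (cases f)
    (simp add: zshift_Fract pcompose_translate_eq_0_iff pcompose_assoc pcompose_pCons add_ac
      flip: pcompose_assoc)

lemma zshift_zero [simp]: "zshift 0 f = f"
  by (cases f) (simp add: zshift_Fract)

lemma zshift_sum: "zshift i (sum g S) = (\<Sum>s\<in>S. zshift i (g s))"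
  by (induction S rule: infinite_finite_induct) (simp_all add: zshift_add)

text \<open>The element \<open>\<Sum>\<^sub>i f\<^sub>i x\<^sup>i\<close> is represented by its family of left coefficients \<open>f\<^sub>i\<close>, and is
  multiplied according to \<open>x\<^sup>i g = \<sigma>\<^sup>i(g) x\<^sup>i\<close>.\<close>

typedef (overloaded) 'k qgr = "{q :: int \<Rightarrow> 'k::field poly fract. finite {i. q i \<noteq> 0}}"
  morphisms qcoeff Qgr
  by (rule exI[of _ "\<lambda>_. 0"]) simp

lifting_forget fract.lifting
setup_lifting type_definition_qgr

lemma finite_qcoeff: "finite {i. qcoeff q i \<noteq> 0}"
  using qcoeff by blast

lift_definition qmonom :: "int \<Rightarrow> 'k::field poly fract \<Rightarrow> 'k qgr" is
  "\<lambda>n f i. if i = n then f else 0"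
  by (rule finite_subset[of _ "{n}" for n]) auto

definition qmult :: "(int \<Rightarrow> 'k::field poly fract) \<Rightarrow> (int \<Rightarrow> 'k poly fract) \<Rightarrow> int \<Rightarrow> 'k poly fract"
  where "qmult p q n = (\<Sum>i | p i \<noteq> 0. p i * zshift i (q (n - i)))"

lemma qmult_superset:
  assumes "finite S" "{i. p i \<noteq> 0} \<subseteq> S"
  shows "qmult p q n = (\<Sum>i\<in>S. p i * zshift i (q (n - i)))"
  unfolding qmult_def using assms by (intro sum.mono_neutral_left) auto

lemma qmult_const_right:
  assumes "finite {i. p i \<noteq> 0}"
  shows "qmult p (\<lambda>i. if i = 0 then f else 0) n = p n * zshift n f"
proof -
  have "qmult p (\<lambda>i. if i = 0 then f else 0) n
      = (\<Sum>i\<in>insert n {i. p i \<noteq> 0}. p i * zshift i (if n - i = 0 then f else 0))"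
    by (rule qmult_superset) (use assms in auto)
  also have "\<dots> = (\<Sum>i\<in>insert n {i. p i \<noteq> 0}. if i = n then p n * zshift n f else 0)"
    by (rule sum.cong) auto
  also have "\<dots> = p n * zshift n f"
    by (subst sum.delta) (use assms in auto)
  finally show ?thesis .
qed

lemma qmult_support:
  "{n. qmult p q n \<noteq> 0} \<subseteq> (\<lambda>(i, j). i + j) ` ({i. p i \<noteq> 0} \<times> {j. q j \<noteq> 0})"
proof
  fix n assume "n \<in> {n. qmult p q n \<noteq> 0}"
  then obtain i where "p i \<noteq> 0" "p i * zshift i (q (n - i)) \<noteq> 0"
    unfolding qmult_def by (auto elim: sum.not_neutral_contains_not_neutral)
  moreover from this have "q (n - i) \<noteq> 0" by auto
  ultimately show "n \<in> (\<lambda>(i, j). i + j) ` ({i. p i \<noteq> 0} \<times> {j. q j \<noteq> 0})"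
    by (intro image_eqI[of _ _ "(i, n - i)"]) auto
qed

lemma qmult_finite:
  assumes "finite {i. p i \<noteq> 0}" "finite {j. q j \<noteq> 0}"
  shows "finite {n. qmult p q n \<noteq> 0}"
  by (rule finite_subset[OF qmult_support]) (use assms in auto)

lemma qmult_assoc:
  assumes p: "finite {i. p i \<noteq> 0}" and q: "finite {i. q i \<noteq> 0}"
  shows "qmult (qmult p q) r n = qmult p (qmult q r) n"
proof -
  let ?S = "{i. p i \<noteq> 0}" and ?T = "{j. q j \<noteq> 0}"
  let ?U = "(\<lambda>(i, j). i + j) ` (?S \<times> ?T)"
  have U: "finite ?U" using p q by auto
  have "qmult (qmult p q) r n = (\<Sum>m\<in>?U. qmult p q m * zshift m (r (n - m)))"
    by (rule qmult_superset[OF U qmult_support])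
  also have "\<dots> = (\<Sum>m\<in>?U. \<Sum>i\<in>?S. p i * zshift i (q (m - i)) * zshift m (r (n - m)))"
    by (simp add: qmult_def sum_distrib_right)
  also have "\<dots> = (\<Sum>i\<in>?S. \<Sum>m\<in>?U. p i * zshift i (q (m - i)) * zshift m (r (n - m)))"
    by (rule sum.swap)
  also have "\<dots> = (\<Sum>i\<in>?S. p i * zshift i (qmult q r (n - i)))"
  proof (rule sum.cong)
    fix i assume i: "i \<in> ?S"
    have "(\<Sum>m\<in>?U. p i * zshift i (q (m - i)) * zshift m (r (n - m)))
        = (\<Sum>m\<in>(\<lambda>j. i + j) ` ?T. p i * zshift i (q (m - i)) * zshift m (r (n - m)))"
    proof (rule sum.mono_neutral_right[OF U])
      show "(\<lambda>j. i + j) ` ?T \<subseteq> ?U" using i by auto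
      show "\<forall>m\<in>?U - (\<lambda>j. i + j) ` ?T. p i * zshift i (q (m - i)) * zshift m (r (n - m)) = 0"
      proof
        fix m assume "m \<in> ?U - (\<lambda>j. i + j) ` ?T"
        then have "m \<notin> (\<lambda>j. i + j) ` ?T" by blast
        then have "q (m - i) = 0" by (metis (mono_tags, lifting) add.commute diff_add_cancel image_eqI mem_Collect_eq)
        then show "p i * zshift i (q (m - i)) * zshift m (r (n - m)) = 0" by simp
      qed
    qed
    also have "\<dots> = (\<Sum>j\<in>?T. p i * zshift i (q j) * zshift (i + j) (r (n - (i + j))))"
      by (subst sum.reindex) (auto simp: inj_on_def)
    also have "\<dots> = p i * zshift i (qmult q r (n - i))"
      by (simp add: qmult_def zshift_sum sum_distrib_left zshift_mult zshift_zshift mult.assoc diff_diff_eq)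
    finally show "(\<Sum>m\<in>?U. p i * zshift i (q (m - i)) * zshift m (r (n - m))) = \<dots>" .
  qed simp
  also have "\<dots> = qmult p (qmult q r) n" by (simp add: qmult_def)
  finally show ?thesis .
qed

instantiation qgr :: (field) ring_1
begin
lift_definition zero_qgr :: "'a qgr" is "\<lambda>_. 0" by simp
lift_definition one_qgr :: "'a qgr" is "\<lambda>i. if i = 0 then 1 else 0" by simp
lift_definition plus_qgr :: "'a qgr \<Rightarrow> 'a qgr \<Rightarrow> 'a qgr" is "\<lambda>p q i. p i + q i"
proof -
  fix p q :: "int \<Rightarrow> 'a poly fract"
  assume "finite {i. p i \<noteq> 0}" "finite {i. q i \<noteq> 0}"
  then have "finite ({i. p i \<noteq> 0} \<union> {i. q i \<noteq> 0})" by simp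
  then show "finite {i. p i + q i \<noteq> 0}" by (rule rev_finite_subset) auto
qed
lift_definition uminus_qgr :: "'a qgr \<Rightarrow> 'a qgr" is "\<lambda>p i. - p i" by simp
lift_definition times_qgr :: "'a qgr \<Rightarrow> 'a qgr \<Rightarrow> 'a qgr" is qmult by (rule qmult_finite)
definition minus_qgr :: "'a qgr \<Rightarrow> 'a qgr \<Rightarrow> 'a qgr" where "minus_qgr p q = p + - q"
instance
proof
  fix a b c :: "'a qgr"
  show "a + b + c = a + (b + c)" by transfer (simp add: add.assoc)
  show "a + b = b + a" by transfer (simp add: add.commute)
  show "0 + a = a" by transfer simp
  show "- a + a = 0" by transfer simp
  show "a - b = a + - b" by (rule minus_qgr_def)
  show "a * b * c = a * (b * c)" by transfer (simp add: fun_eq_iff qmult_assoc)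
  show "1 * a = a"
  proof (transfer, rule ext)
    fix a :: "int \<Rightarrow> 'a poly fract" and n
    show "qmult (\<lambda>i. if i = 0 then 1 else 0) a n = a n"
      by (subst qmult_superset[of "{0}"]) auto
  qed
  show "a * 1 = a"
  proof (transfer, rule ext)
    fix a :: "int \<Rightarrow> 'a poly fract" and n
    assume f: "finite {i. a i \<noteq> 0}"
    then show "qmult a (\<lambda>i. if i = 0 then 1 else 0) n = a n"
      by (simp add: qmult_const_right)
  qed
  show "(a + b) * c = a * c + b * c"
  proof (transfer, rule ext)
    fix a b c :: "int \<Rightarrow> 'a poly fract" and n
    assume "finite {i. a i \<noteq> 0}" "finite {i. b i \<noteq> 0}"
    then have "finite ({i. a i \<noteq> 0} \<union> {i. b i \<noteq> 0})" by simp
    from qmult_superset[OF this, of a] qmult_superset[OF this, of b]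
      qmult_superset[OF this, of "\<lambda>i. a i + b i"]
    show "qmult (\<lambda>i. a i + b i) c n = qmult a c n + qmult b c n"
      by (subst (1 2 3) qmult_superset[of "{i. a i \<noteq> 0} \<union> {i. b i \<noteq> 0}"])
        (use \<open>finite ({i. a i \<noteq> 0} \<union> {i. b i \<noteq> 0})\<close> in \<open>auto simp: algebra_simps sum.distrib\<close>)
  qed
  show "a * (b + c) = a * b + a * c"
    by transfer (simp add: fun_eq_iff qmult_def zshift_add algebra_simps sum.distrib)
  show "(0 :: 'a qgr) \<noteq> 1" by transfer (auto simp: fun_eq_iff)
qed
end

lemma qmonom_0 [simp]: "qmonom i 0 = 0"
  by transfer auto

lemma qmonom_add: "qmonom i (f + g) = qmonom i f + qmonom i g"
  by transfer auto

lemma qmonom_mult: "qmonom i f * qmonom j g = qmonom (i + j) (f * zshift i g)"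
proof (transfer, rule ext)
  fix i j :: int and f g :: "'a poly fract" and n
  show "qmult (\<lambda>k. if k = i then f else 0) (\<lambda>k. if k = j then g else 0) n =
      (if n = i + j then f * zshift i g else 0)"
    by (subst qmult_superset[of "{i}"]) auto
qed

lemma qmonom_one: "qmonom 0 1 = 1"
  by transfer auto


section \<open>The algebra inside its graded quotient ring\<close>

text \<open>Since \<open>x y = z\<^sup>2\<close>, the element \<open>y\<close> is \<open>x\<^sup>-\<^sup>1 z\<^sup>2 = (z - 1)\<^sup>2 x\<^sup>-\<^sup>1\<close>.\<close>

primrec gwa_eval :: "'k::field poly gwa_expr \<Rightarrow> 'k qgr" where
  "gwa_eval (GConst p) = qmonom 0 (Fract p 1)"
| "gwa_eval GX = qmonom 1 1"
| "gwa_eval GY = qmonom (- 1) (Fract (([:0, 1:] - 1)\<^sup>2) 1)"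
| "gwa_eval (GNeg a) = - gwa_eval a"
| "gwa_eval (GAdd a b) = gwa_eval a + gwa_eval b"
| "gwa_eval (GMul a b) = gwa_eval a * gwa_eval b"

lemma qmonom_scalar_central: "qmonom 0 (Fract [:c:] 1) * q = q * qmonom 0 (Fract [:c:] 1)"
proof (transfer, rule ext)
  fix c :: 'a and q :: "int \<Rightarrow> 'a poly fract" and n
  assume f: "finite {i. q i \<noteq> 0}"
  then have "qmult q (\<lambda>i. if i = 0 then Fract [:c:] 1 else 0) n = q n * Fract [:c:] 1"
    by (simp add: qmult_const_right zshift_Fract pcompose_1)
  moreover have "qmult (\<lambda>i. if i = 0 then Fract [:c:] 1 else 0) q n = Fract [:c:] 1 * q n"
    by (subst qmult_superset[of "{0}"]) auto
  ultimately show "qmult (\<lambda>i. if i = 0 then Fract [:c:] 1 else 0) q n =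
      qmult q (\<lambda>i. if i = 0 then Fract [:c:] 1 else 0) n"
    by (simp add: mult.commute)
qed

lemma gwa_eval_respects: "gwa_rel a b \<Longrightarrow> gwa_eval a = gwa_eval b"
proof (induction rule: gwa_rel.induct)
  case (gr_scalar_central c a)
  then show ?case by (simp add: qmonom_scalar_central)
next
  case (gr_one_mul a)
  then show ?case by (simp add: qmonom_one flip: One_fract_def)
next
  case (gr_mul_one a)
  then show ?case by (simp add: qmonom_one flip: One_fract_def)
next
  case (gr_add_zero a)
  then show ?case by (simp flip: Zero_fract_def)
next
  case (gr_add_neg a)
  then show ?case by (simp flip: Zero_fract_def)
qed (simp_all add: algebra_simps qmonom_mult qmonom_add[symmetric] zshift_Fract pcompose_pCons
    pcompose_1 pcompose_mult pcompose_diff pcompose_add power2_eq_square one_pCons)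

lift_definition gwa_embed :: "'k::field gwa \<Rightarrow> 'k qgr" is gwa_eval
  by (rule gwa_eval_respects)

lemma gwa_embed_add: "gwa_embed (a + b) = gwa_embed a + gwa_embed b"
  by transfer simp

lemma gwa_embed_mult: "gwa_embed (a * b) = gwa_embed a * gwa_embed b"
  by transfer simp

lemma gwa_embed_zero: "gwa_embed 0 = 0"
  by (simp add: zero_gwa_def gwa_embed.abs_eq flip: Zero_fract_def)

lemma gwa_embed_one: "gwa_embed 1 = 1"
  by (simp add: one_gwa_def gwa_embed.abs_eq qmonom_one flip: One_fract_def)

instance gwa :: (field) ring_1
  by standard (metis gwa_embed_zero gwa_embed_one zero_neq_one)

text \<open>A graded right \<open>A\<close>-submodule \<open>P\<close> of \<open>Q\<^sub>g\<^sub>r(A)\<close>, as a graded module.\<close>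

definition qsub :: "'k::field qgr set \<Rightarrow> ('k gwa, int, 'k qgr) gmodule" where
  "qsub P = \<lparr>carrier = P, monoid.mult = undefined, one = undefined, zero = 0, add = (+),
     ract = (\<lambda>q a. q * gwa_embed a),
     hcomp = (\<lambda>i. {q \<in> P. \<forall>j. j \<noteq> i \<longrightarrow> qcoeff q j = 0})\<rparr>"

definition A_sub :: "'k::field qgr set" where
  "A_sub = range gwa_embed"

definition qhom :: "'k::field qgr set \<Rightarrow> 'k qgr set \<Rightarrow> ('k qgr \<Rightarrow> 'k qgr) set" where
  "qhom P P' = ghom gwa_algebra (qsub P) (qsub P')"


section \<open>The functors \<open>\<iota>\<^sub>J\<close> on rank one graded projectives\<close>

text \<open>A rank one graded projective \<open>P \<subseteq> Q\<^sub>g\<^sub>r(A)\<close> surjects onto exactly one of \<open>X\<langle>n\<rangle>\<close> and \<open>Y\<langle>n\<rangle>\<close>, and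
  the kernel of a surjection as below does not depend on its choice. Only the action of the
  autoequivalence \<open>\<iota>\<^sub>n\<close> of \<open>gr-A\<close> on rank one graded projectives is needed to form \<open>B\<close>; for other
  sets the value of \<open>iota\<close> is of no interest.\<close>

definition iota :: "int \<Rightarrow> 'k::field qgr set \<Rightarrow> 'k qgr set" where
  "iota n P = (THE K.
     surjects_onto gwa_algebra (qsub P) (shift n X_simple) \<and>
       is_kernel_of_surjection gwa_algebra K (qsub P) (shift n A_mod_xA) \<or>
     surjects_onto gwa_algebra (qsub P) (shift n Y_simple) \<and>
       is_kernel_of_surjection gwa_algebra K (qsub P) (shift (n + 1) A_mod_yA))"

text \<open>The group of finite subsets of the integers under symmetric difference, written additively.\<close>

typedef zfin = "{J :: int set. finite J}" morphisms elts Zfin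
  by (rule exI[of _ "{}"]) simp

setup_lifting type_definition_zfin

lemma finite_elts [simp]: "finite (elts J)"
  using elts by blast

instantiation zfin :: ab_group_add
begin
lift_definition zero_zfin :: zfin is "{}" by simp
lift_definition plus_zfin :: "zfin \<Rightarrow> zfin \<Rightarrow> zfin" is "\<lambda>I J. (I - J) \<union> (J - I)" by simp
lift_definition uminus_zfin :: "zfin \<Rightarrow> zfin" is "\<lambda>J. J" .
lift_definition minus_zfin :: "zfin \<Rightarrow> zfin \<Rightarrow> zfin" is "\<lambda>I J. (I - J) \<union> (J - I)" by simp
instance by standard (transfer; blast)+
end

lift_definition zfin_inter :: "zfin \<Rightarrow> zfin \<Rightarrow> zfin" is "(\<inter>)" by simp

text \<open>The \<open>\<iota>\<^sub>j\<close> commute on rank one graded projectives, so the order of composition is immaterial.\<close>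

definition iota_set :: "zfin \<Rightarrow> 'k::field qgr set \<Rightarrow> 'k qgr set" where
  "iota_set J P = foldr iota (sorted_list_of_set (elts J)) P"

text \<open>\<open>\<iota>\<^sub>J(f)\<close> for a morphism \<open>f\<close> with source \<open>P\<close>.\<close>

definition iota_mor :: "zfin \<Rightarrow> 'k::field qgr set \<Rightarrow> ('k qgr \<Rightarrow> 'k qgr) \<Rightarrow> ('k qgr \<Rightarrow> 'k qgr)" where
  "iota_mor J P f = restrict f (iota_set J P)"

definition h_elt :: "zfin \<Rightarrow> 'k::field poly fract" where
  "h_elt J = (\<Prod>j\<in>elts J. (Fract [:of_int j, 1:] 1)\<^sup>2)"

definition sigma :: "zfin \<Rightarrow> 'k::field qgr \<Rightarrow> 'k qgr" where
  "sigma J = (\<lambda>q \<in> iota_set J (iota_set J A_sub). qmonom 0 (inverse (h_elt J)) * q)"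


section \<open>The \<open>\<int>\<^sub>f\<^sub>i\<^sub>n\<close>-graded algebra \<open>B\<close>\<close>

definition B_comp :: "zfin \<Rightarrow> ('k::field qgr \<Rightarrow> 'k qgr) set" where
  "B_comp J = qhom A_sub (iota_set J A_sub)"

definition B_comp_zero :: "'k::field qgr \<Rightarrow> 'k qgr" where
  "B_comp_zero = (\<lambda>q \<in> A_sub. 0)"

text \<open>\<open>\<iota>\<^sub>I\<^sub>\<oplus>\<^sub>J(\<sigma>\<^sub>I\<^sub>\<inter>\<^sub>J) \<circ> \<iota>\<^sub>J(a) \<circ> b\<close> for \<open>a \<in> B\<^sub>I\<close>, \<open>b \<in> B\<^sub>J\<close>.\<close>

definition B_comp_mult :: "zfin \<Rightarrow> zfin \<Rightarrow> ('k::field qgr \<Rightarrow> 'k qgr) \<Rightarrow> ('k qgr \<Rightarrow> 'k qgr)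
    \<Rightarrow> 'k qgr \<Rightarrow> 'k qgr" where
  "B_comp_mult I J a b =
     (let K = zfin_inter I J in
      compose A_sub
        (iota_mor (I + J) (iota_set K (iota_set K A_sub)) (sigma K))
        (compose A_sub (iota_mor J A_sub a) b))"

text \<open>An element of \<open>B\<close> is the family of its homogeneous components. The ground field acts on
  \<open>Hom(A, \<iota>\<^sub>J A)\<close> as usual, and embeds in \<open>B\<close> as the multiples of the identity of \<open>A\<close>.\<close>

definition B_carrier :: "(zfin \<Rightarrow> 'k::field qgr \<Rightarrow> 'k qgr) set" where
  "B_carrier = {b. (\<forall>J. b J \<in> B_comp J) \<and> finite {J. b J \<noteq> B_comp_zero}}"

definition B_mult :: "(zfin \<Rightarrow> 'k::field qgr \<Rightarrow> 'k qgr) \<Rightarrow> (zfin \<Rightarrow> 'k qgr \<Rightarrow> 'k qgr)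
    \<Rightarrow> zfin \<Rightarrow> 'k qgr \<Rightarrow> 'k qgr" where
  "B_mult a b K = (\<lambda>q \<in> A_sub.
     \<Sum>(I, J) | a I \<noteq> B_comp_zero \<and> b J \<noteq> B_comp_zero \<and> I + J = K.
       B_comp_mult I J (a I) (b J) q)"

definition B_scalar :: "'k::field \<Rightarrow> zfin \<Rightarrow> 'k qgr \<Rightarrow> 'k qgr" where
  "B_scalar c J = (if J = 0 then \<lambda>q \<in> A_sub. qmonom 0 (Fract [:c:] 1) * q else B_comp_zero)"

definition B_algebra :: "('k::field, zfin, zfin \<Rightarrow> 'k qgr \<Rightarrow> 'k qgr) galgebra" where
  "B_algebra = \<lparr>carrier = B_carrier, monoid.mult = B_mult, one = B_scalar 1,
     zero = (\<lambda>J. B_comp_zero), add = (\<lambda>a b J. \<lambda>q \<in> A_sub. a J q + b J q),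
     hpart = (\<lambda>J. {b \<in> B_carrier. \<forall>I. I \<noteq> J \<longrightarrow> b I = B_comp_zero}),
     scal = B_scalar\<rparr>"

end

theory Submission
  imports Defs "HOL-Library.Equipollence" "HOL-Library.Poly_Mapping"
    "HOL-Computational_Algebra.Polynomial_Factorial"
begin

text \<open>Both categories consist of families of \<open>k[z]\<close>-modules joined by two-way arrows. On the
  component \<open>M\<^sub>i\<close> of a graded \<open>A\<close>-module let \<open>Z\<close> act as \<open>z - i\<close>; then \<open>Z\<close> commutes with \<open>x\<close> and \<open>y\<close>,
  and the two composites of \<open>x : M\<^sub>i \<rightarrow> M\<^sub>i\<^sub>+\<^sub>1\<close> and \<open>y : M\<^sub>i\<^sub>+\<^sub>1 \<rightarrow> M\<^sub>i\<close> are \<open>(Z + i)\<^sup>2\<close>. On the other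
  side, computing the kernels that define \<open>\<iota>\<^sub>J A\<close> gives \<open>B\<^sub>J = h\<^sub>J k[z]\<close>, multiplied by
  \<open>a \<cdot> b = h\<^sub>I\<^sub>\<inter>\<^sub>J\<^sup>-\<^sup>1 a b\<close>. So \<open>B\<close> is generated over \<open>k[z]\<close> by commuting elements \<open>b\<^sub>n\<close> of degree \<open>n\<close> with
  \<open>b\<^sub>n\<^sup>2 = (z + n)\<^sup>2\<close>, and a graded \<open>B\<close>-module is a family \<open>N\<^sub>J\<close> with arrows \<open>b\<^sub>n : N\<^sub>J \<rightarrow> N\<^sub>J\<^sub>\<oplus>\<^sub>n\<close>.

  Let \<open>J\<^sub>i\<close> be the interval between \<open>0\<close> and \<open>i\<close>. Then \<open>J\<^sub>i\<^sub>+\<^sub>1 = J\<^sub>i \<oplus> i\<close>, so restricting \<open>N\<close> along the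
  path \<open>(J\<^sub>i)\<close>, with \<open>x\<close> and \<open>y\<close> both acting by \<open>b\<^sub>i\<close>, yields a graded \<open>A\<close>-module. The
  shift \<open>A\<langle>i\<rangle>\<close> is isomorphic to \<open>\<iota>\<^sub>J A\<close> for \<open>J = J\<^sub>i\<close>, and the components of \<open>A\<close> are
  identified with the components of \<open>B\<close> joining the degrees \<open>J\<^sub>i\<close> (\<open>gwa_B_comparison\<close>). The
  restriction is an equivalence because every degree \<open>K\<close> is covered by two degrees of the path:
  for \<open>i\<close> far to the left and \<open>j\<close> far to the right the sets \<open>J\<^sub>i \<oplus> K\<close> and \<open>J\<^sub>j \<oplus> K\<close> are disjoint,
  and since the characteristic is zero the two polynomials \<open>h\<close> of these sets are coprime. Hence
  \<open>1\<close> lies in \<open>\<Sum> B\<^sub>L B\<^sub>L\<close> with \<open>L\<close> ranging over these two sets, and a \<open>B\<close>-module is determined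
  by its restriction.

  This last argument is a graded Morita argument valid for any two graded algebras
  (\<open>gr_cat_equivalence\<close>). Its categorical part is kept symmetric: pairs of matching modules, together
  with the identification of their components, form a span between the two categories, and a span
  whose legs are surjective on objects and fully faithful gives an equivalence
  (\<open>category_span.linearly_equivalent\<close>). The specific part consists of the
  kernels defining \<open>\<iota>\<^sub>n\<close> (\<open>iota_qfam\<close>) and of the resulting description of \<open>B\<close>
  (\<open>B_comp_eq\<close>, \<open>b_elem_compose\<close>).\<close>

section \<open>Equivalences from spans of categories\<close>

lemma (in linear_category) add_in:
  assumes "X \<in> Ob C" "Y \<in> Ob C" "f \<in> Mor C X Y" "g \<in> Mor C X Y"
  shows "MAdd C X Y f g \<in> Mor C X Y"
proof -
  interpret comm_group "\<lparr>carrier = Mor C X Y, monoid.mult = MAdd C X Y, one = MZero C X Y\<rparr>"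
    by (rule hom_group[OF assms(1,2)])
  show ?thesis using m_closed assms(3,4) by simp
qed

text \<open>Objects of the span are labels \<open>t\<close>, each standing for an object of \<open>C\<close> together with a corresponding
  object of \<open>D\<close>; the relation \<open>corr t t'\<close> is the graph of a bijection between the morphisms on the two
  sides. This avoids choosing a functor in either direction: an equivalence is determined by the span only up to
  the choice of a label over each object.\<close>

locale category_span =
  C: linear_category C + D: linear_category D
  for C :: "('o, 'm, 'k::field) lincat" and D :: "('p, 'n, 'k) lincat" +
  fixes K :: "'t set" and s :: "'t \<Rightarrow> 'o" and r :: "'t \<Rightarrow> 'p"
    and corr :: "'t \<Rightarrow> 't \<Rightarrow> 'm \<Rightarrow> 'n \<Rightarrow> bool"
  assumes source_surj: "s ` K = Ob C"
    and target_surj: "r ` K = Ob D"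
    and corr_ex1_right: "\<lbrakk>t \<in> K; t' \<in> K; f \<in> Mor C (s t) (s t')\<rbrakk>
      \<Longrightarrow> \<exists>!g. g \<in> Mor D (r t) (r t') \<and> corr t t' f g"
    and corr_ex1_left: "\<lbrakk>t \<in> K; t' \<in> K; g \<in> Mor D (r t) (r t')\<rbrakk>
      \<Longrightarrow> \<exists>!f. f \<in> Mor C (s t) (s t') \<and> corr t t' f g"
    and corr_id: "t \<in> K \<Longrightarrow> corr t t (Idt C (s t)) (Idt D (r t))"
    and corr_cmp: "\<lbrakk>t \<in> K; t' \<in> K; t'' \<in> K; f \<in> Mor C (s t) (s t'); g \<in> Mor D (r t) (r t');
        f' \<in> Mor C (s t') (s t''); g' \<in> Mor D (r t') (r t''); corr t t' f g; corr t' t'' f' g'\<rbrakk>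
      \<Longrightarrow> corr t t'' (Cmp C (s t) (s t') (s t'') f' f) (Cmp D (r t) (r t') (r t'') g' g)"
    and corr_add: "\<lbrakk>t \<in> K; t' \<in> K; f \<in> Mor C (s t) (s t'); g \<in> Mor D (r t) (r t');
        f' \<in> Mor C (s t) (s t'); g' \<in> Mor D (r t) (r t'); corr t t' f g; corr t t' f' g'\<rbrakk>
      \<Longrightarrow> corr t t' (MAdd C (s t) (s t') f f') (MAdd D (r t) (r t') g g')"
    and corr_scale: "\<lbrakk>t \<in> K; t' \<in> K; f \<in> Mor C (s t) (s t'); g \<in> Mor D (r t) (r t'); corr t t' f g\<rbrakk>
      \<Longrightarrow> corr t t' (MScale C (s t) (s t') c f) (MScale D (r t) (r t') c g)"
begin

definition fwd :: "'t \<Rightarrow> 't \<Rightarrow> 'm \<Rightarrow> 'n" where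
  "fwd t t' f = (THE g. g \<in> Mor D (r t) (r t') \<and> corr t t' f g)"

lemma fwd:
  assumes "t \<in> K" "t' \<in> K" "f \<in> Mor C (s t) (s t')"
  shows "fwd t t' f \<in> Mor D (r t) (r t')" "corr t t' f (fwd t t' f)"
  using theI'[OF corr_ex1_right[OF assms]] unfolding fwd_def by auto

lemma fwd_eqI:
  assumes "t \<in> K" "t' \<in> K" "f \<in> Mor C (s t) (s t')" "g \<in> Mor D (r t) (r t')" "corr t t' f g"
  shows "fwd t t' f = g"
  using corr_ex1_right[OF assms(1-3)] fwd[OF assms(1-3)] assms by blast

definition choose_object :: "'o \<Rightarrow> 't" where "choose_object X = (SOME t. t \<in> K \<and> s t = X)"

lemma choose_object:
  assumes "X \<in> Ob C" shows "choose_object X \<in> K \<and> s (choose_object X) = X"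
proof -
  from assms have "X \<in> s ` K" by (simp add: source_surj)
  then obtain t where "t \<in> K \<and> s t = X" by auto
  then show ?thesis unfolding choose_object_def by (rule someI)
qed

lemma fwd_cmp:
  assumes t: "t \<in> K" "t' \<in> K" "t'' \<in> K" and f: "f \<in> Mor C (s t) (s t')" "f' \<in> Mor C (s t') (s t'')"
  shows "fwd t t'' (Cmp C (s t) (s t') (s t'') f' f)
    = Cmp D (r t) (r t') (r t'') (fwd t' t'' f') (fwd t t' f)"
proof -
  have ob: "s t \<in> Ob C" "s t' \<in> Ob C" "s t'' \<in> Ob C" "r t \<in> Ob D" "r t' \<in> Ob D" "r t'' \<in> Ob D"
    using t source_surj target_surj by auto
  note g = fwd[OF t(1,2) f(1)] fwd[OF t(2,3) f(2)]
  show ?thesis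
    by (rule fwd_eqI[OF t(1,3) C.cmp_in[OF ob(1-3) f] D.cmp_in[OF ob(4-6) g(1,3)]
          corr_cmp[OF t f(1) g(1) f(2) g(3,2,4)]])
qed

lemma fwd_id:
  assumes t: "t \<in> K"
  shows "fwd t t (Idt C (s t)) = Idt D (r t)"
proof -
  have ob: "s t \<in> Ob C" "r t \<in> Ob D" using t source_surj target_surj by auto
  show ?thesis
    by (rule fwd_eqI[OF t t C.id_in[OF ob(1)] D.id_in[OF ob(2)] corr_id[OF t]])
qed

lemma fwd_functor:
  "linear_functor C D (\<lambda>X. r (choose_object X))
     (\<lambda>X Y. fwd (choose_object X) (choose_object Y))"
proof (unfold_locales, goal_cases)
  case (1 X) then show ?case using choose_object target_surj by blast
next
  case (2 X Y f) then show ?case by (intro fwd) (simp_all add: choose_object)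
next
  case (3 X)
  then have ch: "choose_object X \<in> K" "s (choose_object X) = X" using choose_object by auto
  then show ?case using fwd_id[OF ch(1)] by simp
next
  case (4 X Y Z f g)
  let ?X = "choose_object X" and ?Y = "choose_object Y" and ?Z = "choose_object Z"
  have ch: "?X \<in> K" "?Y \<in> K" "?Z \<in> K" "s ?X = X" "s ?Y = Y" "s ?Z = Z"
    using choose_object 4 by auto
  have "fwd ?X ?Z (Cmp C (s ?X) (s ?Y) (s ?Z) g f)
      = Cmp D (r ?X) (r ?Y) (r ?Z) (fwd ?Y ?Z g) (fwd ?X ?Y f)"
    using ch 4(4,5) by (intro fwd_cmp) simp_all
  then show ?case by (simp add: ch)
next
  case (5 X Y f g)
  let ?X = "choose_object X" and ?Y = "choose_object Y"
  have ch: "?X \<in> K" "?Y \<in> K" "s ?X = X" "s ?Y = Y"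
    using choose_object 5 by auto
  have ob: "r ?X \<in> Ob D" "r ?Y \<in> Ob D" using ch target_surj by auto
  have f: "f \<in> Mor C (s ?X) (s ?Y)" "g \<in> Mor C (s ?X) (s ?Y)" using ch 5 by auto
  note f' = fwd[OF ch(1,2) f(1)] fwd[OF ch(1,2) f(2)]
  show ?case
    using corr_add[OF ch(1,2) f(1) f'(1) f(2) f'(3) f'(2,4)]
    by (intro fwd_eqI[OF ch(1,2)]) (simp_all add: ch C.add_in D.add_in ob 5 f')
next
  case (6 X Y f c)
  let ?X = "choose_object X" and ?Y = "choose_object Y"
  have ch: "?X \<in> K" "?Y \<in> K" "s ?X = X" "s ?Y = Y"
    using choose_object 6 by auto
  have ob: "r ?X \<in> Ob D" "r ?Y \<in> Ob D" using ch target_surj by auto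
  have f: "f \<in> Mor C (s ?X) (s ?Y)" using ch 6 by auto
  note f' = fwd[OF ch(1,2) f]
  show ?case
    using corr_scale[OF ch(1,2) f f'(1,2), of c]
    by (intro fwd_eqI[OF ch(1,2)]) (simp_all add: ch C.scale_in D.scale_in ob 6 f')
qed

end

lemma (in category_span) converse_span:
  "category_span D C K r s (\<lambda>t t' g f. corr t t' f g)"
proof (unfold_locales, goal_cases)
  case 1 show ?case by (rule target_surj)
next
  case 2 show ?case by (rule source_surj)
next
  case 3 then show ?case by (rule corr_ex1_left)
next
  case 4 then show ?case by (rule corr_ex1_right)
next
  case 5 then show ?case by (rule corr_id)
next
  case 6 show ?case by (rule corr_cmp[OF 6(1-3) 6(5,4,7,6,8,9)])
next
  case 7 show ?case by (rule corr_add[OF 7(1,2) 7(4,3,6,5,7,8)])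
next
  case 8 show ?case by (rule corr_scale[OF 8(1,2) 8(4,3,5)])
qed

lemma (in category_span) fwd_isomorphism:
  assumes "t \<in> K" "t' \<in> K" "isomorphism C (s t) (s t') f"
  shows "isomorphism D (r t) (r t') (fwd t t' f)"
proof -
  from assms(3) obtain g where f: "f \<in> Mor C (s t) (s t')" and g: "g \<in> Mor C (s t') (s t)"
    and gf: "Cmp C (s t) (s t') (s t) g f = Idt C (s t)" "Cmp C (s t') (s t) (s t') f g = Idt C (s t')"
    unfolding isomorphism_def by blast
  show ?thesis
    unfolding isomorphism_def
    using fwd_cmp[OF assms(1,2,1) f g] fwd_cmp[OF assms(2,1,2) g f]
      fwd(1)[OF assms(1,2) f] fwd(1)[OF assms(2,1) g]
    by (intro conjI bexI[of _ "fwd t' t g"]) (simp_all add: gf fwd_id assms)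
qed

context category_span
begin

interpretation inv: category_span D C K r s "\<lambda>t t' g f. corr t t' f g"
  by (rule converse_span)

text \<open>Going from \<open>Y\<close> to \<open>C\<close> and back passes through two labels over the same object of \<open>C\<close>; the
  identity of that object corresponds to the counit. Naturality and invertibility hold because
  they hold for identities and the correspondence is bijective and respects composition.\<close>

lemma counit:
  "natural_isomorphism D D (\<lambda>Y. r (choose_object (s (inv.choose_object Y))))
     (\<lambda>Y Y' g. fwd (choose_object (s (inv.choose_object Y))) (choose_object (s (inv.choose_object Y')))
        (inv.fwd (inv.choose_object Y) (inv.choose_object Y') g))
     (\<lambda>Y. Y) (\<lambda>Y Y' g. g)
     (\<lambda>Y. fwd (choose_object (s (inv.choose_object Y))) (inv.choose_object Y)
        (Idt C (s (inv.choose_object Y))))"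
  unfolding natural_isomorphism_def
proof (intro conjI ballI)
  fix Y assume Y: "Y \<in> Ob D"
  let ?l = "inv.choose_object Y" and ?k = "choose_object (s (inv.choose_object Y))"
  have l: "?l \<in> K" "r ?l = Y" using inv.choose_object[OF Y] by auto
  then have sl: "s ?l \<in> Ob C" using source_surj by blast
  have k: "?k \<in> K" "s ?k = s ?l" using choose_object[OF sl] by auto
  have "isomorphism C (s ?k) (s ?l) (Idt C (s ?l))"
    unfolding isomorphism_def k using C.id_in[OF sl] C.id_left[OF sl sl C.id_in[OF sl]] by blast
  from fwd_isomorphism[OF k(1) l(1) this]
  show "isomorphism D (r ?k) Y (fwd ?k ?l (Idt C (s ?l)))" using l by simp
next
  fix Y Y' g assume Y: "Y \<in> Ob D" and Y': "Y' \<in> Ob D" and g: "g \<in> Mor D Y Y'"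
  let ?l = "inv.choose_object Y" and ?k = "choose_object (s (inv.choose_object Y))"
  let ?l' = "inv.choose_object Y'" and ?k' = "choose_object (s (inv.choose_object Y'))"
  have l: "?l \<in> K" "r ?l = Y" "?l' \<in> K" "r ?l' = Y'"
    using inv.choose_object[OF Y] inv.choose_object[OF Y'] by auto
  then have sl: "s ?l \<in> Ob C" "s ?l' \<in> Ob C" using source_surj by blast+
  have k: "?k \<in> K" "s ?k = s ?l" "?k' \<in> K" "s ?k' = s ?l'"
    using choose_object[OF sl(1)] choose_object[OF sl(2)] by auto
  define f where "f = inv.fwd ?l ?l' g"
  have f: "f \<in> Mor C (s ?l) (s ?l')" and gf: "fwd ?l ?l' f = g"
    unfolding f_def using l g inv.fwd[of ?l ?l' g] by (auto intro: fwd_eqI)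
  have "Cmp C (s ?k) (s ?k') (s ?l') (Idt C (s ?l')) f = Cmp C (s ?k) (s ?l) (s ?l') f (Idt C (s ?l))"
    unfolding k by (simp add: C.id_left[OF sl f] C.id_right[OF sl f])
  moreover have "fwd ?k ?l' (Cmp C (s ?k) (s ?k') (s ?l') (Idt C (s ?l')) f)
      = Cmp D (r ?k) (r ?k') (r ?l') (fwd ?k' ?l' (Idt C (s ?l'))) (fwd ?k ?k' f)"
    using k l f C.id_in[OF sl(2)] by (intro fwd_cmp) simp_all
  moreover have "fwd ?k ?l' (Cmp C (s ?k) (s ?l) (s ?l') f (Idt C (s ?l)))
      = Cmp D (r ?k) (r ?l) (r ?l') (fwd ?l ?l' f) (fwd ?k ?l (Idt C (s ?l)))"
    using k l f C.id_in[OF sl(1)] by (intro fwd_cmp) simp_all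
  ultimately have "Cmp D (r ?k) (r ?k') (r ?l') (fwd ?k' ?l' (Idt C (s ?l'))) (fwd ?k ?k' f)
      = Cmp D (r ?k) (r ?l) (r ?l') (fwd ?l ?l' f) (fwd ?k ?l (Idt C (s ?l)))" by simp
  then show "Cmp D (r ?k) (r ?k') Y' (fwd ?k' ?l' (Idt C (s ?l'))) (fwd ?k ?k' (inv.fwd ?l ?l' g))
      = Cmp D (r ?k) Y Y' g (fwd ?k ?l (Idt C (s ?l)))"
    by (simp add: l gf flip: f_def)
qed

end

text \<open>The unit of the equivalence is the inverse of the counit of the opposite span.\<close>

lemma (in linear_category) isomorphism_inverse_natural:
  assumes "natural_isomorphism B C Fo Fm Go Gm \<epsilon>"
    and Fo: "\<And>X. X \<in> Ob B \<Longrightarrow> Fo X \<in> Ob C" and Go: "\<And>X. X \<in> Ob B \<Longrightarrow> Go X \<in> Ob C"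
    and Fm: "\<And>X Y f. \<lbrakk>X \<in> Ob B; Y \<in> Ob B; f \<in> Mor B X Y\<rbrakk> \<Longrightarrow> Fm X Y f \<in> Mor C (Fo X) (Fo Y)"
    and Gm: "\<And>X Y f. \<lbrakk>X \<in> Ob B; Y \<in> Ob B; f \<in> Mor B X Y\<rbrakk> \<Longrightarrow> Gm X Y f \<in> Mor C (Go X) (Go Y)"
  obtains \<eta> where "natural_isomorphism B C Go Gm Fo Fm \<eta>"
proof -
  have "\<forall>X\<in>Ob B. \<exists>g. g \<in> Mor C (Go X) (Fo X) \<and> \<epsilon> X \<in> Mor C (Fo X) (Go X) \<and>
      Cmp C (Fo X) (Go X) (Fo X) g (\<epsilon> X) = Idt C (Fo X) \<and>
      Cmp C (Go X) (Fo X) (Go X) (\<epsilon> X) g = Idt C (Go X)"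
    using assms(1) unfolding natural_isomorphism_def isomorphism_def by blast
  from bchoice[OF this] obtain \<eta> where \<eta>: "\<And>X. X \<in> Ob B \<Longrightarrow> \<eta> X \<in> Mor C (Go X) (Fo X)"
      "\<And>X. X \<in> Ob B \<Longrightarrow> \<epsilon> X \<in> Mor C (Fo X) (Go X)"
      "\<And>X. X \<in> Ob B \<Longrightarrow> Cmp C (Fo X) (Go X) (Fo X) (\<eta> X) (\<epsilon> X) = Idt C (Fo X)"
      "\<And>X. X \<in> Ob B \<Longrightarrow> Cmp C (Go X) (Fo X) (Go X) (\<epsilon> X) (\<eta> X) = Idt C (Go X)"
    by blast
  have "natural_isomorphism B C Go Gm Fo Fm \<eta>"
    unfolding natural_isomorphism_def
  proof (intro conjI ballI)
    fix X assume "X \<in> Ob B"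
    then show "isomorphism C (Go X) (Fo X) (\<eta> X)" unfolding isomorphism_def using \<eta> by blast
  next
    fix X Y f assume X: "X \<in> Ob B" and Y: "Y \<in> Ob B" and f: "f \<in> Mor B X Y"
    note ob = Fo[OF X] Fo[OF Y] Go[OF X] Go[OF Y] and F = Fm[OF X Y f] and G = Gm[OF X Y f]
    note x = \<eta>(1,2)[OF X] and y = \<eta>(1,2)[OF Y]
    have nat: "Cmp C (Fo X) (Fo Y) (Go Y) (\<epsilon> Y) (Fm X Y f) = Cmp C (Fo X) (Go X) (Go Y) (Gm X Y f) (\<epsilon> X)"
      using assms(1) X Y f unfolding natural_isomorphism_def by blast
    have "Cmp C (Go X) (Go Y) (Fo Y) (\<eta> Y) (Gm X Y f)
        = Cmp C (Go X) (Go Y) (Fo Y) (\<eta> Y)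
            (Cmp C (Go X) (Go X) (Go Y) (Gm X Y f) (Cmp C (Go X) (Fo X) (Go X) (\<epsilon> X) (\<eta> X)))"
      by (simp add: \<eta>(4)[OF X] id_right[OF ob(3,4) G])
    also have "\<dots> = Cmp C (Go X) (Go Y) (Fo Y) (\<eta> Y)
            (Cmp C (Go X) (Fo X) (Go Y) (Cmp C (Fo X) (Fo Y) (Go Y) (\<epsilon> Y) (Fm X Y f)) (\<eta> X))"
      by (simp add: nat cmp_assoc[OF ob(3,1,3,4) x G])
    also have "\<dots> = Cmp C (Go X) (Fo X) (Fo Y)
        (Cmp C (Fo X) (Go Y) (Fo Y) (\<eta> Y) (Cmp C (Fo X) (Fo Y) (Go Y) (\<epsilon> Y) (Fm X Y f))) (\<eta> X)"
      by (rule cmp_assoc[OF ob(3,1,4,2) x(1) cmp_in[OF ob(1,2,4) F y(2)] y(1)])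
    also have "Cmp C (Fo X) (Go Y) (Fo Y) (\<eta> Y) (Cmp C (Fo X) (Fo Y) (Go Y) (\<epsilon> Y) (Fm X Y f))
        = Fm X Y f"
      by (simp add: cmp_assoc[OF ob(1,2,4,2) F y(2,1)] \<eta>(3)[OF Y] id_left[OF ob(1,2) F])
    finally show "Cmp C (Go X) (Go Y) (Fo Y) (\<eta> Y) (Gm X Y f)
        = Cmp C (Go X) (Fo X) (Fo Y) (Fm X Y f) (\<eta> X)" .
  qed
  then show thesis by (rule that)
qed

theorem (in category_span) linearly_equivalent: "linearly_equivalent C D"
proof -
  interpret inv: category_span D C K r s "\<lambda>t t' g f. corr t t' f g"
    by (rule converse_span)
  interpret F: linear_functor C D "\<lambda>X. r (choose_object X)"
    "\<lambda>X Y. fwd (choose_object X) (choose_object Y)" by (rule fwd_functor)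
  interpret G: linear_functor D C "\<lambda>X. s (inv.choose_object X)"
    "\<lambda>X Y. inv.fwd (inv.choose_object X) (inv.choose_object Y)" by (rule inv.fwd_functor)
  obtain \<eta> where "natural_isomorphism C C (\<lambda>X. X) (\<lambda>X Y f. f)
      (\<lambda>X. s (inv.choose_object (r (choose_object X))))
      (\<lambda>X Y f. inv.fwd (inv.choose_object (r (choose_object X))) (inv.choose_object (r (choose_object Y)))
          (fwd (choose_object X) (choose_object Y) f)) \<eta>"
  proof (rule C.isomorphism_inverse_natural[OF inv.counit])
    show "\<And>X. X \<in> Ob C \<Longrightarrow> s (inv.choose_object (r (choose_object X))) \<in> Ob C"
      by (intro G.obj_in F.obj_in)
    show "\<And>X Y f. X \<in> Ob C \<Longrightarrow> Y \<in> Ob C \<Longrightarrow> f \<in> Mor C X Y \<Longrightarrow>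
       inv.fwd (inv.choose_object (r (choose_object X))) (inv.choose_object (r (choose_object Y)))
        (fwd (choose_object X) (choose_object Y) f) \<in> Mor C (s (inv.choose_object (r (choose_object X))))
           (s (inv.choose_object (r (choose_object Y))))"
      by (intro G.mor_in F.mor_in F.obj_in)
  qed auto
  then have "\<exists>\<eta> \<epsilon>. linear_functor C D (\<lambda>X. r (choose_object X)) (\<lambda>X Y. fwd (choose_object X) (choose_object Y)) \<and>
      linear_functor D C (\<lambda>X. s (inv.choose_object X)) (\<lambda>X Y. inv.fwd (inv.choose_object X) (inv.choose_object Y)) \<and>
      natural_isomorphism C C (\<lambda>X. X) (\<lambda>X Y f. f)
        (\<lambda>X. s (inv.choose_object (r (choose_object X))))
        (\<lambda>X Y f. inv.fwd (inv.choose_object (r (choose_object X))) (inv.choose_object (r (choose_object Y)))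
          (fwd (choose_object X) (choose_object Y) f)) \<eta> \<and>
      natural_isomorphism D D (\<lambda>Y. r (choose_object (s (inv.choose_object Y))))
        (\<lambda>Y Y' g. fwd (choose_object (s (inv.choose_object Y))) (choose_object (s (inv.choose_object Y')))
          (inv.fwd (inv.choose_object Y) (inv.choose_object Y') g))
        (\<lambda>Y. Y) (\<lambda>Y Y' g. g) \<epsilon>"
    using counit fwd_functor inv.fwd_functor by (intro exI conjI) assumption+
  then show ?thesis
    unfolding linearly_equivalent_def
    by (intro conjI C.linear_category_axioms D.linear_category_axioms) (elim exE, intro exI)
qed

section \<open>Graded groups and graded homomorphisms\<close>

locale graded_group = abelian_group M for M :: "('u, 'x) ring_scheme" (structure) +
  fixes H :: "'g \<Rightarrow> 'u set"
  assumes H_subgroup: "subgroup (H g) (add_monoid M)"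
    and H_decomposition: "m \<in> carrier M \<Longrightarrow>
      \<exists>!c. (\<forall>g. c g \<in> H g) \<and> finite {g. c g \<noteq> \<zero>} \<and> m = (\<Oplus>g\<in>{g. c g \<noteq> \<zero>}. c g)"
begin

lemma H_carrier: "m \<in> H g \<Longrightarrow> m \<in> carrier M"
  using subgroup.subset[OF H_subgroup] by auto

lemma H_zero: "\<zero> \<in> H g"
  using subgroup.one_closed[OF H_subgroup] by simp

lemma H_add: "m \<in> H g \<Longrightarrow> n \<in> H g \<Longrightarrow> m \<oplus> n \<in> H g"
  using subgroup.m_closed[OF H_subgroup] by simp

lemma H_minus: "m \<in> H g \<Longrightarrow> \<ominus> m \<in> H g"
  using subgroup.m_inv_closed[OF H_subgroup] by (simp add: a_inv_def)

text \<open>The projections of the direct sum decomposition.\<close>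

definition hpr :: "'u \<Rightarrow> 'g \<Rightarrow> 'u" where
  "hpr m = (THE c. (\<forall>g. c g \<in> H g) \<and> finite {g. c g \<noteq> \<zero>} \<and> m = (\<Oplus>g\<in>{g. c g \<noteq> \<zero>}. c g))"

lemma
  assumes "m \<in> carrier M"
  shows hpr_in: "hpr m g \<in> H g" and hpr_finite: "finite {g. hpr m g \<noteq> \<zero>}"
    and hpr_finsum: "(\<Oplus>g\<in>{g. hpr m g \<noteq> \<zero>}. hpr m g) = m"
  using theI'[OF H_decomposition[OF assms]] unfolding hpr_def[symmetric] by auto

lemma hpr_finsum_superset:
  assumes "m \<in> carrier M" "finite S" "{g. hpr m g \<noteq> \<zero>} \<subseteq> S"
  shows "(\<Oplus>g\<in>S. hpr m g) = m"
proof -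
  have "(\<Oplus>g\<in>S. hpr m g) = (\<Oplus>g\<in>{g. hpr m g \<noteq> \<zero>}. hpr m g)"
    using assms H_carrier[OF hpr_in[OF assms(1)]]
    by (intro add.finprod_mono_neutral_cong_right) auto
  then show ?thesis using hpr_finsum[OF assms(1)] by simp
qed

lemma hpr_unique:
  assumes c: "\<And>g. c g \<in> H g" and S: "finite S" "\<And>g. g \<notin> S \<Longrightarrow> c g = \<zero>"
  shows "hpr (\<Oplus>g\<in>S. c g) = c"
proof -
  let ?m = "\<Oplus>g\<in>S. c g"
  have cc: "\<And>g. c g \<in> carrier M" using c H_carrier by blast
  have m: "?m \<in> carrier M" using cc by (intro finsum_closed) auto
  have "?m = (\<Oplus>g\<in>{g. c g \<noteq> \<zero>}. c g)"
    using S cc by (intro add.finprod_mono_neutral_cong_right) auto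
  moreover have "finite {g. c g \<noteq> \<zero>}" using S by (auto intro: finite_subset)
  ultimately show ?thesis
    unfolding hpr_def using c by (intro the1_equality H_decomposition[OF m]) auto
qed

lemma hpr_add:
  assumes "m \<in> carrier M" "n \<in> carrier M"
  shows "hpr (m \<oplus> n) g = hpr m g \<oplus> hpr n g"
proof -
  let ?S = "{g. hpr m g \<noteq> \<zero>} \<union> {g. hpr n g \<noteq> \<zero>}"
  have S: "finite ?S" using hpr_finite assms by simp
  note c = H_carrier[OF hpr_in[OF assms(1)]] H_carrier[OF hpr_in[OF assms(2)]]
  have "m \<oplus> n = (\<Oplus>g\<in>?S. hpr m g) \<oplus> (\<Oplus>g\<in>?S. hpr n g)"
    using assms S by (simp add: hpr_finsum_superset)
  also have "\<dots> = (\<Oplus>g\<in>?S. hpr m g \<oplus> hpr n g)"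
    using c by (intro finsum_addf[symmetric]) auto
  finally have "hpr (m \<oplus> n) = hpr (\<Oplus>g\<in>?S. hpr m g \<oplus> hpr n g)" by simp
  also have "\<dots> = (\<lambda>g. hpr m g \<oplus> hpr n g)"
    using S assms by (intro hpr_unique) (auto simp: hpr_in H_add)
  finally show ?thesis by simp
qed

lemma hpr_homogeneous:
  assumes "m \<in> H g" shows "hpr m = (\<lambda>h. if h = g then m else \<zero>)"
proof -
  have "m = (\<Oplus>h\<in>{g}. if h = g then m else \<zero>)"
    using H_carrier[OF assms] by simp
  moreover have "hpr (\<Oplus>h\<in>{g}. if h = g then m else \<zero>) = (\<lambda>h. if h = g then m else \<zero>)"
    using assms H_zero by (intro hpr_unique) auto
  ultimately show ?thesis by simp
qed

lemma hpr_zero: "hpr \<zero> g = \<zero>"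
  using hpr_homogeneous[OF H_zero, of g] by simp

lemma hpr_eqI:
  assumes "m \<in> carrier M" "n \<in> carrier M" "\<And>g. hpr m g = hpr n g"
  shows "m = n"
proof -
  have "hpr m = hpr n" using assms(3) by (rule ext)
  have "m = (\<Oplus>g\<in>{g. hpr m g \<noteq> \<zero>}. hpr m g)" by (rule hpr_finsum[OF assms(1), symmetric])
  also have "\<dots> = (\<Oplus>g\<in>{g. hpr n g \<noteq> \<zero>}. hpr n g)" by (simp only: \<open>hpr m = hpr n\<close>)
  also have "\<dots> = n" by (rule hpr_finsum[OF assms(2)])
  finally show ?thesis .
qed

lemma homogeneous_induct [consumes 1, case_names homogeneous add]:
  assumes m: "m \<in> carrier M"
    and hom: "\<And>g n. n \<in> H g \<Longrightarrow> P n"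
    and add: "\<And>n n'. n \<in> carrier M \<Longrightarrow> n' \<in> carrier M \<Longrightarrow> P n \<Longrightarrow> P n' \<Longrightarrow> P (n \<oplus> n')"
  shows "P m"
proof -
  have "P (\<Oplus>g\<in>S. hpr m g)" if "finite S" for S
    using that
  proof induction
    case empty show ?case using hom[OF H_zero] by (simp only: finsum_empty)
  next
    case (insert g S)
    have c: "\<And>h. hpr m h \<in> carrier M" using H_carrier[OF hpr_in[OF m]] .
    then have "(\<Oplus>g\<in>insert g S. hpr m g) = hpr m g \<oplus> (\<Oplus>g\<in>S. hpr m g)"
      using insert.hyps by (intro finsum_insert) auto
    then show ?case
      using add[OF c finsum_closed hom[OF hpr_in[OF m]] insert.IH] c by auto
  qed
  from this[OF hpr_finite[OF m]] show ?thesis by (simp only: hpr_finsum[OF m])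
qed

lemma additive_extension:
  fixes W :: "('w, 'y) ring_scheme" and \<phi> :: "'g \<Rightarrow> 'u \<Rightarrow> 'w"
  assumes W: "abelian_group W"
    and in_W: "\<And>g m. m \<in> H g \<Longrightarrow> \<phi> g m \<in> carrier W"
    and add: "\<And>g m n. m \<in> H g \<Longrightarrow> n \<in> H g \<Longrightarrow> \<phi> g (m \<oplus> n) = \<phi> g m \<oplus>\<^bsub>W\<^esub> \<phi> g n"
  obtains \<Phi> where "\<Phi> \<in> carrier M \<rightarrow>\<^sub>E carrier W"
    "\<And>m n. m \<in> carrier M \<Longrightarrow> n \<in> carrier M \<Longrightarrow> \<Phi> (m \<oplus> n) = \<Phi> m \<oplus>\<^bsub>W\<^esub> \<Phi> n"
    "\<And>g m. m \<in> H g \<Longrightarrow> \<Phi> m = \<phi> g m"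
proof -
  interpret W: abelian_group W by (rule W)
  have zero: "\<phi> g \<zero> = \<zero>\<^bsub>W\<^esub>" for g
    using add[OF H_zero H_zero, of g] in_W[OF H_zero, of g] by simp
  define \<Phi> where "\<Phi> = (\<lambda>m\<in>carrier M. finsum W (\<lambda>g. \<phi> g (hpr m g)) {g. hpr m g \<noteq> \<zero>})"
  have superset: "\<Phi> m = finsum W (\<lambda>g. \<phi> g (hpr m g)) S"
    if "m \<in> carrier M" "finite S" "{g. hpr m g \<noteq> \<zero>} \<subseteq> S" for m S
    unfolding \<Phi>_def using that
    by (auto intro!: W.add.finprod_mono_neutral_cong_left simp: zero in_W hpr_in)
  have 1: "\<Phi> \<in> carrier M \<rightarrow>\<^sub>E carrier W"
    unfolding \<Phi>_def by (auto intro!: W.finsum_closed simp: in_W hpr_in)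
  have 2: "\<Phi> (m \<oplus> n) = \<Phi> m \<oplus>\<^bsub>W\<^esub> \<Phi> n" if mn: "m \<in> carrier M" "n \<in> carrier M" for m n
  proof -
    let ?S = "{g. hpr m g \<noteq> \<zero>} \<union> {g. hpr n g \<noteq> \<zero>}"
    have S: "finite ?S" using hpr_finite mn by simp
    have "\<Phi> (m \<oplus> n) = finsum W (\<lambda>g. \<phi> g (hpr (m \<oplus> n) g)) ?S"
      using mn S by (intro superset) (auto simp: hpr_add)
    also have "\<dots> = finsum W (\<lambda>g. \<phi> g (hpr m g) \<oplus>\<^bsub>W\<^esub> \<phi> g (hpr n g)) ?S"
      using mn by (intro W.finsum_cong') (auto simp: hpr_add add hpr_in in_W)
    also have "\<dots> = finsum W (\<lambda>g. \<phi> g (hpr m g)) ?S \<oplus>\<^bsub>W\<^esub> finsum W (\<lambda>g. \<phi> g (hpr n g)) ?S"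
      using mn by (intro W.finsum_addf) (auto simp: hpr_in in_W)
    finally show ?thesis using superset[OF mn(1) S] superset[OF mn(2) S] by simp
  qed
  have 3: "\<Phi> m = \<phi> g m" if m: "m \<in> H g" for g m
  proof -
    have "\<Phi> m = finsum W (\<lambda>h. \<phi> h (hpr m h)) {g}"
      using m by (intro superset) (auto simp: H_carrier hpr_homogeneous)
    then show ?thesis using in_W[OF m] by (simp add: hpr_homogeneous[OF m])
  qed
  show thesis by (rule that[OF 1 2 3])
qed

end

text \<open>A direct sum decomposition can be recognised from its projections: the difference of \<open>m\<close> and the sum
  of its projections is annihilated by all projections, hence zero.\<close>

lemma graded_groupI:
  fixes M :: "('u, 'x) ring_scheme" (structure) and \<pi> :: "'g \<Rightarrow> 'u \<Rightarrow> 'u"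
  assumes M: "abelian_group M" and H: "\<And>g. subgroup (H g) (add_monoid M)"
    and pr_in: "\<And>g m. m \<in> carrier M \<Longrightarrow> \<pi> g m \<in> H g"
    and pr_add: "\<And>g m n. m \<in> carrier M \<Longrightarrow> n \<in> carrier M \<Longrightarrow> \<pi> g (m \<oplus> n) = \<pi> g m \<oplus> \<pi> g n"
    and pr_same: "\<And>g m. m \<in> H g \<Longrightarrow> \<pi> g m = m"
    and pr_other: "\<And>g h m. m \<in> H g \<Longrightarrow> h \<noteq> g \<Longrightarrow> \<pi> h m = \<zero>"
    and pr_finite: "\<And>m. m \<in> carrier M \<Longrightarrow> finite {g. \<pi> g m \<noteq> \<zero>}"
    and separated: "\<And>m. m \<in> carrier M \<Longrightarrow> (\<And>g. \<pi> g m = \<zero>) \<Longrightarrow> m = \<zero>"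
  shows "graded_group M H"
proof -
  interpret abelian_group M by (rule M)
  have sub: "m \<in> H g \<Longrightarrow> m \<in> carrier M" for g m using subgroup.subset[OF H] by auto
  have pr_zero: "\<pi> g \<zero> = \<zero>" for g
    using subgroup.one_closed[OF H] pr_same[of \<zero> g] by simp
  have pr_sum: "\<pi> g (\<Oplus>h\<in>S. c h) = (if g \<in> S then c g else \<zero>)"
    if "finite S" "\<And>h. c h \<in> H h" for g S c
    using that
  proof induction
    case empty then show ?case by (simp add: pr_zero)
  next
    case (insert h S)
    have cc: "c \<in> S \<rightarrow> carrier M" "c h \<in> carrier M" using insert.prems sub by auto
    show ?case
      using insert cc sub[OF insert.prems] pr_other[OF insert.prems, of g h] pr_same[OF insert.prems, of h]
      by (cases "g = h") (auto simp: pr_add finsum_closed)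
  qed
  have eqI: "m = n" if mn: "m \<in> carrier M" "n \<in> carrier M" and eq: "\<And>g. \<pi> g m = \<pi> g n" for m n
  proof -
    have "\<pi> g (m \<ominus> n) = \<zero>" for g
    proof -
      have "\<pi> g m = \<pi> g ((m \<ominus> n) \<oplus> n)" using mn by (simp add: minus_eq a_assoc l_neg)
      also have "\<dots> = \<pi> g (m \<ominus> n) \<oplus> \<pi> g n" using mn by (intro pr_add) auto
      finally have "\<pi> g n = \<pi> g (m \<ominus> n) \<oplus> \<pi> g n" by (simp add: eq)
      moreover have "\<pi> g (m \<ominus> n) \<in> carrier M" "\<pi> g n \<in> carrier M"
        using mn sub[OF pr_in, of "m \<ominus> n" g] sub[OF pr_in, of n g] by auto
      ultimately show ?thesis by (metis add.r_cancel_one')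
    qed
    then have "m \<ominus> n = \<zero>" using separated[of "m \<ominus> n"] mn by blast
    moreover have "m = (m \<ominus> n) \<oplus> n" using mn by (simp add: minus_eq a_assoc l_neg)
    ultimately show ?thesis using mn by simp
  qed
  show ?thesis
  proof (intro graded_group.intro graded_group_axioms.intro M)
    show "subgroup (H g) (add_monoid M)" for g by (rule H)
    fix m assume m: "m \<in> carrier M"
    let ?P = "\<lambda>c. (\<forall>g. c g \<in> H g) \<and> finite {g. c g \<noteq> \<zero>} \<and> m = (\<Oplus>g\<in>{g. c g \<noteq> \<zero>}. c g)"
    show "\<exists>!c. ?P c"
    proof (rule ex1I)
      have "m = (\<Oplus>g\<in>{g. \<pi> g m \<noteq> \<zero>}. \<pi> g m)"
      proof (rule eqI[OF m])
        show "(\<Oplus>g\<in>{g. \<pi> g m \<noteq> \<zero>}. \<pi> g m) \<in> carrier M"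
          using sub[OF pr_in[OF m]] by (intro finsum_closed) auto
        show "\<pi> g m = \<pi> g (\<Oplus>g\<in>{g. \<pi> g m \<noteq> \<zero>}. \<pi> g m)" for g
          by (subst pr_sum[OF pr_finite[OF m] pr_in[OF m]]) simp
      qed
      then show "?P (\<lambda>g. \<pi> g m)" using pr_in[OF m] pr_finite[OF m] by blast
    next
      fix c assume c: "?P c"
      show "c = (\<lambda>g. \<pi> g m)"
      proof
        fix g
        have "\<pi> g m = \<pi> g (\<Oplus>h\<in>{h. c h \<noteq> \<zero>}. c h)" using c by simp
        also have "\<dots> = c g" using c pr_sum[of "{h. c h \<noteq> \<zero>}" c g] by auto
        finally show "c g = \<pi> g m" by simp
      qed
    qed
  qed
qed

locale graded_algebra = ring R + graded_group R "hpart R"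
  for R :: "('k::field, 'g::ab_group_add, 'r) galgebra" (structure) +
  assumes hpart_mult: "r \<in> hpart R g \<Longrightarrow> s \<in> hpart R h \<Longrightarrow> r \<otimes> s \<in> hpart R (g + h)"
    and hpart_one: "\<one> \<in> hpart R 0"
    and scal_in: "scal R c \<in> hpart R 0"
    and scal_1: "scal R 1 = \<one>"
    and scal_add: "scal R (c + d) = scal R c \<oplus> scal R d"
    and scal_mult: "scal R (c * d) = scal R c \<otimes> scal R d"
    and scal_central: "r \<in> carrier R \<Longrightarrow> scal R c \<otimes> r = r \<otimes> scal R c"

sublocale graded_module \<subseteq> abelian_group M by (rule add_group)

sublocale graded_module \<subseteq> graded_group M "hcomp M"
  by (intro graded_group.intro graded_group_axioms.intro add_group hcomp_subgroup decomposition)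

lemma ghomI:
  assumes "f \<in> carrier M \<rightarrow>\<^sub>E carrier N"
    "\<And>m n. m \<in> carrier M \<Longrightarrow> n \<in> carrier M \<Longrightarrow> f (m \<oplus>\<^bsub>M\<^esub> n) = f m \<oplus>\<^bsub>N\<^esub> f n"
    "\<And>m r. m \<in> carrier M \<Longrightarrow> r \<in> carrier R \<Longrightarrow> f (ract M m r) = ract N (f m) r"
    "\<And>g m. m \<in> hcomp M g \<Longrightarrow> f m \<in> hcomp N g"
  shows "f \<in> ghom R M N"
  using assms unfolding ghom_def by auto

lemma ghomD:
  assumes "f \<in> ghom R M N"
  shows ghom_funcset: "f \<in> carrier M \<rightarrow>\<^sub>E carrier N"
    and ghom_in: "m \<in> carrier M \<Longrightarrow> f m \<in> carrier N"
    and ghom_add: "\<lbrakk>m \<in> carrier M; n \<in> carrier M\<rbrakk> \<Longrightarrow> f (m \<oplus>\<^bsub>M\<^esub> n) = f m \<oplus>\<^bsub>N\<^esub> f n"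
    and ghom_ract: "\<lbrakk>m \<in> carrier M; r \<in> carrier R\<rbrakk> \<Longrightarrow> f (ract M m r) = ract N (f m) r"
    and ghom_hcomp: "m \<in> hcomp M g \<Longrightarrow> f m \<in> hcomp N g"
  using assms unfolding ghom_def by (auto simp: image_subset_iff)

lemma ghom_eqI:
  assumes "f \<in> ghom R M N" "f' \<in> ghom R M N" "\<And>m. m \<in> carrier M \<Longrightarrow> f m = f' m"
  shows "f = f'"
  using assms ghomD(1) by (metis PiE_ext)

context graded_algebra
begin

lemma ghom_eqI_homogeneous:
  assumes M: "graded_module R M" and f: "f \<in> ghom R M N" "f' \<in> ghom R M N"
    and eq: "\<And>g m. m \<in> hcomp M g \<Longrightarrow> f m = f' m"
  shows "f = f'"
proof (rule ghom_eqI[OF f])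
  interpret M: graded_module R M by (rule M)
  fix m assume "m \<in> carrier M"
  then show "f m = f' m"
    by (induction rule: M.homogeneous_induct) (auto simp: eq ghom_add[OF f(1)] ghom_add[OF f(2)])
qed

text \<open>Homomorphisms are determined by, and can be defined on, homogeneous elements. The compatibility
  with the action of an arbitrary ring element follows by additivity in both arguments.\<close>

lemma ghom_extension:
  assumes M: "graded_module R M" and N: "graded_module R N"
    and in_N: "\<And>g m. m \<in> hcomp M g \<Longrightarrow> \<phi> g m \<in> hcomp N g"
    and add: "\<And>g m n. m \<in> hcomp M g \<Longrightarrow> n \<in> hcomp M g \<Longrightarrow> \<phi> g (m \<oplus>\<^bsub>M\<^esub> n) = \<phi> g m \<oplus>\<^bsub>N\<^esub> \<phi> g n"
    and act: "\<And>g m h r. m \<in> hcomp M g \<Longrightarrow> r \<in> hpart R h \<Longrightarrow> \<phi> (g + h) (ract M m r) = ract N (\<phi> g m) r"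
  obtains f where "f \<in> ghom R M N" "\<And>g m. m \<in> hcomp M g \<Longrightarrow> f m = \<phi> g m"
proof -
  interpret M: graded_module R M by (rule M)
  interpret N: graded_module R N by (rule N)
  from in_N N.H_carrier have in_N': "\<And>g m. m \<in> hcomp M g \<Longrightarrow> \<phi> g m \<in> carrier N" by blast
  obtain f where f: "f \<in> carrier M \<rightarrow>\<^sub>E carrier N"
      "\<And>m n. m \<in> carrier M \<Longrightarrow> n \<in> carrier M \<Longrightarrow> f (m \<oplus>\<^bsub>M\<^esub> n) = f m \<oplus>\<^bsub>N\<^esub> f n"
      "\<And>g m. m \<in> hcomp M g \<Longrightarrow> f m = \<phi> g m"
    by (rule M.additive_extension[OF N.add_group, of \<phi>]) (use in_N' add in blast)+
  have fc: "m \<in> carrier M \<Longrightarrow> f m \<in> carrier N" for m using f(1) by blast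
  have "f (ract M m r) = ract N (f m) r" if m: "m \<in> carrier M" and r: "r \<in> carrier R" for m r
    using r
  proof (induction rule: homogeneous_induct)
    case (homogeneous h r)
    note r = this
    from m show ?case
    proof (induction rule: M.homogeneous_induct)
      case (homogeneous g m)
      then show ?case using r by (simp add: f(3)[OF M.ract_degree[OF homogeneous r]] act f(3))
    next
      case (add m n)
      then show ?case using r
        by (simp add: f(2) M.ract_add_left N.ract_add_left M.ract_in H_carrier fc)
    qed
  next
    case (add r s)
    then show ?case using m
      by (simp add: f(2) M.ract_add_right N.ract_add_right M.ract_in fc)
  qed
  then have "f \<in> ghom R M N" using f in_N by (intro ghomI) auto
  then show thesis using f(3) that by blast
qed

end

section \<open>The category of finitely generated graded modules\<close>

context graded_algebra
begin

lemma scal_carrier: "scal R c \<in> carrier R"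
  using H_carrier[OF scal_in] .

lemma gr_cat_linear:
  "linear_category (gr_cat R :: (('r, 'g, 'u) gmodule, 'u \<Rightarrow> 'u, 'k) lincat)"
proof -
  have mod: "graded_module R M" if "M \<in> Ob (gr_cat R)" for M :: "('r, 'g, 'u) gmodule"
    using that by (simp add: gr_cat_def)
  note [simp] = gr_cat_def
  show ?thesis
  proof (rule linear_category.intro, goal_cases)
    case (1 M)
    then show ?case by (auto intro!: ghomI simp: graded_module.ract_in graded_group.H_carrier
        abelian_monoid.a_closed graded_module.add_group[THEN abelian_group.axioms(1)]
        graded_module.hcomp_subgroup[THEN subgroup.subset, THEN subsetD, simplified])
  next
    case (2 L M N f g)
    interpret L: graded_module R L using 2 mod by blast
    from 2 have f: "f \<in> ghom R L M" and g: "g \<in> ghom R M N" by auto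
    have "compose (carrier L) g f \<in> ghom R L N"
      by (rule ghomI) (auto simp: compose_def ghom_in[OF f] ghom_in[OF g] ghom_add[OF f]
          ghom_add[OF g] ghom_ract[OF f] ghom_ract[OF g] L.ract_in L.H_carrier
          ghom_hcomp[OF f] ghom_hcomp[OF g])
    then show ?case by simp
  next
    case (3 M N f)
    then show ?case by (auto simp: compose_def restrict_def ghom_in fun_eq_iff
          dest!: ghom_funcset intro: PiE_arb[symmetric])
  next
    case (4 M N f)
    then show ?case by (auto simp: compose_def restrict_def ghom_in fun_eq_iff
          dest!: ghom_funcset intro: PiE_arb[symmetric])
  next
    case (5 L M N P f g h)
    then show ?case by (auto simp: compose_def restrict_def ghom_in fun_eq_iff)
  next
    case (6 M N)
    interpret M: graded_module R M using 6 mod by blast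
    interpret N: graded_module R N using 6 mod by blast
    have sub: "(\<lambda>m\<in>carrier M. \<ominus>\<^bsub>N\<^esub> f m) \<in> ghom R M N" if f: "f \<in> ghom R M N" for f
    proof (rule ghomI)
      fix m r assume "m \<in> carrier M" "r \<in> carrier R"
      then have "ract N (\<ominus>\<^bsub>N\<^esub> f m) r \<oplus>\<^bsub>N\<^esub> ract N (f m) r = ract N \<zero>\<^bsub>N\<^esub> r"
        by (simp add: N.ract_add_left[symmetric] ghom_in[OF f] N.l_neg)
      also have "\<dots> = \<zero>\<^bsub>N\<^esub>"
        using N.ract_add_left[of "\<zero>\<^bsub>N\<^esub>" "\<zero>\<^bsub>N\<^esub>" r] N.ract_in[of "\<zero>\<^bsub>N\<^esub>" r] \<open>r \<in> carrier R\<close> by simp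
      finally have "\<ominus>\<^bsub>N\<^esub> (ract N (f m) r) = ract N (\<ominus>\<^bsub>N\<^esub> f m) r"
        using \<open>m \<in> carrier M\<close> \<open>r \<in> carrier R\<close>
        by (intro N.minus_equality) (auto simp: ghom_in[OF f] N.ract_in)
      then show "(\<lambda>m\<in>carrier M. \<ominus>\<^bsub>N\<^esub> f m) (ract M m r) = ract N ((\<lambda>m\<in>carrier M. \<ominus>\<^bsub>N\<^esub> f m) m) r"
        using \<open>m \<in> carrier M\<close> \<open>r \<in> carrier R\<close> by (simp add: M.ract_in ghom_ract[OF f])
    qed (auto simp: ghom_in[OF f] ghom_add[OF f] N.minus_add M.H_carrier N.H_minus ghom_hcomp[OF f])
    have zero: "(\<lambda>m\<in>carrier M. \<zero>\<^bsub>N\<^esub>) \<in> ghom R M N"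
    proof (rule ghomI)
      fix m r assume "m \<in> carrier M" "r \<in> carrier R"
      then show "(\<lambda>m\<in>carrier M. \<zero>\<^bsub>N\<^esub>) (ract M m r) = ract N ((\<lambda>m\<in>carrier M. \<zero>\<^bsub>N\<^esub>) m) r"
        using N.ract_add_left[of "\<zero>\<^bsub>N\<^esub>" "\<zero>\<^bsub>N\<^esub>" r] N.ract_in[of "\<zero>\<^bsub>N\<^esub>" r]
        by (simp add: M.ract_in)
    qed (auto simp: M.H_carrier N.H_zero)
    have add: "(\<lambda>m\<in>carrier M. f m \<oplus>\<^bsub>N\<^esub> g m) \<in> ghom R M N"
      if f: "f \<in> ghom R M N" and g: "g \<in> ghom R M N" for f g
      by (rule ghomI) (auto simp: ghom_in[OF f] ghom_add[OF f] ghom_in[OF g] ghom_add[OF g]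
          M.H_carrier N.H_add ghom_hcomp[OF f] ghom_hcomp[OF g] M.ract_in ghom_ract[OF f]
          ghom_ract[OF g] N.ract_add_left N.a_ac)
    show ?case
    proof (rule comm_groupI, goal_cases)
      case 1 then show ?case by (simp add: add)
    next
      case 2 then show ?case by (simp add: zero)
    next
      case 3 then show ?case by (auto simp: restrict_def fun_eq_iff ghom_in N.a_assoc)
    next
      case 4 then show ?case by (auto simp: restrict_def fun_eq_iff ghom_in N.a_comm)
    next
      case (5 f) then show ?case
        by (auto simp: restrict_def fun_eq_iff ghom_in dest!: ghom_funcset intro: PiE_arb[symmetric])
    next
      case (6 f) then show ?case
        by (intro bexI[of _ "\<lambda>m\<in>carrier M. \<ominus>\<^bsub>N\<^esub> f m"])
          (auto simp: restrict_def fun_eq_iff ghom_in N.l_neg sub[unfolded restrict_def])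
    qed
  next
    case (7 M N f c)
    interpret M: graded_module R M using 7 mod by blast
    interpret N: graded_module R N using 7 mod by blast
    from 7 have f: "f \<in> ghom R M N" by simp
    have hc: "n \<in> hcomp N g \<Longrightarrow> ract N n (scal R c) \<in> hcomp N g" for n g
      using N.ract_degree[OF _ scal_in[of c], of n g] by simp
    have "(\<lambda>m\<in>carrier M. ract N (f m) (scal R c)) \<in> ghom R M N"
    proof (rule ghomI)
      fix m r assume mr: "m \<in> carrier M" "r \<in> carrier R"
      then have "ract N (ract N (f m) r) (scal R c) = ract N (ract N (f m) (scal R c)) r"
        using scal_central[OF mr(2), of c] scal_carrier[of c]
        by (simp add: N.ract_mult[symmetric] ghom_in[OF f])
      then show "(\<lambda>m\<in>carrier M. ract N (f m) (scal R c)) (ract M m r)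
          = ract N ((\<lambda>m\<in>carrier M. ract N (f m) (scal R c)) m) r"
        using mr by (simp add: M.ract_in ghom_ract[OF f])
    qed (auto simp: ghom_in[OF f] ghom_add[OF f] N.ract_in N.ract_add_left scal_carrier M.H_carrier
        hc ghom_hcomp[OF f])
    then show ?case by simp
  next
    case (8 M N f)
    then show ?case by (auto simp: restrict_def fun_eq_iff ghom_in scal_1 graded_module.ract_one
          dest!: ghom_funcset intro: PiE_arb[symmetric])
  next
    case (9 M N f c d)
    have "ract N (f m) (scal R (c * d)) = ract N (ract N (f m) (scal R d)) (scal R c)"
      if "m \<in> carrier M" for m
    proof -
      have "graded_module R N" "f m \<in> carrier N" using 9 that ghom_in[of f R M N m] by auto
      from graded_module.ract_mult[OF this scal_carrier scal_carrier, of d c]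
      show ?thesis using scal_central[OF scal_carrier[of d], of c] by (simp add: scal_mult)
    qed
    then show ?case by (auto simp: restrict_def fun_eq_iff)
  next
    case (10 M N f c d)
    then show ?case by (auto simp: restrict_def fun_eq_iff ghom_in scal_add scal_carrier
          graded_module.ract_add_right)
  next
    case (11 M N f g c)
    then show ?case by (auto simp: restrict_def fun_eq_iff ghom_in scal_carrier
          graded_module.ract_add_left)
  next
    case (12 L M N f g h)
    then show ?case by (auto simp: restrict_def compose_def fun_eq_iff ghom_in)
  next
    case (13 L M N e f g)
    then show ?case by (auto simp: restrict_def compose_def fun_eq_iff ghom_in ghom_add)
  next
    case (14 L M N f g c)
    then show ?case by (auto simp: restrict_def compose_def fun_eq_iff ghom_in)
  next
    case (15 L M N f g c)
    then show ?case by (auto simp: restrict_def compose_def fun_eq_iff ghom_in ghom_ract scal_carrier)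
  qed
qed


text \<open>A graded submodule is described by its components. In these terms finite generation can be
  moved between modules over different rings, as only homogeneous elements enter.\<close>

definition closed_family :: "('r, 'g, 'u) gmodule \<Rightarrow> ('g \<Rightarrow> 'u set) \<Rightarrow> bool" where
  "closed_family M U \<longleftrightarrow>
     (\<forall>g. U g \<subseteq> hcomp M g \<and> \<zero>\<^bsub>M\<^esub> \<in> U g \<and> (\<forall>m\<in>U g. \<forall>n\<in>U g. m \<oplus>\<^bsub>M\<^esub> n \<in> U g)) \<and>
     (\<forall>g h. \<forall>m\<in>U g. \<forall>r\<in>hpart R h. ract M m r \<in> U (g + h))"

definition generating :: "('r, 'g, 'u) gmodule \<Rightarrow> ('g \<times> 'u) set \<Rightarrow> bool" where
  "generating M S \<longleftrightarrow> (\<forall>(g, m)\<in>S. m \<in> hcomp M g) \<and>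
     (\<forall>U. closed_family M U \<and> (\<forall>(g, m)\<in>S. m \<in> U g) \<longrightarrow> (\<forall>g. hcomp M g \<subseteq> U g))"

end

context graded_module
begin

lemma zero_ract: "r \<in> carrier R \<Longrightarrow> ract M \<zero>\<^bsub>M\<^esub> r = \<zero>\<^bsub>M\<^esub>"
  using ract_add_left[of "\<zero>\<^bsub>M\<^esub>" "\<zero>\<^bsub>M\<^esub>" r] ract_in[of "\<zero>\<^bsub>M\<^esub>" r] by simp

lemma hpr_ract:
  assumes "m \<in> carrier M" "r \<in> hpart R h" "r \<in> carrier R"
  shows "hpr (ract M m r) g = ract M (hpr m (g - h)) r"
  using assms(1)
proof (induction rule: homogeneous_induct)
  case (homogeneous k n)
  from hpr_homogeneous[OF ract_degree[OF homogeneous assms(2)]] hpr_homogeneous[OF homogeneous]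
  show ?case using assms(3) by (auto simp: zero_ract)
next
  case (add n n')
  then show ?case using assms(3) H_carrier[OF hpr_in]
    by (simp add: ract_add_left hpr_add ract_in)
qed

end

context graded_algebra
begin

lemma hpart_carrier: "r \<in> hpart R g \<Longrightarrow> r \<in> carrier R" by (rule H_carrier)

text \<open>The homogeneous components of finitely many generators generate.\<close>

lemma generating_of_fin_generated:
  assumes "graded_module R M" and "fin_generated R M"
  obtains S where "finite S" "generating M S"
proof -
  interpret M: graded_module R M by (rule assms(1))
  from assms(2) obtain T where T: "T \<subseteq> carrier M" "finite T"
    and gen: "\<And>m. m \<in> carrier M \<Longrightarrow> \<exists>r \<in> T \<rightarrow> carrier R. m = (\<Oplus>\<^bsub>M\<^esub>s\<in>T. ract M s (r s))"
    unfolding fin_generated_def by blast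
  define S where "S = (\<Union>t\<in>T. (\<lambda>g. (g, M.hpr t g)) ` {g. M.hpr t g \<noteq> \<zero>\<^bsub>M\<^esub>})"
  have "finite S" using T M.hpr_finite unfolding S_def by auto
  moreover have "generating M S"
    unfolding generating_def
  proof (intro conjI allI impI)
    show "\<forall>(g, m)\<in>S. m \<in> hcomp M g" unfolding S_def using T M.hpr_in by auto
  next
    fix U g assume U: "closed_family M U \<and> (\<forall>(g, m)\<in>S. m \<in> U g)"
    define V where "V = {m \<in> carrier M. \<forall>g. M.hpr m g \<in> U g}"
    have V_add: "m \<oplus>\<^bsub>M\<^esub> n \<in> V" if "m \<in> V" "n \<in> V" for m n
      using that U unfolding V_def closed_family_def by (auto simp: M.hpr_add)
    have V_ract: "ract M m r \<in> V" if m: "m \<in> V" and r: "r \<in> carrier R" for m r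
      using r
    proof (induction rule: homogeneous_induct)
      case (homogeneous h r)
      note r = homogeneous hpart_carrier[OF homogeneous]
      have "M.hpr (ract M m r) g \<in> U g" for g
      proof -
        have "ract M (M.hpr m (g - h)) r \<in> U (g - h + h)"
          using U m r unfolding V_def closed_family_def by blast
        then show ?thesis using m r by (simp add: V_def M.hpr_ract[of m r h])
      qed
      then show ?case using m r by (auto simp: V_def M.ract_in)
    next
      case (add r s)
      then show ?case using m V_add by (simp add: V_def M.ract_add_right)
    qed
    have T_V: "t \<in> V" if "t \<in> T" for t
    proof -
      have "M.hpr t g \<in> U g" for g
        using that U unfolding S_def closed_family_def by (cases "M.hpr t g = \<zero>\<^bsub>M\<^esub>") auto
      then show ?thesis using that T by (auto simp: V_def)
    qed
    have zero_V: "\<zero>\<^bsub>M\<^esub> \<in> V" using U by (auto simp: V_def closed_family_def M.hpr_zero)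
    have sum_V: "(\<Oplus>\<^bsub>M\<^esub>s\<in>T'. ract M s (r s)) \<in> V"
      if "finite T'" "T' \<subseteq> T" "r \<in> T \<rightarrow> carrier R" for T' r
      using that
    proof (induction)
      case (insert t T')
      have c: "(\<lambda>s. ract M s (r s)) \<in> T' \<rightarrow> carrier M" "ract M t (r t) \<in> carrier M"
        using insert T by (auto intro!: M.ract_in)
      show ?case
        using insert c V_add[OF V_ract[OF T_V] insert.IH] by (auto simp: M.finsum_insert)
    qed (simp add: zero_V)
    show "hcomp M g \<subseteq> U g"
    proof
      fix m assume m: "m \<in> hcomp M g"
      from gen[OF M.H_carrier[OF m]] sum_V[OF T(2) subset_refl] have "m \<in> V" by auto
      then show "m \<in> U g" using M.hpr_homogeneous[OF m] by (auto simp: V_def dest: spec[of _ g])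
    qed
  qed
  ultimately show thesis by (rule that)
qed

lemma fin_generated_of_generating:
  assumes "graded_module R M" and fin: "finite S" and gen: "generating M S"
  shows "fin_generated R M"
proof -
  interpret M: graded_module R M by (rule assms(1))
  define T where "T = snd ` S"
  have T: "finite T" "T \<subseteq> carrier M"
    unfolding T_def using fin gen M.H_carrier by (auto simp: generating_def)
  define V where "V = {(\<Oplus>\<^bsub>M\<^esub>s\<in>T. ract M s (r s)) | r. r \<in> T \<rightarrow> carrier R}"
  have V_carrier: "V \<subseteq> carrier M" unfolding V_def using T by (auto intro!: M.finsum_closed M.ract_in)
  have zero_V: "\<zero>\<^bsub>M\<^esub> \<in> V"
  proof -
    have "ract M s \<zero> = \<zero>\<^bsub>M\<^esub>" if "s \<in> carrier M" for s
      using M.ract_add_right[OF that, of \<zero> \<zero>] M.ract_in[OF that, of \<zero>] by simp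
    then have "(\<Oplus>\<^bsub>M\<^esub>s\<in>T. ract M s \<zero>) = \<zero>\<^bsub>M\<^esub>"
      using T by (intro M.add.finprod_one_eqI) auto
    then show ?thesis unfolding V_def by (intro CollectI exI[of _ "\<lambda>_. \<zero>"]) auto
  qed
  have V_add: "m \<oplus>\<^bsub>M\<^esub> n \<in> V" if mn: "m \<in> V" "n \<in> V" for m n
  proof -
    from mn obtain r s where r: "r \<in> T \<rightarrow> carrier R" "m = (\<Oplus>\<^bsub>M\<^esub>t\<in>T. ract M t (r t))"
      and s: "s \<in> T \<rightarrow> carrier R" "n = (\<Oplus>\<^bsub>M\<^esub>t\<in>T. ract M t (s t))" by (auto simp: V_def)
    have c: "(\<lambda>t. ract M t (r t)) \<in> T \<rightarrow> carrier M" "(\<lambda>t. ract M t (s t)) \<in> T \<rightarrow> carrier M"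
      using T r s by (auto intro!: M.ract_in)
    have "m \<oplus>\<^bsub>M\<^esub> n = (\<Oplus>\<^bsub>M\<^esub>t\<in>T. ract M t (r t) \<oplus>\<^bsub>M\<^esub> ract M t (s t))"
      unfolding r(2) s(2) using c by (rule M.finsum_addf[symmetric])
    also have "\<dots> = (\<Oplus>\<^bsub>M\<^esub>t\<in>T. ract M t (r t \<oplus> s t))"
      using T r s by (intro M.finsum_cong') (auto intro!: M.ract_in M.ract_add_right[symmetric])
    finally show ?thesis using r s unfolding V_def by (auto intro!: exI[of _ "\<lambda>t. r t \<oplus> s t"])
  qed
  have V_ract: "ract M m a \<in> V" if m: "m \<in> V" and a: "a \<in> carrier R" for m a
  proof -
    from m obtain r where r: "r \<in> T \<rightarrow> carrier R" "m = (\<Oplus>\<^bsub>M\<^esub>t\<in>T. ract M t (r t))"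
      by (auto simp: V_def)
    have "ract M (\<Oplus>\<^bsub>M\<^esub>t\<in>T'. ract M t (r t)) a = (\<Oplus>\<^bsub>M\<^esub>t\<in>T'. ract M t (r t \<otimes> a))"
      if "finite T'" "T' \<subseteq> T" for T'
      using that
    proof induction
      case empty then show ?case by (simp add: M.zero_ract a)
    next
      case (insert t T')
      have c: "(\<lambda>t. ract M t (r t)) \<in> T' \<rightarrow> carrier M" "ract M t (r t) \<in> carrier M"
        "(\<lambda>t. ract M t (r t \<otimes> a)) \<in> T' \<rightarrow> carrier M" "ract M t (r t \<otimes> a) \<in> carrier M"
        using insert T r a by (auto intro!: M.ract_in)
      have "ract M t (r t \<otimes> a) = ract M (ract M t (r t)) a"
        using insert T r a by (intro M.ract_mult) auto
      then show ?case
        using insert c a M.ract_add_left[OF c(2) M.finsum_closed[OF c(1)] a] by (simp add: M.finsum_insert)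
    qed
    from this[OF T(1) subset_refl] show ?thesis
      unfolding r(2) V_def using r(1) a by (auto intro!: exI[of _ "\<lambda>t. r t \<otimes> a"])
  qed
  have T_V: "t \<in> V" if t: "t \<in> T" for t
  proof -
    let ?r = "\<lambda>s. if t = s then \<one> else \<zero>"
    have z: "ract M s \<zero> = \<zero>\<^bsub>M\<^esub>" if "s \<in> carrier M" for s
      using M.ract_add_right[OF that, of \<zero> \<zero>] M.ract_in[OF that, of \<zero>] by simp
    have "(\<Oplus>\<^bsub>M\<^esub>s\<in>T. ract M s (?r s)) = (\<Oplus>\<^bsub>M\<^esub>s\<in>T. if t = s then s else \<zero>\<^bsub>M\<^esub>)"
      using T by (intro M.finsum_cong') (auto simp: M.ract_one z)
    also have "\<dots> = t" using T t by (intro M.finsum_singleton) auto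
    finally show ?thesis unfolding V_def by (intro CollectI exI[of _ ?r]) auto
  qed
  have "closed_family M (\<lambda>g. V \<inter> hcomp M g)"
    unfolding closed_family_def
    using V_add V_ract zero_V M.H_zero M.H_add M.ract_degree hpart_carrier by auto
  moreover have "\<forall>(g, m)\<in>S. m \<in> V \<inter> hcomp M g"
    using T_V gen by (auto simp: T_def generating_def image_iff split_beta)
  ultimately have hV: "hcomp M g \<subseteq> V" for g
    using gen unfolding generating_def by blast
  have "m \<in> V" if "m \<in> carrier M" for m
    using that by (induction rule: M.homogeneous_induct) (use hV V_add in auto)
  then show ?thesis unfolding fin_generated_def V_def using T by (intro exI[of _ T]) auto
qed

end

section \<open>Cardinality and transport of structure\<close>

text \<open>The objects of the category have carriers inside a fixed type, so modules built by external
  constructions have to be moved into that type. This is possible because a finitely generated module over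
  an algebra of at most the size of the ground field is itself at most of this size.\<close>

lemma infinite_times_lepoll:
  assumes K: "infinite K" and "A \<lesssim> K" "B \<lesssim> K"
  shows "A \<times> B \<lesssim> K"
proof -
  have "A \<times> B \<lesssim> K \<times> K" using assms by (intro times_lepoll_mono)
  also have "K \<times> K \<lesssim> K"
    using card_of_Times_same_infinite[OF K] by (simp add: lepoll_def card_of_ordLeq ordIso_imp_ordLeq)
  finally show ?thesis .
qed

lemma infinite_UN_lepoll:
  assumes K: "infinite K" and I: "I \<lesssim> K" and A: "\<And>i. i \<in> I \<Longrightarrow> A i \<lesssim> K"
  shows "(\<Union>i\<in>I. A i) \<lesssim> K"
proof -
  from A have "\<forall>i\<in>I. \<exists>f. A i \<subseteq> f ` K" by (simp add: lepoll_iff)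
  then obtain f where f: "\<And>i. i \<in> I \<Longrightarrow> A i \<subseteq> f i ` K" by metis
  have "(\<Union>i\<in>I. A i) \<subseteq> (\<lambda>(i, k). f i k) ` (I \<times> K)" using f by force
  then have "(\<Union>i\<in>I. A i) \<lesssim> I \<times> K" by (auto simp: lepoll_iff)
  also have "I \<times> K \<lesssim> K" using K I by (intro infinite_times_lepoll) auto
  finally show ?thesis .
qed

lemma infinite_lists_lepoll:
  assumes K: "infinite K"
  shows "lists K \<lesssim> K"
proof -
  have "{xs \<in> lists K. length xs = n} \<lesssim> K" for n
  proof (induction n)
    case 0
    have "{xs \<in> lists K. length xs = 0} \<subseteq> {[]}" by auto
    then show ?case using K by (meson finite.emptyI finite_insert finite_lepoll_infinite finite_subset)
  next
    case (Suc n)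
    have "{xs \<in> lists K. length xs = Suc n} \<subseteq> (\<lambda>(x, xs). x # xs) ` (K \<times> {xs \<in> lists K. length xs = n})"
      by (auto simp: length_Suc_conv image_iff)
    then have "{xs \<in> lists K. length xs = Suc n} \<lesssim> K \<times> {xs \<in> lists K. length xs = n}"
      by (rule subset_image_lepoll)
    also have "\<dots> \<lesssim> K" using K Suc by (intro infinite_times_lepoll) auto
    finally show ?case .
  qed
  moreover have "(UNIV :: nat set) \<lesssim> K" using K by (simp add: infinite_le_lepoll)
  ultimately have "(\<Union>n. {xs \<in> lists K. length xs = n}) \<lesssim> K" using K by (intro infinite_UN_lepoll)
  moreover have "lists K \<subseteq> (\<Union>n. {xs \<in> lists K. length xs = n})" by auto
  ultimately show ?thesis using lepoll_trans subset_imp_lepoll by blast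
qed

text \<open>Every element is a finite sum of homogeneous ones; the sets \<open>X n\<close> of sums of \<open>n\<close> homogeneous elements
  exhaust the group.\<close>

lemma (in graded_group) carrier_lepoll:
  assumes K: "infinite K" and I: "(UNIV :: 'g set) \<lesssim> K" and H: "\<And>g. H g \<lesssim> K"
  shows "carrier M \<lesssim> K"
proof -
  define X where "X = rec_nat {\<zero>} (\<lambda>_ Y. (\<lambda>(a, b). a \<oplus> b) ` ((\<Union>g. H g) \<times> Y))"
  have X: "X 0 = {\<zero>}" "X (Suc n) = (\<lambda>(a, b). a \<oplus> b) ` ((\<Union>g. H g) \<times> X n)" for n
    by (simp_all add: X_def)
  have H': "(\<Union>g. H g) \<lesssim> K" using infinite_UN_lepoll[OF K I H] .
  have "X n \<lesssim> K" for n
  proof (induction n)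
    case 0 show ?case using K by (simp add: X finite_lepoll_infinite)
  next
    case (Suc n)
    have "X (Suc n) \<lesssim> (\<Union>g. H g) \<times> X n" unfolding X by (rule image_lepoll)
    also have "\<dots> \<lesssim> K" using K H' Suc by (rule infinite_times_lepoll)
    finally show ?case .
  qed
  moreover have "(UNIV :: nat set) \<lesssim> K" using K by (simp add: infinite_le_lepoll)
  ultimately have "(\<Union>n. X n) \<lesssim> K" using K by (intro infinite_UN_lepoll)
  moreover have "carrier M \<subseteq> (\<Union>n. X n)"
  proof
    fix m assume m: "m \<in> carrier M"
    have c: "\<And>g. hpr m g \<in> carrier M" using H_carrier[OF hpr_in[OF m]] .
    have "(\<Oplus>g\<in>S. hpr m g) \<in> (\<Union>n. X n)" if "finite S" for S
      using that
    proof induction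
      case empty then show ?case using X(1) by (auto intro: exI[of _ 0])
    next
      case (insert g S)
      then obtain n where "(\<Oplus>g\<in>S. hpr m g) \<in> X n" by blast
      then have "hpr m g \<oplus> (\<Oplus>g\<in>S. hpr m g) \<in> X (Suc n)"
        unfolding X using hpr_in[OF m, of g] by force
      then show ?case using insert c by (auto simp: finsum_insert)
    qed
    from this[OF hpr_finite[OF m]] show "m \<in> (\<Union>n. X n)" by (simp only: hpr_finsum[OF m])
  qed
  ultimately show ?thesis using lepoll_trans subset_imp_lepoll by blast
qed

lemma (in graded_module) fin_generated_lepoll:
  assumes K: "infinite K" and R: "carrier R \<lesssim> K" and fg: "fin_generated R M"
  shows "carrier M \<lesssim> K"
proof -
  from fg obtain T where T: "T \<subseteq> carrier M" "finite T"
    and gen: "\<And>m. m \<in> carrier M \<Longrightarrow> \<exists>r \<in> T \<rightarrow> carrier R. m = (\<Oplus>\<^bsub>M\<^esub>s\<in>T. ract M s (r s))"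
    unfolding fin_generated_def by blast
  define X where "X T' = {(\<Oplus>\<^bsub>M\<^esub>s\<in>T'. ract M s (r s)) | r. r \<in> T' \<rightarrow> carrier R}" for T'
  have "X T' \<lesssim> K" if "finite T'" "T' \<subseteq> T" for T'
    using that
  proof induction
    case empty
    have "X {} \<subseteq> {\<zero>\<^bsub>M\<^esub>}" by (auto simp: X_def)
    then show ?case using K by (meson finite.emptyI finite_insert finite_lepoll_infinite finite_subset)
  next
    case (insert t T')
    have "X (insert t T') \<subseteq> (\<lambda>(r, m). ract M t r \<oplus>\<^bsub>M\<^esub> m) ` (carrier R \<times> X T')"
    proof
      fix m assume "m \<in> X (insert t T')"
      then obtain r where r: "r \<in> insert t T' \<rightarrow> carrier R"
        and m: "m = (\<Oplus>\<^bsub>M\<^esub>s\<in>insert t T'. ract M s (r s))" by (auto simp: X_def)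
      have "m = ract M t (r t) \<oplus>\<^bsub>M\<^esub> (\<Oplus>\<^bsub>M\<^esub>s\<in>T'. ract M s (r s))"
        unfolding m using insert T r by (intro finsum_insert) (auto intro!: ract_in)
      moreover have "(\<Oplus>\<^bsub>M\<^esub>s\<in>T'. ract M s (r s)) \<in> X T'" using r by (auto simp: X_def)
      ultimately show "m \<in> (\<lambda>(r, m). ract M t r \<oplus>\<^bsub>M\<^esub> m) ` (carrier R \<times> X T')" using r by force
    qed
    then have "X (insert t T') \<lesssim> carrier R \<times> X T'" by (rule subset_image_lepoll)
    also have "\<dots> \<lesssim> K" using K R insert by (intro infinite_times_lepoll) auto
    finally show ?case .
  qed
  then have "X T \<lesssim> K" using T by blast
  moreover have "carrier M \<subseteq> X T" unfolding X_def using gen by auto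
  ultimately show ?thesis using lepoll_trans subset_imp_lepoll by blast
qed

lemma (in graded_module) transport:
  fixes e :: "'u \<Rightarrow> 'w"
  assumes e: "inj_on e (carrier M)" and ring: "abelian_group R"
  obtains M' :: "('r, 'g, 'w) gmodule" where "graded_module R M'"
    "carrier M' = e ` carrier M" "\<And>g. hcomp M' g = e ` hcomp M g"
    "\<And>m n. m \<in> carrier M \<Longrightarrow> n \<in> carrier M \<Longrightarrow> e (m \<oplus>\<^bsub>M\<^esub> n) = e m \<oplus>\<^bsub>M'\<^esub> e n"
    "\<And>m r. m \<in> carrier M \<Longrightarrow> r \<in> carrier R \<Longrightarrow> e (ract M m r) = ract M' (e m) r"
proof -
  interpret R: abelian_group R by (rule ring)
  define d where "d = the_inv_into (carrier M) e"
  have d: "m \<in> carrier M \<Longrightarrow> d (e m) = m" for m using e by (simp add: d_def the_inv_into_f_f)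
  define M' :: "('r, 'g, 'w) gmodule" where
    "M' = \<lparr>carrier = e ` carrier M, monoid.mult = undefined, one = undefined, zero = e \<zero>\<^bsub>M\<^esub>,
       add = (\<lambda>x y. e (d x \<oplus>\<^bsub>M\<^esub> d y)), ract = (\<lambda>x r. e (ract M (d x) r)),
       hcomp = (\<lambda>g. e ` hcomp M g)\<rparr>"
  have ab: "abelian_group M'"
  proof (rule abelian_groupI)
    fix x assume "x \<in> carrier M'"
    then obtain m where m: "x = e m" "m \<in> carrier M" by (auto simp: M'_def)
    then show "\<exists>y\<in>carrier M'. y \<oplus>\<^bsub>M'\<^esub> x = \<zero>\<^bsub>M'\<^esub>"
      by (intro bexI[of _ "e (\<ominus>\<^bsub>M\<^esub> m)"]) (auto simp: M'_def d l_neg)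
  qed (auto simp: M'_def d a_ac)
  have sub: "subgroup (hcomp M' g) (add_monoid M')" for g
  proof -
    interpret M': abelian_group M' by (rule ab)
    show ?thesis
    proof (rule M'.add.subgroupI)
      fix x assume "x \<in> hcomp M' g"
      then obtain m where m: "x = e m" "m \<in> hcomp M g" by (auto simp: M'_def)
      then have "e (\<ominus>\<^bsub>M\<^esub> m) \<oplus>\<^bsub>M'\<^esub> x = \<zero>\<^bsub>M'\<^esub>" using H_carrier by (simp add: M'_def d l_neg)
      then have "\<ominus>\<^bsub>M'\<^esub> x = e (\<ominus>\<^bsub>M\<^esub> m)"
        using m H_carrier by (intro M'.minus_equality) (auto simp: M'_def)
      then show "\<ominus>\<^bsub>M'\<^esub> x \<in> hcomp M' g" using m H_minus by (auto simp: M'_def)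
    next
      show "hcomp M' g \<subseteq> carrier M'" using H_carrier by (auto simp: M'_def)
      show "hcomp M' g \<noteq> {}" using H_zero by (auto simp: M'_def)
      fix x y assume "x \<in> hcomp M' g" "y \<in> hcomp M' g"
      then show "x \<oplus>\<^bsub>M'\<^esub> y \<in> hcomp M' g" using H_carrier H_add by (auto simp: M'_def d)
    qed
  qed
  have e_zero: "m \<in> carrier M \<Longrightarrow> e m = e \<zero>\<^bsub>M\<^esub> \<longleftrightarrow> m = \<zero>\<^bsub>M\<^esub>" for m
    using e by (auto dest: inj_onD)
  have hc: "hpr m g \<in> carrier M" if "m \<in> carrier M" for m g using H_carrier[OF hpr_in[OF that]] .
  have "graded_group M' (hcomp M')"
  proof (rule graded_groupI[where \<pi> = "\<lambda>g x. e (hpr (d x) g)", OF ab sub])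
    fix x assume x: "x \<in> carrier M'"
    then obtain m where m: "x = e m" "m \<in> carrier M" by (auto simp: M'_def)
    show "finite {g. e (hpr (d x) g) \<noteq> \<zero>\<^bsub>M'\<^esub>}"
      using hpr_finite[OF m(2)] m by (simp add: M'_def d e_zero hc)
    show "e (hpr (d x) g) \<in> hcomp M' g" for g using m hpr_in by (auto simp: M'_def d)
    assume "\<And>g. e (hpr (d x) g) = \<zero>\<^bsub>M'\<^esub>"
    then have "\<And>g. hpr m g = \<zero>\<^bsub>M\<^esub>" using m by (simp add: M'_def d e_zero hc)
    then have "m = \<zero>\<^bsub>M\<^esub>" using m(2) hpr_eqI[of m "\<zero>\<^bsub>M\<^esub>"] by (simp add: hpr_zero)
    then show "x = \<zero>\<^bsub>M'\<^esub>" using m by (simp add: M'_def)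
  next
    fix g x y assume "x \<in> carrier M'" "y \<in> carrier M'"
    then show "e (hpr (d (x \<oplus>\<^bsub>M'\<^esub> y)) g) = e (hpr (d x) g) \<oplus>\<^bsub>M'\<^esub> e (hpr (d y) g)"
      by (auto simp: M'_def d hpr_add hc)
  next
    fix g x assume "x \<in> hcomp M' g"
    then show "e (hpr (d x) g) = x" by (auto simp: M'_def d H_carrier hpr_homogeneous)
  next
    fix g h x assume "x \<in> hcomp M' g" "h \<noteq> g"
    then show "e (hpr (d x) h) = \<zero>\<^bsub>M'\<^esub>" by (auto simp: M'_def d H_carrier hpr_homogeneous)
  qed
  then interpret M': graded_group M' "hcomp M'" .
  have "graded_module R M'"
    by (rule graded_module.intro[OF ab _ _ _ _ _ sub M'.H_decomposition])
      (auto simp: M'_def d ract_in ract_add_left ract_add_right ract_mult ract_one ract_degree H_carrier)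
  then show thesis
    by (rule that) (auto simp: M'_def d)
qed

section \<open>External direct sums\<close>

text \<open>The summands \<open>V g\<close> are subgroups of one ambient group \<open>W\<close>, possibly repeated or overlapping; \<open>T\<close> is the
  module structure.\<close>

definition direct_sum :: "('w, 'y) ring_scheme \<Rightarrow> ('g \<Rightarrow> 'w set) \<Rightarrow> (('g \<Rightarrow> 'w) \<Rightarrow> 'r \<Rightarrow> 'g \<Rightarrow> 'w)
    \<Rightarrow> ('r, 'g, 'g \<Rightarrow> 'w) gmodule" where
  "direct_sum W V T = \<lparr>carrier = {m. (\<forall>g. m g \<in> V g) \<and> finite {g. m g \<noteq> \<zero>\<^bsub>W\<^esub>}},
     monoid.mult = undefined, one = undefined, zero = (\<lambda>_. \<zero>\<^bsub>W\<^esub>), add = (\<lambda>m n g. m g \<oplus>\<^bsub>W\<^esub> n g),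
     ract = T, hcomp = (\<lambda>g. {m. m g \<in> V g \<and> (\<forall>h. h \<noteq> g \<longrightarrow> m h = \<zero>\<^bsub>W\<^esub>)})\<rparr>"

lemma direct_sum_graded_group:
  fixes W :: "('w, 'y) ring_scheme" and V :: "'g \<Rightarrow> 'w set"
  assumes W: "abelian_group W" and V: "\<And>g. subgroup (V g) (add_monoid W)"
  shows "graded_group (direct_sum W V T) (hcomp (direct_sum W V T))"
proof -
  interpret W: abelian_group W by (rule W)
  note [simp] = direct_sum_def
  have V_W: "x \<in> V g \<Longrightarrow> x \<in> carrier W" for x g using subgroup.subset[OF V] by auto
  have V_0: "\<zero>\<^bsub>W\<^esub> \<in> V g" for g using subgroup.one_closed[OF V] by simp
  have V_add: "x \<in> V g \<Longrightarrow> y \<in> V g \<Longrightarrow> x \<oplus>\<^bsub>W\<^esub> y \<in> V g" for x y g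
    using subgroup.m_closed[OF V] by simp
  have V_neg: "x \<in> V g \<Longrightarrow> \<ominus>\<^bsub>W\<^esub> x \<in> V g" for x g
    using subgroup.m_inv_closed[OF V] by (simp add: a_inv_def)
  have fin_add: "finite {g. m g \<oplus>\<^bsub>W\<^esub> n g \<noteq> \<zero>\<^bsub>W\<^esub>}"
    if "finite {g. m g \<noteq> \<zero>\<^bsub>W\<^esub>}" "finite {g. n g \<noteq> \<zero>\<^bsub>W\<^esub>}" for m n :: "'g \<Rightarrow> 'w"
  proof (rule finite_subset)
    show "{g. m g \<oplus>\<^bsub>W\<^esub> n g \<noteq> \<zero>\<^bsub>W\<^esub>} \<subseteq> {g. m g \<noteq> \<zero>\<^bsub>W\<^esub>} \<union> {g. n g \<noteq> \<zero>\<^bsub>W\<^esub>}" by auto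
  qed (use that in simp)
  have neg: "(\<lambda>g. \<ominus>\<^bsub>W\<^esub> m g) \<in> carrier (direct_sum W V T)" if "m \<in> carrier (direct_sum W V T)" for m
  proof -
    have "{g. \<ominus>\<^bsub>W\<^esub> m g \<noteq> \<zero>\<^bsub>W\<^esub>} \<subseteq> {g. m g \<noteq> \<zero>\<^bsub>W\<^esub>}" by auto
    then show ?thesis using that by (auto simp: V_neg intro: finite_subset)
  qed
  have D_W: "m g \<in> carrier W" if "\<forall>g. m g \<in> V g" for m g using that V_W by blast
  have ab: "abelian_group (direct_sum W V T)"
  proof (rule abelian_groupI)
    fix m assume "m \<in> carrier (direct_sum W V T)"
    then show "\<exists>n\<in>carrier (direct_sum W V T). n \<oplus>\<^bsub>direct_sum W V T\<^esub> m = \<zero>\<^bsub>direct_sum W V T\<^esub>"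
      by (intro bexI[OF _ neg]) (auto simp: W.l_neg D_W fun_eq_iff)
  qed (auto simp: V_add V_0 fin_add W.a_ac D_W fun_eq_iff)
  interpret D: abelian_group "direct_sum W V T" by (rule ab)
  have supp: "finite {h. m h \<noteq> \<zero>\<^bsub>W\<^esub>}" if "\<forall>h. h \<noteq> g \<longrightarrow> m h = \<zero>\<^bsub>W\<^esub>" for g and m :: "'g \<Rightarrow> 'w"
    using that by (intro finite_subset[of "{h. m h \<noteq> \<zero>\<^bsub>W\<^esub>}" "{g}"]) auto
  have carr: "hcomp (direct_sum W V T) g \<subseteq> carrier (direct_sum W V T)" for g
  proof
    fix m assume m: "m \<in> hcomp (direct_sum W V T) g"
    have "m h \<in> V h" for h using m V_0 by (cases "h = g") auto
    then show "m \<in> carrier (direct_sum W V T)" using m supp[of g m] by auto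
  qed
  have sub: "subgroup (hcomp (direct_sum W V T) g) (add_monoid (direct_sum W V T))" for g
  proof (rule D.add.subgroupI)
    show "hcomp (direct_sum W V T) g \<subseteq> carrier (direct_sum W V T)" by (rule carr)
    show "hcomp (direct_sum W V T) g \<noteq> {}" using V_0 by (auto intro!: exI[of _ "\<lambda>_. \<zero>\<^bsub>W\<^esub>"])
  next
    fix m assume m: "m \<in> hcomp (direct_sum W V T) g"
    then have "m \<in> carrier (direct_sum W V T)" using carr by (rule subsetD[rotated])
    then have "\<ominus>\<^bsub>direct_sum W V T\<^esub> m = (\<lambda>g. \<ominus>\<^bsub>W\<^esub> m g)"
      by (intro D.minus_equality neg) (auto simp: W.l_neg fun_eq_iff D_W)
    then show "\<ominus>\<^bsub>direct_sum W V T\<^esub> m \<in> hcomp (direct_sum W V T) g" using m V_neg by simp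
  next
    fix m n assume "m \<in> hcomp (direct_sum W V T) g" "n \<in> hcomp (direct_sum W V T) g"
    then show "m \<oplus>\<^bsub>direct_sum W V T\<^esub> n \<in> hcomp (direct_sum W V T) g" using V_add by simp
  qed
  show ?thesis
  proof (rule graded_groupI[where \<pi> = "\<lambda>g m h. if h = g then m g else \<zero>\<^bsub>W\<^esub>", OF ab sub])
    fix m assume "m \<in> carrier (direct_sum W V T)"
    then have "finite {g. m g \<noteq> \<zero>\<^bsub>W\<^esub>}" by simp
    then show "finite {g. (\<lambda>h. if h = g then m g else \<zero>\<^bsub>W\<^esub>) \<noteq> \<zero>\<^bsub>direct_sum W V T\<^esub>}"
      by (rule finite_subset[rotated]) (auto simp: fun_eq_iff)
  next
    fix m assume "\<And>g. (\<lambda>h. if h = g then m g else \<zero>\<^bsub>W\<^esub>) = \<zero>\<^bsub>direct_sum W V T\<^esub>"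
    then have "m g = \<zero>\<^bsub>W\<^esub>" for g by (auto dest!: meta_spec[of _ g] fun_cong[of _ _ g])
    then show "m = \<zero>\<^bsub>direct_sum W V T\<^esub>" by (simp add: fun_eq_iff)
  qed (auto simp: fun_eq_iff V_0)
qed

context graded_algebra
begin

text \<open>An action of the homogeneous elements of \<open>R\<close> on the summands extends to a module structure. A
  homogeneous \<open>r\<close> of degree \<open>h\<close> acts on a family \<open>m\<close> by shifting it: no sum occurs in
  \<open>(m r)\<^sub>k = m\<^sub>k\<^sub>-\<^sub>h r\<close>. The action of all of \<open>R\<close> is then the additive extension in \<open>r\<close>, and each
  module law is additive in every argument.\<close>

lemma direct_sum_module:
  fixes W :: "('w, 'y) ring_scheme" and V :: "'g \<Rightarrow> 'w set" and act :: "'g \<Rightarrow> 'g \<Rightarrow> 'w \<Rightarrow> 'r \<Rightarrow> 'w"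
  assumes W: "abelian_group W" and V: "\<And>g. subgroup (V g) (add_monoid W)"
    and act_in: "\<And>g h v r. v \<in> V g \<Longrightarrow> r \<in> hpart R h \<Longrightarrow> act g h v r \<in> V (g + h)"
    and act_add_left: "\<And>g h v w r. v \<in> V g \<Longrightarrow> w \<in> V g \<Longrightarrow> r \<in> hpart R h
      \<Longrightarrow> act g h (v \<oplus>\<^bsub>W\<^esub> w) r = act g h v r \<oplus>\<^bsub>W\<^esub> act g h w r"
    and act_add_right: "\<And>g h v r s. v \<in> V g \<Longrightarrow> r \<in> hpart R h \<Longrightarrow> s \<in> hpart R h
      \<Longrightarrow> act g h v (r \<oplus> s) = act g h v r \<oplus>\<^bsub>W\<^esub> act g h v s"
    and act_mult: "\<And>g h k v r s. v \<in> V g \<Longrightarrow> r \<in> hpart R h \<Longrightarrow> s \<in> hpart R k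
      \<Longrightarrow> act g (h + k) v (r \<otimes> s) = act (g + h) k (act g h v r) s"
    and act_one: "\<And>g v. v \<in> V g \<Longrightarrow> act g 0 v \<one> = v"
  obtains T where "graded_module R (direct_sum W V T)"
    "\<And>m r g h. m \<in> carrier (direct_sum W V T) \<Longrightarrow> r \<in> hpart R h \<Longrightarrow> T m r (g + h) = act g h (m g) r"
proof -
  interpret W: abelian_group W by (rule W)
  have V_W: "x \<in> V g \<Longrightarrow> x \<in> carrier W" for x g using subgroup.subset[OF V] by auto
  have V_0: "\<zero>\<^bsub>W\<^esub> \<in> V g" for g using subgroup.one_closed[OF V] by simp
  have act_0: "act g h \<zero>\<^bsub>W\<^esub> r = \<zero>\<^bsub>W\<^esub>" if "r \<in> hpart R h" for g h r
    using act_add_left[OF V_0 V_0 that, of g] V_W[OF act_in[OF V_0 that, of g]] by simp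
  define C where "C = {m. (\<forall>g. m g \<in> V g) \<and> finite {g. m g \<noteq> \<zero>\<^bsub>W\<^esub>}}"
  have C: "carrier (direct_sum W V T) = C" for T :: "('g \<Rightarrow> 'w) \<Rightarrow> 'r \<Rightarrow> 'g \<Rightarrow> 'w"
    by (simp add: direct_sum_def C_def)
  have CV: "m g \<in> V g" if "m \<in> C" for m g using that by (simp add: C_def)
  have CW: "m g \<in> carrier W" if "m \<in> C" for m g using CV[OF that] by (rule V_W)
  define \<phi> where "\<phi> m h r = (\<lambda>k. act (k - h) h (m (k - h)) r)" for m h r
  have \<phi>_C: "\<phi> m h r \<in> C" if m: "m \<in> C" and r: "r \<in> hpart R h" for m h r
  proof -
    have "\<phi> m h r k \<in> V k" for k
      unfolding \<phi>_def using act_in[OF CV[OF m] r, of "k - h"] by simp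
    moreover have "{k. \<phi> m h r k \<noteq> \<zero>\<^bsub>W\<^esub>} \<subseteq> (\<lambda>g. g + h) ` {g. m g \<noteq> \<zero>\<^bsub>W\<^esub>}"
    proof
      fix k assume "k \<in> {k. \<phi> m h r k \<noteq> \<zero>\<^bsub>W\<^esub>}"
      then have "m (k - h) \<noteq> \<zero>\<^bsub>W\<^esub>" using act_0[OF r] by (auto simp: \<phi>_def)
      then show "k \<in> (\<lambda>g. g + h) ` {g. m g \<noteq> \<zero>\<^bsub>W\<^esub>}" by (intro image_eqI[of _ _ "k - h"]) auto
    qed
    ultimately show ?thesis using m by (auto simp: C_def intro: finite_subset)
  qed
  let ?D0 = "direct_sum W V (\<lambda>_ _ _. \<zero>\<^bsub>W\<^esub>) :: ('r, 'g, 'g \<Rightarrow> 'w) gmodule"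
  have D0: "abelian_group ?D0"
    using direct_sum_graded_group[OF W V] by (rule graded_group.axioms(1))
  have add_D: "add (direct_sum W V T) = (\<lambda>m n g. m g \<oplus>\<^bsub>W\<^esub> n g)" for T :: "('g \<Rightarrow> 'w) \<Rightarrow> 'r \<Rightarrow> 'g \<Rightarrow> 'w"
    by (simp add: direct_sum_def)
  have "\<exists>t. t \<in> carrier R \<rightarrow> C \<and> (\<forall>r\<in>carrier R. \<forall>s\<in>carrier R. t (r \<oplus> s) = (\<lambda>g. t r g \<oplus>\<^bsub>W\<^esub> t s g)) \<and>
      (\<forall>h. \<forall>r\<in>hpart R h. t r = \<phi> m h r)" if m: "m \<in> C" for m
  proof -
    obtain t where "t \<in> carrier R \<rightarrow>\<^sub>E carrier ?D0"
        "\<And>r s. r \<in> carrier R \<Longrightarrow> s \<in> carrier R \<Longrightarrow> t (r \<oplus> s) = t r \<oplus>\<^bsub>?D0\<^esub> t s"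
        "\<And>h r. r \<in> hpart R h \<Longrightarrow> t r = \<phi> m h r"
    proof (rule additive_extension[OF D0, of "\<phi> m"])
      show "\<phi> m h r \<in> carrier ?D0" if "r \<in> hpart R h" for h r
        unfolding C by (rule \<phi>_C[OF m that])
      show "\<phi> m h (r \<oplus> s) = \<phi> m h r \<oplus>\<^bsub>?D0\<^esub> \<phi> m h s" if "r \<in> hpart R h" "s \<in> hpart R h" for h r s
        using that CV[OF m] by (simp add: add_D \<phi>_def act_add_right)
    qed blast
    then show ?thesis by (intro exI[of _ t]) (auto simp: C add_D)
  qed
  then have "\<forall>m\<in>C. \<exists>t. t \<in> carrier R \<rightarrow> C \<and>
      (\<forall>r\<in>carrier R. \<forall>s\<in>carrier R. t (r \<oplus> s) = (\<lambda>g. t r g \<oplus>\<^bsub>W\<^esub> t s g)) \<and>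
      (\<forall>h. \<forall>r\<in>hpart R h. t r = \<phi> m h r)" by blast
  from bchoice[OF this] obtain T where T: "\<forall>m\<in>C. T m \<in> carrier R \<rightarrow> C \<and>
      (\<forall>r\<in>carrier R. \<forall>s\<in>carrier R. T m (r \<oplus> s) = (\<lambda>g. T m r g \<oplus>\<^bsub>W\<^esub> T m s g)) \<and>
      (\<forall>h. \<forall>r\<in>hpart R h. T m r = \<phi> m h r)" by (elim exE)
  have T_C: "T m r \<in> C" if "m \<in> C" "r \<in> carrier R" for m r
    using bspec[OF T that(1)] that(2) by (auto dest!: conjunct1)
  have T_add: "T m (r \<oplus> s) = (\<lambda>g. T m r g \<oplus>\<^bsub>W\<^esub> T m s g)"
    if "m \<in> C" "r \<in> carrier R" "s \<in> carrier R" for m r s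
    using bspec[OF T that(1)] that(2,3) by (auto dest!: conjunct2)
  have T_hom: "T m r = \<phi> m h r" if "m \<in> C" "r \<in> hpart R h" for m r h
    using bspec[OF T that(1)] that(2) by (auto dest!: conjunct2)
  let ?D = "direct_sum W V T"
  interpret D: graded_group ?D "hcomp ?D" by (rule direct_sum_graded_group[OF W V])
  have C_add: "(\<lambda>g. m g \<oplus>\<^bsub>W\<^esub> n g) \<in> C" if "m \<in> C" "n \<in> C" for m n
    using D.a_closed[of m n] that by (simp add: C add_D)
  have T_add_left: "T (\<lambda>g. m g \<oplus>\<^bsub>W\<^esub> n g) r = (\<lambda>g. T m r g \<oplus>\<^bsub>W\<^esub> T n r g)"
    if mn: "m \<in> C" "n \<in> C" and r: "r \<in> carrier R" for m n r
    using r
  proof (induction rule: homogeneous_induct)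
    case (homogeneous h r)
    then show ?case using mn by (simp add: T_hom C_add \<phi>_def act_add_left CV)
  next
    case (add r s)
    then show ?case using mn by (auto simp: T_add C_add fun_eq_iff CW T_C W.a_ac)
  qed
  have T_mult: "T m (r \<otimes> s) = T (T m r) s" if m: "m \<in> C" and r: "r \<in> carrier R" and s: "s \<in> carrier R" for m r s
    using r
  proof (induction rule: homogeneous_induct)
    case (homogeneous h r)
    note r = homogeneous hpart_carrier[OF homogeneous]
    from s show ?case
    proof (induction rule: homogeneous_induct)
      case (homogeneous k s)
      show ?case
      proof
        fix l
        have "T m (r \<otimes> s) l = act (l - (h + k)) (h + k) (m (l - (h + k))) (r \<otimes> s)"
          using m r homogeneous by (simp add: T_hom[OF m hpart_mult] \<phi>_def)
        also have "\<dots> = act (l - k) k (act (l - k - h) h (m (l - k - h)) r) s"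
          using act_mult[OF CV[OF m] r(1) homogeneous, of "l - (h + k)"] by (simp add: algebra_simps)
        also have "\<dots> = T (T m r) s l"
          using T_hom[OF T_C[OF m r(2)] homogeneous] T_hom[OF m r(1)] by (simp add: \<phi>_def)
        finally show "T m (r \<otimes> s) l = T (T m r) s l" .
      qed
    next
      case (add s s')
      then show ?case using m r by (simp add: r_distr T_add T_C)
    qed
  next
    case (add r r')
    then show ?case using m s by (simp add: l_distr T_add T_add_left T_C)
  qed
  have "graded_module R ?D"
  proof (rule graded_module.intro[OF D.abelian_group_axioms _ _ _ _ _ D.H_subgroup D.H_decomposition])
    fix m n r s
    assume "m \<in> carrier ?D"
    then have m: "m \<in> C" by (simp add: C)
    show "ract ?D m \<one> = m"
      using T_hom[OF m hpart_one] by (simp add: direct_sum_def \<phi>_def act_one CV[OF m])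
    assume r: "r \<in> carrier R"
    show "ract ?D m r \<in> carrier ?D" unfolding C using T_C[OF m r] by (simp add: direct_sum_def)
    show "ract ?D (m \<oplus>\<^bsub>?D\<^esub> n) r = ract ?D m r \<oplus>\<^bsub>?D\<^esub> ract ?D n r" if "n \<in> carrier ?D"
      using T_add_left[OF m _ r, of n] that by (simp add: C) (simp add: direct_sum_def)
    assume s: "s \<in> carrier R"
    show "ract ?D m (r \<oplus> s) = ract ?D m r \<oplus>\<^bsub>?D\<^esub> ract ?D m s"
      using T_add[OF m r s] by (simp add: direct_sum_def)
    show "ract ?D m (r \<otimes> s) = ract ?D (ract ?D m r) s"
      using T_mult[OF m r s] by (simp add: direct_sum_def)
  next
    fix m g r h assume m: "m \<in> hcomp ?D g" and r: "r \<in> hpart R h"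
    have mC: "m \<in> C" using D.H_carrier[OF m] by (simp add: C)
    have "\<phi> m h r k = \<zero>\<^bsub>W\<^esub>" if "k \<noteq> g + h" for k
    proof -
      have "k - h \<noteq> g" using that by auto
      then have "m (k - h) = \<zero>\<^bsub>W\<^esub>" using m by (simp add: direct_sum_def)
      then show ?thesis by (simp add: \<phi>_def act_0[OF r])
    qed
    then show "ract ?D m r \<in> hcomp ?D (g + h)"
      using T_hom[OF mC r] CV[OF \<phi>_C[OF mC r]] by (simp add: direct_sum_def)
  qed
  then show thesis
    by (rule that) (simp add: C T_hom \<phi>_def)
qed

end

section \<open>Comparing two graded algebras\<close>

text \<open>The situation of graded Morita theory, in coordinates. The maps \<open>\<phi> i d\<close> identify \<open>A\<^sub>d\<close> with the
  component of \<open>B\<close> joining the degrees \<open>J i\<close> and \<open>J (i + d)\<close>, that is with the homomorphisms between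
  the corresponding shifts of \<open>B\<close>; so the full subcategory of these shifts is that of the shifts of \<open>A\<close>.
  The assumption \<open>cover\<close> says that they generate: the identity of every shift \<open>K\<close>
  factors through a sum of two of them. Then a graded \<open>B\<close>-module amounts to its components in the degrees \<open>J i\<close>.\<close>

locale graded_comparison = A: graded_algebra A + B: graded_algebra B
  for A :: "('k::field, 'd::ab_group_add, 'a) galgebra"
    and B :: "('k, 'g::ab_group_add, 'b) galgebra" +
  fixes J :: "'d \<Rightarrow> 'g" and \<phi> :: "'d \<Rightarrow> 'd \<Rightarrow> 'a \<Rightarrow> 'b"
  assumes \<phi>_bij: "bij_betw (\<phi> i d) (hpart A d) (hpart B (J (i + d) - J i))"
    and \<phi>_add: "a \<in> hpart A d \<Longrightarrow> a' \<in> hpart A d \<Longrightarrow> \<phi> i d (a \<oplus>\<^bsub>A\<^esub> a') = \<phi> i d a \<oplus>\<^bsub>B\<^esub> \<phi> i d a'"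
    and \<phi>_mult: "a \<in> hpart A d \<Longrightarrow> a' \<in> hpart A d'
      \<Longrightarrow> \<phi> i (d + d') (a \<otimes>\<^bsub>A\<^esub> a') = \<phi> i d a \<otimes>\<^bsub>B\<^esub> \<phi> (i + d) d' a'"
    and \<phi>_one: "\<phi> i 0 \<one>\<^bsub>A\<^esub> = \<one>\<^bsub>B\<^esub>"
    and \<phi>_scal: "\<phi> i 0 (scal A c) = scal B c"
    and cover: "\<exists>i j c c' e e'. c \<in> hpart B (J i - K) \<and> c' \<in> hpart B (K - J i) \<and>
      e \<in> hpart B (J j - K) \<and> e' \<in> hpart B (K - J j) \<and> \<one>\<^bsub>B\<^esub> = c \<otimes>\<^bsub>B\<^esub> c' \<oplus>\<^bsub>B\<^esub> e \<otimes>\<^bsub>B\<^esub> e'"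
begin

text \<open>\<open>M\<close> is isomorphic to the restriction of \<open>N\<close> to the degrees \<open>J i\<close>, through \<open>\<theta>\<close>.\<close>

definition matching :: "('b, 'g, 'v) gmodule \<Rightarrow> ('a, 'd, 'u) gmodule \<Rightarrow> ('d \<Rightarrow> 'v \<Rightarrow> 'u) \<Rightarrow> bool" where
  "matching N M \<theta> \<longleftrightarrow> graded_module B N \<and> graded_module A M \<and>
     (\<forall>i. bij_betw (\<theta> i) (hcomp N (J i)) (hcomp M i)) \<and>
     (\<forall>i. \<forall>n\<in>hcomp N (J i). \<forall>n'\<in>hcomp N (J i). \<theta> i (n \<oplus>\<^bsub>N\<^esub> n') = \<theta> i n \<oplus>\<^bsub>M\<^esub> \<theta> i n') \<and>
     (\<forall>i d. \<forall>n\<in>hcomp N (J i). \<forall>a\<in>hpart A d. \<theta> (i + d) (ract N n (\<phi> i d a)) = ract M (\<theta> i n) a)"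

lemma \<phi>_in: "a \<in> hpart A d \<Longrightarrow> \<phi> i d a \<in> hpart B (J (i + d) - J i)"
  using \<phi>_bij by (rule bij_betwE[THEN bspec])

lemma \<phi>_surj:
  assumes "b \<in> hpart B (J j - J i)"
  obtains a where "a \<in> hpart A (j - i)" "\<phi> i (j - i) a = b"
proof -
  have "b \<in> \<phi> i (j - i) ` hpart A (j - i)"
    using assms bij_betw_imp_surj_on[OF \<phi>_bij, of i "j - i"] by simp
  then show thesis using that by blast
qed

lemma hpart_mult_diff:
  assumes "b \<in> hpart B (h - g)" "b' \<in> hpart B (k - h)"
  shows "b \<otimes>\<^bsub>B\<^esub> b' \<in> hpart B (k - g)"
  using B.hpart_mult[OF assms] by (simp add: algebra_simps)

lemma ract_diff:
  assumes "graded_module B N" "n \<in> hcomp N g" "b \<in> hpart B (h - g)"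
  shows "ract N n b \<in> hcomp N h"
  using graded_module.ract_degree[OF assms] by (simp add: algebra_simps)

text \<open>The form in which \<open>cover\<close> is used: an element is recovered from its products with \<open>c\<close> and \<open>e\<close>, which
  lie in components that the restriction sees.\<close>

lemma cover_split:
  assumes N: "graded_module B N" and n: "n \<in> carrier N"
    and c: "c \<in> carrier B" "c' \<in> carrier B" "e \<in> carrier B" "e' \<in> carrier B"
    and one: "\<one>\<^bsub>B\<^esub> = c \<otimes>\<^bsub>B\<^esub> c' \<oplus>\<^bsub>B\<^esub> e \<otimes>\<^bsub>B\<^esub> e'"
  shows "ract N (ract N n c) c' \<oplus>\<^bsub>N\<^esub> ract N (ract N n e) e' = n"
proof -
  interpret N: graded_module B N by (rule N)
  have "n = ract N n (c \<otimes>\<^bsub>B\<^esub> c' \<oplus>\<^bsub>B\<^esub> e \<otimes>\<^bsub>B\<^esub> e')" using N.ract_one[OF n] one by simp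
  also have "\<dots> = ract N (ract N n c) c' \<oplus>\<^bsub>N\<^esub> ract N (ract N n e) e'"
    using n c by (simp add: N.ract_add_right N.ract_mult)
  finally show ?thesis ..
qed

context
  fixes N :: "('b, 'g, 'v) gmodule" and M :: "('a, 'd, 'u) gmodule" and \<theta> :: "'d \<Rightarrow> 'v \<Rightarrow> 'u"
  assumes NM: "matching N M \<theta>"
begin

lemma matching_modules: "graded_module B N" "graded_module A M"
  using NM by (auto simp: matching_def)

lemma \<theta>_bij: "bij_betw (\<theta> i) (hcomp N (J i)) (hcomp M i)"
  using NM by (simp add: matching_def)

lemma \<theta>_in: "n \<in> hcomp N (J i) \<Longrightarrow> \<theta> i n \<in> hcomp M i"
  using bij_betwE[OF \<theta>_bij] by blast

lemma \<theta>_surj: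
  assumes "m \<in> hcomp M i"
  obtains n where "n \<in> hcomp N (J i)" "\<theta> i n = m"
proof -
  have "m \<in> \<theta> i ` hcomp N (J i)" using assms bij_betw_imp_surj_on[OF \<theta>_bij, of i] by simp
  then show thesis using that by blast
qed

lemma \<theta>_inj: "n \<in> hcomp N (J i) \<Longrightarrow> n' \<in> hcomp N (J i) \<Longrightarrow> \<theta> i n = \<theta> i n' \<Longrightarrow> n = n'"
  using bij_betw_imp_inj_on[OF \<theta>_bij] by (rule inj_onD)

lemma \<theta>_add: "n \<in> hcomp N (J i) \<Longrightarrow> n' \<in> hcomp N (J i) \<Longrightarrow> \<theta> i (n \<oplus>\<^bsub>N\<^esub> n') = \<theta> i n \<oplus>\<^bsub>M\<^esub> \<theta> i n'"
  using NM by (simp add: matching_def)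

lemma \<theta>_act: "n \<in> hcomp N (J i) \<Longrightarrow> a \<in> hpart A d \<Longrightarrow> \<theta> (i + d) (ract N n (\<phi> i d a)) = ract M (\<theta> i n) a"
  using NM by (simp add: matching_def)

lemma \<theta>_act_diff:
  "n \<in> hcomp N (J i) \<Longrightarrow> a \<in> hpart A (j - i) \<Longrightarrow> \<theta> j (ract N n (\<phi> i (j - i) a)) = ract M (\<theta> i n) a"
  using \<theta>_act[of n i a "j - i"] by simp

lemma \<theta>_zero: "\<theta> i \<zero>\<^bsub>N\<^esub> = \<zero>\<^bsub>M\<^esub>"
proof -
  interpret N: graded_module B N by (rule matching_modules)
  interpret M: graded_module A M by (rule matching_modules)
  show ?thesis
    using \<theta>_add[OF N.H_zero N.H_zero, of i] M.H_carrier[OF \<theta>_in[OF N.H_zero, of i]] by simp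
qed

text \<open>If \<open>n\<close> in degree \<open>K\<close> is one of the generators of \<open>N\<close>, then \<open>n c\<close> and \<open>n e\<close> serve as generators of the
  restriction: for \<open>b\<close> landing in a degree \<open>J l\<close>, \<open>n b = (n c) (c' b) + (n e) (e' b)\<close> and both
  \<open>c' b\<close> and \<open>e' b\<close> come from \<open>A\<close>.\<close>

lemma matching_fin_generated_right:
  assumes "fin_generated B N"
  shows "fin_generated A M"
proof -
  interpret N: graded_module B N by (rule matching_modules)
  interpret M: graded_module A M by (rule matching_modules)
  from B.generating_of_fin_generated[OF matching_modules(1) assms]
  obtain S where S: "finite S" "B.generating N S" .
  have "\<exists>T. finite T \<and> (\<forall>(i, m)\<in>T. m \<in> hcomp M i) \<and>
      (\<forall>U. A.closed_family M U \<longrightarrow> (\<forall>(i, m)\<in>T. m \<in> U i) \<longrightarrow>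
        (\<forall>i b. b \<in> hpart B (J i - fst s) \<longrightarrow> \<theta> i (ract N (snd s) b) \<in> U i))" if "s \<in> S" for s
  proof -
    obtain K n where s: "s = (K, n)" by (cases s)
    have n: "n \<in> hcomp N K" using that S s by (auto simp: B.generating_def)
    from cover[of K] obtain i j c c' e e' where c: "c \<in> hpart B (J i - K)" "c' \<in> hpart B (K - J i)"
      and e: "e \<in> hpart B (J j - K)" "e' \<in> hpart B (K - J j)"
      and one: "\<one>\<^bsub>B\<^esub> = c \<otimes>\<^bsub>B\<^esub> c' \<oplus>\<^bsub>B\<^esub> e \<otimes>\<^bsub>B\<^esub> e'" by blast
    note ce = c[THEN B.hpart_carrier] e[THEN B.hpart_carrier]
    note nc = ract_diff[OF matching_modules(1) n c(1)] and ne = ract_diff[OF matching_modules(1) n e(1)]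
    let ?T = "{(i, \<theta> i (ract N n c)), (j, \<theta> j (ract N n e))}"
    have "\<theta> l (ract N n b) \<in> U l"
      if U: "A.closed_family M U" "\<forall>(i, m)\<in>?T. m \<in> U i" and b: "b \<in> hpart B (J l - K)" for U l b
    proof -
      have bc: "b \<in> carrier B" using B.hpart_carrier[OF b] .
      obtain a1 where a1: "a1 \<in> hpart A (l - i)" "\<phi> i (l - i) a1 = c' \<otimes>\<^bsub>B\<^esub> b"
        by (rule \<phi>_surj[OF hpart_mult_diff[OF c(2) b]])
      obtain a2 where a2: "a2 \<in> hpart A (l - j)" "\<phi> j (l - j) a2 = e' \<otimes>\<^bsub>B\<^esub> b"
        by (rule \<phi>_surj[OF hpart_mult_diff[OF e(2) b]])
      have "ract N n b = ract N (ract N (ract N n c) c' \<oplus>\<^bsub>N\<^esub> ract N (ract N n e) e') b"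
        using cover_split[OF matching_modules(1) N.H_carrier[OF n] ce one] by simp
      also have "\<dots> = ract N (ract N n c) (\<phi> i (l - i) a1) \<oplus>\<^bsub>N\<^esub> ract N (ract N n e) (\<phi> j (l - j) a2)"
        using ce bc N.H_carrier[OF n] by (simp add: a1 a2 N.ract_add_left N.ract_mult N.ract_in)
      finally have "\<theta> l (ract N n b) = ract M (\<theta> i (ract N n c)) a1 \<oplus>\<^bsub>M\<^esub> ract M (\<theta> j (ract N n e)) a2"
        using \<theta>_act_diff[OF nc a1(1)] \<theta>_act_diff[OF ne a2(1)]
          ract_diff[OF matching_modules(1) nc \<phi>_in[OF a1(1), of i, simplified]]
          ract_diff[OF matching_modules(1) ne \<phi>_in[OF a2(1), of j, simplified]]
        by (simp add: \<theta>_add)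
      moreover have "ract M (\<theta> i (ract N n c)) a1 \<in> U (i + (l - i))"
        using U a1 unfolding A.closed_family_def by blast
      moreover have "ract M (\<theta> j (ract N n e)) a2 \<in> U (j + (l - j))"
        using U a2 unfolding A.closed_family_def by blast
      ultimately show ?thesis using U(1) unfolding A.closed_family_def by simp
    qed
    then have "\<forall>U. A.closed_family M U \<longrightarrow> (\<forall>(i, m)\<in>?T. m \<in> U i) \<longrightarrow>
        (\<forall>i b. b \<in> hpart B (J i - fst s) \<longrightarrow> \<theta> i (ract N (snd s) b) \<in> U i)"
      unfolding s fst_conv snd_conv by blast
    moreover have "\<forall>(i, m)\<in>?T. m \<in> hcomp M i" using \<theta>_in[OF nc] \<theta>_in[OF ne] by simp
    moreover have "finite ?T" by simp
    ultimately show ?thesis by (intro exI[of _ ?T] conjI)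
  qed
  then have "\<forall>s\<in>S. \<exists>T. finite T \<and> (\<forall>(i, m)\<in>T. m \<in> hcomp M i) \<and>
      (\<forall>U. A.closed_family M U \<longrightarrow> (\<forall>(i, m)\<in>T. m \<in> U i) \<longrightarrow>
        (\<forall>i b. b \<in> hpart B (J i - fst s) \<longrightarrow> \<theta> i (ract N (snd s) b) \<in> U i))" by blast
  from bchoice[OF this] obtain T where "\<forall>s\<in>S. finite (T s) \<and> (\<forall>(i, m)\<in>T s. m \<in> hcomp M i) \<and>
      (\<forall>U. A.closed_family M U \<longrightarrow> (\<forall>(i, m)\<in>T s. m \<in> U i) \<longrightarrow>
        (\<forall>i b. b \<in> hpart B (J i - fst s) \<longrightarrow> \<theta> i (ract N (snd s) b) \<in> U i))" by (elim exE)
  note T_all = bspec[OF this]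
  have T: "finite (T s)" "\<forall>(i, m)\<in>T s. m \<in> hcomp M i" if "s \<in> S" for s
    by (rule T_all[OF that, THEN conjunct1], rule T_all[OF that, THEN conjunct2, THEN conjunct1])
  have T_U: "\<theta> i (ract N (snd s) b) \<in> U i"
    if "s \<in> S" "A.closed_family M U" "\<forall>(i, m)\<in>T s. m \<in> U i" "b \<in> hpart B (J i - fst s)" for s U i b
    using T_all[OF that(1), THEN conjunct2, THEN conjunct2, THEN spec, THEN mp, OF that(2), THEN mp, OF that(3)]
      that(4) by simp
  have "A.generating M (\<Union>s\<in>S. T s)"
    unfolding A.generating_def
  proof (intro conjI allI impI)
    show "\<forall>(i, m)\<in>(\<Union>s\<in>S. T s). m \<in> hcomp M i" using T(2) by fastforce
  next
    fix U i assume U: "A.closed_family M U \<and> (\<forall>(i, m)\<in>(\<Union>s\<in>S. T s). m \<in> U i)"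
    define V where "V K = {n \<in> hcomp N K. \<forall>i b. b \<in> hpart B (J i - K) \<longrightarrow> \<theta> i (ract N n b) \<in> U i}" for K
    have "B.closed_family N V"
      unfolding B.closed_family_def
    proof (intro conjI allI ballI)
      fix K show "V K \<subseteq> hcomp N K" by (auto simp: V_def)
      show "\<zero>\<^bsub>N\<^esub> \<in> V K" using U
        by (auto simp: V_def N.H_zero N.zero_ract B.hpart_carrier \<theta>_zero A.closed_family_def)
      fix n n' assume n: "n \<in> V K" "n' \<in> V K"
      have "\<theta> i (ract N (n \<oplus>\<^bsub>N\<^esub> n') b) \<in> U i" if b: "b \<in> hpart B (J i - K)" for i b
      proof -
        have "\<theta> i (ract N (n \<oplus>\<^bsub>N\<^esub> n') b) = \<theta> i (ract N n b) \<oplus>\<^bsub>M\<^esub> \<theta> i (ract N n' b)"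
        proof -
          have nK: "n \<in> hcomp N K" "n' \<in> hcomp N K" using n by (auto simp: V_def)
          show ?thesis
            using N.ract_add_left[OF nK[THEN N.H_carrier] B.hpart_carrier[OF b]]
              \<theta>_add[OF nK[THEN ract_diff[OF matching_modules(1) _ b]]] by simp
        qed
        then show ?thesis using n b U by (auto simp: V_def A.closed_family_def)
      qed
      then show "n \<oplus>\<^bsub>N\<^esub> n' \<in> V K" using n by (simp add: V_def N.H_add)
    next
      fix K h n b assume n: "n \<in> V K" and b: "b \<in> hpart B h"
      have "\<theta> i (ract N (ract N n b) b') \<in> U i" if b': "b' \<in> hpart B (J i - (K + h))" for i b'
      proof -
        have "b \<otimes>\<^bsub>B\<^esub> b' \<in> hpart B (J i - K)" using B.hpart_mult[OF b b'] by (simp add: algebra_simps)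
        moreover have "ract N (ract N n b) b' = ract N n (b \<otimes>\<^bsub>B\<^esub> b')"
        proof -
          have "n \<in> hcomp N K" using n by (simp add: V_def)
          from N.ract_mult[OF N.H_carrier[OF this] b[THEN B.hpart_carrier] b'[THEN B.hpart_carrier]]
          show ?thesis ..
        qed
        ultimately show ?thesis using n by (simp add: V_def)
      qed
      then show "ract N n b \<in> V (K + h)" using n b by (simp add: V_def N.ract_degree)
    qed
    moreover have "\<forall>(K, n)\<in>S. n \<in> V K"
    proof (clarify)
      fix K n assume "(K, n) \<in> S"
      then show "n \<in> V K"
        using T_U[of "(K, n)" U] U S(2) by (auto simp: V_def B.generating_def)
    qed
    ultimately have V: "hcomp N K \<subseteq> V K" for K using S(2) unfolding B.generating_def by blast
    show "hcomp M i \<subseteq> U i"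
    proof
      fix m assume "m \<in> hcomp M i"
      then obtain n where n: "n \<in> hcomp N (J i)" "\<theta> i n = m" by (rule \<theta>_surj)
      then have "\<theta> i (ract N n \<one>\<^bsub>B\<^esub>) \<in> U i" using V[of "J i"] B.hpart_one by (auto simp: V_def)
      then show "m \<in> U i" using n by (simp add: N.ract_one N.H_carrier)
    qed
  qed
  moreover have "finite (\<Union>s\<in>S. T s)" using S T by simp
  ultimately show ?thesis using matching_modules(2) by (intro A.fin_generated_of_generating)
qed

text \<open>Conversely the generators of the restriction generate \<open>N\<close>, since every \<open>n\<close> equals
  \<open>(n c) c' + (n e) e'\<close>.\<close>

lemma matching_fin_generated_left:
  assumes "fin_generated A M"
  shows "fin_generated B N"
proof -
  interpret N: graded_module B N by (rule matching_modules)
  interpret M: graded_module A M by (rule matching_modules)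
  from A.generating_of_fin_generated[OF matching_modules(2) assms]
  obtain S where S: "finite S" "A.generating M S" .
  define T where "T = (\<lambda>(i, m). (J i, the_inv_into (hcomp N (J i)) (\<theta> i) m)) ` S"
  have inv: "the_inv_into (hcomp N (J i)) (\<theta> i) (\<theta> i n) = n" if "n \<in> hcomp N (J i)" for i n
    using bij_betw_imp_inj_on[OF \<theta>_bij] that by (rule the_inv_into_f_f)
  have "B.generating N T"
    unfolding B.generating_def
  proof (intro conjI allI impI)
    have "the_inv_into (hcomp N (J i)) (\<theta> i) m \<in> hcomp N (J i)" if "(i, m) \<in> S" for i m
    proof -
      have "m \<in> hcomp M i" using that S(2) by (auto simp: A.generating_def)
      then show ?thesis by (rule \<theta>_surj) (auto simp: inv)
    qed
    then show "\<forall>(K, n)\<in>T. n \<in> hcomp N K" by (auto simp: T_def)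
  next
    fix U K assume U: "B.closed_family N U \<and> (\<forall>(K, n)\<in>T. n \<in> U K)"
    define V where "V i = \<theta> i ` U (J i)" for i
    have UN: "n \<in> U K \<Longrightarrow> n \<in> hcomp N K" for n K using U by (auto simp: B.closed_family_def)
    have "A.closed_family M V"
      unfolding A.closed_family_def
    proof (intro conjI allI ballI)
      fix i show "V i \<subseteq> hcomp M i" using UN \<theta>_in by (auto simp: V_def)
      show "\<zero>\<^bsub>M\<^esub> \<in> V i" 
      proof -
        have "\<zero>\<^bsub>N\<^esub> \<in> U (J i)" using U unfolding B.closed_family_def by blast
        then have "\<theta> i \<zero>\<^bsub>N\<^esub> \<in> V i" unfolding V_def by (rule imageI)
        then show ?thesis by (simp only: \<theta>_zero)
      qed
      fix m m' assume "m \<in> V i" "m' \<in> V i"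
      then obtain n n' where n: "n \<in> U (J i)" "n' \<in> U (J i)" "m = \<theta> i n" "m' = \<theta> i n'"
        by (auto simp: V_def)
      then have "m \<oplus>\<^bsub>M\<^esub> m' = \<theta> i (n \<oplus>\<^bsub>N\<^esub> n')" using UN by (simp add: \<theta>_add)
      moreover have "n \<oplus>\<^bsub>N\<^esub> n' \<in> U (J i)" using U n unfolding B.closed_family_def by blast
      ultimately show "m \<oplus>\<^bsub>M\<^esub> m' \<in> V i" by (simp add: V_def)
    next
      fix i d m a assume "m \<in> V i" and a: "a \<in> hpart A d"
      then obtain n where n: "n \<in> U (J i)" "m = \<theta> i n" by (auto simp: V_def)
      have "ract N n (\<phi> i d a) \<in> U (J i + (J (i + d) - J i))"
        using U n(1) \<phi>_in[OF a, of i] unfolding B.closed_family_def by blast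
      then show "ract M m a \<in> V (i + d)"
        using \<theta>_act[OF UN[OF n(1)] a] n(2) by (simp add: V_def) (metis imageI)
    qed
    moreover have "\<forall>(i, m)\<in>S. m \<in> V i"
    proof clarify
      fix i m assume im: "(i, m) \<in> S"
      have "m \<in> hcomp M i" using im S(2) by (auto simp: A.generating_def)
      then obtain n where n: "n \<in> hcomp N (J i)" "\<theta> i n = m" by (rule \<theta>_surj)
      have "(J i, n) \<in> T"
        unfolding T_def using inv[OF n(1)] n(2) by (intro image_eqI[OF _ im]) simp
      then have "n \<in> U (J i)" using U by blast
      then show "m \<in> V i" using n(2) by (auto simp: V_def)
    qed
    ultimately have V: "hcomp M i \<subseteq> V i" for i using S(2) unfolding A.generating_def by blast
    have UJ: "hcomp N (J i) \<subseteq> U (J i)" for i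
    proof
      fix n assume n: "n \<in> hcomp N (J i)"
      then have "\<theta> i n \<in> V i" using V \<theta>_in by blast
      then obtain n' where "n' \<in> U (J i)" "\<theta> i n = \<theta> i n'" by (auto simp: V_def)
      then show "n \<in> U (J i)" using \<theta>_inj[OF n UN] by simp
    qed
    show "hcomp N K \<subseteq> U K"
    proof
      fix n assume n: "n \<in> hcomp N K"
      from cover[of K] obtain i j c c' e e' where c: "c \<in> hpart B (J i - K)" "c' \<in> hpart B (K - J i)"
        and e: "e \<in> hpart B (J j - K)" "e' \<in> hpart B (K - J j)"
        and one: "\<one>\<^bsub>B\<^esub> = c \<otimes>\<^bsub>B\<^esub> c' \<oplus>\<^bsub>B\<^esub> e \<otimes>\<^bsub>B\<^esub> e'" by blast
      have "ract N n c \<in> U (J i)" "ract N n e \<in> U (J j)"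
        using UJ ract_diff[OF matching_modules(1) n] c e by blast+
      then have "ract N (ract N n c) c' \<in> U (J i + (K - J i))" "ract N (ract N n e) e' \<in> U (J j + (K - J j))"
        using U c e unfolding B.closed_family_def by blast+
      then have "ract N (ract N n c) c' \<oplus>\<^bsub>N\<^esub> ract N (ract N n e) e' \<in> U K"
        using U unfolding B.closed_family_def by simp
      then show "n \<in> U K"
        using cover_split[OF matching_modules(1) N.H_carrier[OF n] c[THEN B.hpart_carrier]
            e[THEN B.hpart_carrier] one] by simp
    qed
  qed
  moreover have "finite T" using S by (simp add: T_def)
  ultimately show ?thesis using matching_modules(1) by (intro B.fin_generated_of_generating)
qed

end

lemma matching_hom_ex1_right:
  assumes NM: "matching N M \<theta>" and NM': "matching N' M' \<theta>'" and f: "f \<in> ghom B N N'"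
  shows "\<exists>!g. g \<in> ghom A M M' \<and> (\<forall>i. \<forall>n\<in>hcomp N (J i). g (\<theta> i n) = \<theta>' i (f n))"
proof -
  interpret N: graded_module B N by (rule matching_modules[OF NM])
  interpret M: graded_module A M by (rule matching_modules[OF NM])
  interpret N': graded_module B N' by (rule matching_modules[OF NM'])
  interpret M': graded_module A M' by (rule matching_modules[OF NM'])
  define \<psi> where "\<psi> i = the_inv_into (hcomp N (J i)) (\<theta> i)" for i
  have \<psi>: "\<psi> i (\<theta> i n) = n" if "n \<in> hcomp N (J i)" for i n
    unfolding \<psi>_def using bij_betw_imp_inj_on[OF \<theta>_bij[OF NM]] that by (rule the_inv_into_f_f)
  obtain g where g: "g \<in> ghom A M M'" "\<And>i m. m \<in> hcomp M i \<Longrightarrow> g m = \<theta>' i (f (\<psi> i m))"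
  proof (rule A.ghom_extension[OF matching_modules(2)[OF NM] matching_modules(2)[OF NM'],
        of "\<lambda>i m. \<theta>' i (f (\<psi> i m))"])
    fix i m assume m: "m \<in> hcomp M i"
    then obtain n where n: "n \<in> hcomp N (J i)" "m = \<theta> i n" using \<theta>_surj[OF NM] by metis
    then show "\<theta>' i (f (\<psi> i m)) \<in> hcomp M' i" by (simp add: \<psi> \<theta>_in[OF NM'] ghom_hcomp[OF f])
  next
    fix i m m' assume m: "m \<in> hcomp M i" "m' \<in> hcomp M i"
    obtain n where n: "n \<in> hcomp N (J i)" "m = \<theta> i n" using \<theta>_surj[OF NM m(1)] by metis
    obtain n' where n': "n' \<in> hcomp N (J i)" "m' = \<theta> i n'" using \<theta>_surj[OF NM m(2)] by metis
    have "m \<oplus>\<^bsub>M\<^esub> m' = \<theta> i (n \<oplus>\<^bsub>N\<^esub> n')" using n n' by (simp add: \<theta>_add[OF NM])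
    moreover have "f (n \<oplus>\<^bsub>N\<^esub> n') = f n \<oplus>\<^bsub>N'\<^esub> f n'"
      using ghom_add[OF f N.H_carrier[OF n(1)] N.H_carrier[OF n'(1)]] .
    ultimately show "\<theta>' i (f (\<psi> i (m \<oplus>\<^bsub>M\<^esub> m'))) = \<theta>' i (f (\<psi> i m)) \<oplus>\<^bsub>M'\<^esub> \<theta>' i (f (\<psi> i m'))"
      using n n' N.H_add[OF n(1) n'(1)] by (simp add: \<psi> \<theta>_add[OF NM'] ghom_hcomp[OF f])
  next
    fix i m d a assume m: "m \<in> hcomp M i" and a: "a \<in> hpart A d"
    obtain n where n: "n \<in> hcomp N (J i)" "m = \<theta> i n" using \<theta>_surj[OF NM m] by metis
    have na: "ract N n (\<phi> i d a) \<in> hcomp N (J (i + d))"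
      by (rule ract_diff[OF matching_modules(1)[OF NM] n(1) \<phi>_in[OF a]])
    have "\<psi> (i + d) (ract M m a) = ract N n (\<phi> i d a)"
      using \<theta>_act[OF NM n(1) a] \<psi>[OF na] n(2) by simp
    moreover have "f (ract N n (\<phi> i d a)) = ract N' (f n) (\<phi> i d a)"
      by (rule ghom_ract[OF f N.H_carrier[OF n(1)] B.hpart_carrier[OF \<phi>_in[OF a]]])
    ultimately show "\<theta>' (i + d) (f (\<psi> (i + d) (ract M m a))) = ract M' (\<theta>' i (f (\<psi> i m))) a"
      using \<theta>_act[OF NM' ghom_hcomp[OF f n(1)] a] \<psi>[OF n(1)] n(2) by simp
  qed (rule that)
  show ?thesis
  proof (rule ex1I[of _ g])
    show "g \<in> ghom A M M' \<and> (\<forall>i. \<forall>n\<in>hcomp N (J i). g (\<theta> i n) = \<theta>' i (f n))"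
      using g(1) g(2)[OF \<theta>_in[OF NM]] by (simp add: \<psi>)
    fix g' assume g': "g' \<in> ghom A M M' \<and> (\<forall>i. \<forall>n\<in>hcomp N (J i). g' (\<theta> i n) = \<theta>' i (f n))"
    show "g' = g"
    proof (rule A.ghom_eqI_homogeneous[OF matching_modules(2)[OF NM] _ g(1)])
      show "g' \<in> ghom A M M'" using g' by simp
      fix i m assume "m \<in> hcomp M i"
      then obtain n where n: "n \<in> hcomp N (J i)" "m = \<theta> i n" using \<theta>_surj[OF NM] by metis
      then show "g' m = g m" using g' g(2)[OF \<theta>_in[OF NM n(1)]] by (simp add: \<psi>)
    qed
  qed
qed

text \<open>Restriction is fully faithful. A homomorphism \<open>g\<close> between the restrictions prescribes maps \<open>\<gamma> i\<close>
  on the components of degree \<open>J i\<close>. The image of \<open>n\<close> in degree \<open>K\<close> is the only \<open>n'\<close> with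
  \<open>n' b = \<gamma> i (n b)\<close> for all \<open>i\<close> and all \<open>b\<close> of degree \<open>J i - K\<close>; such an \<open>n'\<close> exists, namely
  \<open>\<gamma> (n c) c' + \<gamma> (n e) e'\<close>. Additivity and linearity follow from the uniqueness.\<close>

lemma matching_hom_ex1_left:
  assumes NM: "matching N M \<theta>" and NM': "matching N' M' \<theta>'" and g: "g \<in> ghom A M M'"
  shows "\<exists>!f. f \<in> ghom B N N' \<and> (\<forall>i. \<forall>n\<in>hcomp N (J i). g (\<theta> i n) = \<theta>' i (f n))"
proof -
  note modN = matching_modules(1)[OF NM] and modN' = matching_modules(1)[OF NM']
  interpret N: graded_module B N by (rule modN)
  interpret M: graded_module A M by (rule matching_modules[OF NM])
  interpret N': graded_module B N' by (rule modN')
  interpret M': graded_module A M' by (rule matching_modules[OF NM'])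
  define \<gamma> where "\<gamma> i n = the_inv_into (hcomp N' (J i)) (\<theta>' i) (g (\<theta> i n))" for i n
  have \<gamma>: "\<gamma> i n \<in> hcomp N' (J i) \<and> \<theta>' i (\<gamma> i n) = g (\<theta> i n)" if n: "n \<in> hcomp N (J i)" for i n
  proof -
    have "g (\<theta> i n) \<in> hcomp M' i" using ghom_hcomp[OF g \<theta>_in[OF NM n]] .
    then obtain n' where n': "n' \<in> hcomp N' (J i)" "\<theta>' i n' = g (\<theta> i n)" by (rule \<theta>_surj[OF NM'])
    then have "\<gamma> i n = n'"
      unfolding \<gamma>_def using bij_betw_imp_inj_on[OF \<theta>_bij[OF NM']] by (metis the_inv_into_f_f)
    then show ?thesis using n' by simp
  qed
  have \<gamma>_eqI: "\<gamma> i n = n'" if "n \<in> hcomp N (J i)" "n' \<in> hcomp N' (J i)" "\<theta>' i n' = g (\<theta> i n)" for i n n'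
    using \<theta>_inj[OF NM', of "\<gamma> i n" i n'] \<gamma>[OF that(1)] that by simp
  have \<gamma>_add: "\<gamma> i (n \<oplus>\<^bsub>N\<^esub> n') = \<gamma> i n \<oplus>\<^bsub>N'\<^esub> \<gamma> i n'"
    if n: "n \<in> hcomp N (J i)" "n' \<in> hcomp N (J i)" for i n n'
  proof (rule \<gamma>_eqI)
    show "\<theta>' i (\<gamma> i n \<oplus>\<^bsub>N'\<^esub> \<gamma> i n') = g (\<theta> i (n \<oplus>\<^bsub>N\<^esub> n'))"
      using \<gamma>[OF n(1)] \<gamma>[OF n(2)] ghom_add[OF g \<theta>_in[OF NM n(1), THEN M.H_carrier] \<theta>_in[OF NM n(2), THEN M.H_carrier]]
      by (simp add: \<theta>_add[OF NM'] \<theta>_add[OF NM n])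
  qed (use n \<gamma> N.H_add N'.H_add in auto)
  have \<gamma>_act: "\<gamma> j (ract N n b) = ract N' (\<gamma> i n) b"
    if n: "n \<in> hcomp N (J i)" and b: "b \<in> hpart B (J j - J i)" for i j n b
  proof -
    obtain a where a: "a \<in> hpart A (j - i)" "\<phi> i (j - i) a = b" using b by (rule \<phi>_surj)
    have g\<theta>: "g (ract M (\<theta> i n) a) = ract M' (g (\<theta> i n)) a"
      by (rule ghom_ract[OF g M.H_carrier[OF \<theta>_in[OF NM n]] A.hpart_carrier[OF a(1)]])
    show ?thesis
    proof (rule \<gamma>_eqI[OF ract_diff[OF modN n b] ract_diff[OF modN' _ b]])
      show "\<gamma> i n \<in> hcomp N' (J i)" using \<gamma>[OF n] by simp
      then show "\<theta>' j (ract N' (\<gamma> i n) b) = g (\<theta> j (ract N n b))"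
        using \<theta>_act_diff[OF NM n a(1)] \<theta>_act_diff[OF NM' _ a(1), of "\<gamma> i n"] \<gamma>[OF n] g\<theta> a(2) by simp
    qed
  qed
  have separated: "n' = n''"
    if n': "n' \<in> hcomp N' K" and n'': "n'' \<in> hcomp N' K"
      and eq: "\<And>i b. b \<in> hpart B (J i - K) \<Longrightarrow> ract N' n' b = ract N' n'' b" for K n' n''
  proof -
    from cover[of K] obtain i j c c' e e' where c: "c \<in> hpart B (J i - K)" "c' \<in> hpart B (K - J i)"
      and e: "e \<in> hpart B (J j - K)" "e' \<in> hpart B (K - J j)"
      and one: "\<one>\<^bsub>B\<^esub> = c \<otimes>\<^bsub>B\<^esub> c' \<oplus>\<^bsub>B\<^esub> e \<otimes>\<^bsub>B\<^esub> e'" by blast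
    note ce = c[THEN B.hpart_carrier] e[THEN B.hpart_carrier]
    have "n' = ract N' (ract N' n' c) c' \<oplus>\<^bsub>N'\<^esub> ract N' (ract N' n' e) e'"
      by (rule cover_split[OF modN' N'.H_carrier[OF n'] ce one, symmetric])
    also have "\<dots> = ract N' (ract N' n'' c) c' \<oplus>\<^bsub>N'\<^esub> ract N' (ract N' n'' e) e'"
      by (simp only: eq[OF c(1)] eq[OF e(1)])
    also have "\<dots> = n''" by (rule cover_split[OF modN' N'.H_carrier[OF n''] ce one])
    finally show ?thesis .
  qed
  define char where "char K n n' \<longleftrightarrow> n' \<in> hcomp N' K \<and>
      (\<forall>i. \<forall>b\<in>hpart B (J i - K). ract N' n' b = \<gamma> i (ract N n b))" for K n n'
  have char_ex: "\<exists>n'. char K n n'" if n: "n \<in> hcomp N K" for K n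
  proof -
    from cover[of K] obtain i j c c' e e' where c: "c \<in> hpart B (J i - K)" "c' \<in> hpart B (K - J i)"
      and e: "e \<in> hpart B (J j - K)" "e' \<in> hpart B (K - J j)"
      and one: "\<one>\<^bsub>B\<^esub> = c \<otimes>\<^bsub>B\<^esub> c' \<oplus>\<^bsub>B\<^esub> e \<otimes>\<^bsub>B\<^esub> e'" by blast
    note ce = c[THEN B.hpart_carrier] e[THEN B.hpart_carrier]
    note nc = ract_diff[OF modN n c(1)] and ne = ract_diff[OF modN n e(1)]
    note \<gamma>c = \<gamma>[OF nc, THEN conjunct1] and \<gamma>e = \<gamma>[OF ne, THEN conjunct1]
    let ?n = "ract N' (\<gamma> i (ract N n c)) c' \<oplus>\<^bsub>N'\<^esub> ract N' (\<gamma> j (ract N n e)) e'"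
    have "ract N' ?n b = \<gamma> l (ract N n b)" if b: "b \<in> hpart B (J l - K)" for l b
    proof -
      note bc = B.hpart_carrier[OF b]
      note cb = hpart_mult_diff[OF c(2) b] and eb = hpart_mult_diff[OF e(2) b]
      have "ract N' ?n b = ract N' (\<gamma> i (ract N n c)) (c' \<otimes>\<^bsub>B\<^esub> b) \<oplus>\<^bsub>N'\<^esub> ract N' (\<gamma> j (ract N n e)) (e' \<otimes>\<^bsub>B\<^esub> b)"
        using ce bc N'.H_carrier[OF \<gamma>c] N'.H_carrier[OF \<gamma>e]
        by (simp add: N'.ract_add_left N'.ract_in N'.ract_mult)
      also have "\<dots> = \<gamma> l (ract N (ract N n c) (c' \<otimes>\<^bsub>B\<^esub> b)) \<oplus>\<^bsub>N'\<^esub> \<gamma> l (ract N (ract N n e) (e' \<otimes>\<^bsub>B\<^esub> b))"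
        using \<gamma>_act[OF nc cb] \<gamma>_act[OF ne eb] by simp
      also have "\<dots> = \<gamma> l (ract N (ract N n c) (c' \<otimes>\<^bsub>B\<^esub> b) \<oplus>\<^bsub>N\<^esub> ract N (ract N n e) (e' \<otimes>\<^bsub>B\<^esub> b))"
        using \<gamma>_add[OF ract_diff[OF modN nc cb] ract_diff[OF modN ne eb]] by simp
      also have "ract N (ract N n c) (c' \<otimes>\<^bsub>B\<^esub> b) \<oplus>\<^bsub>N\<^esub> ract N (ract N n e) (e' \<otimes>\<^bsub>B\<^esub> b)
          = ract N (ract N (ract N n c) c' \<oplus>\<^bsub>N\<^esub> ract N (ract N n e) e') b"
        using ce bc N.H_carrier[OF n] by (simp add: N.ract_add_left N.ract_mult N.ract_in)
      also have "\<dots> = ract N n b" by (simp add: cover_split[OF modN N.H_carrier[OF n] ce one])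
      finally show ?thesis .
    qed
    moreover have "?n \<in> hcomp N' K"
      by (intro N'.H_add ract_diff[OF modN' \<gamma>c c(2)] ract_diff[OF modN' \<gamma>e e(2)])
    ultimately show ?thesis unfolding char_def by blast
  qed
  have char_unique: "n' = n''" if "char K n n'" "char K n n''" for K n n' n''
    using separated[of n' K n''] that unfolding char_def by simp
  define F where "F K n = (SOME n'. char K n n')" for K n
  have F: "char K n (F K n)" if "n \<in> hcomp N K" for K n
    unfolding F_def using char_ex[OF that] by (rule someI_ex)
  have F_in: "n \<in> hcomp N K \<Longrightarrow> F K n \<in> hcomp N' K" for K n using F by (simp add: char_def)
  have F_act: "ract N' (F K n) b = \<gamma> i (ract N n b)" if "n \<in> hcomp N K" "b \<in> hpart B (J i - K)" for K n i b
    using F[OF that(1)] that(2) by (simp add: char_def)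
  obtain f where f: "f \<in> ghom B N N'" "\<And>K n. n \<in> hcomp N K \<Longrightarrow> f n = F K n"
  proof (rule B.ghom_extension[OF modN modN', of F])
    fix K n assume "n \<in> hcomp N K" then show "F K n \<in> hcomp N' K" by (rule F_in)
  next
    fix K n n' assume n: "n \<in> hcomp N K" "n' \<in> hcomp N K"
    have "char K (n \<oplus>\<^bsub>N\<^esub> n') (F K n \<oplus>\<^bsub>N'\<^esub> F K n')"
      unfolding char_def
    proof (intro conjI allI ballI)
      show "F K n \<oplus>\<^bsub>N'\<^esub> F K n' \<in> hcomp N' K" using n by (intro N'.H_add F_in)
      fix i b assume b: "b \<in> hpart B (J i - K)"
      have "ract N (n \<oplus>\<^bsub>N\<^esub> n') b = ract N n b \<oplus>\<^bsub>N\<^esub> ract N n' b"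
        using n[THEN N.H_carrier] B.hpart_carrier[OF b] by (simp add: N.ract_add_left)
      then show "ract N' (F K n \<oplus>\<^bsub>N'\<^esub> F K n') b = \<gamma> i (ract N (n \<oplus>\<^bsub>N\<^esub> n') b)"
        using F_in[OF n(1), THEN N'.H_carrier] F_in[OF n(2), THEN N'.H_carrier] B.hpart_carrier[OF b]
          \<gamma>_add[OF ract_diff[OF modN n(1) b] ract_diff[OF modN n(2) b]]
        by (simp add: N'.ract_add_left F_act[OF n(1) b] F_act[OF n(2) b])
    qed
    then show "F K (n \<oplus>\<^bsub>N\<^esub> n') = F K n \<oplus>\<^bsub>N'\<^esub> F K n'"
      by (rule char_unique[OF F[OF N.H_add[OF n]]])
  next
    fix K n h b assume n: "n \<in> hcomp N K" and b: "b \<in> hpart B h"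
    have "char (K + h) (ract N n b) (ract N' (F K n) b)"
      unfolding char_def
    proof (intro conjI allI ballI)
      show "ract N' (F K n) b \<in> hcomp N' (K + h)" by (rule N'.ract_degree[OF F_in[OF n] b])
      fix i b' assume b': "b' \<in> hpart B (J i - (K + h))"
      have bb: "b \<otimes>\<^bsub>B\<^esub> b' \<in> hpart B (J i - K)" using B.hpart_mult[OF b b'] by (simp add: algebra_simps)
      show "ract N' (ract N' (F K n) b) b' = \<gamma> i (ract N (ract N n b) b')"
        using F_act[OF n bb] N.ract_mult[OF N.H_carrier[OF n] b[THEN B.hpart_carrier] b'[THEN B.hpart_carrier]]
          N'.ract_mult[OF N'.H_carrier[OF F_in[OF n]] b[THEN B.hpart_carrier] b'[THEN B.hpart_carrier]]
        by simp
    qed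
    then show "F (K + h) (ract N n b) = ract N' (F K n) b"
      by (rule char_unique[OF F[OF N.ract_degree[OF n b]]])
  qed (rule that)
  show ?thesis
  proof (rule ex1I[of _ f])
    have "g (\<theta> i n) = \<theta>' i (f n)" if n: "n \<in> hcomp N (J i)" for i n
    proof -
      have "ract N' (F (J i) n) \<one>\<^bsub>B\<^esub> = \<gamma> i (ract N n \<one>\<^bsub>B\<^esub>)"
        using B.hpart_one by (intro F_act[OF n]) simp
      then have "f n = \<gamma> i n"
        using f(2)[OF n] n F_in[OF n] by (simp add: N.ract_one N'.ract_one N.H_carrier N'.H_carrier)
      then show ?thesis using \<gamma>[OF n] by simp
    qed
    then show "f \<in> ghom B N N' \<and> (\<forall>i. \<forall>n\<in>hcomp N (J i). g (\<theta> i n) = \<theta>' i (f n))"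
      using f(1) by simp
    fix f' assume f': "f' \<in> ghom B N N' \<and> (\<forall>i. \<forall>n\<in>hcomp N (J i). g (\<theta> i n) = \<theta>' i (f' n))"
    then have f'_hom: "f' \<in> ghom B N N'" by simp
    show "f' = f"
    proof (rule B.ghom_eqI_homogeneous[OF modN f'_hom f(1)])
      fix K n assume n: "n \<in> hcomp N K"
      have "char K n (f' n)"
        unfolding char_def
      proof (intro conjI allI ballI)
        show "f' n \<in> hcomp N' K" by (rule ghom_hcomp[OF f'_hom n])
        fix i b assume b: "b \<in> hpart B (J i - K)"
        have "\<gamma> i (ract N n b) = f' (ract N n b)"
          using ract_diff[OF modN n b] ghom_hcomp[OF f'_hom ract_diff[OF modN n b]] f' by (intro \<gamma>_eqI) auto
        then show "ract N' (f' n) b = \<gamma> i (ract N n b)"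
          using ghom_ract[OF f'_hom N.H_carrier[OF n] B.hpart_carrier[OF b]] by simp
      qed
      then show "f' n = f n" using char_unique[OF _ F[OF n]] f(2)[OF n] by simp
    qed
  qed
qed


text \<open>The restriction itself, as an external direct sum, with \<open>A\<close> acting through \<open>\<phi>\<close>.\<close>

lemma matching_right_exists:
  fixes N :: "('b, 'g, 'v) gmodule"
  assumes N: "graded_module B N"
  obtains M :: "('a, 'd, 'd \<Rightarrow> 'v) gmodule" and \<theta> where "matching N M \<theta>"
proof -
  interpret N: graded_module B N by (rule N)
  let ?V = "\<lambda>i. hcomp N (J i)"
  obtain T where T: "graded_module A (direct_sum N ?V T)"
    "\<And>m a i d. m \<in> carrier (direct_sum N ?V T) \<Longrightarrow> a \<in> hpart A d \<Longrightarrow> T m a (i + d) = ract N (m i) (\<phi> i d a)"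
  proof (rule A.direct_sum_module[OF N.abelian_group_axioms N.H_subgroup,
        of J "\<lambda>i d n a. ract N n (\<phi> i d a)"])
    fix i d n a assume "n \<in> ?V i" "a \<in> hpart A d"
    then show "ract N n (\<phi> i d a) \<in> ?V (i + d)" by (rule ract_diff[OF N _ \<phi>_in])
  next
    fix i d n n' a assume "n \<in> ?V i" "n' \<in> ?V i" "a \<in> hpart A d"
    then show "ract N (n \<oplus>\<^bsub>N\<^esub> n') (\<phi> i d a) = ract N n (\<phi> i d a) \<oplus>\<^bsub>N\<^esub> ract N n' (\<phi> i d a)"
      by (intro N.ract_add_left N.H_carrier B.hpart_carrier[OF \<phi>_in])
  next
    fix i d n a a' assume n: "n \<in> ?V i" and a: "a \<in> hpart A d" "a' \<in> hpart A d"
    then show "ract N n (\<phi> i d (a \<oplus>\<^bsub>A\<^esub> a')) = ract N n (\<phi> i d a) \<oplus>\<^bsub>N\<^esub> ract N n (\<phi> i d a')"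
      using N.ract_add_right[OF N.H_carrier[OF n] a[THEN \<phi>_in, THEN B.hpart_carrier]]
      by (simp add: \<phi>_add)
  next
    fix i d d' n a a' assume n: "n \<in> ?V i" and a: "a \<in> hpart A d" "a' \<in> hpart A d'"
    then show "ract N n (\<phi> i (d + d') (a \<otimes>\<^bsub>A\<^esub> a')) = ract N (ract N n (\<phi> i d a)) (\<phi> (i + d) d' a')"
      using N.ract_mult[OF N.H_carrier[OF n] \<phi>_in[OF a(1), THEN B.hpart_carrier] \<phi>_in[OF a(2), THEN B.hpart_carrier]]
      by (simp add: \<phi>_mult)
  next
    fix i n assume "n \<in> ?V i"
    then show "ract N n (\<phi> i 0 \<one>\<^bsub>A\<^esub>) = n" by (simp add: \<phi>_one N.ract_one N.H_carrier)
  qed (rule that)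
  let ?M = "direct_sum N ?V T" and ?\<theta> = "\<lambda>i n k. if k = i then n else \<zero>\<^bsub>N\<^esub>"
  interpret M: graded_module A ?M by (rule T)
  have hc: "m \<in> hcomp ?M i \<longleftrightarrow> m i \<in> ?V i \<and> (\<forall>k. k \<noteq> i \<longrightarrow> m k = \<zero>\<^bsub>N\<^esub>)" for m i
    by (simp add: direct_sum_def)
  have add: "m \<oplus>\<^bsub>?M\<^esub> m' = (\<lambda>k. m k \<oplus>\<^bsub>N\<^esub> m' k)" for m m' by (simp add: direct_sum_def)
  have ract: "ract ?M = T" by (simp add: direct_sum_def)
  have "matching N ?M ?\<theta>"
    unfolding matching_def
  proof (intro conjI allI ballI N T(1))
    fix i
    show "bij_betw (?\<theta> i) (?V i) (hcomp ?M i)"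
    proof (rule bij_betwI[of _ _ _ "\<lambda>m. m i"])
      show "?\<theta> i \<in> ?V i \<rightarrow> hcomp ?M i" "(\<lambda>m. m i) \<in> hcomp ?M i \<rightarrow> ?V i" by (auto simp: hc)
    qed (auto simp: hc)
    fix n n' assume "n \<in> ?V i" "n' \<in> ?V i"
    then show "?\<theta> i (n \<oplus>\<^bsub>N\<^esub> n') = ?\<theta> i n \<oplus>\<^bsub>?M\<^esub> ?\<theta> i n'" by (auto simp: add)
  next
    fix i d n a assume n: "n \<in> ?V i" and a: "a \<in> hpart A d"
    have m: "?\<theta> i n \<in> hcomp ?M i" using n by (simp add: hc)
    have "T (?\<theta> i n) a \<in> hcomp ?M (i + d)" using M.ract_degree[OF m a] by (simp add: ract)
    moreover have "T (?\<theta> i n) a (i + d) = ract N n (\<phi> i d a)"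
      using T(2)[OF M.H_carrier[OF m] a, of i] by simp
    ultimately have "T (?\<theta> i n) a k = ?\<theta> (i + d) (ract N n (\<phi> i d a)) k" for k
      using hc[of "T (?\<theta> i n) a" "i + d"] by (cases "k = i + d") simp_all
    then show "?\<theta> (i + d) (ract N n (\<phi> i d a)) = ract ?M (?\<theta> i n) a"
      unfolding ract by (intro ext) simp
  qed
  then show thesis by (rule that)
qed

text \<open>The component of degree \<open>K\<close> of the \<open>B\<close>-module belonging to \<open>M\<close> consists of the \<open>A\<close>-linear maps
  to \<open>M\<close> from the module with components \<open>B\<^bsub>J i - K\<^esub>\<close>. They are extended by zero so that
  equality of functions is equality of maps.\<close>

definition compatible_maps :: "('a, 'd, 'u) gmodule \<Rightarrow> 'g \<Rightarrow> ('d \<Rightarrow> 'b \<Rightarrow> 'u) set" where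
  "compatible_maps M K = {\<psi>. (\<forall>i b. b \<notin> hpart B (J i - K) \<longrightarrow> \<psi> i b = \<zero>\<^bsub>M\<^esub>) \<and>
     (\<forall>i. \<forall>b\<in>hpart B (J i - K). \<psi> i b \<in> hcomp M i) \<and>
     (\<forall>i. \<forall>b\<in>hpart B (J i - K). \<forall>b'\<in>hpart B (J i - K). \<psi> i (b \<oplus>\<^bsub>B\<^esub> b') = \<psi> i b \<oplus>\<^bsub>M\<^esub> \<psi> i b') \<and>
     (\<forall>i d. \<forall>b\<in>hpart B (J i - K). \<forall>a\<in>hpart A d. \<psi> (i + d) (b \<otimes>\<^bsub>B\<^esub> \<phi> i d a) = ract M (\<psi> i b) a)}"

lemma compatible_mapsD:
  assumes "\<psi> \<in> compatible_maps M K"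
  shows "b \<notin> hpart B (J i - K) \<Longrightarrow> \<psi> i b = \<zero>\<^bsub>M\<^esub>"
    and "b \<in> hpart B (J i - K) \<Longrightarrow> \<psi> i b \<in> hcomp M i"
    and "b \<in> hpart B (J i - K) \<Longrightarrow> b' \<in> hpart B (J i - K) \<Longrightarrow> \<psi> i (b \<oplus>\<^bsub>B\<^esub> b') = \<psi> i b \<oplus>\<^bsub>M\<^esub> \<psi> i b'"
    and "b \<in> hpart B (J i - K) \<Longrightarrow> a \<in> hpart A d \<Longrightarrow> \<psi> (i + d) (b \<otimes>\<^bsub>B\<^esub> \<phi> i d a) = ract M (\<psi> i b) a"
  using assms unfolding compatible_maps_def by blast+

lemma compatible_mapsI:
  assumes "\<And>i b. b \<notin> hpart B (J i - K) \<Longrightarrow> \<psi> i b = \<zero>\<^bsub>M\<^esub>"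
    and "\<And>i b. b \<in> hpart B (J i - K) \<Longrightarrow> \<psi> i b \<in> hcomp M i"
    and "\<And>i b b'. b \<in> hpart B (J i - K) \<Longrightarrow> b' \<in> hpart B (J i - K) \<Longrightarrow> \<psi> i (b \<oplus>\<^bsub>B\<^esub> b') = \<psi> i b \<oplus>\<^bsub>M\<^esub> \<psi> i b'"
    and "\<And>i d b a. b \<in> hpart B (J i - K) \<Longrightarrow> a \<in> hpart A d \<Longrightarrow> \<psi> (i + d) (b \<otimes>\<^bsub>B\<^esub> \<phi> i d a) = ract M (\<psi> i b) a"
  shows "\<psi> \<in> compatible_maps M K"
  unfolding compatible_maps_def using assms by blast

lemma compatible_maps_add:
  assumes M: "graded_module A M" and \<psi>: "\<psi> \<in> compatible_maps M K" and \<chi>: "\<chi> \<in> compatible_maps M K"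
  shows "(\<lambda>i b. \<psi> i b \<oplus>\<^bsub>M\<^esub> \<chi> i b) \<in> compatible_maps M K"
proof -
  interpret M: graded_module A M by (rule M)
  note \<psi>D = compatible_mapsD[OF \<psi>] and \<chi>D = compatible_mapsD[OF \<chi>]
  show ?thesis
  proof (rule compatible_mapsI)
    fix i b b' assume b: "b \<in> hpart B (J i - K)" "b' \<in> hpart B (J i - K)"
    show "\<psi> i (b \<oplus>\<^bsub>B\<^esub> b') \<oplus>\<^bsub>M\<^esub> \<chi> i (b \<oplus>\<^bsub>B\<^esub> b') = (\<psi> i b \<oplus>\<^bsub>M\<^esub> \<chi> i b) \<oplus>\<^bsub>M\<^esub> (\<psi> i b' \<oplus>\<^bsub>M\<^esub> \<chi> i b')"
      unfolding \<psi>D(3)[OF b] \<chi>D(3)[OF b]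
      using \<psi>D(2)[OF b(1), THEN M.H_carrier] \<psi>D(2)[OF b(2), THEN M.H_carrier]
        \<chi>D(2)[OF b(1), THEN M.H_carrier] \<chi>D(2)[OF b(2), THEN M.H_carrier] by (simp add: M.a_ac)
  next
    fix i d b a assume b: "b \<in> hpart B (J i - K)" and a: "a \<in> hpart A d"
    show "\<psi> (i + d) (b \<otimes>\<^bsub>B\<^esub> \<phi> i d a) \<oplus>\<^bsub>M\<^esub> \<chi> (i + d) (b \<otimes>\<^bsub>B\<^esub> \<phi> i d a) = ract M (\<psi> i b \<oplus>\<^bsub>M\<^esub> \<chi> i b) a"
      unfolding \<psi>D(4)[OF b a] \<chi>D(4)[OF b a]
      using M.ract_add_left[OF \<psi>D(2)[OF b, THEN M.H_carrier] \<chi>D(2)[OF b, THEN M.H_carrier] A.hpart_carrier[OF a]]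
      by simp
  qed (simp_all add: \<psi>D(1,2) \<chi>D(1,2) M.H_add)
qed

lemma compatible_maps_mult:
  assumes M: "graded_module A M" and \<psi>: "\<psi> \<in> compatible_maps M K" and c: "c \<in> hpart B L"
  shows "(\<lambda>i b. if b \<in> hpart B (J i - (K + L)) then \<psi> i (c \<otimes>\<^bsub>B\<^esub> b) else \<zero>\<^bsub>M\<^esub>) \<in> compatible_maps M (K + L)"
proof -
  note \<psi>D = compatible_mapsD[OF \<psi>]
  have cb: "c \<otimes>\<^bsub>B\<^esub> b \<in> hpart B (J i - K)" if "b \<in> hpart B (J i - (K + L))" for b i
    using B.hpart_mult[OF c that] by (simp add: algebra_simps)
  show ?thesis
  proof (rule compatible_mapsI)
    fix i b b' assume b: "b \<in> hpart B (J i - (K + L))" "b' \<in> hpart B (J i - (K + L))"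
    have "c \<otimes>\<^bsub>B\<^esub> (b \<oplus>\<^bsub>B\<^esub> b') = c \<otimes>\<^bsub>B\<^esub> b \<oplus>\<^bsub>B\<^esub> c \<otimes>\<^bsub>B\<^esub> b'"
      using B.hpart_carrier[OF c] b[THEN B.hpart_carrier] by (simp add: B.r_distr)
    then show "(if b \<oplus>\<^bsub>B\<^esub> b' \<in> hpart B (J i - (K + L)) then \<psi> i (c \<otimes>\<^bsub>B\<^esub> (b \<oplus>\<^bsub>B\<^esub> b')) else \<zero>\<^bsub>M\<^esub>)
        = (if b \<in> hpart B (J i - (K + L)) then \<psi> i (c \<otimes>\<^bsub>B\<^esub> b) else \<zero>\<^bsub>M\<^esub>) \<oplus>\<^bsub>M\<^esub>
          (if b' \<in> hpart B (J i - (K + L)) then \<psi> i (c \<otimes>\<^bsub>B\<^esub> b') else \<zero>\<^bsub>M\<^esub>)"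
      using b B.H_add[OF b] \<psi>D(3)[OF cb[OF b(1)] cb[OF b(2)]] by simp
  next
    fix i d b a assume b: "b \<in> hpart B (J i - (K + L))" and a: "a \<in> hpart A d"
    have "b \<otimes>\<^bsub>B\<^esub> \<phi> i d a \<in> hpart B (J (i + d) - (K + L))" by (rule hpart_mult_diff[OF b \<phi>_in[OF a]])
    moreover have "c \<otimes>\<^bsub>B\<^esub> (b \<otimes>\<^bsub>B\<^esub> \<phi> i d a) = (c \<otimes>\<^bsub>B\<^esub> b) \<otimes>\<^bsub>B\<^esub> \<phi> i d a"
      using B.m_assoc[OF c[THEN B.hpart_carrier] b[THEN B.hpart_carrier] \<phi>_in[OF a, THEN B.hpart_carrier]] by simp
    ultimately show "(if b \<otimes>\<^bsub>B\<^esub> \<phi> i d a \<in> hpart B (J (i + d) - (K + L)) then \<psi> (i + d) (c \<otimes>\<^bsub>B\<^esub> (b \<otimes>\<^bsub>B\<^esub> \<phi> i d a)) else \<zero>\<^bsub>M\<^esub>)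
        = ract M (if b \<in> hpart B (J i - (K + L)) then \<psi> i (c \<otimes>\<^bsub>B\<^esub> b) else \<zero>\<^bsub>M\<^esub>) a"
      using b \<psi>D(4)[OF cb[OF b] a] by simp
  qed (use \<psi>D(2) cb in simp_all)
qed

text \<open>For \<open>K = J i\<close> the source is the free module on the identity element in degree \<open>i\<close>, by way of \<open>\<phi>\<close>.\<close>

lemma compatible_maps_J_bij:
  assumes M: "graded_module A M"
  shows "bij_betw (\<lambda>\<psi>. \<psi> i \<one>\<^bsub>B\<^esub>) (compatible_maps M (J i)) (hcomp M i)"
proof (rule bij_betw_imageI)
  interpret M: graded_module A M by (rule M)
  have one: "\<one>\<^bsub>B\<^esub> \<in> hpart B (J i - J i)" using B.hpart_one by simp
  show "inj_on (\<lambda>\<psi>. \<psi> i \<one>\<^bsub>B\<^esub>) (compatible_maps M (J i))"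
  proof (rule inj_onI)
    fix \<psi> \<chi> assume \<psi>: "\<psi> \<in> compatible_maps M (J i)" and \<chi>: "\<chi> \<in> compatible_maps M (J i)"
      and eq: "\<psi> i \<one>\<^bsub>B\<^esub> = \<chi> i \<one>\<^bsub>B\<^esub>"
    have "\<psi> k b = \<chi> k b" for k b
    proof (cases "b \<in> hpart B (J k - J i)")
      case True
      then obtain a where a: "a \<in> hpart A (k - i)" "\<phi> i (k - i) a = b" by (rule \<phi>_surj)
      have "\<psi> k b = ract M (\<psi> i \<one>\<^bsub>B\<^esub>) a" "\<chi> k b = ract M (\<chi> i \<one>\<^bsub>B\<^esub>) a"
        using compatible_mapsD(4)[OF \<psi> one a(1)] compatible_mapsD(4)[OF \<chi> one a(1)] a(2)
          B.hpart_carrier[OF True] by simp_all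
      then show ?thesis using eq by simp
    qed (simp add: compatible_mapsD(1)[OF \<psi>] compatible_mapsD(1)[OF \<chi>])
    then show "\<psi> = \<chi>" by (intro ext)
  qed
  show "(\<lambda>\<psi>. \<psi> i \<one>\<^bsub>B\<^esub>) ` compatible_maps M (J i) = hcomp M i"
  proof (intro equalityI subsetI)
    fix m assume "m \<in> (\<lambda>\<psi>. \<psi> i \<one>\<^bsub>B\<^esub>) ` compatible_maps M (J i)"
    then show "m \<in> hcomp M i" using compatible_mapsD(2)[OF _ one] by auto
  next
    fix m assume m: "m \<in> hcomp M i"
    define \<rho> where "\<rho> k = the_inv_into (hpart A (k - i)) (\<phi> i (k - i))" for k
    have \<rho>: "\<rho> k (\<phi> i (k - i) a) = a" if "a \<in> hpart A (k - i)" for k a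
      unfolding \<rho>_def using bij_betw_imp_inj_on[OF \<phi>_bij] that by (rule the_inv_into_f_f)
    define \<psi> where "\<psi> k b = (if b \<in> hpart B (J k - J i) then ract M m (\<rho> k b) else \<zero>\<^bsub>M\<^esub>)" for k b
    have \<psi>_\<phi>: "\<psi> k (\<phi> i (k - i) a) = ract M m a" if a: "a \<in> hpart A (k - i)" for k a
      using \<phi>_in[OF a, of i] \<rho>[OF a] by (simp add: \<psi>_def)
    have "\<psi> \<in> compatible_maps M (J i)"
    proof (rule compatible_mapsI)
      fix k b assume b: "b \<in> hpart B (J k - J i)"
      obtain a where a: "a \<in> hpart A (k - i)" "\<phi> i (k - i) a = b" using b by (rule \<phi>_surj)
      show "\<psi> k b \<in> hcomp M k" using \<psi>_\<phi>[OF a(1)] M.ract_degree[OF m a(1)] a(2) by simp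
      fix b' assume b': "b' \<in> hpart B (J k - J i)"
      obtain a' where a': "a' \<in> hpart A (k - i)" "\<phi> i (k - i) a' = b'" using b' by (rule \<phi>_surj)
      show "\<psi> k (b \<oplus>\<^bsub>B\<^esub> b') = \<psi> k b \<oplus>\<^bsub>M\<^esub> \<psi> k b'"
        using \<psi>_\<phi>[OF a(1)] \<psi>_\<phi>[OF a'(1)] \<psi>_\<phi>[OF A.H_add[OF a(1) a'(1)]] \<phi>_add[OF a(1) a'(1), of i] a(2) a'(2)
          M.ract_add_right[OF M.H_carrier[OF m] a(1)[THEN A.hpart_carrier] a'(1)[THEN A.hpart_carrier]]
        by simp
    next
      fix k d b c assume b: "b \<in> hpart B (J k - J i)" and c: "c \<in> hpart A d"
      obtain a where a: "a \<in> hpart A (k - i)" "\<phi> i (k - i) a = b" using b by (rule \<phi>_surj)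
      have kd: "k - i + d = k + d - i" by simp
      have "a \<otimes>\<^bsub>A\<^esub> c \<in> hpart A (k + d - i)" using A.hpart_mult[OF a(1) c] by (simp only: kd)
      moreover have "\<phi> i (k + d - i) (a \<otimes>\<^bsub>A\<^esub> c) = b \<otimes>\<^bsub>B\<^esub> \<phi> k d c"
        using \<phi>_mult[OF a(1) c, of i] a(2) by (simp only: kd) simp
      ultimately show "\<psi> (k + d) (b \<otimes>\<^bsub>B\<^esub> \<phi> k d c) = ract M (\<psi> k b) c"
        using \<psi>_\<phi>[of "a \<otimes>\<^bsub>A\<^esub> c" "k + d"] \<psi>_\<phi>[OF a(1)] a(2)
          M.ract_mult[OF M.H_carrier[OF m] a(1)[THEN A.hpart_carrier] c[THEN A.hpart_carrier]]
        by simp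
    qed (simp add: \<psi>_def)
    moreover have "\<psi> i \<one>\<^bsub>B\<^esub> = m"
      using \<psi>_\<phi>[of "\<one>\<^bsub>A\<^esub>" i] A.hpart_one M.ract_one[OF M.H_carrier[OF m]] by (simp add: \<phi>_one)
    ultimately show "m \<in> (\<lambda>\<psi>. \<psi> i \<one>\<^bsub>B\<^esub>) ` compatible_maps M (J i)" by (intro image_eqI[of _ _ \<psi>]) simp_all
  qed
qed

text \<open>An element \<open>c\<close> of \<open>B\<close> acts on compatible maps by precomposition with left multiplication by \<open>c\<close>.\<close>

lemma matching_left_exists:
  fixes M :: "('a, 'd, 'u) gmodule"
  assumes M: "graded_module A M"
  obtains N :: "('b, 'g, 'g \<Rightarrow> 'd \<Rightarrow> 'b \<Rightarrow> 'u) gmodule" and \<theta> where "matching N M \<theta>"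
proof -
  interpret M: graded_module A M by (rule M)
  define W :: "('d \<Rightarrow> 'b \<Rightarrow> 'u) ring" where
    "W = \<lparr>carrier = {\<psi>. \<forall>i b. \<psi> i b \<in> carrier M}, monoid.mult = undefined, one = undefined,
       zero = (\<lambda>_ _. \<zero>\<^bsub>M\<^esub>), add = (\<lambda>\<psi> \<chi> i b. \<psi> i b \<oplus>\<^bsub>M\<^esub> \<chi> i b)\<rparr>"
  have W: "abelian_group W"
  proof (rule abelian_groupI)
    fix \<psi> assume "\<psi> \<in> carrier W"
    then show "\<exists>\<chi>\<in>carrier W. \<chi> \<oplus>\<^bsub>W\<^esub> \<psi> = \<zero>\<^bsub>W\<^esub>"
      by (intro bexI[of _ "\<lambda>i b. \<ominus>\<^bsub>M\<^esub> \<psi> i b"]) (auto simp: W_def M.l_neg)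
  qed (auto simp: W_def M.a_ac)
  interpret W: abelian_group W by (rule W)
  let ?V = "compatible_maps M"
  have V_carrier: "\<psi> i b \<in> carrier M" if "\<psi> \<in> ?V K" for \<psi> K i b
    using compatible_mapsD(1)[OF that, of b i] compatible_mapsD(2)[OF that, of b i, THEN M.H_carrier]
    by (cases "b \<in> hpart B (J i - K)") auto
  have sub: "subgroup (?V K) (add_monoid W)" for K
  proof (rule W.add.subgroupI)
    show "?V K \<subseteq> carrier W" using V_carrier by (auto simp: W_def)
    have "(\<lambda>_ _. \<zero>\<^bsub>M\<^esub>) \<in> ?V K"
      by (rule compatible_mapsI) (simp_all add: M.H_zero M.zero_ract A.hpart_carrier)
    then show "?V K \<noteq> {}" by blast
    show "\<psi> \<oplus>\<^bsub>W\<^esub> \<chi> \<in> ?V K" if "\<psi> \<in> ?V K" "\<chi> \<in> ?V K" for \<psi> \<chi>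
      using compatible_maps_add[OF M that] by (simp add: W_def)
    fix \<psi> assume \<psi>: "\<psi> \<in> ?V K"
    have "\<ominus>\<^bsub>W\<^esub> \<psi> = (\<lambda>i b. \<ominus>\<^bsub>M\<^esub> \<psi> i b)"
      using V_carrier[OF \<psi>] by (intro W.minus_equality) (auto simp: W_def M.l_neg)
    moreover have "(\<lambda>i b. \<ominus>\<^bsub>M\<^esub> \<psi> i b) \<in> ?V K"
    proof (rule compatible_mapsI)
      fix i b b' assume b: "b \<in> hpart B (J i - K)" "b' \<in> hpart B (J i - K)"
      then show "\<ominus>\<^bsub>M\<^esub> \<psi> i (b \<oplus>\<^bsub>B\<^esub> b') = \<ominus>\<^bsub>M\<^esub> \<psi> i b \<oplus>\<^bsub>M\<^esub> \<ominus>\<^bsub>M\<^esub> \<psi> i b'"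
        using V_carrier[OF \<psi>] by (simp add: compatible_mapsD(3)[OF \<psi>] M.minus_add)
    next
      fix i d b a assume b: "b \<in> hpart B (J i - K)" and a: "a \<in> hpart A d"
      note ac = A.hpart_carrier[OF a]
      have "ract M (\<ominus>\<^bsub>M\<^esub> \<psi> i b) a \<oplus>\<^bsub>M\<^esub> ract M (\<psi> i b) a = \<zero>\<^bsub>M\<^esub>"
        using V_carrier[OF \<psi>, of i b] ac by (simp add: M.l_neg M.zero_ract flip: M.ract_add_left)
      then show "\<ominus>\<^bsub>M\<^esub> \<psi> (i + d) (b \<otimes>\<^bsub>B\<^esub> \<phi> i d a) = ract M (\<ominus>\<^bsub>M\<^esub> \<psi> i b) a"
        unfolding compatible_mapsD(4)[OF \<psi> b a] using V_carrier[OF \<psi>, of i b] ac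
        by (intro M.minus_equality) (simp_all add: M.ract_in)
    qed (simp_all add: compatible_mapsD(1,2)[OF \<psi>] M.H_minus)
    ultimately show "\<ominus>\<^bsub>W\<^esub> \<psi> \<in> ?V K" by simp
  qed
  let ?act = "\<lambda>K L \<psi> c i b. if b \<in> hpart B (J i - (K + L)) then \<psi> i (c \<otimes>\<^bsub>B\<^esub> b) else \<zero>\<^bsub>M\<^esub>"
  have cb: "c \<otimes>\<^bsub>B\<^esub> b \<in> hpart B (J i - K)" if "c \<in> hpart B L" "b \<in> hpart B (J i - (K + L))" for c b i K L
    using B.hpart_mult[OF that] by (simp add: algebra_simps)
  obtain T where T: "graded_module B (direct_sum W ?V T)"
    "\<And>m c K L. m \<in> carrier (direct_sum W ?V T) \<Longrightarrow> c \<in> hpart B L \<Longrightarrow> T m c (K + L) = ?act K L (m K) c"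
  proof (rule B.direct_sum_module[where act = ?act, OF W sub])
    fix K L \<psi> c assume "\<psi> \<in> ?V K" "c \<in> hpart B L"
    then show "?act K L \<psi> c \<in> ?V (K + L)" by (rule compatible_maps_mult[OF M])
  next
    fix K L \<psi> \<chi> c
    show "?act K L (\<psi> \<oplus>\<^bsub>W\<^esub> \<chi>) c = ?act K L \<psi> c \<oplus>\<^bsub>W\<^esub> ?act K L \<chi> c"
      by (auto simp: W_def fun_eq_iff)
  next
    fix K L \<psi> c c' assume \<psi>: "\<psi> \<in> ?V K" and c: "c \<in> hpart B L" "c' \<in> hpart B L"
    have "\<psi> i ((c \<oplus>\<^bsub>B\<^esub> c') \<otimes>\<^bsub>B\<^esub> b) = \<psi> i (c \<otimes>\<^bsub>B\<^esub> b) \<oplus>\<^bsub>M\<^esub> \<psi> i (c' \<otimes>\<^bsub>B\<^esub> b)"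
      if b: "b \<in> hpart B (J i - (K + L))" for i b
      using compatible_mapsD(3)[OF \<psi> cb[OF c(1) b] cb[OF c(2) b]]
        B.l_distr[OF c[THEN B.hpart_carrier] b[THEN B.hpart_carrier]] by simp
    then show "?act K L \<psi> (c \<oplus>\<^bsub>B\<^esub> c') = ?act K L \<psi> c \<oplus>\<^bsub>W\<^esub> ?act K L \<psi> c'"
      by (auto simp: W_def fun_eq_iff)
  next
    fix K L L' \<psi> c c' assume \<psi>: "\<psi> \<in> ?V K" and c: "c \<in> hpart B L" "c' \<in> hpart B L'"
    have "\<psi> i ((c \<otimes>\<^bsub>B\<^esub> c') \<otimes>\<^bsub>B\<^esub> b) = \<psi> i (c \<otimes>\<^bsub>B\<^esub> (c' \<otimes>\<^bsub>B\<^esub> b))"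
      "c' \<otimes>\<^bsub>B\<^esub> b \<in> hpart B (J i - (K + L))"
      if b: "b \<in> hpart B (J i - (K + L + L'))" for i b
      using cb[OF c(2), of b i "K + L"] b
        B.m_assoc[OF c[THEN B.hpart_carrier] b[THEN B.hpart_carrier]] by simp_all
    then show "?act K (L + L') \<psi> (c \<otimes>\<^bsub>B\<^esub> c') = ?act (K + L) L' (?act K L \<psi> c) c'"
      by (auto simp: fun_eq_iff add.assoc)
  next
    fix K \<psi> assume \<psi>: "\<psi> \<in> ?V K"
    then show "?act K 0 \<psi> \<one>\<^bsub>B\<^esub> = \<psi>"
      by (auto simp: fun_eq_iff B.hpart_carrier compatible_mapsD(1)[OF \<psi>])
  qed (rule that)
  let ?N = "direct_sum W ?V T" and ?\<theta> = "\<lambda>i n. n (J i) i \<one>\<^bsub>B\<^esub>"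
  interpret N: graded_module B ?N by (rule T)
  have hc: "n \<in> hcomp ?N K \<longleftrightarrow> n K \<in> ?V K \<and> (\<forall>L. L \<noteq> K \<longrightarrow> n L = \<zero>\<^bsub>W\<^esub>)" for n K
    by (simp add: direct_sum_def)
  have "matching ?N M ?\<theta>"
    unfolding matching_def
  proof (intro conjI allI ballI M T(1))
    fix i
    have "bij_betw (\<lambda>n. n (J i)) (hcomp ?N (J i)) (?V (J i))"
    proof (rule bij_betwI[of _ _ _ "\<lambda>\<psi> K. if K = J i then \<psi> else \<zero>\<^bsub>W\<^esub>"])
      fix n assume "n \<in> hcomp ?N (J i)"
      then show "(\<lambda>K. if K = J i then n (J i) else \<zero>\<^bsub>W\<^esub>) = n" by (auto simp: hc fun_eq_iff)
    qed (auto simp: hc)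
    from bij_betw_trans[OF this compatible_maps_J_bij[OF M]]
    show "bij_betw (?\<theta> i) (hcomp ?N (J i)) (hcomp M i)" by (simp add: comp_def)
    fix n n'
    show "?\<theta> i (n \<oplus>\<^bsub>?N\<^esub> n') = ?\<theta> i n \<oplus>\<^bsub>M\<^esub> ?\<theta> i n'" by (simp add: direct_sum_def W_def)
  next
    fix i d n a assume n: "n \<in> hcomp ?N (J i)" and a: "a \<in> hpart A d"
    have \<psi>: "n (J i) \<in> ?V (J i)" using n by (simp add: hc)
    have J: "J i + (J (i + d) - J i) = J (i + d)" by simp
    have "ract ?N n (\<phi> i d a) (J i + (J (i + d) - J i)) = ?act (J i) (J (i + d) - J i) (n (J i)) (\<phi> i d a)"
      using T(2)[OF N.H_carrier[OF n] \<phi>_in[OF a, of i], of "J i"] by (simp add: direct_sum_def)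
    then have "?\<theta> (i + d) (ract ?N n (\<phi> i d a)) = n (J i) (i + d) (\<phi> i d a)"
      using B.hpart_one B.hpart_carrier[OF \<phi>_in[OF a, of i]] by (simp add: J)
    also have "\<dots> = n (J i) (i + d) (\<one>\<^bsub>B\<^esub> \<otimes>\<^bsub>B\<^esub> \<phi> i d a)"
      using B.hpart_carrier[OF \<phi>_in[OF a, of i]] by simp
    also have "\<dots> = ract M (?\<theta> i n) a"
      using B.hpart_one by (intro compatible_mapsD(4)[OF \<psi> _ a]) simp
    finally show "?\<theta> (i + d) (ract ?N n (\<phi> i d a)) = ract M (?\<theta> i n) a" .
  qed
  then show thesis by (rule that)
qed


lemma matching_transport_right:
  fixes e :: "'u \<Rightarrow> 'w"
  assumes NM: "matching N M \<theta>" and e: "inj_on e (carrier M)"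
  obtains M' :: "('a, 'd, 'w) gmodule" where "matching N M' (\<lambda>i n. e (\<theta> i n))"
proof -
  interpret M: graded_module A M by (rule matching_modules[OF NM])
  obtain M' :: "('a, 'd, 'w) gmodule" where M': "graded_module A M'"
    "carrier M' = e ` carrier M" "\<And>g. hcomp M' g = e ` hcomp M g"
    "\<And>m n. m \<in> carrier M \<Longrightarrow> n \<in> carrier M \<Longrightarrow> e (m \<oplus>\<^bsub>M\<^esub> n) = e m \<oplus>\<^bsub>M'\<^esub> e n"
    "\<And>m r. m \<in> carrier M \<Longrightarrow> r \<in> carrier A \<Longrightarrow> e (ract M m r) = ract M' (e m) r"
    by (rule M.transport[OF e A.abelian_group_axioms]) (rule that)
  have "matching N M' (\<lambda>i n. e (\<theta> i n))"
    unfolding matching_def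
  proof (intro conjI allI ballI M'(1) matching_modules(1)[OF NM])
    fix i
    have "inj_on e (hcomp M i)" by (rule inj_on_subset[OF e]) (auto intro: M.H_carrier)
    then have "bij_betw e (hcomp M i) (hcomp M' i)" by (simp add: bij_betw_def M'(3))
    from bij_betw_trans[OF \<theta>_bij[OF NM] this]
    show "bij_betw (\<lambda>n. e (\<theta> i n)) (hcomp N (J i)) (hcomp M' i)" by (simp add: comp_def)
    fix n n' assume n: "n \<in> hcomp N (J i)" "n' \<in> hcomp N (J i)"
    show "e (\<theta> i (n \<oplus>\<^bsub>N\<^esub> n')) = e (\<theta> i n) \<oplus>\<^bsub>M'\<^esub> e (\<theta> i n')"
      using M'(4)[OF \<theta>_in[OF NM n(1), THEN M.H_carrier] \<theta>_in[OF NM n(2), THEN M.H_carrier]]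
      by (simp add: \<theta>_add[OF NM n])
  next
    fix i d n a assume n: "n \<in> hcomp N (J i)" and a: "a \<in> hpart A d"
    show "e (\<theta> (i + d) (ract N n (\<phi> i d a))) = ract M' (e (\<theta> i n)) a"
      using M'(5)[OF \<theta>_in[OF NM n, THEN M.H_carrier] A.hpart_carrier[OF a]]
      by (simp add: \<theta>_act[OF NM n a])
  qed
  then show thesis by (rule that)
qed

lemma matching_transport_left:
  fixes e :: "'v \<Rightarrow> 'w"
  assumes NM: "matching N M \<theta>" and e: "inj_on e (carrier N)"
  obtains N' :: "('b, 'g, 'w) gmodule" and \<theta>' where "matching N' M \<theta>'"
proof -
  interpret N: graded_module B N by (rule matching_modules[OF NM])
  obtain N' :: "('b, 'g, 'w) gmodule" where N': "graded_module B N'"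
    "carrier N' = e ` carrier N" "\<And>g. hcomp N' g = e ` hcomp N g"
    "\<And>m n. m \<in> carrier N \<Longrightarrow> n \<in> carrier N \<Longrightarrow> e (m \<oplus>\<^bsub>N\<^esub> n) = e m \<oplus>\<^bsub>N'\<^esub> e n"
    "\<And>m r. m \<in> carrier N \<Longrightarrow> r \<in> carrier B \<Longrightarrow> e (ract N m r) = ract N' (e m) r"
    by (rule N.transport[OF e B.abelian_group_axioms]) (rule that)
  define d where "d = the_inv_into (carrier N) e"
  have d: "d (e n) = n" if "n \<in> carrier N" for n unfolding d_def using e that by (rule the_inv_into_f_f)
  have "matching N' M (\<lambda>i x. \<theta> i (d x))"
    unfolding matching_def
  proof (intro conjI allI ballI N'(1) matching_modules(2)[OF NM])
    fix i
    have "bij_betw d (hcomp N' (J i)) (hcomp N (J i))"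
      by (rule bij_betwI[of _ _ _ e]) (auto simp: N'(3) d N.H_carrier)
    from bij_betw_trans[OF this \<theta>_bij[OF NM]]
    show "bij_betw (\<lambda>x. \<theta> i (d x)) (hcomp N' (J i)) (hcomp M i)" by (simp add: comp_def)
    fix x x' assume "x \<in> hcomp N' (J i)" "x' \<in> hcomp N' (J i)"
    then obtain n n' where n: "n \<in> hcomp N (J i)" "n' \<in> hcomp N (J i)" "x = e n" "x' = e n'"
      by (auto simp: N'(3))
    have "x \<oplus>\<^bsub>N'\<^esub> x' = e (n \<oplus>\<^bsub>N\<^esub> n')" using n N'(4)[OF n(1,2)[THEN N.H_carrier]] by simp
    then show "\<theta> i (d (x \<oplus>\<^bsub>N'\<^esub> x')) = \<theta> i (d x) \<oplus>\<^bsub>M\<^esub> \<theta> i (d x')"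
      using n N.H_carrier[OF n(1)] N.H_carrier[OF n(2)] by (simp add: d \<theta>_add[OF NM n(1,2)])
  next
    fix i k x a assume "x \<in> hcomp N' (J i)" and a: "a \<in> hpart A k"
    then obtain n where n: "n \<in> hcomp N (J i)" "x = e n" by (auto simp: N'(3))
    note nc = N.H_carrier[OF n(1)] and bc = B.hpart_carrier[OF \<phi>_in[OF a, of i]]
    have "ract N' x (\<phi> i k a) = e (ract N n (\<phi> i k a))" using N'(5)[OF nc bc] n(2) by simp
    then show "\<theta> (i + k) (d (ract N' x (\<phi> i k a))) = ract M (\<theta> i (d x)) a"
      using n(2) nc N.ract_in[OF nc bc] by (simp add: d \<theta>_act[OF NM n(1) a])
  qed
  then show thesis by (rule that)
qed

text \<open>The span consists of the matching triples. Both legs are surjective on objects, since a partner of a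
  given module exists in some type, is finitely generated, hence is not larger than \<open>K\<close>, and can be moved into
  the type in question.\<close>

theorem gr_cat_equivalence:
  fixes U :: "'u set" and V :: "'v set"
  assumes K: "infinite K" and A: "carrier A \<lesssim> K" and B: "carrier B \<lesssim> K"
    and U: "K \<lesssim> U" and V: "K \<lesssim> V"
  shows "linearly_equivalent
    (gr_cat A :: (('a, 'd, 'u) gmodule, 'u \<Rightarrow> 'u, 'k) lincat)
    (gr_cat B :: (('b, 'g, 'v) gmodule, 'v \<Rightarrow> 'v, 'k) lincat)"
proof -
  let ?C = "gr_cat A :: (('a, 'd, 'u) gmodule, 'u \<Rightarrow> 'u, 'k) lincat"
  let ?D = "gr_cat B :: (('b, 'g, 'v) gmodule, 'v \<Rightarrow> 'v, 'k) lincat"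
  define T where "T = {(M :: ('a, 'd, 'u) gmodule, N :: ('b, 'g, 'v) gmodule, \<theta>).
    matching N M \<theta> \<and> fin_generated A M \<and> fin_generated B N}"
  define corr where "corr = (\<lambda>(M :: ('a, 'd, 'u) gmodule, N :: ('b, 'g, 'v) gmodule, \<theta>)
      (M' :: ('a, 'd, 'u) gmodule, N' :: ('b, 'g, 'v) gmodule, \<theta>') (g :: 'u \<Rightarrow> 'u) (f :: 'v \<Rightarrow> 'v).
      \<forall>i. \<forall>n\<in>hcomp N (J i). g (\<theta> i n) = \<theta>' i (f n))"
  have T_mem: "(M, N, \<theta>) \<in> T \<longleftrightarrow> matching N M \<theta> \<and> fin_generated A M \<and> fin_generated B N" for M N \<theta>
    by (simp add: T_def)
  have Ob: "M \<in> Ob ?C \<longleftrightarrow> graded_module A M \<and> fin_generated A M" "N \<in> Ob ?D \<longleftrightarrow> graded_module B N \<and> fin_generated B N" for M N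
    by (simp_all add: gr_cat_def)
  note cat = gr_cat_def
  interpret C: linear_category ?C by (rule A.gr_cat_linear)
  interpret D: linear_category ?D by (rule B.gr_cat_linear)
  have total_right: "\<exists>N \<theta>. (M, N, \<theta>) \<in> T" if M: "M \<in> Ob ?C" for M
  proof -
    obtain N0 :: "('b, 'g, 'g \<Rightarrow> 'd \<Rightarrow> 'b \<Rightarrow> 'u) gmodule" and \<theta>0 where N0: "matching N0 M \<theta>0"
      using matching_left_exists[of M] M by (auto simp: Ob)
    have fg: "fin_generated B N0" using matching_fin_generated_left[OF N0] M by (simp add: Ob)
    have "carrier N0 \<lesssim> V"
      using graded_module.fin_generated_lepoll[OF matching_modules(1)[OF N0] K B fg] V by (rule lepoll_trans)
    then obtain e :: "('g \<Rightarrow> 'd \<Rightarrow> 'b \<Rightarrow> 'u) \<Rightarrow> 'v" where "inj_on e (carrier N0)" unfolding lepoll_def by (elim exE conjE) (rule that)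
    then obtain N :: "('b, 'g, 'v) gmodule" and \<theta> where N: "matching N M \<theta>"
      by (rule matching_transport_left[OF N0])
    then have "(M, N, \<theta>) \<in> T" using matching_fin_generated_left[OF N] M by (simp add: T_mem Ob)
    then show ?thesis by blast
  qed
  have total_left: "\<exists>M \<theta>. (M, N, \<theta>) \<in> T" if N: "N \<in> Ob ?D" for N
  proof -
    obtain M0 :: "('a, 'd, 'd \<Rightarrow> 'v) gmodule" and \<theta>0 where M0: "matching N M0 \<theta>0"
      using matching_right_exists[of N] N by (auto simp: Ob)
    have fg: "fin_generated A M0" using matching_fin_generated_right[OF M0] N by (simp add: Ob)
    have "carrier M0 \<lesssim> U"
      using graded_module.fin_generated_lepoll[OF matching_modules(2)[OF M0] K A fg] U by (rule lepoll_trans)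
    then obtain e :: "('d \<Rightarrow> 'v) \<Rightarrow> 'u" where "inj_on e (carrier M0)" unfolding lepoll_def by (elim exE conjE) (rule that)
    then obtain M :: "('a, 'd, 'u) gmodule" where M: "matching N M (\<lambda>i n. e (\<theta>0 i n))"
      by (rule matching_transport_right[OF M0])
    then have "(M, N, \<lambda>i n. e (\<theta>0 i n)) \<in> T" using matching_fin_generated_right[OF M] N by (simp add: T_mem Ob)
    then show ?thesis by blast
  qed
  have "category_span ?C ?D T fst (\<lambda>t. fst (snd t)) corr"
  proof (intro category_span.intro category_span_axioms.intro C.linear_category_axioms D.linear_category_axioms,
      goal_cases)
    case 1
    have "M \<in> Ob ?C" if "(M, N, \<theta>) \<in> T" for M N \<theta>
      using that matching_modules(2)[of N M \<theta>] by (simp add: T_mem Ob)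
    then show ?case using total_right by (force simp: image_iff)
  next
    case 2
    have "N \<in> Ob ?D" if "(M, N, \<theta>) \<in> T" for M N \<theta>
      using that matching_modules(1)[of N M \<theta>] by (simp add: T_mem Ob)
    then show ?case using total_left by (force simp: image_iff)
  next
    case (3 t t' g)
    obtain M N \<theta> M' N' \<theta>' where t: "t = (M, N, \<theta>)" "t' = (M', N', \<theta>')" by (cases t, cases t')
    show ?case
      using matching_hom_ex1_left[of N M \<theta> N' M' \<theta>' g] 3 by (simp add: t T_mem cat corr_def)
  next
    case (4 t t' f)
    obtain M N \<theta> M' N' \<theta>' where t: "t = (M, N, \<theta>)" "t' = (M', N', \<theta>')" by (cases t, cases t')
    show ?case
      using matching_hom_ex1_right[of N M \<theta> N' M' \<theta>' f] 4 by (simp add: t T_mem cat corr_def)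
  next
    case (5 t)
    obtain M N \<theta> where t: "t = (M, N, \<theta>)" by (cases t)
    then have NM: "matching N M \<theta>" using 5 by (simp add: T_mem)
    interpret N: graded_module B N by (rule matching_modules[OF NM])
    interpret M: graded_module A M by (rule matching_modules[OF NM])
    show ?case
      using \<theta>_in[OF NM, THEN M.H_carrier] N.H_carrier by (auto simp: t cat corr_def)
  next
    case (6 t t' t'' g f g' f')
    obtain M N \<theta> M' N' \<theta>' M'' N'' \<theta>'' where t: "t = (M, N, \<theta>)" "t' = (M', N', \<theta>')" "t'' = (M'', N'', \<theta>'')"
      by (cases t, cases t', cases t'')
    then have NM: "matching N M \<theta>" using 6 by (simp add: T_mem)
    interpret N: graded_module B N by (rule matching_modules[OF NM])
    interpret M: graded_module A M by (rule matching_modules[OF NM])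
    have f: "f \<in> ghom B N N'" using 6 by (simp add: t cat)
    show ?case
      using 6(8,9) \<theta>_in[OF NM, THEN M.H_carrier] N.H_carrier ghom_hcomp[OF f]
      by (auto simp: t cat corr_def compose_def)
  next
    case (7 t t' g f g' f')
    obtain M N \<theta> M' N' \<theta>' where t: "t = (M, N, \<theta>)" "t' = (M', N', \<theta>')" by (cases t, cases t')
    then have NM: "matching N M \<theta>" and NM': "matching N' M' \<theta>'" using 7 by (simp_all add: T_mem)
    interpret N: graded_module B N by (rule matching_modules[OF NM])
    interpret M: graded_module A M by (rule matching_modules[OF NM])
    have f: "f \<in> ghom B N N'" "f' \<in> ghom B N N'" using 7 by (simp_all add: t cat)
    show ?case
      using 7(7,8) \<theta>_in[OF NM, THEN M.H_carrier] N.H_carrier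
        \<theta>_add[OF NM' ghom_hcomp[OF f(1)] ghom_hcomp[OF f(2)]]
      by (auto simp: t cat corr_def)
  next
    case (8 t t' g f c)
    obtain M N \<theta> M' N' \<theta>' where t: "t = (M, N, \<theta>)" "t' = (M', N', \<theta>')" by (cases t, cases t')
    then have NM: "matching N M \<theta>" and NM': "matching N' M' \<theta>'" using 8 by (simp_all add: T_mem)
    interpret N: graded_module B N by (rule matching_modules[OF NM])
    interpret M: graded_module A M by (rule matching_modules[OF NM])
    have f: "f \<in> ghom B N N'" using 8 by (simp_all add: t cat)
    have "\<theta>' i (ract N' n (scal B c)) = ract M' (\<theta>' i n) (scal A c)" if "n \<in> hcomp N' (J i)" for i n
      using \<theta>_act[OF NM' that A.scal_in[of c]] by (simp add: \<phi>_scal)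
    then show ?case
      using 8(5) \<theta>_in[OF NM, THEN M.H_carrier] N.H_carrier ghom_hcomp[OF f]
      by (auto simp: t cat corr_def)
  qed
  then show ?thesis by (rule category_span.linearly_equivalent)
qed

end

section \<open>Normal forms in the generalized Weyl algebra\<close>

lemma gwa_const_add: "gwa_const (p + q) = gwa_const p + gwa_const q"
  by transfer (rule gr_const_add)

lemma gwa_const_mult: "gwa_const (p * q) = gwa_const p * gwa_const q"
  by transfer (rule gr_const_mul)

lemma gwa_const_0 [simp]: "gwa_const 0 = 0"
  by (simp add: gwa_const_def zero_gwa_def)

lemma gwa_const_1 [simp]: "gwa_const 1 = 1"
  by (simp add: gwa_const_def one_gwa_def)

lemma gwa_const_minus: "gwa_const (- p) = - gwa_const p"
  using gwa_const_add[of p "- p"] by (simp add: eq_neg_iff_add_eq_0 add.commute)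

lemma gwa_const_scalar_commute: "gwa_const [:c:] * a = a * gwa_const [:c:]"
  by transfer (rule gr_scalar_central)

definition lin :: "int \<Rightarrow> 'k::field poly" where "lin j = [:of_int j, 1:]"

definition pshift :: "int \<Rightarrow> 'k::field poly \<Rightarrow> 'k poly" where "pshift i p = pcompose p (lin i)"

lemma pshift_simps [simp]:
  "pshift i (p + q) = pshift i p + pshift i q" "pshift i (p * q) = pshift i p * pshift i q"
  "pshift i 0 = 0" "pshift i 1 = 1" "pshift i (- p) = - pshift i p" "pshift i (p - q) = pshift i p - pshift i q"
  "pshift i [:c:] = [:c:]" "pshift i (lin j) = lin (i + j)" "pshift 0 p = p"
  by (simp_all add: pshift_def lin_def pcompose_add pcompose_mult pcompose_1 pcompose_uminus
      pcompose_diff pcompose_pCons add_ac)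

lemma pshift_power [simp]: "pshift i (p ^ n) = pshift i p ^ n"
  by (induction n) simp_all

lemma pshift_pshift [simp]: "pshift i (pshift j p) = pshift (i + j) p"
proof -
  have "pcompose (lin j) (lin i) = (lin (i + j) :: 'a poly)"
    using pshift_simps(8)[of i j] by (simp add: pshift_def)
  then show ?thesis by (simp add: pshift_def pcompose_assoc flip: pcompose_assoc)
qed

lemma pshift_eq_0_iff [simp]: "pshift i p = 0 \<longleftrightarrow> p = 0"
  by (metis pshift_pshift pshift_simps(3,9) add.left_inverse)

lemma lin_neq_0 [simp]: "lin j \<noteq> 0" by (simp add: lin_def)

lemma gwa_x_const: "gwa_x * gwa_const p = gwa_const (pshift 1 p) * gwa_x"
proof (induction p)
  case (pCons c p)
  have z: "gwa_x * gwa_const [:0, 1:] = gwa_const (lin 1) * (gwa_x :: 'a gwa)"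
    unfolding lin_def by transfer (use gr_xz in \<open>simp add: one_pCons\<close>)
  have "pCons c p = [:c:] + [:0, 1:] * p" by simp
  then have "gwa_x * gwa_const (pCons c p) = gwa_const [:c:] * gwa_x + gwa_const (lin 1) * gwa_const (pshift 1 p) * gwa_x"
    by (simp only: gwa_const_add gwa_const_mult distrib_left gwa_const_scalar_commute pCons.IH z
          mult.assoc flip: mult.assoc[of gwa_x "gwa_const [:0, 1:]"])
  moreover have "pshift 1 (pCons c p) = [:c:] + lin 1 * pshift 1 p"
    by (simp add: pshift_def lin_def pcompose_pCons)
  ultimately show ?case by (simp add: gwa_const_add gwa_const_mult distrib_right)
qed simp

lemma gwa_y_const: "gwa_y * gwa_const p = gwa_const (pshift (- 1) p) * gwa_y"
proof (induction p)
  case (pCons c p)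
  have z: "gwa_y * gwa_const [:0, 1:] = gwa_const (lin (- 1)) * (gwa_y :: 'a gwa)"
    unfolding lin_def by transfer (use gr_yz in \<open>simp add: one_pCons\<close>)
  have "pCons c p = [:c:] + [:0, 1:] * p" by simp
  then have "gwa_y * gwa_const (pCons c p) = gwa_const [:c:] * gwa_y + gwa_const (lin (- 1)) * gwa_const (pshift (- 1) p) * gwa_y"
    by (simp only: gwa_const_add gwa_const_mult distrib_left gwa_const_scalar_commute pCons.IH z
          mult.assoc flip: mult.assoc[of gwa_y "gwa_const [:0, 1:]"])
  moreover have "pshift (- 1) (pCons c p) = [:c:] + lin (- 1) * pshift (- 1) p"
    by (simp add: pshift_def lin_def pcompose_pCons)
  ultimately show ?case by (simp add: gwa_const_add gwa_const_mult distrib_right)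
qed simp

lemma gwa_xy: "gwa_x * gwa_y = gwa_const (lin 0 ^ 2)"
  unfolding lin_def by transfer (use gr_xy in simp)

lemma gwa_yx: "gwa_y * gwa_x = gwa_const (lin (- 1) ^ 2)"
  unfolding lin_def by transfer (use gr_yx in \<open>simp add: one_pCons\<close>)

lemma gwa_x_power_const: "gwa_x ^ n * gwa_const p = gwa_const (pshift (int n) p) * gwa_x ^ n"
proof (induction n arbitrary: p)
  case (Suc n)
  have "gwa_x ^ Suc n * gwa_const p = gwa_x ^ n * gwa_const (pshift 1 p) * gwa_x"
    by (simp only: power_Suc2 mult.assoc gwa_x_const)
  also have "\<dots> = gwa_const (pshift (int (Suc n)) p) * gwa_x ^ Suc n"
    by (simp add: Suc power_Suc2 mult.assoc add.commute del: power_Suc)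
  finally show ?case .
qed simp

lemma gwa_y_power_const: "gwa_y ^ n * gwa_const p = gwa_const (pshift (- int n) p) * gwa_y ^ n"
proof (induction n arbitrary: p)
  case (Suc n)
  have "gwa_y ^ Suc n * gwa_const p = gwa_y ^ n * gwa_const (pshift (- 1) p) * gwa_y"
    by (simp only: power_Suc2 mult.assoc gwa_y_const)
  also have "\<dots> = gwa_const (pshift (- int (Suc n)) p) * gwa_y ^ Suc n"
    by (simp add: Suc power_Suc2 mult.assoc algebra_simps del: power_Suc)
  finally show ?case .
qed simp

text \<open>The typical homogeneous element of degree \<open>i\<close>, with its coefficient on the left as in the quotient ring.\<close>

definition gwa_mon :: "int \<Rightarrow> 'k::field poly \<Rightarrow> 'k gwa" where
  "gwa_mon i p = gwa_const p * (if i \<ge> 0 then gwa_x ^ nat i else gwa_y ^ nat (- i))"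

lemma gwa_mon_add: "gwa_mon i (p + q) = gwa_mon i p + gwa_mon i q"
  by (simp add: gwa_mon_def gwa_const_add distrib_right)

lemma gwa_mon_0 [simp]: "gwa_mon i 0 = 0"
  by (simp add: gwa_mon_def)

lemma gwa_mon_const: "gwa_mon i p * gwa_const q = gwa_mon i (p * pshift i q)"
  by (auto simp: gwa_mon_def mult.assoc gwa_x_power_const gwa_y_power_const gwa_const_mult)

lemma gwa_mon_x: "\<exists>r. gwa_mon i p * gwa_x = gwa_mon (i + 1) r"
proof (cases "i \<ge> 0")
  case True
  then have "gwa_mon i p * gwa_x = gwa_mon (i + 1) p"
    by (simp add: gwa_mon_def nat_add_distrib mult.assoc flip: power_Suc2)
  then show ?thesis ..
next
  case False
  define m where "m = nat (- i - 1)"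
  have i: "i = - int (Suc m)" and nat: "nat (- i) = Suc m" using False by (auto simp: m_def)
  have "gwa_mon i p * gwa_x = gwa_const p * (gwa_y ^ m * (gwa_y * gwa_x))"
    using False by (simp add: gwa_mon_def nat power_Suc2 mult.assoc del: power_Suc)
  also have "\<dots> = gwa_const (p * pshift (- int m) (lin (- 1) ^ 2)) * gwa_y ^ m"
    by (simp only: gwa_yx gwa_y_power_const gwa_const_mult mult.assoc)
  also have "\<dots> = gwa_mon (i + 1) (p * pshift (- int m) (lin (- 1) ^ 2))"
    unfolding i by (cases m) (simp_all add: gwa_mon_def nat_add_distrib)
  finally show ?thesis ..
qed

lemma gwa_mon_y: "\<exists>r. gwa_mon i p * gwa_y = gwa_mon (i - 1) r"
proof (cases "i \<ge> 1")
  case False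
  then have "nat (- (i - 1)) = Suc (nat (- i))" by simp
  then have "gwa_mon i p * gwa_y = gwa_mon (i - 1) p"
    using False by (cases "i = 0") (simp_all add: gwa_mon_def mult.assoc del: power_Suc flip: power_Suc2)
  then show ?thesis ..
next
  case True
  define m where "m = nat (i - 1)"
  have i: "i = int (Suc m)" and nat: "nat i = Suc m" using True by (auto simp: m_def)
  have "gwa_mon i p * gwa_y = gwa_const p * (gwa_x ^ m * (gwa_x * gwa_y))"
    using True by (simp add: gwa_mon_def nat power_Suc2 mult.assoc del: power_Suc)
  also have "\<dots> = gwa_const (p * pshift (int m) (lin 0 ^ 2)) * gwa_x ^ m"
    by (simp only: gwa_xy gwa_x_power_const gwa_const_mult mult.assoc)
  also have "\<dots> = gwa_mon (i - 1) (p * pshift (int m) (lin 0 ^ 2))"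
    unfolding i by (simp add: gwa_mon_def)
  finally show ?thesis ..
qed

text \<open>Multiplying a normal form by a generator gives a normal form; induction over the grading extends
  this to all homogeneous factors. With \<open>1\<close> as the left factor it shows that all homogeneous elements are
  normal forms.\<close>

lemma gwa_mon_homogeneous_mult: "gwa_homogeneous j b \<Longrightarrow> \<exists>r. gwa_mon i p * b = gwa_mon (i + j) r"
proof (induction arbitrary: i p rule: gwa_homogeneous.induct)
  case (1 q) then show ?case using gwa_mon_const[of i p q] by auto
next
  case 2 then show ?case by (rule gwa_mon_x)
next
  case 3 then show ?case using gwa_mon_y[of i p] by simp
next
  case (4 j a b)
  then obtain r s where "gwa_mon i p * a = gwa_mon (i + j) r" "gwa_mon i p * b = gwa_mon (i + j) s" by blast
  then show ?case by (auto simp: distrib_left simp flip: gwa_mon_add)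
next
  case (5 j a k b)
  then obtain r where r: "gwa_mon i p * a = gwa_mon (i + j) r" by blast
  obtain s where "gwa_mon (i + j) r * b = gwa_mon (i + j + k) s" using 5 by blast
  then show ?case using r by (auto simp: add.assoc simp flip: mult.assoc)
qed

lemma gwa_homogeneous_mon: "gwa_homogeneous i (gwa_mon i p)"
proof -
  have x: "gwa_homogeneous (int n) (gwa_const p * gwa_x ^ n)" for n
  proof (induction n)
    case (Suc n)
    from gwa_homogeneous.intros(5)[OF this gwa_homogeneous.intros(2)]
    show ?case by (simp add: mult.assoc power_Suc2 add.commute del: power_Suc)
  qed (simp add: gwa_homogeneous.intros(1))
  have y: "gwa_homogeneous (- int n) (gwa_const p * gwa_y ^ n)" for n
  proof (induction n)
    case (Suc n)
    from gwa_homogeneous.intros(5)[OF this gwa_homogeneous.intros(3)]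
    show ?case by (simp add: mult.assoc power_Suc2 algebra_simps del: power_Suc)
  qed (simp add: gwa_homogeneous.intros(1))
  show ?thesis using x[of "nat i"] y[of "nat (- i)"] by (auto simp: gwa_mon_def)
qed

lemma gwa_homogeneous_iff: "gwa_homogeneous i a \<longleftrightarrow> (\<exists>p. a = gwa_mon i p)"
proof
  assume "gwa_homogeneous i a"
  from gwa_mon_homogeneous_mult[OF this, of 0 1] show "\<exists>p. a = gwa_mon i p"
    by (simp add: gwa_mon_def[of 0])
qed (auto intro: gwa_homogeneous_mon)

lemma gwa_normal_form:
  obtains S p where "finite S" "\<And>i. i \<notin> S \<Longrightarrow> p i = 0" "a = (\<Sum>i\<in>S. gwa_mon i (p i))"
proof -
  define N where "N a \<longleftrightarrow> (\<exists>S p. finite S \<and> (\<forall>i. i \<notin> S \<longrightarrow> p i = 0) \<and> a = (\<Sum>i\<in>S. gwa_mon i (p i)))"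
    for a :: "'a gwa"
  have mon: "N (gwa_mon i p)" for i p
    unfolding N_def by (intro exI[of _ "{i}"] exI[of _ "\<lambda>j. if j = i then p else 0"]) auto
  have add: "N (a + b)" if "N a" "N b" for a b
  proof -
    from that obtain S p T q where S: "finite S" "\<forall>i. i \<notin> S \<longrightarrow> p i = 0" "a = (\<Sum>i\<in>S. gwa_mon i (p i))"
      and T: "finite T" "\<forall>i. i \<notin> T \<longrightarrow> q i = 0" "b = (\<Sum>i\<in>T. gwa_mon i (q i))" unfolding N_def by blast
    have "a = (\<Sum>i\<in>S \<union> T. gwa_mon i (p i))" "b = (\<Sum>i\<in>S \<union> T. gwa_mon i (q i))"
      unfolding S(3) T(3) using S T by (auto intro!: sum.mono_neutral_left)
    then have "a + b = (\<Sum>i\<in>S \<union> T. gwa_mon i (p i + q i))" by (simp add: gwa_mon_add sum.distrib)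
    then show ?thesis unfolding N_def using S T
      by (intro exI[of _ "S \<union> T"] exI[of _ "\<lambda>i. p i + q i"]) auto
  qed
  have sum: "N (\<Sum>i\<in>S. f i)" if "\<And>i. i \<in> S \<Longrightarrow> N (f i)" "finite S" for f :: "int \<Rightarrow> 'a gwa" and S
    using that(2,1) mon[of 0 0] by (induction S) (auto intro: add)
  have mult_hom: "N (a * b)" if "N a" "gwa_homogeneous j b" for a b j
  proof -
    from that(1) obtain S p where S: "finite S" "a = (\<Sum>i\<in>S. gwa_mon i (p i))" unfolding N_def by blast
    have "N (gwa_mon i (p i) * b)" for i
      using gwa_mon_homogeneous_mult[OF that(2), of i "p i"] mon by auto
    then show ?thesis unfolding S(2) sum_distrib_right using S(1) by (intro sum)
  qed
  have mult: "N (a * b)" if "N a" "N b" for a b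
  proof -
    from that(2) obtain S p where S: "finite S" "b = (\<Sum>i\<in>S. gwa_mon i (p i))" unfolding N_def by blast
    show ?thesis unfolding S(2) sum_distrib_left
      using S(1) by (intro sum mult_hom[OF that(1) gwa_homogeneous_mon])
  qed
  have const: "N (gwa_const p)" for p using mon[of 0 p] by (simp add: gwa_mon_def)
  have "N (abs_gwa e)" for e :: "'a poly gwa_expr"
  proof (induction e)
    case (GConst p) show ?case using const[of p] by (simp add: gwa_const_def)
  next
    case GX show ?case using mon[of 1 1] by (simp add: gwa_mon_def gwa_x_def)
  next
    case GY show ?case using mon[of "- 1" 1] by (simp add: gwa_mon_def gwa_y_def)
  next
    case (GNeg e)
    have "N (gwa_const (- 1) * abs_gwa e)" by (rule mult[OF const GNeg])
    then show ?case by (simp add: gwa_const_minus uminus_gwa.abs_eq)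
  next
    case (GAdd e f) then show ?case using add by (simp flip: plus_gwa.abs_eq)
  next
    case (GMul e f) then show ?case using mult by (simp flip: times_gwa.abs_eq)
  qed
  then have "N a" by (induction a rule: gwa.abs_induct)
  then show thesis using that unfolding N_def by blast
qed

lemma qcoeff_simps [simp]:
  "qcoeff 0 i = 0" "qcoeff (q + q') i = qcoeff q i + qcoeff q' i" "qcoeff (- q) i = - qcoeff q i"
  by (simp_all add: zero_qgr.rep_eq plus_qgr.rep_eq uminus_qgr.rep_eq)

lemma qcoeff_qmonom: "qcoeff (qmonom n f) i = (if i = n then f else 0)"
  by transfer simp

lemma qcoeff_sum: "qcoeff (\<Sum>s\<in>S. q s) i = (\<Sum>s\<in>S. qcoeff (q s) i)"
  by (induction S rule: infinite_finite_induct) simp_all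

lemma qgr_eqI: "(\<And>i. qcoeff q i = qcoeff q' i) \<Longrightarrow> q = q'"
  by transfer auto

lemma zshift_to_fract: "zshift i (to_fract p) = to_fract (pshift i p)"
  by (simp add: to_fract_def zshift_Fract pcompose_1 pshift_def lin_def)

text \<open>The coefficient of \<open>y\<^sup>-\<^sup>i = (z - 1)\<^sup>2 \<cdots> (z + i)\<^sup>2 x\<^sup>i\<close> for negative \<open>i\<close>. For \<open>i \<ge> 0\<close> the product is
  empty, in accordance with \<open>x\<^sup>i\<close> having coefficient \<open>1\<close>.\<close>

definition acoeff :: "int \<Rightarrow> 'k::field poly" where
  "acoeff i = (\<Prod>j\<in>{i..<0}. lin j ^ 2)"

lemma acoeff_neq_0 [simp]: "acoeff i \<noteq> (0 :: 'k::field poly)"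
  by (simp add: acoeff_def)

lemma gwa_embed_const: "gwa_embed (gwa_const p) = qmonom 0 (to_fract p)"
  by (simp add: to_fract_def) (transfer, simp)

lemma gwa_embed_x: "gwa_embed gwa_x = qmonom 1 1"
  by transfer simp

lemma gwa_embed_y: "gwa_embed gwa_y = qmonom (- 1) (to_fract (lin (- 1) ^ 2))"
  by (simp add: to_fract_def lin_def) (transfer, simp add: one_pCons)

lemma gwa_embed_mon: "gwa_embed (gwa_mon i p) = qmonom i (to_fract (p * acoeff i))"
proof -
  have x: "gwa_embed (gwa_x ^ n) = qmonom (int n) (1 :: 'a poly fract)" for n
    by (induction n) (simp_all add: gwa_embed_one gwa_embed_mult gwa_embed_x qmonom_mult qmonom_one)
  have y: "gwa_embed (gwa_y ^ n) = qmonom (- int n) (to_fract (acoeff (- int n) :: 'a poly))" for n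
  proof (induction n)
    case 0 then show ?case by (simp add: gwa_embed_one qmonom_one acoeff_def)
  next
    case (Suc n)
    have "{- int (Suc n)..<0} = insert (- int (Suc n)) {- int n..<0}" by auto
    then have "acoeff (- int (Suc n)) = lin (- int (Suc n)) ^ 2 * (acoeff (- int n) :: 'a poly)"
      by (simp add: acoeff_def)
    moreover have "gwa_embed (gwa_y ^ Suc n) = qmonom (- int n - 1)
        (to_fract (acoeff (- int n)) * to_fract (lin (- int n - 1) ^ 2) :: 'a poly fract)"
      by (simp add: power_Suc2 gwa_embed_mult Suc gwa_embed_y qmonom_mult zshift_to_fract del: power_Suc)
    moreover have "- int n - 1 = - int (Suc n)" by simp
    ultimately show ?case by (simp only:) (simp add: mult.commute)
  qed
  show ?thesis
    using x[of "nat i"] y[of "nat (- i)"]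
    by (auto simp: gwa_mon_def gwa_embed_mult gwa_embed_const qmonom_mult acoeff_def)
qed

lemma gwa_normal_form_coeff:
  obtains p where "finite {i. p i \<noteq> 0}" "a = (\<Sum>i | p i \<noteq> 0. gwa_mon i (p i))"
    "\<And>i. qcoeff (gwa_embed a) i = to_fract (p i * acoeff i)"
proof -
  obtain S p where S: "finite S" "\<And>i. i \<notin> S \<Longrightarrow> p i = 0" "a = (\<Sum>i\<in>S. gwa_mon i (p i))"
    by (rule gwa_normal_form[of a]) (rule that)
  have fin: "finite {i. p i \<noteq> 0}" using S by (auto intro: finite_subset)
  have a: "a = (\<Sum>i | p i \<noteq> 0. gwa_mon i (p i))" unfolding S(3) using S by (intro sum.mono_neutral_right) auto
  have "gwa_embed (\<Sum>i\<in>T. gwa_mon i (p i)) = (\<Sum>i\<in>T. qmonom i (to_fract (p i * acoeff i)))" for T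
    by (induction T rule: infinite_finite_induct) (simp_all add: gwa_embed_zero gwa_embed_add gwa_embed_mon)
  then have "qcoeff (gwa_embed a) i = to_fract (p i * acoeff i)" for i
    unfolding a using fin by (simp add: qcoeff_sum qcoeff_qmonom)
  from that[OF fin a this] show thesis .
qed

lemma gwa_embed_minus: "gwa_embed (- a) = - gwa_embed a"
  by transfer simp

text \<open>The coefficients of the image determine those of a normal form.\<close>

lemma gwa_embed_inject [simp]: "gwa_embed a = gwa_embed b \<longleftrightarrow> a = b"
proof
  assume eq: "gwa_embed a = gwa_embed b"
  obtain p where p: "a - b = (\<Sum>i | p i \<noteq> 0. gwa_mon i (p i))"
    "\<And>i. qcoeff (gwa_embed (a - b)) i = to_fract (p i * acoeff i)"
    by (rule gwa_normal_form_coeff[of "a - b"]) (rule that)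
  have "gwa_embed (a - b) = 0" using eq gwa_embed_add[of a "- b"] by (simp add: gwa_embed_minus)
  then have "p i = 0" for i using p(2)[of i] by simp
  then have "a - b = 0" using p(1) by simp
  then show "a = b" by simp
qed simp

text \<open>The graded \<open>k[z]\<close>-submodule \<open>\<Sum> p\<^sub>i k[z] x\<^sup>i\<close> of the quotient ring.\<close>

definition qfam :: "(int \<Rightarrow> 'k::field poly fract) \<Rightarrow> 'k qgr set" where
  "qfam p = {q. \<forall>i. \<exists>g. qcoeff q i = p i * to_fract g}"

lemma A_sub_qfam: "A_sub = qfam (\<lambda>i. to_fract (acoeff i))"
proof (intro equalityI subsetI)
  fix q :: "'a qgr" assume "q \<in> A_sub"
  then obtain a where a: "q = gwa_embed a" by (auto simp: A_sub_def)
  obtain p where "\<And>i. qcoeff (gwa_embed a) i = to_fract (p i * acoeff i)" by (rule gwa_normal_form_coeff[of a]) (rule that)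
  then show "q \<in> qfam (\<lambda>i. to_fract (acoeff i))" by (auto simp: a qfam_def mult.commute)
next
  fix q :: "'a qgr" assume "q \<in> qfam (\<lambda>i. to_fract (acoeff i))"
  then obtain g where g: "\<And>i. qcoeff q i = to_fract (acoeff i) * to_fract (g i)" unfolding qfam_def by auto metis
  have "gwa_embed (\<Sum>i\<in>T. gwa_mon i (g i)) = (\<Sum>i\<in>T. qmonom i (to_fract (g i * acoeff i)))" for T
    by (induction T rule: infinite_finite_induct) (simp_all add: gwa_embed_zero gwa_embed_add gwa_embed_mon)
  then have "gwa_embed (\<Sum>i | qcoeff q i \<noteq> 0. gwa_mon i (g i)) = q"
    using finite_qcoeff[of q] by (intro qgr_eqI) (auto simp: qcoeff_sum qcoeff_qmonom g mult.commute)
  then show "q \<in> A_sub" unfolding A_sub_def by (metis rangeI)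
qed

lemma hpart_gwa: "hpart gwa_algebra i = range (gwa_mon i)"
  by (auto simp: gwa_algebra_def gwa_homogeneous_iff)

lemma gwa_mon_inject [simp]: "gwa_mon i p = gwa_mon i q \<longleftrightarrow> p = q"
proof
  assume "gwa_mon i p = gwa_mon i q"
  then have "qcoeff (gwa_embed (gwa_mon i p)) i = qcoeff (gwa_embed (gwa_mon i q)) i" by simp
  then show "p = q" by (simp add: gwa_embed_mon qcoeff_qmonom)
qed simp

lemma gwa_graded_algebra: "graded_algebra (gwa_algebra :: ('k::field, int, 'k gwa) galgebra)"
proof -
  let ?A = "gwa_algebra :: ('k, int, 'k gwa) galgebra"
  note [simp] = gwa_algebra_def
  have ab: "abelian_group ?A"
    by (rule abelian_groupI) (auto simp: add_ac intro: exI[of _ "- x" for x])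
  have ring: "ring ?A"
    by (rule ringI[OF ab]) (auto intro!: monoidI simp: mult.assoc algebra_simps)
  define cf where "cf i a = (THE p. qcoeff (gwa_embed a) i = to_fract (p * acoeff i))" for i and a :: "'k gwa"
  have cf_eq: "cf i a = p" if "qcoeff (gwa_embed a) i = to_fract (p * acoeff i)" for i a p
    unfolding cf_def using that by (intro the_equality) auto
  have cf: "qcoeff (gwa_embed a) i = to_fract (cf i a * acoeff i)" for i a
  proof -
    obtain p where p: "\<And>i. qcoeff (gwa_embed a) i = to_fract (p i * acoeff i)" by (rule gwa_normal_form_coeff[of a]) (rule that)
    show ?thesis using p[of i] cf_eq[OF p] by simp
  qed
  interpret ab: abelian_group ?A by (rule ab)
  have neg: "\<ominus>\<^bsub>?A\<^esub> a = - a" for a by (rule ab.minus_equality) simp_all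
  have "graded_group ?A (hpart ?A)"
  proof (rule graded_groupI[where \<pi> = "\<lambda>i a. gwa_mon i (cf i a)", OF ab])
    show "subgroup (hpart ?A i) (add_monoid ?A)" for i
    proof (rule ab.add.subgroupI)
      show "\<ominus>\<^bsub>?A\<^esub> a \<in> hpart ?A i" if "a \<in> hpart ?A i" for a
      proof -
        from that obtain p where "a = gwa_mon i p" by (auto simp: hpart_gwa simp del: gwa_algebra_def)
        then have "- a = gwa_mon i (- p)" by (simp add: gwa_mon_def gwa_const_minus)
        then show ?thesis by (simp only: neg hpart_gwa) simp
      qed
    next
      show "a \<oplus>\<^bsub>?A\<^esub> b \<in> hpart ?A i" if "a \<in> hpart ?A i" "b \<in> hpart ?A i" for a b
        using that by (simp add: gwa_homogeneous.intros(4))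
      show "hpart ?A i \<noteq> {}" using gwa_homogeneous_mon[of i 0] by auto
    qed simp
  next
    fix i and a b :: "'k gwa"
    show "gwa_mon i (cf i (a \<oplus>\<^bsub>?A\<^esub> b)) = gwa_mon i (cf i a) \<oplus>\<^bsub>?A\<^esub> gwa_mon i (cf i b)"
      using cf_eq[of "a + b" i "cf i a + cf i b"] by (simp add: gwa_mon_add gwa_embed_add cf algebra_simps)
  next
    fix i a assume "a \<in> hpart ?A i"
    then obtain p where p: "a = gwa_mon i p" by (auto simp: hpart_gwa simp del: gwa_algebra_def)
    then have "cf i a = p" by (intro cf_eq) (simp add: gwa_embed_mon qcoeff_qmonom)
    then show "gwa_mon i (cf i a) = a" using p by simp
    fix h assume "h \<noteq> i"
    then have "cf h a = 0" using p by (intro cf_eq) (simp add: gwa_embed_mon qcoeff_qmonom)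
    then show "gwa_mon h (cf h a) = \<zero>\<^bsub>?A\<^esub>" by simp
  next
    fix a :: "'k gwa"
    have "gwa_mon i (cf i a) \<noteq> 0 \<longleftrightarrow> qcoeff (gwa_embed a) i \<noteq> 0" for i
      using gwa_mon_inject[of i "cf i a" 0] by (simp add: cf)
    then show "finite {i. gwa_mon i (cf i a) \<noteq> \<zero>\<^bsub>?A\<^esub>}" by (simp add: finite_qcoeff)
    assume "\<And>i. gwa_mon i (cf i a) = \<zero>\<^bsub>?A\<^esub>"
    then have "qcoeff (gwa_embed a) i = 0" for i using gwa_mon_inject[of i "cf i a" 0] by (simp add: cf)
    then have "gwa_embed a = gwa_embed 0" by (intro qgr_eqI) (simp add: gwa_embed_zero)
    then show "a = \<zero>\<^bsub>?A\<^esub>" by simp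
  qed (simp_all add: hpart_gwa del: gwa_algebra_def)
  then show ?thesis
  proof (intro graded_algebra.intro graded_algebra_axioms.intro ring)
    fix r s :: "'k gwa" and c d :: 'k and g h
    show "r \<in> hpart ?A g \<Longrightarrow> s \<in> hpart ?A h \<Longrightarrow> r \<otimes>\<^bsub>?A\<^esub> s \<in> hpart ?A (g + h)"
      by (simp add: gwa_homogeneous.intros(5))
    show "\<one>\<^bsub>?A\<^esub> \<in> hpart ?A 0" using gwa_homogeneous.intros(1)[of 1] by simp
    show "scal ?A c \<in> hpart ?A 0" by (simp add: gwa_homogeneous.intros(1))
    show "scal ?A 1 = \<one>\<^bsub>?A\<^esub>" by (simp flip: one_pCons)
    show "scal ?A (c + d) = scal ?A c \<oplus>\<^bsub>?A\<^esub> scal ?A d" by (simp flip: gwa_const_add)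
    show "scal ?A (c * d) = scal ?A c \<otimes>\<^bsub>?A\<^esub> scal ?A d" by (simp add: mult.commute flip: gwa_const_mult)
    show "scal ?A c \<otimes>\<^bsub>?A\<^esub> r = r \<otimes>\<^bsub>?A\<^esub> scal ?A c" by (simp add: gwa_const_scalar_commute)
  qed
qed

lemma qcoeff_qmonom_mult: "qcoeff (qmonom n f * q) i = f * zshift n (qcoeff q (i - n))"
  by (simp add: times_qgr.rep_eq qmonom.rep_eq) (subst qmult_superset[of "{n}"], auto)

lemma qcoeff_diff: "qcoeff (q - q') i = qcoeff q i - qcoeff q' i"
  using qcoeff_simps(2)[of q "- q'" i] by simp

lemma zshift_eq_0_iff [simp]: "zshift i f = 0 \<longleftrightarrow> f = 0"
  using zshift_zshift[of "- i" i f] by (metis zshift_0 zshift_zero add.left_inverse)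

section \<open>Graded quotients of submodules of the quotient ring\<close>

definition right_ideal :: "'k::field gwa set \<Rightarrow> bool" where
  "right_ideal I \<longleftrightarrow> 0 \<in> I \<and> (\<forall>a\<in>I. \<forall>b\<in>I. a + b \<in> I) \<and> (\<forall>a\<in>I. \<forall>b. a * b \<in> I)"

abbreviation coset :: "'k::field gwa set \<Rightarrow> 'k gwa \<Rightarrow> 'k gwa set" where
  "coset I a \<equiv> I +>\<^bsub>gwa_algebra\<^esub> a"

lemma coset_def: "coset I a = (\<lambda>i. i + a) ` I"
  by (auto simp: a_r_coset_def' gwa_algebra_def)

context
  fixes I :: "'k::field gwa set"
  assumes I: "right_ideal I"
begin

lemma ideal_add: "a \<in> I \<Longrightarrow> b \<in> I \<Longrightarrow> a + b \<in> I" using I by (simp add: right_ideal_def)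
lemma ideal_mult: "a \<in> I \<Longrightarrow> a * b \<in> I" using I by (simp add: right_ideal_def)
lemma ideal_zero: "0 \<in> I" using I by (simp add: right_ideal_def)
lemma ideal_minus: "a \<in> I \<Longrightarrow> - a \<in> I" using ideal_mult[of a "- 1"] by simp
lemma ideal_diff: "a \<in> I \<Longrightarrow> b \<in> I \<Longrightarrow> a - b \<in> I" using ideal_add[of a "- b"] ideal_minus by simp

lemma coset_eq_iff: "coset I a = coset I b \<longleftrightarrow> a - b \<in> I"
proof
  assume "coset I a = coset I b"
  moreover have "a \<in> coset I a" unfolding coset_def using ideal_zero by force
  ultimately obtain i where "i \<in> I" "a = i + b" by (auto simp: coset_def)
  then show "a - b \<in> I" by simp
next
  assume ab: "a - b \<in> I"
  have "coset I a \<subseteq> coset I b" if "a - b \<in> I" for a b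
  proof
    fix c assume "c \<in> coset I a"
    then obtain i where i: "i \<in> I" "c = i + a" by (auto simp: coset_def)
    then have "c = (i + (a - b)) + b" by simp
    then show "c \<in> coset I b" unfolding coset_def using ideal_add[OF i(1) that] by (rule image_eqI)
  qed
  from this[OF ab] this[of b a] ideal_minus[OF ab] show "coset I a = coset I b" by simp
qed

lemma quotient_zero: "zero (quotient_module gwa_algebra I) = coset I 0"
  by (simp add: quotient_module_def coset_def)

lemma quotient_carrier: "carrier (quotient_module gwa_algebra I) = range (coset I)"
  by (auto simp: quotient_module_def A_RCOSETS_def' gwa_algebra_def)

lemma quotient_add: "add (quotient_module gwa_algebra I) (coset I a) (coset I b) = coset I (a + b)"
proof -
  have "\<exists>k\<in>I. i + a + (j + b) = k + (a + b)" if "i \<in> I" "j \<in> I" for i j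
    using ideal_add[OF that] by (intro bexI[of _ "i + j"]) (simp_all add: algebra_simps)
  moreover have "\<exists>i\<in>I. \<exists>j\<in>I. k + (a + b) = i + a + (j + b)" if "k \<in> I" for k
    using that ideal_zero by (intro bexI[of _ k] bexI[of _ 0]) (simp_all add: algebra_simps)
  ultimately show ?thesis
    unfolding quotient_module_def set_add_def' coset_def by (auto simp: gwa_algebra_def image_iff)
qed

lemma quotient_ract: "ract (quotient_module gwa_algebra I) (coset I a) r = coset I (a * r)"
proof -
  have "coset I (u * r) = coset I (a * r)" if "u \<in> coset I a" for u
  proof -
    from that obtain i where "i \<in> I" "u = i + a" by (auto simp: coset_def)
    then show ?thesis unfolding coset_eq_iff using ideal_mult[of i r] by (simp add: algebra_simps)
  qed
  moreover have "a \<in> coset I a" unfolding coset_def using ideal_zero by force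
  ultimately have "(\<Union>u\<in>coset I a. coset I (u * r)) = coset I (a * r)" by blast
  then show ?thesis by (simp add: quotient_module_def gwa_algebra_def)
qed

lemma quotient_hcomp: "hcomp (quotient_module gwa_algebra I) i = range (\<lambda>p. coset I (gwa_mon i p))"
  by (auto simp: quotient_module_def hpart_gwa)

end

text \<open>All four right ideals that enter the definition of \<open>\<iota>\<^sub>n\<close> have this shape: in the degrees belonging to \<open>D\<close> they
  require divisibility by \<open>e\<close>, and in all other degrees they contain everything.\<close>

definition degree_ideal :: "'k::field poly \<Rightarrow> int set \<Rightarrow> 'k gwa set" where
  "degree_ideal e D = {a. \<forall>i\<in>D. \<exists>g. qcoeff (gwa_embed a) i = to_fract (acoeff i * (e * g))}"

lemma gwa_mon_in_degree_ideal: "gwa_mon i p \<in> degree_ideal e D \<longleftrightarrow> (i \<in> D \<longrightarrow> e dvd p)"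
proof -
  have "(\<exists>g. to_fract (p * acoeff i) = to_fract (acoeff i * (e * g))) \<longleftrightarrow> e dvd p" for p :: "'a poly"
    by (auto simp: dvd_def mult.commute[of p] simp del: to_fract_mult)
  moreover have "\<exists>g. (0::'a poly fract) = to_fract (acoeff j * (e * g))" for j
    by (rule exI[of _ 0]) simp
  ultimately show ?thesis
    by (auto simp: degree_ideal_def gwa_embed_mon qcoeff_qmonom)
qed

lemma degree_ideal_cong_coeff:
  assumes "a \<in> degree_ideal e D" "\<And>i. i \<in> D \<Longrightarrow> qcoeff (gwa_embed b) i = qcoeff (gwa_embed a) i \<or> qcoeff (gwa_embed b) i = 0"
  shows "b \<in> degree_ideal e D"
proof -
  have "\<exists>g. (0::'a poly fract) = to_fract (acoeff j * (e * g))" for j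
    by (rule exI[of _ 0]) simp
  then show ?thesis using assms unfolding degree_ideal_def by force
qed

text \<open>Comaximality of two elements. Unlike coprimality in a gcd ring it makes sense and is multiplicative
  in any commutative ring.\<close>

definition bezout :: "'a::comm_ring_1 \<Rightarrow> 'a \<Rightarrow> bool" where
  "bezout a b \<longleftrightarrow> (\<exists>s t. s * a + t * b = 1)"

lemma bezout_mult: "bezout a c \<Longrightarrow> bezout b c \<Longrightarrow> bezout (a * b) c"
proof -
  assume "bezout a c" "bezout b c"
  then obtain s t s' t' where st: "s * a + t * c = 1" "s' * b + t' * c = 1" by (auto simp: bezout_def)
  have "(s * s') * (a * b) + (s * a * t' + t * (s' * b + t' * c)) * c = (s * a + t * c) * (s' * b + t' * c)"
    by (simp add: algebra_simps)
  then show ?thesis unfolding bezout_def st by auto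
qed

lemma bezout_commute: "bezout a b \<Longrightarrow> bezout b a"
  unfolding bezout_def by (metis add.commute)

lemma bezout_1 [simp]: "bezout 1 a"
  unfolding bezout_def by (rule exI[of _ 1], rule exI[of _ 0]) simp

lemma bezout_power2: "bezout a b \<Longrightarrow> bezout (a ^ 2) b"
  by (simp add: power2_eq_square bezout_mult)

lemma bezout_prod: "(\<And>i. i \<in> S \<Longrightarrow> bezout (f i) b) \<Longrightarrow> bezout (prod f S) b"
  by (induction S rule: infinite_finite_induct) (auto intro: bezout_mult)

lemma bezout_dvd_cancel: "bezout u e \<Longrightarrow> e dvd u * w \<Longrightarrow> e dvd w"
proof -
  assume "bezout u e" and dvd: "e dvd u * w"
  then obtain s t where st: "s * u + t * e = 1" by (auto simp: bezout_def)
  have "w = (s * u + t * e) * w" by (simp only: st mult_1)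
  also have "\<dots> = s * (u * w) + e * (t * w)" by (simp add: algebra_simps)
  finally show ?thesis using dvd by (metis dvd_add dvd_mult dvd_triv_left)
qed

lemma bezout_lin:
  fixes i j :: int
  assumes "i \<noteq> j"
  shows "bezout (lin i :: 'k::field_char_0 poly) (lin j)"
proof -
  let ?c = "inverse (of_int (i - j)) :: 'k"
  have "[:?c:] * lin i + [:- ?c:] * lin j = ([:?c * of_int (i - j):] :: 'k poly)"
    by (simp add: lin_def algebra_simps)
  also have "\<dots> = 1" using assms by (simp add: one_pCons del: of_int_diff)
  finally show ?thesis unfolding bezout_def by blast
qed

lemma lin_not_dvd_1: "\<not> lin n dvd (1 :: 'k::field poly)"
proof
  assume "lin n dvd (1 :: 'k poly)"
  then obtain g where "(1 :: 'k poly) = lin n * g" by (auto simp: dvd_def)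
  then have "poly 1 (- of_int n :: 'k) = poly (lin n * g) (- of_int n)" by simp
  then show False by (simp add: lin_def)
qed

definition qcomp :: "int \<Rightarrow> 'k::field qgr \<Rightarrow> 'k qgr" where
  "qcomp i q = qmonom i (qcoeff q i)"

lemma qfam_add: "q \<in> qfam p \<Longrightarrow> q' \<in> qfam p \<Longrightarrow> q + q' \<in> qfam p"
proof -
  assume "q \<in> qfam p" "q' \<in> qfam p"
  then have "\<exists>g. qcoeff (q + q') i = p i * to_fract g" for i
    unfolding qfam_def by (auto dest!: spec[of _ i]) (metis distrib_left to_fract_add)
  then show ?thesis by (simp add: qfam_def)
qed

lemma qmonom_in_qfam: "qmonom i (p i * to_fract g) \<in> qfam p"
  unfolding qfam_def by (auto simp: qcoeff_qmonom intro: exI[of _ 0])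

lemma qcomp_in_qfam: "q \<in> qfam p \<Longrightarrow> \<exists>g. qcomp i q = qmonom i (p i * to_fract g)"
  unfolding qfam_def qcomp_def by (auto dest!: spec[of _ i])

lemma sum_qcomp: "(\<Sum>i | qcoeff q i \<noteq> 0. qcomp i q) = q"
  using finite_qcoeff[of q] by (intro qgr_eqI) (auto simp: qcoeff_sum qcomp_def qcoeff_qmonom)

lemma qfam_induct [consumes 1, case_names monom add]:
  assumes q: "q \<in> qfam p"
    and hom: "\<And>i g. R (qmonom i (p i * to_fract g))"
    and add: "\<And>q q'. q \<in> qfam p \<Longrightarrow> q' \<in> qfam p \<Longrightarrow> R q \<Longrightarrow> R q' \<Longrightarrow> R (q + q')"
  shows "R q"
proof -
  have zero: "0 \<in> qfam p \<and> R 0" using qmonom_in_qfam[of undefined p 0] hom[of undefined 0] by simp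
  have "(\<Sum>i\<in>S. qcomp i q) \<in> qfam p \<and> R (\<Sum>i\<in>S. qcomp i q)" if "finite S" for S
    using that
  proof induction
    case (insert i S)
    obtain g where "qcomp i q = qmonom i (p i * to_fract g)" using qcomp_in_qfam[OF q] by blast
    then have "qcomp i q \<in> qfam p" "R (qcomp i q)" using qmonom_in_qfam hom by auto
    then show ?case using insert by (auto intro: qfam_add add)
  qed (use zero in simp)
  from this[OF finite_qcoeff[of q]] show ?thesis by (simp add: sum_qcomp)
qed

lemma qsub_simps [simp]:
  "carrier (qsub P) = P" "zero (qsub P) = 0" "add (qsub P) = (+)" "ract (qsub P) q a = q * gwa_embed a"
  by (simp_all add: qsub_def)

lemma gwa_algebra_carrier [simp]: "carrier gwa_algebra = UNIV" by (simp add: gwa_algebra_def)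

lemma qmonom_in_hcomp: "qmonom i (p i * to_fract g) \<in> hcomp (qsub (qfam p)) i"
  using qmonom_in_qfam[of i p g] by (simp add: qsub_def qcoeff_qmonom)

text \<open>The kernel of a surjection is the same for all surjections. In degree \<open>i\<close> both the source and \<open>A\<close> are cyclic over
  \<open>k[z]\<close>, so the map is multiplication by some \<open>u\<^sub>i\<close> modulo \<open>e\<close>, or zero; surjectivity forces \<open>u\<^sub>i\<close> to
  be invertible modulo \<open>e\<close>, and then the kernel in this degree is \<open>e\<close> times the component, up to the shift of
  the variable.\<close>

lemma surjection_kernel:
  fixes p :: "int \<Rightarrow> 'k::field poly fract"
  assumes p0: "\<And>i. p i \<noteq> 0" and I: "right_ideal I" and ID: "I = degree_ideal e D"
    and f: "f \<in> ghom gwa_algebra (qsub (qfam p)) (shift n (quotient_module gwa_algebra I))"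
    and surj: "f ` qfam p = carrier (shift n (quotient_module gwa_algebra I))"
  shows "a_kernel (qsub (qfam p)) (shift n (quotient_module gwa_algebra I)) f
    = {q \<in> qfam p. \<forall>i. i - n \<in> D \<longrightarrow> (\<exists>g. qcoeff q i = p i * to_fract (pshift n e * g))}"
proof -
  note sh = shift_def
  have f_add: "f (q + q') = coset I (a + a')"
    if "q \<in> qfam p" "q' \<in> qfam p" "f q = coset I a" "f q' = coset I a'" for q q' a a'
    using ghom_add[OF f, of q q'] that quotient_add[OF I, of a a'] by (simp add: sh)
  have f_act: "f (q * gwa_embed c) = coset I (a * c)" if "q \<in> qfam p" "f q = coset I a" for q a c
    using ghom_ract[OF f, of q c] that quotient_ract[OF I, of a c] by (simp add: sh)
  have f_hom: "\<exists>r. f (qmonom i (p i * to_fract g)) = coset I (gwa_mon (i - n) r)" for i g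
    using ghom_hcomp[OF f qmonom_in_hcomp[of i p g]] quotient_hcomp[OF I] by (auto simp: sh)
  have f0: "f 0 = coset I 0"
  proof -
    obtain r where "f 0 = coset I (gwa_mon (- n) r)" using f_hom[of 0 0] by auto
    from f_act[OF _ this, of 0] qmonom_in_qfam[of 0 p 0] show ?thesis by (simp add: gwa_embed_zero)
  qed
  \<comment> \<open>\<open>a\<close> lifts \<open>f q\<close> in such a way that the components of \<open>a\<close> lift the values of \<open>f\<close> on the components of \<open>q\<close>\<close>
  define S where "S q a \<longleftrightarrow> f q = coset I a \<and> (\<forall>i. \<exists>b. f (qcomp i q) = coset I b \<and>
      gwa_embed b = qcomp (i - n) (gwa_embed a))" for q a
  have S_ex: "\<exists>a. S q a" if "q \<in> qfam p" for q
    using that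
  proof (induction rule: qfam_induct)
    case (monom i g)
    obtain r where r: "f (qmonom i (p i * to_fract g)) = coset I (gwa_mon (i - n) r)" using f_hom by blast
    have "S (qmonom i (p i * to_fract g)) (gwa_mon (i - n) r)"
      unfolding S_def
    proof (intro conjI r allI)
      fix j show "\<exists>b. f (qcomp j (qmonom i (p i * to_fract g))) = coset I b \<and>
          gwa_embed b = qcomp (j - n) (gwa_embed (gwa_mon (i - n) r))"
      proof (cases "j = i")
        case True
        then show ?thesis using r
          by (intro exI[of _ "gwa_mon (i - n) r"]) (simp add: qcomp_def qcoeff_qmonom gwa_embed_mon)
      next
        case False
        then show ?thesis using f0
          by (intro exI[of _ 0]) (simp add: qcomp_def qcoeff_qmonom gwa_embed_mon gwa_embed_zero)
      qed
    qed
    then show ?case ..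
  next
    case (add q q')
    then obtain a a' where a: "S q a" "S q' a'" by blast
    have "S (q + q') (a + a')"
      unfolding S_def
    proof (intro conjI allI)
      show "f (q + q') = coset I (a + a')" 
        using a f_add[OF add(1,2)] unfolding S_def by blast
      fix i
      from a obtain b b' where b: "f (qcomp i q) = coset I b" "gwa_embed b = qcomp (i - n) (gwa_embed a)"
        "f (qcomp i q') = coset I b'" "gwa_embed b' = qcomp (i - n) (gwa_embed a')" unfolding S_def by blast
      have "qcomp i q \<in> qfam p" "qcomp i q' \<in> qfam p"
        using qcomp_in_qfam[OF add(1), of i] qcomp_in_qfam[OF add(2), of i] qmonom_in_qfam by auto
      from f_add[OF this b(1,3)] show "\<exists>b. f (qcomp i (q + q')) = coset I b \<and>
          gwa_embed b = qcomp (i - n) (gwa_embed (a + a'))"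
        using b by (intro exI[of _ "b + b'"]) (simp add: qcomp_def gwa_embed_add qmonom_add)
    qed
    then show ?case ..
  qed
  have comp_iff: "f q = coset I 0 \<longleftrightarrow> (\<forall>i. f (qcomp i q) = coset I 0)" if q: "q \<in> qfam p" for q
  proof -
    obtain a where a: "S q a" using S_ex[OF q] ..
    have fa: "f q = coset I a" using a by (simp add: S_def)
    have "f (qcomp i q) = coset I 0 \<longleftrightarrow> (i - n \<in> D \<longrightarrow> (\<exists>g. qcoeff (gwa_embed a) (i - n) = to_fract (acoeff (i - n) * (e * g))))" for i
    proof -
      from a obtain b where b: "f (qcomp i q) = coset I b" "gwa_embed b = qcomp (i - n) (gwa_embed a)"
        unfolding S_def by blast
      have "\<exists>g. (0::'k poly fract) = to_fract (acoeff j * (e * g))" for j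
        by (rule exI[of _ 0]) simp
      then have "b \<in> degree_ideal e D \<longleftrightarrow>
          (i - n \<in> D \<longrightarrow> (\<exists>g. qcoeff (gwa_embed a) (i - n) = to_fract (acoeff (i - n) * (e * g))))"
        unfolding degree_ideal_def by (auto simp: b(2) qcomp_def qcoeff_qmonom)
      then show ?thesis unfolding b(1) using coset_eq_iff[OF I, of b 0] ID by simp
    qed
    then have "(\<forall>i. f (qcomp i q) = coset I 0) \<longleftrightarrow>
        (\<forall>i. i - n \<in> D \<longrightarrow> (\<exists>g. qcoeff (gwa_embed a) (i - n) = to_fract (acoeff (i - n) * (e * g))))" by simp
    also have "\<dots> \<longleftrightarrow> a \<in> I"
      unfolding ID degree_ideal_def by (auto dest: spec[of _ "i + n" for i])
    also have "\<dots> \<longleftrightarrow> f q = coset I 0" unfolding fa using coset_eq_iff[OF I, of a 0] by simp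
    finally show ?thesis by simp
  qed
  have "\<exists>u. \<forall>g. f (qmonom i (p i * to_fract g)) = coset I (gwa_mon (i - n) (u * pshift (- n) g))" for i
  proof -
    obtain u where u: "f (qmonom i (p i * to_fract 1)) = coset I (gwa_mon (i - n) u)" using f_hom by blast
    have "f (qmonom i (p i * to_fract g)) = coset I (gwa_mon (i - n) (u * pshift (- n) g))" for g
      using f_act[OF qmonom_in_qfam u, of "gwa_const (pshift (- i) g)"]
      by (simp add: gwa_embed_const qmonom_mult zshift_to_fract gwa_mon_const)
    then show ?thesis by blast
  qed
  then obtain u where u: "\<And>i g. f (qmonom i (p i * to_fract g)) = coset I (gwa_mon (i - n) (u i * pshift (- n) g))"
    by metis
  have u_bezout: "bezout (u i) e" if i: "i - n \<in> D" for i
  proof -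
    have "coset I (gwa_mon (i - n) 1) \<in> f ` qfam p"
      unfolding surj using quotient_carrier[OF I] by (simp add: sh)
    then obtain q where q: "q \<in> qfam p" "f q = coset I (gwa_mon (i - n) 1)" by auto
    obtain a where a: "S q a" using S_ex[OF q(1)] ..
    then obtain b where b: "f (qcomp i q) = coset I b" "gwa_embed b = qcomp (i - n) (gwa_embed a)"
      unfolding S_def by blast
    obtain g where g: "qcomp i q = qmonom i (p i * to_fract g)" using qcomp_in_qfam[OF q(1)] by blast
    have "f q = coset I a" using a by (simp add: S_def)
    then have aI: "a - gwa_mon (i - n) 1 \<in> I" using q(2) coset_eq_iff[OF I] by metis
    have "b - gwa_mon (i - n) 1 \<in> I"
      unfolding ID
    proof (rule degree_ideal_cong_coeff)
      show "a - gwa_mon (i - n) 1 \<in> degree_ideal e D" using aI ID by simp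
    qed (auto simp: diff_conv_add_uminus gwa_embed_add gwa_embed_minus b(2) gwa_embed_mon qcomp_def qcoeff_qmonom
        simp del: add_uminus_conv_diff)
    moreover have "b - gwa_mon (i - n) (u i * pshift (- n) g) \<in> I"
      using b(1) u[of i g] g coset_eq_iff[OF I] by metis
    ultimately have "(b - gwa_mon (i - n) 1) - (b - gwa_mon (i - n) (u i * pshift (- n) g)) \<in> I"
      by (rule ideal_diff[OF I])
    moreover have "gwa_mon (i - n) (- 1 :: 'k poly) = - gwa_mon (i - n) 1"
      by (simp add: gwa_mon_def gwa_const_minus)
    ultimately have "gwa_mon (i - n) (u i * pshift (- n) g + (- 1)) \<in> I" by (simp only: gwa_mon_add) simp
    then have "e dvd u i * pshift (- n) g + (- 1)" using i unfolding ID by (simp only: gwa_mon_in_degree_ideal)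
    then obtain h where "u i * pshift (- n) g + (- 1) = e * h" by (auto simp: dvd_def)
    then have "pshift (- n) g * u i + (- h) * e = 1" by (simp add: algebra_simps)
    then show ?thesis unfolding bezout_def by blast
  qed
  have "f q = coset I 0 \<longleftrightarrow> (\<forall>i. i - n \<in> D \<longrightarrow> (\<exists>g. qcoeff q i = p i * to_fract (pshift n e * g)))"
    if q: "q \<in> qfam p" for q
  proof -
    have "f (qcomp i q) = coset I 0 \<longleftrightarrow> (i - n \<in> D \<longrightarrow> (\<exists>g. qcoeff q i = p i * to_fract (pshift n e * g)))" for i
    proof -
      obtain g where g: "qcomp i q = qmonom i (p i * to_fract g)" using qcomp_in_qfam[OF q] by blast
      then have "qcoeff (qcomp i q) i = p i * to_fract g" by (simp add: qcoeff_qmonom)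
      then have gc: "qcoeff q i = p i * to_fract g" by (simp add: qcomp_def qcoeff_qmonom)
      have "f (qcomp i q) = coset I 0 \<longleftrightarrow> (i - n \<in> D \<longrightarrow> e dvd u i * pshift (- n) g)"
        unfolding g u using coset_eq_iff[OF I, of "gwa_mon (i - n) (u i * pshift (- n) g)" 0]
          gwa_mon_in_degree_ideal[of "i - n" "u i * pshift (- n) g" e D] ID by simp
      also have "\<dots> \<longleftrightarrow> (i - n \<in> D \<longrightarrow> e dvd pshift (- n) g)"
        using bezout_dvd_cancel[OF u_bezout, of i "pshift (- n) g"] dvd_mult[of e "pshift (- n) g" "u i"]
        by blast
      also have "e dvd pshift (- n) g \<longleftrightarrow> (\<exists>h. g = pshift n e * h)"
      proof
        assume "e dvd pshift (- n) g"
        then obtain h where "pshift (- n) g = e * h" by (auto simp: dvd_def)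
        then have "pshift n (pshift (- n) g) = pshift n (e * h)" by simp
        then show "\<exists>h. g = pshift n e * h" by auto
      qed auto
      also have "(\<exists>h. g = pshift n e * h) \<longleftrightarrow> (\<exists>h. qcoeff q i = p i * to_fract (pshift n e * h))"
        using p0[of i] by (simp add: gc del: to_fract_mult)
      finally show ?thesis .
    qed
    then show ?thesis using comp_iff[OF q] by simp
  qed
  then show ?thesis
    unfolding a_kernel_def' using quotient_zero[OF I] by (auto simp: sh)
qed

text \<open>Left multiplication by \<open>t\<close> maps the family into \<open>x\<^sup>n A\<close>; here \<open>pshift n (acoeff (i - n))\<close> is the
  coefficient of the latter in degree \<open>i\<close>. The cofactors \<open>v\<^sub>i\<close> being invertible modulo the shifted \<open>e\<close>, the composite with
  the projection to the quotient is surjective.\<close>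

lemma surjection_exists:
  fixes p :: "int \<Rightarrow> 'k::field poly fract" and v :: "int \<Rightarrow> 'k poly"
  assumes p0: "\<And>i. p i \<noteq> 0" and I: "right_ideal I" and ID: "I = degree_ideal e D"
    and closed: "\<And>q a. q \<in> qfam p \<Longrightarrow> q * gwa_embed a \<in> qfam p"
    and tv: "\<And>i. t * p i = to_fract (pshift n (acoeff (i - n)) * v i)"
    and bez: "\<And>i. i - n \<in> D \<Longrightarrow> bezout (v i) (pshift n e)"
  shows "\<exists>f \<in> ghom gwa_algebra (qsub (qfam p)) (shift n (quotient_module gwa_algebra I)).
    f ` qfam p = carrier (shift n (quotient_module gwa_algebra I))"
proof -
  note sh = shift_def
  define tq where "tq q = qmonom (- n) (zshift (- n) t) * q" for q
  have tq_coeff: "qcoeff (tq q) k = zshift (- n) (t * qcoeff q (k + n))" for q k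
    by (simp add: tq_def qcoeff_qmonom_mult zshift_mult)
  have tq_coeff': "qcoeff (tq q) k = to_fract (acoeff k * pshift (- n) (v (k + n) * g))"
    if "qcoeff q (k + n) = p (k + n) * to_fract g" for q k g
  proof -
    have "t * qcoeff q (k + n) = to_fract (pshift n (acoeff k) * v (k + n) * g)"
      using tv[of "k + n"] that by (simp add: mult.assoc[symmetric])
    then show ?thesis by (simp only: tq_coeff zshift_to_fract) (simp add: mult.assoc)
  qed
  have tq_A: "tq q \<in> range gwa_embed" if "q \<in> qfam p" for q
  proof -
    have "\<exists>g. qcoeff (tq q) k = to_fract (acoeff k) * to_fract g" for k
    proof -
      obtain g where "qcoeff q (k + n) = p (k + n) * to_fract g" using \<open>q \<in> qfam p\<close> by (auto simp: qfam_def)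
      from tq_coeff'[OF this] show ?thesis by (metis to_fract_mult)
    qed
    then have "tq q \<in> A_sub" by (simp add: A_sub_qfam qfam_def)
    then show ?thesis by (simp add: A_sub_def)
  qed
  define h where "h q = inv_into UNIV gwa_embed (tq q)" for q
  have h: "gwa_embed (h q) = tq q" if "q \<in> qfam p" for q
    unfolding h_def using tq_A[OF that] by (rule f_inv_into_f)
  have h_eq: "h q = a" if "gwa_embed a = tq q" for q a
    unfolding h_def that[symmetric] by (rule inv_f_f) (simp add: inj_def)
  have h_add: "h (q + q') = h q + h q'" if "q \<in> qfam p" "q' \<in> qfam p" for q q'
    by (rule h_eq) (simp add: gwa_embed_add h that tq_def distrib_left)
  have h_act: "h (q * gwa_embed a) = h q * a" if "q \<in> qfam p" for q a
    by (rule h_eq) (simp add: gwa_embed_mult h that tq_def mult.assoc)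
  define f where "f = (\<lambda>q\<in>qfam p. coset I (h q))"
  have "f \<in> ghom gwa_algebra (qsub (qfam p)) (shift n (quotient_module gwa_algebra I))"
  proof (rule ghomI)
    fix i q assume q: "q \<in> hcomp (qsub (qfam p)) i"
    then have qq: "q \<in> qfam p" and "\<And>j. j \<noteq> i \<Longrightarrow> qcoeff q j = 0" by (auto simp: qsub_def)
    then have 0: "\<And>k. k \<noteq> i - n \<Longrightarrow> qcoeff (tq q) k = 0" by (simp add: tq_coeff)
    obtain g where "qcoeff q (i - n + n) = p (i - n + n) * to_fract g" using qq by (auto simp: qfam_def)
    from tq_coeff'[OF this] 0 have "tq q = gwa_embed (gwa_mon (i - n) (pshift (- n) (v i * g)))"
      by (intro qgr_eqI) (auto simp: gwa_embed_mon qcoeff_qmonom mult.commute)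
    then have "h q = gwa_mon (i - n) (pshift (- n) (v i * g))" by (intro h_eq) simp
    then show "f q \<in> hcomp (shift n (quotient_module gwa_algebra I)) i"
      using qq by (simp add: f_def sh quotient_hcomp[OF I])
  next
    show "f \<in> carrier (qsub (qfam p)) \<rightarrow>\<^sub>E carrier (shift n (quotient_module gwa_algebra I))"
      by (auto simp: f_def sh quotient_carrier[OF I])
  qed (auto simp: f_def sh qfam_add closed h_add h_act quotient_add[OF I] quotient_ract[OF I])
  moreover have "carrier (shift n (quotient_module gwa_algebra I)) \<subseteq> f ` qfam p"
  proof
    fix U assume "U \<in> carrier (shift n (quotient_module gwa_algebra I))"
    then obtain a where U: "U = coset I a" by (auto simp: sh quotient_carrier[OF I])
    obtain r where r: "finite {i. r i \<noteq> 0}" "\<And>i. qcoeff (gwa_embed a) i = to_fract (r i * acoeff i)"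
      by (rule gwa_normal_form_coeff[of a]) (rule that)
    \<comment> \<open>invert \<open>v\<close> modulo \<open>e\<close> in each degree where the ideal is not everything\<close>
    have "\<exists>g. (r k = 0 \<longrightarrow> g = 0) \<and> (k \<in> D \<longrightarrow> e dvd pshift (- n) (v (k + n) * g) - r k)" for k
    proof (cases "k \<in> D")
      case True
      then obtain s s' where st: "s * v (k + n) + s' * pshift n e = 1"
        using bez[of "k + n"] by (auto simp: bezout_def)
      define g where "g = s * pshift n (r k)"
      have "v (k + n) * g - pshift n (r k) = (s * v (k + n) - 1) * pshift n (r k)"
        by (simp add: g_def algebra_simps)
      also have "s * v (k + n) - 1 = - (s' * pshift n e)" using st by (simp add: algebra_simps)
      finally have "pshift (- n) (v (k + n) * g - pshift n (r k)) = pshift (- n) (- (s' * pshift n e) * pshift n (r k))" by simp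
      then have "pshift (- n) (v (k + n) * g) - r k = e * (- pshift (- n) s' * r k)"
        by (simp add: algebra_simps)
      then show ?thesis by (intro exI[of _ g]) (simp add: g_def)
    qed auto
    then obtain g where g: "\<And>k. r k = 0 \<Longrightarrow> g k = 0"
      "\<And>k. k \<in> D \<Longrightarrow> e dvd pshift (- n) (v (k + n) * g k) - r k" by metis
    have fin: "finite {i. p i * to_fract (g (i - n)) \<noteq> 0}"
    proof (rule finite_subset)
      show "{i. p i * to_fract (g (i - n)) \<noteq> 0} \<subseteq> (\<lambda>k. k + n) ` {k. r k \<noteq> 0}"
        using g(1) by (auto intro!: image_eqI[of _ _ "i - n" for i])
    qed (use r in simp)
    define q where "q = (\<Sum>i | p i * to_fract (g (i - n)) \<noteq> 0. qmonom i (p i * to_fract (g (i - n))))"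
    have qc: "qcoeff q i = p i * to_fract (g (i - n))" for i
      unfolding q_def using fin by (simp add: qcoeff_sum qcoeff_qmonom)
    then have qq: "q \<in> qfam p" by (auto simp: qfam_def)
    have "h q - a \<in> I"
      unfolding ID degree_ideal_def
    proof (intro CollectI ballI)
      fix k assume "k \<in> D"
      from g(2)[OF this] obtain w where w: "pshift (- n) (v (k + n) * g k) - r k = e * w" by (auto simp: dvd_def)
      have "qcoeff (tq q) k = to_fract (acoeff k * pshift (- n) (v (k + n) * g k))"
        using tq_coeff'[of q k "g k"] qc[of "k + n"] by simp
      then have "qcoeff (gwa_embed (h q - a)) k
          = to_fract (acoeff k * pshift (- n) (v (k + n) * g k) - r k * acoeff k)"
        using gwa_embed_add[of "h q" "- a"] by (simp add: h[OF qq] gwa_embed_minus r qcoeff_diff)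
      also have "\<dots> = to_fract (acoeff k * (e * w))" by (simp add: algebra_simps flip: w)
      finally show "\<exists>w. qcoeff (gwa_embed (h q - a)) k = to_fract (acoeff k * (e * w))" by blast
    qed
    then have "f q = U" using qq by (simp add: f_def U coset_eq_iff[OF I])
    then show "U \<in> f ` qfam p" using qq by blast
  qed
  moreover have "f ` qfam p \<subseteq> carrier (shift n (quotient_module gwa_algebra I))"
    by (auto simp: f_def sh quotient_carrier[OF I])
  ultimately show ?thesis by blast
qed

section \<open>The four right ideals\<close>

lemma acoeff_step: "acoeff i = (if i < 0 then lin i ^ 2 else 1) * acoeff (i + 1)"
proof (cases "i < 0")
  case True
  then have "{i..<0} = insert i {i + 1..<0}" by auto
  then show ?thesis using True by (simp add: acoeff_def)
qed (simp add: acoeff_def)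

lemma pshift_acoeff: "pshift n (acoeff (i - n)) = (\<Prod>j\<in>{i..<n}. lin j ^ 2)"
proof -
  have "pshift n (prod f S) = (\<Prod>s\<in>S. pshift n (f s))" for f :: "int \<Rightarrow> 'a poly" and S
    by (induction S rule: infinite_finite_induct) simp_all
  then have "pshift n (acoeff (i - n)) = (\<Prod>j\<in>{i - n..<0}. lin (n + j) ^ 2 :: 'a poly)"
    by (simp add: acoeff_def)
  also have "\<dots> = (\<Prod>j\<in>(\<lambda>j. n + j) ` {i - n..<0}. lin j ^ 2)"
    by (subst prod.reindex) (auto simp: inj_on_def)
  also have "(\<lambda>j. n + j) ` {i - n..<0} = {i..<n}" by (simp add: image_add_atLeastLessThan)
  finally show ?thesis .
qed

lemma pshift_1_acoeff: "pshift 1 (acoeff (i - 1)) = (if i \<le> 0 then lin 0 ^ 2 else 1) * acoeff i"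
proof (cases "i \<le> 0")
  case True
  then have "{i..<1} = insert 0 {i..<0}" by auto
  then show ?thesis using True unfolding pshift_acoeff by (simp add: acoeff_def)
qed (unfold pshift_acoeff, simp add: acoeff_def)

lemma pshift_m1_acoeff: "lin (- 1) ^ 2 * pshift (- 1) (acoeff (i + 1)) = (if i \<ge> 0 then lin (- 1) ^ 2 else 1) * acoeff i"
proof -
  have *: "pshift (- 1) (acoeff (i + 1)) = (\<Prod>j\<in>{i..<- 1}. lin j ^ 2 :: 'a poly)"
    using pshift_acoeff[of "- 1" i] by simp
  show ?thesis
  proof (cases "i \<ge> 0")
    case False
    then have "{i..<0} = insert (- 1) {i..<- 1}" by auto
    then show ?thesis using False unfolding * by (simp add: acoeff_def)
  qed (unfold *, simp add: acoeff_def)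
qed

lemma in_A_subI: "(\<And>i. \<exists>g. qcoeff q i = to_fract (acoeff i * g)) \<Longrightarrow> \<exists>a. gwa_embed a = q"
proof -
  assume "\<And>i. \<exists>g. qcoeff q i = to_fract (acoeff i * g)"
  then have "q \<in> A_sub" by (simp add: A_sub_qfam qfam_def)
  then show ?thesis by (auto simp: A_sub_def)
qed

lemma gwa_coeffE:
  obtains g where "qcoeff (gwa_embed a) i = to_fract (acoeff i * g)"
proof -
  obtain p where "\<And>i. qcoeff (gwa_embed a) i = to_fract (p i * acoeff i)"
    by (rule gwa_normal_form_coeff[of a]) (rule that)
  then show thesis using that[of "p i"] by (simp add: mult.commute)
qed

lemma degree_idealE:
  assumes "a \<in> degree_ideal e D" "i \<in> D"
  obtains g where "qcoeff (gwa_embed a) i = to_fract (acoeff i * (e * g))"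
  using assms unfolding degree_ideal_def by blast

text \<open>Dividing an element of the right-hand side by \<open>x\<close> in the quotient ring gives an element of \<open>A\<close>: the
  coefficients \<open>acoeff\<close> absorb the factor \<open>z\<^sup>2\<close> exactly in the degrees \<open>i \<le> 0\<close>.\<close>

lemma xA_ideal: "{gwa_x * a | a. True} = degree_ideal (lin 0 ^ 2) {..0 :: int}"
proof (intro equalityI subsetI)
  fix b :: "'a gwa" assume "b \<in> {gwa_x * a | a. True}"
  then obtain a where b: "b = gwa_x * a" by auto
  show "b \<in> degree_ideal (lin 0 ^ 2) {..0}"
    unfolding degree_ideal_def
  proof (intro CollectI ballI)
    fix i :: int assume "i \<in> {..0}"
    obtain g where "qcoeff (gwa_embed a) (i - 1) = to_fract (acoeff (i - 1) * g)" by (rule gwa_coeffE)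
    then have "qcoeff (gwa_embed b) i = to_fract (pshift 1 (acoeff (i - 1)) * pshift 1 g)"
      by (simp add: b gwa_embed_mult gwa_embed_x qcoeff_qmonom_mult zshift_to_fract zshift_mult)
    also have "\<dots> = to_fract (acoeff i * (lin 0 ^ 2 * pshift 1 g))"
      using \<open>i \<in> {..0}\<close> by (simp add: pshift_1_acoeff)
    finally show "\<exists>g. qcoeff (gwa_embed b) i = to_fract (acoeff i * (lin 0 ^ 2 * g))" ..
  qed
next
  fix b :: "'a gwa" assume b: "b \<in> degree_ideal (lin 0 ^ 2) {..0}"
  have "\<exists>g. qcoeff (qmonom (- 1) 1 * gwa_embed b) i = to_fract (acoeff i * g)" for i
  proof -
    have "\<exists>g. qcoeff (gwa_embed b) (i + 1) = to_fract (pshift 1 (acoeff i) * g)"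
    proof (cases "i + 1 \<le> 0")
      case True
      then obtain g where "qcoeff (gwa_embed b) (i + 1) = to_fract (acoeff (i + 1) * (lin 0 ^ 2 * g))"
        using degree_idealE[OF b, of "i + 1"] by auto
      then show ?thesis using True pshift_1_acoeff[of "i + 1", where 'a = 'a] by (intro exI[of _ g]) (simp add: mult_ac del: to_fract_mult)
    next
      case False
      obtain g where "qcoeff (gwa_embed b) (i + 1) = to_fract (acoeff (i + 1) * g)" by (rule gwa_coeffE)
      then show ?thesis using False pshift_1_acoeff[of "i + 1", where 'a = 'a] by (intro exI[of _ g]) simp
    qed
    then obtain g where "qcoeff (gwa_embed b) (i + 1) = to_fract (pshift 1 (acoeff i) * g)" ..
    then show ?thesis
      by (intro exI[of _ "pshift (- 1) g"]) (simp add: qcoeff_qmonom_mult zshift_mult zshift_to_fract)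
  qed
  from in_A_subI[OF this] obtain a where a: "gwa_embed a = qmonom (- 1) 1 * gwa_embed b" ..
  have "gwa_embed (gwa_x * a) = gwa_embed b"
    by (simp add: gwa_embed_mult gwa_embed_x a qmonom_mult qmonom_one flip: mult.assoc)
  then show "b \<in> {gwa_x * a | a. True}" by auto
qed

lemma yA_ideal: "{gwa_y * a | a. True} = degree_ideal (lin (- 1) ^ 2) {0 :: int..}"
proof (intro equalityI subsetI)
  fix b :: "'a gwa" assume "b \<in> {gwa_y * a | a. True}"
  then obtain a where b: "b = gwa_y * a" by auto
  show "b \<in> degree_ideal (lin (- 1) ^ 2) {0..}"
    unfolding degree_ideal_def
  proof (intro CollectI ballI)
    fix i :: int assume "i \<in> {0..}"
    obtain g where "qcoeff (gwa_embed a) (i + 1) = to_fract (acoeff (i + 1) * g)" by (rule gwa_coeffE)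
    then have "qcoeff (gwa_embed b) i = to_fract (lin (- 1) ^ 2 * pshift (- 1) (acoeff (i + 1)) * pshift (- 1) g)"
      by (simp add: b gwa_embed_mult gwa_embed_y qcoeff_qmonom_mult zshift_to_fract zshift_mult)
    also have "\<dots> = to_fract (acoeff i * (lin (- 1) ^ 2 * pshift (- 1) g))"
      unfolding pshift_m1_acoeff using \<open>i \<in> {0..}\<close> by simp
    finally show "\<exists>g. qcoeff (gwa_embed b) i = to_fract (acoeff i * (lin (- 1) ^ 2 * g))" ..
  qed
next
  fix b :: "'a gwa" assume b: "b \<in> degree_ideal (lin (- 1) ^ 2) {0..}"
  let ?yinv = "qmonom 1 (inverse (to_fract (lin 0 ^ 2))) :: 'a qgr"
  have "\<exists>g. qcoeff (?yinv * gwa_embed b) i = to_fract (acoeff i * g)" for i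
  proof -
    have "\<exists>g. qcoeff (gwa_embed b) (i - 1) = to_fract (lin (- 1) ^ 2 * pshift (- 1) (acoeff i) * g)"
    proof (cases "i - 1 \<ge> 0")
      case True
      then obtain g where "qcoeff (gwa_embed b) (i - 1) = to_fract (acoeff (i - 1) * (lin (- 1) ^ 2 * g))"
        using degree_idealE[OF b, of "i - 1"] by auto
      then show ?thesis using True pshift_m1_acoeff[of "i - 1", where 'a = 'a] by (intro exI[of _ g]) (simp add: mult_ac del: to_fract_mult)
    next
      case False
      obtain g where "qcoeff (gwa_embed b) (i - 1) = to_fract (acoeff (i - 1) * g)" by (rule gwa_coeffE)
      then show ?thesis using False pshift_m1_acoeff[of "i - 1", where 'a = 'a] by (intro exI[of _ g]) (simp del: to_fract_mult)
    qed
    then obtain g where g: "qcoeff (gwa_embed b) (i - 1) = to_fract (lin (- 1) ^ 2 * pshift (- 1) (acoeff i) * g)" ..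
    have "qcoeff (?yinv * gwa_embed b) i = inverse (to_fract (lin 0 ^ 2)) * to_fract (lin 0 ^ 2 * (acoeff i * pshift 1 g))"
      by (simp only: qcoeff_qmonom_mult g zshift_to_fract) (simp add: mult.assoc)
    also have "\<dots> = to_fract (acoeff i * pshift 1 g)" by simp
    finally show ?thesis ..
  qed
  from in_A_subI[OF this] obtain a where a: "gwa_embed a = ?yinv * gwa_embed b" ..
  have "zshift (- 1) (inverse (to_fract (lin 0 ^ 2))) * zshift (- 1) (to_fract (lin 0 ^ 2)) = (1 :: 'a poly fract)"
    by (simp flip: zshift_mult)
  then have "qmonom (- 1) (to_fract (lin (- 1) ^ 2)) * ?yinv = qmonom 0 1"
    by (simp add: qmonom_mult zshift_to_fract mult.commute)
  then have "gwa_embed (gwa_y * a) = gwa_embed b"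
    by (simp add: gwa_embed_mult gwa_embed_y a qmonom_one flip: mult.assoc)
  then show "b \<in> {gwa_y * a | a. True}" by auto
qed

text \<open>Passing from \<open>xA\<close> to \<open>xA + zA\<close> weakens divisibility by \<open>z\<^sup>2\<close> to divisibility by \<open>z\<close>, and likewise for \<open>y\<close>.\<close>

lemma degree_ideal_power_sum:
  fixes c :: "'k::field poly"
  shows "degree_ideal c D = {a + gwa_const c * b | a b. a \<in> degree_ideal (c ^ 2) D}"
proof (intro equalityI subsetI)
  fix d assume d: "d \<in> degree_ideal c D"
  obtain r where fin: "finite {i. r i \<noteq> 0}" and r: "\<And>i. qcoeff (gwa_embed d) i = to_fract (r i * acoeff i)"
    by (rule gwa_normal_form_coeff[of d]) (rule that)
  have "\<forall>i\<in>D. \<exists>g. r i = c * g"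
  proof
    fix i assume "i \<in> D"
    then obtain g where "to_fract (r i * acoeff i) = to_fract (acoeff i * (c * g))"
      using degree_idealE[OF d, of i] unfolding r by blast
    then have "r i = c * g" by (simp add: mult.commute[of "r i"] del: to_fract_mult)
    then show "\<exists>g. r i = c * g" ..
  qed
  then obtain g where g: "\<And>i. i \<in> D \<Longrightarrow> r i = c * g i" by metis
  define b where "b = (\<Sum>i | r i \<noteq> 0. if i \<in> D then gwa_mon i (g i) else 0)"
  have gb: "gwa_const c * b = (\<Sum>i | r i \<noteq> 0. if i \<in> D then gwa_mon i (r i) else 0)"
    unfolding b_def sum_distrib_left
    by (intro sum.cong) (auto simp: gwa_mon_def gwa_const_mult g mult.assoc)
  have emb: "gwa_embed (\<Sum>i\<in>T. if i \<in> D then gwa_mon i (r i) else 0)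
      = (\<Sum>i\<in>T. if i \<in> D then qmonom i (to_fract (r i * acoeff i)) else 0)" for T
    by (induction T rule: infinite_finite_induct) (simp_all add: gwa_embed_zero gwa_embed_add gwa_embed_mon)
  have "qcoeff (gwa_embed (gwa_const c * b)) i = (if i \<in> D then qcoeff (gwa_embed d) i else 0)" for i
  proof -
    have "qcoeff (gwa_embed (gwa_const c * b)) i
        = (\<Sum>j | r j \<noteq> 0. if j = i then (if i \<in> D then to_fract (r i * acoeff i) else 0) else 0)"
      unfolding gb emb qcoeff_sum by (intro sum.cong) (auto simp: qcoeff_qmonom)
    also have "\<dots> = (if i \<in> D then qcoeff (gwa_embed d) i else 0)" using fin by (simp add: r)
    finally show ?thesis .
  qed
  then have "d - gwa_const c * b \<in> degree_ideal (c ^ 2) D"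
    using gwa_embed_add[of d "- (gwa_const c * b)"]
    by (auto simp: degree_ideal_def gwa_embed_minus qcoeff_diff intro: exI[of _ 0])
  then show "d \<in> {a + gwa_const c * b | a b. a \<in> degree_ideal (c ^ 2) D}"
    by (intro CollectI exI[of _ "d - gwa_const c * b"] exI[of _ b]) simp
next
  fix d assume "d \<in> {a + gwa_const c * b | a b. a \<in> degree_ideal (c ^ 2) D}"
  then obtain a b where d: "d = a + gwa_const c * b" and a: "a \<in> degree_ideal (c ^ 2) D" by blast
  show "d \<in> degree_ideal c D"
    unfolding degree_ideal_def
  proof (intro CollectI ballI)
    fix i assume "i \<in> D"
    then obtain g where g: "qcoeff (gwa_embed a) i = to_fract (acoeff i * (c ^ 2 * g))"
      using degree_idealE[OF a, of i] by blast
    obtain g' where g': "qcoeff (gwa_embed b) i = to_fract (acoeff i * g')" by (rule gwa_coeffE)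
    have "qcoeff (gwa_embed d) i = to_fract (acoeff i * (c * (c * g + g')))"
      by (simp add: d gwa_embed_add gwa_embed_mult gwa_embed_const qcoeff_qmonom_mult g g'
          power2_eq_square algebra_simps)
    then show "\<exists>g. qcoeff (gwa_embed d) i = to_fract (acoeff i * (c * g))" ..
  qed
qed

lemma gwa_z_lin: "gwa_z = gwa_const (lin 0)"
  by (simp add: gwa_z_def lin_def)

lemma gwa_z_minus_1_lin: "gwa_z - 1 = gwa_const (lin (- 1))"
proof -
  have "lin (- 1) = lin 0 + (- 1 :: 'a poly)" by (simp add: lin_def one_pCons)
  then show ?thesis unfolding gwa_z_lin by (simp only: gwa_const_add gwa_const_minus) simp
qed

lemma X_ideal: "{gwa_x * a + gwa_z * b | a b. True} = degree_ideal (lin 0) {..0}"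
  by (subst degree_ideal_power_sum) (unfold xA_ideal[symmetric] gwa_z_lin, blast)

lemma Y_ideal: "{gwa_y * a + (gwa_z - 1) * b | a b. True} = degree_ideal (lin (- 1)) {0..}"
  by (subst degree_ideal_power_sum) (unfold yA_ideal[symmetric] gwa_z_minus_1_lin, blast)

lemma right_ideal_principal: "right_ideal {w * a | a. True}"
  unfolding right_ideal_def
  by (auto intro: exI[of _ 0]) (metis distrib_left, metis mult.assoc)

lemma right_ideal_sum: "right_ideal {w * a + w' * b | a b. True}"
  unfolding right_ideal_def
proof (intro conjI ballI allI)
  have "0 = w * 0 + w' * 0" by simp
  then show "0 \<in> {w * a + w' * b | a b. True}" by blast
next
  fix c d assume "c \<in> {w * a + w' * b | a b. True}" "d \<in> {w * a + w' * b | a b. True}"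
  then obtain a b a' b' where "c = w * a + w' * b" "d = w * a' + w' * b'" by blast
  then have "c + d = w * (a + a') + w' * (b + b')" by (simp add: algebra_simps)
  then show "c + d \<in> {w * a + w' * b | a b. True}" by blast
next
  fix c r assume "c \<in> {w * a + w' * b | a b. True}"
  then obtain a b where "c = w * a + w' * b" by blast
  then have "c * r = w * (a * r) + w' * (b * r)" by (simp add: algebra_simps)
  then show "c * r \<in> {w * a + w' * b | a b. True}" by blast
qed

section \<open>The functors \<open>\<iota>\<^sub>n\<close>\<close>

text \<open>Let \<open>P\<close> be the graded submodule with coefficients \<open>p\<close>. For \<open>i \<notin> T\<close>, \<open>x\<close> maps \<open>P\<^sub>i\<close> onto \<open>P\<^sub>i\<^sub>+\<^sub>1\<close>; for \<open>i \<in> T\<close>, \<open>y\<close> maps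
  \<open>P\<^sub>i\<^sub>+\<^sub>1\<close> onto \<open>P\<^sub>i\<close>. This is the dichotomy between surjecting onto \<open>X\<langle>i\<rangle>\<close> and onto \<open>Y\<langle>i\<rangle>\<close>. For \<open>A\<close> itself, \<open>T\<close> is
  the set of negative integers.\<close>

definition steps :: "(int \<Rightarrow> 'k::field poly fract) \<Rightarrow> int set \<Rightarrow> bool" where
  "steps p T \<longleftrightarrow> (\<forall>i. p i \<noteq> 0 \<and> p i = to_fract (if i \<in> T then lin i ^ 2 else 1) * p (i + 1))"

lemma steps_closed:
  assumes p: "steps p T" and q: "q \<in> qfam p"
  shows "q * gwa_embed a \<in> qfam p"
proof -
  have x: "q * gwa_embed gwa_x \<in> qfam p" if "q \<in> qfam p" for q
    using that
  proof (induction rule: qfam_induct)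
    case (monom i g)
    have "p i = to_fract (if i \<in> T then lin i ^ 2 else 1) * p (i + 1)" using p unfolding steps_def by blast
    then have "qmonom i (p i * to_fract g) * gwa_embed gwa_x
        = qmonom (i + 1) (p (i + 1) * to_fract ((if i \<in> T then lin i ^ 2 else 1) * g))"
      by (simp add: gwa_embed_x qmonom_mult mult_ac)
    then show ?case by (simp only: qmonom_in_qfam)
  qed (simp add: distrib_right qfam_add)
  have y: "q * gwa_embed gwa_y \<in> qfam p" if "q \<in> qfam p" for q
    using that
  proof (induction rule: qfam_induct)
    case (monom i g)
    have "p (i - 1) = to_fract (if i - 1 \<in> T then lin (i - 1) ^ 2 else 1) * p (i - 1 + 1)"
      using p unfolding steps_def by blast
    then have "p i * to_fract (lin (i - 1) ^ 2) = p (i - 1) * to_fract (if i - 1 \<in> T then 1 else lin (i - 1) ^ 2)"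
      by (auto simp: mult_ac)
    then have "qmonom i (p i * to_fract g) * gwa_embed gwa_y
        = qmonom (i - 1) (p (i - 1) * to_fract ((if i - 1 \<in> T then 1 else lin (i - 1) ^ 2) * g))"
      by (simp add: gwa_embed_y qmonom_mult zshift_to_fract mult_ac)
    then show ?case by (simp only: qmonom_in_qfam)
  qed (simp add: distrib_right qfam_add)
  have c: "q * gwa_embed (gwa_const r) \<in> qfam p" if "q \<in> qfam p" for q r
    using that
  proof (induction rule: qfam_induct)
    case (monom i g)
    have "qmonom i (p i * to_fract g) * gwa_embed (gwa_const r) = qmonom i (p i * to_fract (g * pshift i r))"
      by (simp add: gwa_embed_const qmonom_mult zshift_to_fract mult_ac)
    then show ?case by (simp only: qmonom_in_qfam)
  qed (simp add: distrib_right qfam_add)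
  have "\<forall>q\<in>qfam p. q * gwa_embed (abs_gwa e) \<in> qfam p" for e
  proof (induction e)
    case (GConst r) show ?case using c[of _ r] by (simp add: gwa_const_def)
  next
    case GX show ?case using x by (simp add: gwa_x_def)
  next
    case GY show ?case using y by (simp add: gwa_y_def)
  next
    case (GNeg e)
    have "gwa_embed (abs_gwa (GNeg e)) = gwa_embed (abs_gwa e) * gwa_embed (gwa_const (- 1))"
      by (simp add: gwa_const_minus gwa_embed_minus gwa_embed_one flip: uminus_gwa.abs_eq)
    then show ?case using GNeg c by (simp add: mult.assoc[symmetric])
  next
    case (GAdd e f) then show ?case
      by (simp add: gwa_embed_add distrib_left qfam_add flip: plus_gwa.abs_eq)
  next
    case (GMul e f) then show ?case
      by (simp add: gwa_embed_mult mult.assoc[symmetric] flip: times_gwa.abs_eq)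
  qed
  then show ?thesis using q by (induction a rule: gwa.abs_induct) blast
qed

text \<open>As \<open>i\<close> grows past an element \<open>j\<close> of \<open>W\<close>, a factor \<open>(z + j)\<^sup>2\<close> disappears if \<open>j \<ge> m\<close>, and appears if
  \<open>j < m\<close>. The orientation makes the product \<open>h\<^sub>W\<close> at \<open>i = m\<close>.\<close>

definition step_prod :: "int \<Rightarrow> int set \<Rightarrow> int \<Rightarrow> 'k::field poly" where
  "step_prod m W i = (\<Prod>j\<in>W. if (i \<le> j) = (m \<le> j) then lin j ^ 2 else 1)"

lemma step_prod_step:
  assumes "finite W"
  shows "step_prod m W i * (if i \<in> W \<and> i < m then lin i ^ 2 else 1)
    = step_prod m W (i + 1) * (if i \<in> W \<and> m \<le> i then lin i ^ 2 else (1 :: 'k::field poly))"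
proof -
  have eq: "(\<Prod>j\<in>W - {i}. if (i \<le> j) = (m \<le> j) then lin j ^ 2 else (1 :: 'k poly))
      = (\<Prod>j\<in>W - {i}. if (i + 1 \<le> j) = (m \<le> j) then lin j ^ 2 else 1)"
    by (intro prod.cong) auto
  show ?thesis
  proof (cases "i \<in> W")
    case True
    then show ?thesis using assms eq
      by (auto simp: step_prod_def prod.remove[of W i] algebra_simps)
  next
    case False
    then have "W - {i} = W" by simp
    then show ?thesis using False eq by (simp add: step_prod_def)
  qed
qed

lemma step_prod_neq_0 [simp]: "step_prod m W i \<noteq> 0"
  by (cases "finite W") (auto simp: step_prod_def)

text \<open>The quotient of the two sides does not change from \<open>i\<close> to \<open>i + 1\<close>, because \<open>W\<close> records the places where
  the steps of \<open>p\<close> differ from those of \<open>x\<^sup>m A\<close>.\<close>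

lemma multiplier_exists:
  assumes p: "steps p T" and W: "finite W" "W = {j. (j \<in> T) \<noteq> (j < m)}"
  obtains t where "\<And>i. t * p i = to_fract (pshift m (acoeff (i - m)) * step_prod m W i)"
proof -
  define c where "c i = to_fract (pshift m (acoeff (i - m)) * step_prod m W i) / p i" for i
  have p0: "p i \<noteq> 0" for i using p unfolding steps_def by blast
  have "c i = c (i + 1)" for i
  proof -
    let ?S = "\<lambda>i. pshift m (acoeff (i - m)) :: 'a poly"
    have S: "?S i = (if i < m then lin i ^ 2 else 1) * ?S (i + 1)"
    proof (cases "i < m")
      case True
      then have "{i..<m} = insert i {i + 1..<m}" by auto
      then show ?thesis using True by (simp add: pshift_acoeff)
    qed (simp add: pshift_acoeff)
    let ?X = "if i \<in> T then lin i ^ 2 else (1 :: 'a poly)"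
    have v: "step_prod m W i * (if i \<notin> T \<and> i < m then lin i ^ 2 else 1)
        = step_prod m W (i + 1) * (if i \<in> T \<and> m \<le> i then lin i ^ 2 else (1 :: 'a poly))"
      using step_prod_step[OF W(1), of m i] unfolding W(2) by (auto split: if_splits)
    have N: "?S i * step_prod m W i = ?X * (?S (i + 1) * step_prod m W (i + 1))"
      unfolding S using v by (cases "i < m"; cases "i \<in> T") (simp_all add: mult_ac)
    have p_i: "p i = to_fract ?X * p (i + 1)" using p unfolding steps_def by blast
    have "to_fract ?X \<noteq> 0" by simp
    then show ?thesis
      unfolding c_def N to_fract_mult[of ?X] p_i by (rule mult_divide_mult_cancel_left)
  qed
  then have up: "c i = c (i + 1)" "c (i - 1) = c i" for i using \<open>\<And>i. c i = c (i + 1)\<close>[of "i - 1"] by auto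
  have "c i = c 0" for i
    by (induction i rule: int_induct[where k = 0]) (use up in simp_all)
  then have "c 0 * p i = to_fract (pshift m (acoeff (i - m)) * step_prod m W i)" for i
    using p0 by (simp add: c_def field_simps)
  then show thesis by (rule that)
qed

lemma shift_shift: "shift m (shift n M) = shift (m + n) M"
  by (simp add: shift_def algebra_simps diff_diff_eq)

lemma kernel_closed:
  assumes f: "f \<in> ghom gwa_algebra (qsub P) (shift m (quotient_module gwa_algebra I))" and I: "right_ideal I"
    and q: "q \<in> a_kernel (qsub P) (shift m (quotient_module gwa_algebra I)) f" and qa: "q * gwa_embed a \<in> P"
  shows "q * gwa_embed a \<in> a_kernel (qsub P) (shift m (quotient_module gwa_algebra I)) f"
  using q qa ghom_ract[OF f, of q a] quotient_ract[OF I, of 0 a] quotient_zero[OF I]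
  by (simp add: a_kernel_def' shift_def)

lemma qfam_divisible:
  "{q \<in> qfam p. \<forall>i. C i \<longrightarrow> (\<exists>g. qcoeff q i = p i * to_fract (e * g))}
    = qfam (\<lambda>i. p i * to_fract (if C i then e else 1))"
proof -
  have "(\<exists>g. x = p i * to_fract g) \<and> (C i \<longrightarrow> (\<exists>g. x = p i * to_fract (e * g)))
      \<longleftrightarrow> (\<exists>g. x = p i * to_fract (if C i then e else 1) * to_fract g)" for x i
    by (cases "C i") (auto simp: mult.assoc simp flip: to_fract_mult)
  then show ?thesis unfolding qfam_def by blast
qed

text \<open>A generator of the component of degree \<open>i\<close> is killed for degree reasons. If the algebra carries it to a generator of
  the component of degree \<open>j\<close>, this one is killed as well, although the kernel there consists of
  multiples of \<open>z + n\<close> only.\<close>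

lemma no_surjection:
  fixes p :: "int \<Rightarrow> 'k::field poly fract"
  assumes p: "steps p T" and I: "right_ideal I" "I = degree_ideal e D" and e: "pshift m e = lin n"
    and surj: "surjects_onto gwa_algebra (qsub (qfam p)) (shift m (quotient_module gwa_algebra I))"
    and ij: "i - m \<notin> D" "j - m \<in> D" and gen: "qmonom i (p i) * gwa_embed a = qmonom j (p j)"
  shows False
proof -
  have p0: "p i \<noteq> 0" for i using p unfolding steps_def by blast
  obtain f where f: "f \<in> ghom gwa_algebra (qsub (qfam p)) (shift m (quotient_module gwa_algebra I))"
    and f_surj: "f ` qfam p = carrier (shift m (quotient_module gwa_algebra I))"
    using surj by (auto simp: surjects_onto_def)
  note K = surjection_kernel[OF p0 I f f_surj]
  have mem: "qmonom i (p i) \<in> qfam p" for i using qmonom_in_qfam[of i p 1] by simp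
  have "qmonom i (p i) \<in> a_kernel (qsub (qfam p)) (shift m (quotient_module gwa_algebra I)) f"
    unfolding K using mem[of i] ij(1) by (auto simp: qcoeff_qmonom intro: exI[of _ 0])
  from kernel_closed[OF f I(1) this, of a]
  have "qmonom j (p j) \<in> a_kernel (qsub (qfam p)) (shift m (quotient_module gwa_algebra I)) f"
    using mem[of j] by (simp add: gen)
  then obtain g where "qcoeff (qmonom j (p j)) j = p j * to_fract (lin n * g)"
    unfolding K using ij(2) by (auto simp: e)
  then have "p j * to_fract 1 = p j * to_fract (lin n * g)" by (simp add: qcoeff_qmonom del: to_fract_mult)
  then have "1 = lin n * g" using p0[of j] by (simp del: to_fract_mult to_fract_1)
  then show False using lin_not_dvd_1[of n, where 'k = 'k] by (metis dvd_triv_left)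
qed

text \<open>The place \<open>n\<close> decides between the two clauses of the definition. In the clause that applies, the
  multiplier has cofactors composed of \<open>(z + j)\<^sup>2\<close> with \<open>j \<noteq> n\<close>, so the required surjections exist;
  the other clause is excluded by \<open>no_surjection\<close>. The kernel inserts a factor \<open>(z + n)\<^sup>2\<close> in the degrees
  \<open>i \<le> n\<close> or \<open>i > n\<close> respectively.\<close>

lemma iota_qfam:
  fixes p :: "int \<Rightarrow> 'k::field_char_0 poly fract"
  assumes p: "steps p T" and T: "finite {j. (j \<in> T) \<noteq> (j < 0)}"
  shows "iota n (qfam p) = qfam (\<lambda>i. p i * to_fract (if (i \<le> n) = (n \<notin> T) then lin n ^ 2 else 1))"
proof -
  have p0: "p i \<noteq> 0" for i using p unfolding steps_def by blast
  have p_step: "p i = to_fract (if i \<in> T then lin i ^ 2 else 1) * p (i + 1)" for i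
    using p unfolding steps_def by blast
  have W: "finite {j. (j \<in> T) \<noteq> (j < m)}" for m
  proof (rule finite_subset)
    show "{j. (j \<in> T) \<noteq> (j < m)} \<subseteq> {j. (j \<in> T) \<noteq> (j < 0)} \<union> {min 0 m..max 0 m}" by auto
  qed (use T in simp)
  have surj: "\<exists>f \<in> ghom gwa_algebra (qsub (qfam p)) (shift m (quotient_module gwa_algebra I)).
      f ` qfam p = carrier (shift m (quotient_module gwa_algebra I))"
    if I: "right_ideal I" "I = degree_ideal e D" and m: "(n \<in> T) = (n < m)"
      and e: "\<And>j. j \<noteq> n \<Longrightarrow> bezout (lin j) (pshift m e)" for I e D m
  proof -
    let ?W = "{j. (j \<in> T) \<noteq> (j < m)}"
    obtain t where t: "\<And>i. t * p i = to_fract (pshift m (acoeff (i - m)) * step_prod m ?W i)"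
      by (rule multiplier_exists[OF p W refl]) (rule that)
    have "bezout (step_prod m ?W i) (pshift m e)" for i
      unfolding step_prod_def using m by (intro bezout_prod) (auto intro!: bezout_power2 e)
    from surjection_exists[OF p0 I steps_closed[OF p] t this] show ?thesis .
  qed
  let ?P = "qsub (qfam p)" and ?R = "qfam (\<lambda>i. p i * to_fract (if (i \<le> n) = (n \<notin> T) then lin n ^ 2 else 1))"
  have bez1: "bezout (lin j) (lin n :: 'k poly)" if "j \<noteq> n" for j using that by (rule bezout_lin)
  have bez2: "bezout (lin j) (lin n ^ 2 :: 'k poly)" if "j \<noteq> n" for j
    using bezout_commute[OF bezout_power2[OF bezout_commute[OF bez1[OF that]]]] .
  have xA: "A_mod_xA = quotient_module gwa_algebra {gwa_x * a | a. True}"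
    and yA: "A_mod_yA = quotient_module gwa_algebra {gwa_y * a | a. True}"
    and X: "shift n X_simple = shift n (quotient_module gwa_algebra {gwa_x * a + gwa_z * b | a b. True})"
    and Y: "shift n Y_simple = shift (n + 1) (quotient_module gwa_algebra {gwa_y * a + (gwa_z - 1) * b | a b. True})"
    by (simp_all add: A_mod_xA_def A_mod_yA_def X_simple_def Y_simple_def shift_shift)
  show ?thesis
  proof (cases "n \<in> T")
    case False
    have kernel: "a_kernel ?P (shift n A_mod_xA) f = ?R"
      if "f \<in> ghom gwa_algebra ?P (shift n A_mod_xA)" "f ` qfam p = carrier (shift n A_mod_xA)" for f
      unfolding xA surjection_kernel[OF p0 right_ideal_principal xA_ideal that[unfolded xA]]
      using False qfam_divisible[of p "\<lambda>i. i \<le> n" "lin n ^ 2"] by simp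
    have "surjects_onto gwa_algebra ?P (shift n X_simple)"
      unfolding surjects_onto_def X qsub_simps
      by (rule surj[OF right_ideal_sum X_ideal]) (simp_all add: False bez1)
    moreover have "is_kernel_of_surjection gwa_algebra ?R ?P (shift n A_mod_xA)"
    proof -
      obtain f where f: "f \<in> ghom gwa_algebra ?P (shift n A_mod_xA)" "f ` qfam p = carrier (shift n A_mod_xA)"
        using surj[OF right_ideal_principal xA_ideal, of n] False bez2 unfolding xA by auto
      then show ?thesis using kernel[OF f] by (auto simp: is_kernel_of_surjection_def)
    qed
    moreover have "\<not> surjects_onto gwa_algebra ?P (shift n Y_simple)"
    proof
      assume *: "surjects_onto gwa_algebra ?P (shift n Y_simple)"
      show False
      proof (rule no_surjection[OF p right_ideal_sum Y_ideal _ *[unfolded Y]])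
        show "pshift (n + 1) (lin (- 1)) = (lin n :: 'k poly)" by simp
        show "qmonom n (p n) * gwa_embed gwa_x = qmonom (n + 1) (p (n + 1))"
          using False p_step[of n] by (simp add: gwa_embed_x qmonom_mult)
      qed simp_all
    qed
    ultimately show ?thesis
      unfolding iota_def using kernel
      by (intro the_equality) (auto simp: is_kernel_of_surjection_def)
  next
    case True
    have kernel: "a_kernel ?P (shift (n + 1) A_mod_yA) f = ?R"
      if "f \<in> ghom gwa_algebra ?P (shift (n + 1) A_mod_yA)" "f ` qfam p = carrier (shift (n + 1) A_mod_yA)" for f
      unfolding yA surjection_kernel[OF p0 right_ideal_principal yA_ideal that[unfolded yA]]
      using True qfam_divisible[of p "\<lambda>i. n + 1 \<le> i" "lin n ^ 2"]
      by (simp add: not_le zless_iff_Suc_zadd add1_zle_eq)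
    have "surjects_onto gwa_algebra ?P (shift n Y_simple)"
      unfolding surjects_onto_def Y qsub_simps
      by (rule surj[OF right_ideal_sum Y_ideal]) (simp_all add: True bez1)
    moreover have "is_kernel_of_surjection gwa_algebra ?R ?P (shift (n + 1) A_mod_yA)"
    proof -
      obtain f where f: "f \<in> ghom gwa_algebra ?P (shift (n + 1) A_mod_yA)" "f ` qfam p = carrier (shift (n + 1) A_mod_yA)"
        using surj[OF right_ideal_principal yA_ideal, of "n + 1"] True bez2 unfolding yA by auto
      then show ?thesis using kernel[OF f] by (auto simp: is_kernel_of_surjection_def)
    qed
    moreover have "\<not> surjects_onto gwa_algebra ?P (shift n X_simple)"
    proof
      assume *: "surjects_onto gwa_algebra ?P (shift n X_simple)"
      show False
      proof (rule no_surjection[OF p right_ideal_sum X_ideal _ *[unfolded X]])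
        show "pshift n (lin 0) = (lin n :: 'k poly)" by simp
        show "qmonom (n + 1) (p (n + 1)) * gwa_embed gwa_y = qmonom n (p n)"
          using True p_step[of n] by (simp add: gwa_embed_y qmonom_mult zshift_to_fract mult.commute)
      qed simp_all
    qed
    ultimately show ?thesis
      unfolding iota_def using kernel
      by (intro the_equality) (auto simp: is_kernel_of_surjection_def)
  qed
qed

definition sqprod :: "int set \<Rightarrow> 'k::field poly" where "sqprod S = (\<Prod>j\<in>S. lin j ^ 2)"

lemma sqprod_neq_0 [simp]: "sqprod S \<noteq> 0"
  by (cases "finite S") (auto simp: sqprod_def)

lemma sqprod_empty [simp]: "sqprod {} = 1" by (simp add: sqprod_def)

section \<open>The modules \<open>\<iota>\<^sub>J A\<close>\<close>

text \<open>The coefficients of \<open>c \<cdot> \<iota>\<^sub>S A\<close>. A set \<open>S\<close> and a scalar \<open>c\<close> suffice to follow iterated applications of the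
  \<open>\<iota>\<^sub>n\<close>: removing \<open>n\<close> from \<open>S\<close> is applying \<open>\<iota>\<^sub>n\<close> a second time, and contributes the scalar
  \<open>(z + n)\<^sup>2\<close>.\<close>

definition twist :: "int set \<Rightarrow> 'k::field poly fract \<Rightarrow> int \<Rightarrow> 'k poly fract" where
  "twist S c i = c * to_fract (step_prod 0 S i * acoeff i)"

lemma twist_0: "twist S c 0 = c * to_fract (sqprod S)"
proof -
  have "step_prod 0 S 0 = (sqprod S :: 'a poly)"
    unfolding step_prod_def sqprod_def by (intro prod.cong) auto
  then show ?thesis by (simp add: twist_def acoeff_def)
qed

lemma twist_scale: "twist S (c * d) i = c * twist S d i"
  by (simp add: twist_def mult.assoc)

lemma steps_twist:
  assumes S: "finite S" and c: "c \<noteq> 0"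
  shows "steps (twist S c) {i. (i < 0) \<noteq> (i \<in> S)}"
  unfolding steps_def
proof (intro allI conjI)
  fix i :: int
  show "twist S c i \<noteq> 0" using c by (simp add: twist_def)
  have v: "step_prod 0 S i * (if i \<in> S \<and> i < 0 then lin i ^ 2 else 1)
      = step_prod 0 S (i + 1) * (if i \<in> S \<and> 0 \<le> i then lin i ^ 2 else (1 :: 'a poly))"
    by (rule step_prod_step[OF S])
  have "step_prod 0 S i * acoeff i = (if (i < 0) \<noteq> (i \<in> S) then lin i ^ 2 else 1) * (step_prod 0 S (i + 1) * acoeff (i + 1) :: 'a poly)"
    unfolding acoeff_step[of i] using v by (cases "i < 0"; cases "i \<in> S") (simp_all add: mult_ac)
  then have "twist S c i = c * to_fract ((if (i < 0) \<noteq> (i \<in> S) then lin i ^ 2 else 1) * (step_prod 0 S (i + 1) * acoeff (i + 1)))"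
    by (simp only: twist_def)
  also have "\<dots> = to_fract (if i \<in> {i. (i < 0) \<noteq> (i \<in> S)} then lin i ^ 2 else 1) * twist S c (i + 1)"
    by (simp only: to_fract_mult twist_def mem_Collect_eq mult_ac)
  finally show "twist S c i = to_fract (if i \<in> {i. (i < 0) \<noteq> (i \<in> S)} then lin i ^ 2 else 1) * twist S c (i + 1)" .
qed

lemma iota_twist:
  fixes c :: "'k::field_char_0 poly fract"
  assumes S: "finite S" and c: "c \<noteq> 0"
  shows "iota n (qfam (twist S c))
    = qfam (twist (S - {n} \<union> ({n} - S)) (c * to_fract (if n \<in> S then lin n ^ 2 else 1)))"
proof -
  let ?T = "{i. (i < 0) \<noteq> (i \<in> S)}"
  have "finite {j. (j \<in> ?T) \<noteq> (j < 0)}" by (rule finite_subset[OF _ S]) auto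
  then have "iota n (qfam (twist S c)) = qfam (\<lambda>i. twist S c i * to_fract (if (i \<le> n) = (n \<notin> ?T) then lin n ^ 2 else 1))"
    by (rule iota_qfam[OF steps_twist[OF S c]])
  also have "(\<lambda>i. twist S c i * to_fract (if (i \<le> n) = (n \<notin> ?T) then lin n ^ 2 else 1))
      = twist (S - {n} \<union> ({n} - S)) (c * to_fract (if n \<in> S then lin n ^ 2 else 1))"
  proof
    fix i
    show "twist S c i * to_fract (if (i \<le> n) = (n \<notin> ?T) then lin n ^ 2 else 1)
        = twist (S - {n} \<union> ({n} - S)) (c * to_fract (if n \<in> S then lin n ^ 2 else 1)) i"
    proof (cases "n \<in> S")
      case True
      then have "step_prod 0 S i = (if (i \<le> n) = (0 \<le> n) then lin n ^ 2 else 1) * (step_prod 0 (S - {n}) i :: 'k poly)"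
        using S by (simp add: step_prod_def prod.remove)
      then show ?thesis using True by (auto simp: twist_def mult_ac Diff_triv)
    next
      case False
      then have "step_prod 0 (insert n S) i = (if (i \<le> n) = (0 \<le> n) then lin n ^ 2 else 1) * (step_prod 0 S i :: 'k poly)"
        using S by (simp add: step_prod_def)
      moreover have "S - {n} \<union> ({n} - S) = insert n S" using False by auto
      ultimately show ?thesis using False by (auto simp: twist_def mult_ac)
    qed
  qed
  finally show ?thesis .
qed

lemma foldr_iota_twist:
  fixes c :: "'k::field_char_0 poly fract"
  assumes "distinct xs" and S: "finite S" and c: "c \<noteq> 0"
  shows "foldr iota xs (qfam (twist S c))
    = qfam (twist (S - set xs \<union> (set xs - S)) (c * to_fract (sqprod (set xs \<inter> S))))"
  using assms(1)
proof (induction xs)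
  case Nil
  then show ?case by simp
next
  case (Cons x xs)
  let ?S = "S - set xs \<union> (set xs - S)" and ?c = "c * to_fract (sqprod (set xs \<inter> S))"
  have x: "x \<notin> set xs" using Cons by simp
  have "foldr iota (x # xs) (qfam (twist S c)) = iota x (qfam (twist ?S ?c))" using Cons by simp
  also have "\<dots> = qfam (twist (?S - {x} \<union> ({x} - ?S)) (?c * to_fract (if x \<in> ?S then lin x ^ 2 else 1)))"
    using S c by (intro iota_twist) auto
  also have "?S - {x} \<union> ({x} - ?S) = S - set (x # xs) \<union> (set (x # xs) - S)" using x by auto
  also have "?c * to_fract (if x \<in> ?S then lin x ^ 2 else 1) = c * to_fract (sqprod (set (x # xs) \<inter> S))"
    using x by (auto simp: sqprod_def mult_ac)
  finally show ?case .
qed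

lemma iota_set_twist:
  fixes c :: "'k::field_char_0 poly fract"
  assumes "c \<noteq> 0"
  shows "iota_set J (qfam (twist (elts L) c)) = qfam (twist (elts (L + J)) (c * to_fract (sqprod (elts (zfin_inter L J)))))"
  unfolding iota_set_def using foldr_iota_twist[OF distinct_sorted_list_of_set finite_elts assms, of "elts J" L]
  by (simp add: plus_zfin.rep_eq zfin_inter.rep_eq Int_commute)

lemma A_sub_twist: "A_sub = qfam (twist (elts 0) 1)"
  by (simp add: A_sub_qfam twist_def[abs_def] step_prod_def zero_zfin.rep_eq)

lemma zfin_add_self [simp]: "J + J = (0 :: zfin)" by transfer auto

lemma zfin_inter_simps [simp]: "zfin_inter J J = J" "zfin_inter 0 J = 0" "zfin_inter J 0 = 0"
  by (transfer, auto)+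

lemma iota_set_A_sub: "iota_set J (A_sub :: 'k::field_char_0 qgr set) = qfam (twist (elts J) 1)"
  using iota_set_twist[of "1 :: 'k poly fract" J 0] by (simp add: A_sub_twist zero_zfin.rep_eq)

lemma iota_set_iota_set_A_sub:
  "iota_set J (iota_set J (A_sub :: 'k::field_char_0 qgr set)) = qfam (twist (elts 0) (to_fract (sqprod (elts J))))"
  using iota_set_twist[of "1 :: 'k poly fract" J J] by (simp add: iota_set_A_sub)

lemma h_elt_sqprod: "h_elt J = to_fract (sqprod (elts J))"
proof -
  have "to_fract (prod f S) = (\<Prod>s\<in>S. to_fract (f s))" for f :: "int \<Rightarrow> 'a poly" and S
    by (induction S rule: infinite_finite_induct) simp_all
  then show ?thesis by (simp add: h_elt_def sqprod_def lin_def power2_eq_square to_fract_def flip: to_fract_mult)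
qed

lemma sqprod_add:
  "sqprod (elts I) * sqprod (elts J) = sqprod (elts (I + J)) * (sqprod (elts (zfin_inter I J)) ^ 2 :: 'k::field poly)"
proof -
  have "sqprod (elts I) = sqprod (elts I - elts J) * (sqprod (elts I \<inter> elts J) :: 'k poly)"
    "sqprod (elts J) = sqprod (elts J - elts I) * (sqprod (elts I \<inter> elts J) :: 'k poly)"
    "sqprod (elts (I + J)) = sqprod (elts I - elts J) * (sqprod (elts J - elts I) :: 'k poly)"
    unfolding sqprod_def plus_zfin.rep_eq
    by (subst prod.union_disjoint[symmetric]; force intro: prod.cong)+
  then show ?thesis by (simp add: zfin_inter.rep_eq power2_eq_square)
qed

section \<open>The components of \<open>B\<close> and their product\<close>

lemma qfam_twist_scale: "q \<in> qfam (twist S d) \<Longrightarrow> qmonom 0 c * q \<in> qfam (twist S (c * d))"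
  unfolding qfam_def by (auto simp: qcoeff_qmonom_mult twist_scale mult.assoc)

lemma qfam_twist_subset: "qfam (twist S c) \<subseteq> qfam (twist {} c)"
proof
  fix q assume q: "q \<in> qfam (twist S c)"
  have "\<exists>g. qcoeff q i = twist {} c i * to_fract g" for i
  proof -
    obtain g where "qcoeff q i = twist S c i * to_fract g" using q by (auto simp: qfam_def)
    then have "qcoeff q i = twist {} c i * to_fract (step_prod 0 S i * g)"
      by (simp add: twist_def step_prod_def[of 0 "{}"] mult_ac)
    then show ?thesis ..
  qed
  then show "q \<in> qfam (twist {} c)" by (simp add: qfam_def)
qed

text \<open>By \<open>B_comp_eq\<close> below, the homomorphisms \<open>A \<rightarrow> \<iota>\<^sub>J A\<close> are precisely these.\<close>

definition b_elem :: "zfin \<Rightarrow> 'k::field poly \<Rightarrow> 'k qgr \<Rightarrow> 'k qgr" where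
  "b_elem J g = (\<lambda>q\<in>A_sub. qmonom 0 (to_fract (sqprod (elts J) * g)) * q)"

lemma one_in_A_sub: "1 \<in> A_sub"
  unfolding A_sub_def using gwa_embed_one by (metis rangeI)

lemma b_elem_inject [simp]: "b_elem J g = b_elem J g' \<longleftrightarrow> g = g'"
proof
  assume "b_elem J g = b_elem J g'"
  then have "qcoeff (b_elem J g 1) 0 = qcoeff (b_elem J g' 1) 0" by simp
  then show "g = g'" by (simp add: b_elem_def qcoeff_qmonom one_in_A_sub del: to_fract_mult)
qed simp

lemma b_elem_0: "b_elem J 0 = B_comp_zero"
  by (simp add: b_elem_def B_comp_zero_def)

lemma b_elem_mem:
  assumes q: "q \<in> (A_sub :: 'k::field_char_0 qgr set)"
  shows "b_elem J g q \<in> iota_set J A_sub"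
proof -
  obtain a where a: "q = gwa_embed a" using q by (auto simp: A_sub_def)
  have "qmonom 0 (to_fract (sqprod (elts J) * g)) \<in> qfam (twist (elts J) 1)"
    using qmonom_in_qfam[of 0 "twist (elts J) 1" g] by (simp add: twist_0)
  from steps_closed[OF steps_twist[OF finite_elts] this, of a] show ?thesis
    using q by (simp add: b_elem_def a iota_set_A_sub)
qed

text \<open>A homomorphism out of \<open>A\<close> is determined by the image of \<open>1\<close>, which lies in degree \<open>0\<close>, and the degree
  \<open>0\<close> component of \<open>\<iota>\<^sub>J A\<close> is \<open>h\<^sub>J k[z]\<close>.\<close>

lemma B_comp_eq: "B_comp J = range (b_elem J :: 'k::field_char_0 poly \<Rightarrow> _)"
proof (intro equalityI subsetI)
  fix f :: "'k qgr \<Rightarrow> 'k qgr" assume "f \<in> B_comp J"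
  then have f: "f \<in> ghom gwa_algebra (qsub A_sub) (qsub (qfam (twist (elts J) 1)))"
    by (simp add: B_comp_def qhom_def iota_set_A_sub)
  have one: "1 \<in> hcomp (qsub (A_sub :: 'k qgr set)) 0"
    by (simp add: qsub_def one_in_A_sub) (simp add: qcoeff_qmonom flip: qmonom_one)
  have f1: "f 1 \<in> qfam (twist (elts J) 1)" "\<And>i. i \<noteq> 0 \<Longrightarrow> qcoeff (f 1) i = 0"
    using ghom_hcomp[OF f one] by (auto simp: qsub_def)
  then obtain g where g: "qcoeff (f 1) 0 = twist (elts J) 1 0 * to_fract g" by (auto simp: qfam_def)
  have f1': "f 1 = qmonom 0 (to_fract (sqprod (elts J) * g))"
    using f1(2) by (intro qgr_eqI) (auto simp: qcoeff_qmonom g twist_0)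
  have "f = b_elem J g"
  proof
    fix q
    show "f q = b_elem J g q"
    proof (cases "q \<in> A_sub")
      case True
      then obtain a where a: "q = gwa_embed a" by (auto simp: A_sub_def)
      have "f (ract (qsub A_sub) 1 a) = ract (qsub (qfam (twist (elts J) 1))) (f 1) a"
        by (rule ghom_ract[OF f]) (simp_all add: one_in_A_sub)
      then show ?thesis using True by (simp add: b_elem_def f1' a)
    next
      case False
      then show ?thesis using PiE_arb[OF ghom_funcset[OF f], of q] by (simp add: b_elem_def)
    qed
  qed
  then show "f \<in> range (b_elem J)" by blast
next
  fix f :: "'k qgr \<Rightarrow> 'k qgr" assume "f \<in> range (b_elem J)"
  then obtain g where f: "f = b_elem J g" by blast
  have act: "q * gwa_embed a \<in> A_sub" "q + q' \<in> A_sub" if "q \<in> A_sub" "q' \<in> A_sub" for q q' :: "'k qgr" and a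
    using that unfolding A_sub_def by (auto simp flip: gwa_embed_mult gwa_embed_add)
  show "f \<in> B_comp J"
    unfolding B_comp_def qhom_def f
  proof (rule ghomI)
    show "b_elem J g \<in> carrier (qsub A_sub) \<rightarrow>\<^sub>E carrier (qsub (iota_set J A_sub))"
      using b_elem_mem[of _ J g] by (auto simp: b_elem_def)
    fix i and q :: "'k qgr" assume "q \<in> hcomp (qsub A_sub) i"
    then have q: "q \<in> A_sub" "\<And>j. j \<noteq> i \<Longrightarrow> qcoeff q j = 0" by (auto simp: qsub_def)
    then show "b_elem J g q \<in> hcomp (qsub (iota_set J A_sub)) i"
      using b_elem_mem[OF q(1), of J g] by (simp add: qsub_def) (simp add: b_elem_def qcoeff_qmonom_mult)
  qed (simp_all add: b_elem_def act distrib_left mult.assoc)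
qed

text \<open>The product divides \<open>h\<^sub>I g h\<^sub>J g'\<close> by \<open>h\<close> of \<open>I \<inter> J\<close>, whereas \<open>h\<^sub>I h\<^sub>J = h\<^sub>I\<^sub>\<oplus>\<^sub>J h\<^sub>I\<^sub>\<inter>\<^sub>J\<^sup>2\<close>. Most of the work is
  to see that all values lie in the domains to which the maps are restricted.\<close>

lemma b_elem_compose:
  "B_comp_mult I J (b_elem I g) (b_elem J g' :: 'k::field_char_0 qgr \<Rightarrow> _)
    = b_elem (I + J) (sqprod (elts (zfin_inter I J)) * g * g')"
proof
  fix q :: "'k qgr"
  let ?K = "zfin_inter I J"
  let ?h = "\<lambda>J. sqprod (elts J) :: 'k poly"
  show "B_comp_mult I J (b_elem I g) (b_elem J g') q = b_elem (I + J) (?h ?K * g * g') q"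
  proof (cases "q \<in> A_sub")
    case False
    then show ?thesis by (simp add: B_comp_mult_def b_elem_def compose_def Let_def)
  next
    case True
    have sub: "iota_set J A_sub \<subseteq> (A_sub :: 'k qgr set)" for J
      unfolding iota_set_A_sub unfolding A_sub_twist zero_zfin.rep_eq by (rule qfam_twist_subset)
    note bq = b_elem_mem[OF True, of J g']
    have inner: "compose A_sub (iota_mor J A_sub (b_elem I g)) (b_elem J g') q
        = qmonom 0 (to_fract (?h I * g)) * (qmonom 0 (to_fract (?h J * g')) * q)"
      using True bq subsetD[OF sub bq] by (simp add: compose_def iota_mor_def) (simp add: b_elem_def True)
    have h: "(?h I * g) * (?h J * g') = ?h ?K * (?h (I + J) * (?h ?K * g * g'))"
      using sqprod_add[of I J, where 'k = 'k] by (simp add: power2_eq_square mult_ac)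
    then have "qmonom 0 (to_fract (?h I * g)) * (qmonom 0 (to_fract (?h J * g')) * q)
        = qmonom 0 (to_fract (?h ?K)) * (qmonom 0 (to_fract (?h (I + J) * (?h ?K * g * g'))) * q)"
      by (simp only: mult.assoc[symmetric, of "qmonom 0 _"] qmonom_mult zshift_zero add_0 to_fract_mult[symmetric])
    also have "\<dots> = qmonom 0 (to_fract (?h ?K)) * b_elem (I + J) (?h ?K * g * g') q"
      by (simp only: b_elem_def restrict_apply' True)
    finally have v: "compose A_sub (iota_mor J A_sub (b_elem I g)) (b_elem J g') q
        = qmonom 0 (to_fract (?h ?K)) * b_elem (I + J) (?h ?K * g * g') q" using inner by simp
    have mem: "qmonom 0 (to_fract (?h ?K)) * b_elem (I + J) (?h ?K * g * g') q \<in> qfam (twist (elts (I + J)) (to_fract (?h ?K)))"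
      using qfam_twist_scale[OF b_elem_mem[OF True, of "I + J" "?h ?K * g * g'", unfolded iota_set_A_sub], of "to_fract (?h ?K)"]
      by simp
    have dom: "iota_set (I + J) (iota_set ?K (iota_set ?K A_sub)) = qfam (twist (elts (I + J)) (to_fract (?h ?K)))"
      unfolding iota_set_iota_set_A_sub using iota_set_twist[of "to_fract (?h ?K)" "I + J" 0] by (simp add: zero_zfin.rep_eq)
    have dom2: "qfam (twist (elts (I + J)) (to_fract (?h ?K))) \<subseteq> iota_set ?K (iota_set ?K A_sub)"
      unfolding iota_set_iota_set_A_sub zero_zfin.rep_eq by (rule qfam_twist_subset)
    have "B_comp_mult I J (b_elem I g) (b_elem J g') q
        = qmonom 0 (inverse (to_fract (?h ?K))) * (qmonom 0 (to_fract (?h ?K)) * b_elem (I + J) (?h ?K * g * g') q)"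
      using True v mem subsetD[OF dom2 mem]
      by (simp add: B_comp_mult_def Let_def compose_eq iota_mor_def dom sigma_def h_elt_sqprod)
    also have "\<dots> = b_elem (I + J) (?h ?K * g * g') q"
      by (simp add: qmonom_mult qmonom_one flip: mult.assoc)
    finally show ?thesis .
  qed
qed

section \<open>\<open>B\<close> as a graded algebra\<close>

lemma ringI_embedding:
  fixes R (structure) and \<gamma> :: "'r \<Rightarrow> 's::ring_1"
  assumes inj: "inj_on \<gamma> (carrier R)"
    and closed: "\<And>x y. x \<in> carrier R \<Longrightarrow> y \<in> carrier R \<Longrightarrow> x \<oplus> y \<in> carrier R"
      "\<And>x y. x \<in> carrier R \<Longrightarrow> y \<in> carrier R \<Longrightarrow> x \<otimes> y \<in> carrier R"
      "\<zero> \<in> carrier R" "\<one> \<in> carrier R"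
      "\<And>x. x \<in> carrier R \<Longrightarrow> \<exists>y\<in>carrier R. \<gamma> y = - \<gamma> x"
    and hom: "\<And>x y. x \<in> carrier R \<Longrightarrow> y \<in> carrier R \<Longrightarrow> \<gamma> (x \<oplus> y) = \<gamma> x + \<gamma> y"
      "\<And>x y. x \<in> carrier R \<Longrightarrow> y \<in> carrier R \<Longrightarrow> \<gamma> (x \<otimes> y) = \<gamma> x * \<gamma> y"
      "\<gamma> \<zero> = 0" "\<gamma> \<one> = 1"
  shows "ring R"
proof -
  have eqI: "x = y" if "x \<in> carrier R" "y \<in> carrier R" "\<gamma> x = \<gamma> y" for x y
    using inj that by (simp add: inj_on_def)
  show ?thesis
  proof (rule ringI)
    show "abelian_group R"
    proof (rule abelian_groupI)
      fix x assume x: "x \<in> carrier R"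
      then obtain y where "y \<in> carrier R" "\<gamma> y = - \<gamma> x" using closed(5) by blast
      then show "\<exists>y\<in>carrier R. y \<oplus> x = \<zero>" using x by (intro bexI[of _ y] eqI) (simp_all add: closed hom)
    qed (simp_all add: closed, (rule eqI; simp add: closed hom add_ac)+)
    show "monoid R"
      by (rule monoidI) (simp_all add: closed, (rule eqI; simp add: closed hom mult.assoc)+)
  qed (rule eqI; simp add: closed hom distrib_left distrib_right)+
qed

text \<open>A square root of \<open>h\<^sub>J\<close>. Since \<open>linprod I * linprod J = h\<^sub>I\<^sub>\<inter>\<^sub>J linprod (I + J)\<close>, the map that sends the element
  with coefficient \<open>g\<close> in degree \<open>J\<close> to \<open>linprod J * g\<close> turns the twisted product of \<open>B\<close> into that of the group
  algebra of \<open>zfin\<close> over \<open>k[z]\<close>.\<close>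

definition linprod :: "zfin \<Rightarrow> 'k::field poly" where "linprod J = (\<Prod>j\<in>elts J. lin j)"

lemma linprod_neq_0 [simp]: "linprod J \<noteq> 0" by (simp add: linprod_def)

lemma linprod_0 [simp]: "linprod 0 = 1" by (simp add: linprod_def zero_zfin.rep_eq)

lemma sqprod_linprod: "sqprod (elts J) = linprod J ^ 2"
  by (simp add: sqprod_def linprod_def prod_power_distrib)

lemma linprod_mult: "linprod I * linprod J = linprod (I + J) * (sqprod (elts (zfin_inter I J)) :: 'k::field poly)"
proof -
  have "linprod I = (\<Prod>j\<in>elts I - elts J. lin j) * (\<Prod>j\<in>elts I \<inter> elts J. lin j :: 'k poly)"
    "linprod J = (\<Prod>j\<in>elts J - elts I. lin j) * (\<Prod>j\<in>elts I \<inter> elts J. lin j :: 'k poly)"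
    "linprod (I + J) = (\<Prod>j\<in>elts I - elts J. lin j) * (\<Prod>j\<in>elts J - elts I. lin j :: 'k poly)"
    unfolding linprod_def plus_zfin.rep_eq
    by (subst prod.union_disjoint[symmetric]; force intro: prod.cong)+
  then show ?thesis by (simp add: zfin_inter.rep_eq sqprod_def prod.distrib power2_eq_square)
qed

definition b_coeff :: "(zfin \<Rightarrow> 'k::field qgr \<Rightarrow> 'k qgr) \<Rightarrow> zfin \<Rightarrow> 'k poly" where
  "b_coeff b J = (THE g. b J = b_elem J g)"

lemma b_coeff_eq: "b J = b_elem J g \<Longrightarrow> b_coeff b J = g"
  unfolding b_coeff_def by (rule the_equality) auto

lemma b_elem_coeff:
  assumes "b \<in> (B_carrier :: (zfin \<Rightarrow> 'k::field_char_0 qgr \<Rightarrow> _) set)"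
  shows "b_elem J (b_coeff b J) = b J"
proof -
  from assms have "b J \<in> range (b_elem J)" by (simp add: B_carrier_def B_comp_eq)
  then obtain g where "b J = b_elem J g" by blast
  then show ?thesis using b_coeff_eq[of b J g] by simp
qed

lemma b_elem_eq_zero_iff: "b_elem J g = B_comp_zero \<longleftrightarrow> g = 0"
  using b_elem_inject[of J g 0] by (simp add: b_elem_0)

lemma b_coeff_eq_0_iff:
  assumes "b \<in> (B_carrier :: (zfin \<Rightarrow> 'k::field_char_0 qgr \<Rightarrow> _) set)"
  shows "b_coeff b J = 0 \<longleftrightarrow> b J = B_comp_zero"
  using b_elem_coeff[OF assms, of J] b_elem_eq_zero_iff by metis

lemma B_carrier_iff:
  "b \<in> (B_carrier :: (zfin \<Rightarrow> 'k::field_char_0 qgr \<Rightarrow> _) set) \<longleftrightarrow>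
     (\<exists>g. (\<forall>J. b J = b_elem J (g J)) \<and> finite {J. g J \<noteq> 0})"
proof
  assume b: "b \<in> B_carrier"
  then have "finite {J. b_coeff b J \<noteq> 0}" by (simp add: b_coeff_eq_0_iff) (simp add: B_carrier_def)
  then show "\<exists>g. (\<forall>J. b J = b_elem J (g J)) \<and> finite {J. g J \<noteq> 0}"
    using b_elem_coeff[OF b] by (intro exI[of _ "b_coeff b"]) simp
next
  assume "\<exists>g. (\<forall>J. b J = b_elem J (g J)) \<and> finite {J. g J \<noteq> 0}"
  then show "b \<in> B_carrier" by (auto simp: B_carrier_def B_comp_eq b_elem_eq_zero_iff)
qed

definition b_single :: "zfin \<Rightarrow> 'k::field poly \<Rightarrow> zfin \<Rightarrow> 'k qgr \<Rightarrow> 'k qgr" where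
  "b_single J g = (\<lambda>I. b_elem I (if I = J then g else 0))"

text \<open>The embedding of \<open>B\<close> into the group algebra, from which \<open>B\<close> inherits the ring axioms and commutativity.\<close>

definition b_embed :: "(zfin \<Rightarrow> 'k::field qgr \<Rightarrow> 'k qgr) \<Rightarrow> zfin \<Rightarrow>\<^sub>0 'k poly" where
  "b_embed b = Abs_poly_mapping (\<lambda>J. linprod J * b_coeff b J)"

lemma lookup_b_embed:
  assumes "\<And>J. b J = b_elem J (g J)" "finite {J. g J \<noteq> 0}"
  shows "Poly_Mapping.lookup (b_embed b) J = linprod J * g J"
proof -
  have "b_coeff b = g" using b_coeff_eq[OF assms(1)] by (rule ext)
  then show ?thesis using assms(2) by (simp add: b_embed_def Abs_poly_mapping_inverse)
qed

lemma b_single_carrier: "b_single J g \<in> (B_carrier :: (zfin \<Rightarrow> 'k::field_char_0 qgr \<Rightarrow> _) set)"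
  unfolding B_carrier_iff b_single_def
  by (intro exI[of _ "\<lambda>I. if I = J then g else 0"]) simp

lemma b_embed_single: "b_embed (b_single J g) = Poly_Mapping.single J (linprod J * g)"
  by (rule poly_mapping_eqI, subst lookup_b_embed[of _ "\<lambda>I. if I = J then g else 0"])
    (auto simp: b_single_def lookup_single when_def)

lemma b_embed_inj: "inj_on b_embed (B_carrier :: (zfin \<Rightarrow> 'k::field_char_0 qgr \<Rightarrow> _) set)"
proof (rule inj_onI, rule ext)
  fix a b :: "zfin \<Rightarrow> 'k qgr \<Rightarrow> 'k qgr" and J
  assume a: "a \<in> B_carrier" and b: "b \<in> B_carrier" and eq: "b_embed a = b_embed b"
  obtain f where f: "\<And>J. a J = b_elem J (f J)" "finite {J. f J \<noteq> 0}" using a by (auto simp: B_carrier_iff)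
  obtain g where g: "\<And>J. b J = b_elem J (g J)" "finite {J. g J \<noteq> 0}" using b by (auto simp: B_carrier_iff)
  have "linprod J * f J = linprod J * g J" using eq lookup_b_embed[OF f, of J] lookup_b_embed[OF g, of J] by simp
  then show "a J = b J" by (simp add: f g)
qed

lemma lookup_times_superset:
  fixes f g :: "'g::monoid_add \<Rightarrow>\<^sub>0 's::semiring_0"
  assumes "finite S" "finite T" "\<And>I. I \<notin> S \<Longrightarrow> Poly_Mapping.lookup f I = 0" "\<And>J. J \<notin> T \<Longrightarrow> Poly_Mapping.lookup g J = 0"
  shows "Poly_Mapping.lookup (f * g) K = (\<Sum>(I, J)\<in>{(I, J). I \<in> S \<and> J \<in> T \<and> I + J = K}. Poly_Mapping.lookup f I * Poly_Mapping.lookup g J)"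
proof -
  have sum_single: "(\<Sum>I\<in>S. Poly_Mapping.single I (Poly_Mapping.lookup f I)) = f"
    if "finite S" "\<And>I. I \<notin> S \<Longrightarrow> Poly_Mapping.lookup f I = 0" for S and f :: "'g \<Rightarrow>\<^sub>0 's"
    using that by (intro poly_mapping_eqI) (auto simp: lookup_sum lookup_single when_def)
  have "f * g = (\<Sum>I\<in>S. Poly_Mapping.single I (Poly_Mapping.lookup f I)) * (\<Sum>J\<in>T. Poly_Mapping.single J (Poly_Mapping.lookup g J))"
    using assms by (simp add: sum_single)
  also have "\<dots> = (\<Sum>(I, J)\<in>S \<times> T. Poly_Mapping.single (I + J) (Poly_Mapping.lookup f I * Poly_Mapping.lookup g J))"
    by (simp add: sum_product sum.cartesian_product mult_single)
  finally have "Poly_Mapping.lookup (f * g) K = (\<Sum>(I, J)\<in>S \<times> T. if I + J = K then Poly_Mapping.lookup f I * Poly_Mapping.lookup g J else 0)"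
    by (simp add: lookup_sum lookup_single when_def split_def)
  also have "\<dots> = (\<Sum>p\<in>{p \<in> S \<times> T. fst p + snd p = K}. Poly_Mapping.lookup f (fst p) * Poly_Mapping.lookup g (snd p))"
    using assms by (subst sum.inter_filter) (auto simp: split_def)
  also have "{p \<in> S \<times> T. fst p + snd p = K} = {(I, J). I \<in> S \<and> J \<in> T \<and> I + J = K}" by auto
  finally show ?thesis by (simp add: split_def)
qed

lemma b_elem_add: "(\<lambda>q\<in>A_sub. b_elem J f q + b_elem J g q) = b_elem J (f + g)"
  by (rule ext) (simp add: b_elem_def distrib_left distrib_right qmonom_add)

lemma b_elem_sum:
  assumes "q \<in> A_sub"
  shows "(\<Sum>s\<in>S. b_elem J (f s) q) = b_elem J (\<Sum>s\<in>S. f s) q"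
proof (induction S rule: infinite_finite_induct)
  case (insert s S)
  then show ?case using fun_cong[OF b_elem_add[of J "f s" "\<Sum>s\<in>S. f s"], of q] assms by simp
qed (use assms in \<open>simp_all add: b_elem_def\<close>)

lemma B_mult_b_elem:
  fixes a b :: "zfin \<Rightarrow> 'k::field_char_0 qgr \<Rightarrow> 'k qgr"
  assumes a: "\<And>J. a J = b_elem J (f J)" and b: "\<And>J. b J = b_elem J (g J)"
  shows "B_mult a b K = b_elem K (\<Sum>(I, J)\<in>{(I, J). I \<in> {I. f I \<noteq> 0} \<and> J \<in> {J. g J \<noteq> 0} \<and> I + J = K}.
    sqprod (elts (zfin_inter I J)) * f I * g J)"
proof -
  let ?S = "{(I, J). I \<in> {I. f I \<noteq> 0} \<and> J \<in> {J. g J \<noteq> 0} \<and> I + J = K}"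
  have "B_mult a b K = (\<lambda>q\<in>A_sub. \<Sum>(I, J)\<in>?S. b_elem K (sqprod (elts (zfin_inter I J)) * f I * g J) q)"
    unfolding B_mult_def a b b_elem_eq_zero_iff
    by (intro restrict_ext sum.cong) (auto simp: b_elem_compose)
  also have "\<dots> = (\<lambda>q\<in>A_sub. b_elem K (\<Sum>(I, J)\<in>?S. sqprod (elts (zfin_inter I J)) * f I * g J) q)"
    by (intro restrict_ext) (simp add: split_def b_elem_sum)
  also have "\<dots> = b_elem K (\<Sum>(I, J)\<in>?S. sqprod (elts (zfin_inter I J)) * f I * g J)"
    by (auto simp: b_elem_def)
  finally show ?thesis .
qed

lemma b_mult_support:
  fixes f g :: "zfin \<Rightarrow> 'k::field poly"
  assumes "finite {J. f J \<noteq> 0}" "finite {J. g J \<noteq> 0}"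
  shows "finite {K. (\<Sum>(I, J)\<in>{(I, J). I \<in> {I. f I \<noteq> 0} \<and> J \<in> {J. g J \<noteq> 0} \<and> I + J = K}. h I J) \<noteq> 0}"
proof (rule finite_subset)
  show "{K. (\<Sum>(I, J)\<in>{(I, J). I \<in> {I. f I \<noteq> 0} \<and> J \<in> {J. g J \<noteq> 0} \<and> I + J = K}. h I J) \<noteq> 0}
      \<subseteq> (\<lambda>(I, J). I + J) ` ({J. f J \<noteq> 0} \<times> {J. g J \<noteq> 0})"
    by (force elim: sum.not_neutral_contains_not_neutral)
qed (use assms in auto)

lemma b_embed_mult:
  fixes a b :: "zfin \<Rightarrow> 'k::field_char_0 qgr \<Rightarrow> 'k qgr"
  assumes a: "a \<in> B_carrier" and b: "b \<in> B_carrier"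
  shows "B_mult a b \<in> B_carrier" "b_embed (B_mult a b) = b_embed a * b_embed b"
proof -
  obtain f where f: "\<And>J. a J = b_elem J (f J)" "finite {J. f J \<noteq> 0}" using a by (auto simp: B_carrier_iff)
  obtain g where g: "\<And>J. b J = b_elem J (g J)" "finite {J. g J \<noteq> 0}" using b by (auto simp: B_carrier_iff)
  note ab = B_mult_b_elem[OF f(1) g(1)] and fin = b_mult_support[OF f(2) g(2), of "\<lambda>I J. sqprod (elts (zfin_inter I J)) * f I * g J"]
  show "B_mult a b \<in> B_carrier" unfolding B_carrier_iff by (intro exI conjI allI) (rule ab, rule fin)
  show "b_embed (B_mult a b) = b_embed a * b_embed b"
  proof (rule poly_mapping_eqI)
    fix K
    let ?S = "{(I, J). I \<in> {I. f I \<noteq> 0} \<and> J \<in> {J. g J \<noteq> 0} \<and> I + J = K}"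
    have "Poly_Mapping.lookup (b_embed (B_mult a b)) K = linprod K * (\<Sum>(I, J)\<in>?S. sqprod (elts (zfin_inter I J)) * f I * g J)"
      by (rule lookup_b_embed[OF ab fin])
    also have "\<dots> = (\<Sum>(I, J)\<in>?S. (linprod I * f I) * (linprod J * g J))"
      unfolding sum_distrib_left
    proof (rule sum.cong[OF refl], clarify)
      fix I J
      show "linprod (I + J) * (sqprod (elts (zfin_inter I J)) * f I * g J) = linprod I * f I * (linprod J * g J)"
        using linprod_mult[of I J, where 'k = 'k] by (simp add: mult_ac)
    qed
    also have "\<dots> = Poly_Mapping.lookup (b_embed a * b_embed b) K"
      by (subst lookup_times_superset[OF f(2) g(2)]) (simp_all add: lookup_b_embed[OF f] lookup_b_embed[OF g])
    finally show "Poly_Mapping.lookup (b_embed (B_mult a b)) K = Poly_Mapping.lookup (b_embed a * b_embed b) K" .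
  qed
qed

lemma b_embed_add:
  fixes a b :: "zfin \<Rightarrow> 'k::field_char_0 qgr \<Rightarrow> 'k qgr"
  assumes a: "a \<in> B_carrier" and b: "b \<in> B_carrier"
  shows "(\<lambda>J. \<lambda>q\<in>A_sub. a J q + b J q) \<in> B_carrier" "b_embed (\<lambda>J. \<lambda>q\<in>A_sub. a J q + b J q) = b_embed a + b_embed b"
proof -
  obtain f where f: "\<And>J. a J = b_elem J (f J)" "finite {J. f J \<noteq> 0}" using a by (auto simp: B_carrier_iff)
  obtain g where g: "\<And>J. b J = b_elem J (g J)" "finite {J. g J \<noteq> 0}" using b by (auto simp: B_carrier_iff)
  have ab: "(\<lambda>q\<in>A_sub. a J q + b J q) = b_elem J (f J + g J)" for J by (simp add: f g b_elem_add)
  have fin: "finite {J. f J + g J \<noteq> 0}"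
    by (rule finite_subset[of _ "{J. f J \<noteq> 0} \<union> {J. g J \<noteq> 0}"]) (use f g in auto)
  show "(\<lambda>J. \<lambda>q\<in>A_sub. a J q + b J q) \<in> B_carrier"
    unfolding B_carrier_iff by (intro exI conjI allI) (rule ab, rule fin)
  show "b_embed (\<lambda>J. \<lambda>q\<in>A_sub. a J q + b J q) = b_embed a + b_embed b"
    by (rule poly_mapping_eqI)
      (simp add: lookup_b_embed[of _ "\<lambda>J. f J + g J", OF ab fin] lookup_add lookup_b_embed[OF f] lookup_b_embed[OF g] distrib_left)
qed

lemma B_scalar_single: "B_scalar c = b_single 0 [:c:]"
proof -
  have "b_elem 0 [:c:] = (\<lambda>q\<in>A_sub. qmonom 0 (Fract [:c:] 1) * q)"
    by (simp add: b_elem_def zero_zfin.rep_eq to_fract_def)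
  then show ?thesis by - (rule ext, simp add: B_scalar_def b_single_def b_elem_0)
qed

lemma B_zero_single: "(\<lambda>J. B_comp_zero) = b_single 0 0"
  by (rule ext) (simp add: b_single_def b_elem_0)

lemma B_ring: "ring (B_algebra :: ('k::field_char_0, zfin, zfin \<Rightarrow> 'k qgr \<Rightarrow> 'k qgr) galgebra)"
proof (rule ringI_embedding[of b_embed])
  fix a :: "zfin \<Rightarrow> 'k qgr \<Rightarrow> 'k qgr" assume "a \<in> carrier B_algebra"
  then obtain f where f: "\<And>J. a J = b_elem J (f J)" "finite {J. f J \<noteq> 0}"
    by (auto simp: B_carrier_iff B_algebra_def)
  have "b_embed (\<lambda>J. b_elem J (- f J)) = - b_embed a"
    using f(2) by (intro poly_mapping_eqI) (simp add: lookup_b_embed[of _ "\<lambda>J. - f J"] lookup_b_embed[OF f])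
  moreover have "(\<lambda>J. b_elem J (- f J)) \<in> B_carrier" unfolding B_carrier_iff
    using f(2) by (intro exI[of _ "\<lambda>J. - f J"]) simp
  ultimately show "\<exists>b\<in>carrier B_algebra. b_embed b = - b_embed a" by (auto simp: B_algebra_def)
qed (simp_all add: B_algebra_def b_embed_inj b_embed_mult b_embed_add B_zero_single B_scalar_single b_single_carrier
    b_embed_single flip: one_pCons)

lemma hpart_B: "hpart B_algebra J = range (b_single J :: 'k::field_char_0 poly \<Rightarrow> _)"
proof (intro equalityI subsetI)
  fix b :: "zfin \<Rightarrow> 'k qgr \<Rightarrow> 'k qgr" assume "b \<in> hpart B_algebra J"
  then have b: "b \<in> B_carrier" "\<And>I. I \<noteq> J \<Longrightarrow> b I = B_comp_zero" by (auto simp: B_algebra_def)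
  then have "b = b_single J (b_coeff b J)"
    by - (rule ext, auto simp: b_single_def b_elem_coeff b_elem_0)
  then show "b \<in> range (b_single J)" by blast
next
  fix b :: "zfin \<Rightarrow> 'k qgr \<Rightarrow> 'k qgr" assume "b \<in> range (b_single J)"
  then obtain g where b: "b = b_single J g" by blast
  have "b \<in> B_carrier" unfolding b by (rule b_single_carrier)
  moreover have "b I = B_comp_zero" if "I \<noteq> J" for I using that by (simp add: b b_single_def b_elem_0)
  ultimately show "b \<in> hpart B_algebra J" by (simp add: B_algebra_def)
qed

lemma b_single_inject [simp]: "b_single J g = b_single J g' \<longleftrightarrow> g = g'"
proof
  assume "b_single J g = b_single J g'"
  then have "b_single J g J = b_single J g' J" by simp
  then show "g = g'" by (simp add: b_single_def)
qed simp

lemma b_single_add: "b_single J g \<oplus>\<^bsub>B_algebra\<^esub> b_single J g' = b_single J (g + g')"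
  by (rule ext) (simp add: B_algebra_def b_single_def b_elem_add)

lemma b_single_mult_eqI:
  fixes g g' h :: "'k::field_char_0 poly"
  assumes "linprod I * g * (linprod J * g') = linprod (I + J) * h"
  shows "b_single I g \<otimes>\<^bsub>B_algebra\<^esub> b_single J g' = b_single (I + J) h"
proof (rule inj_onD[OF b_embed_inj])
  show "b_embed (b_single I g \<otimes>\<^bsub>B_algebra\<^esub> b_single J g') = b_embed (b_single (I + J) h)"
    using assms by (simp add: B_algebra_def b_embed_mult b_single_carrier b_embed_single mult_single)
qed (simp_all add: B_algebra_def b_embed_mult b_single_carrier)

lemma B_graded_algebra:
  "graded_algebra (B_algebra :: ('k::field_char_0, zfin, zfin \<Rightarrow> 'k qgr \<Rightarrow> 'k qgr) galgebra)"
proof -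
  let ?B = "B_algebra :: ('k, zfin, zfin \<Rightarrow> 'k qgr \<Rightarrow> 'k qgr) galgebra"
  interpret ring ?B by (rule B_ring)
  have carrier: "carrier ?B = B_carrier" by (simp add: B_algebra_def)
  have zero: "\<zero>\<^bsub>?B\<^esub> = b_single J 0" for J
    by (rule ext) (simp add: B_algebra_def b_single_def b_elem_0)
  have hc: "b_single J g \<in> carrier ?B" for J g by (simp add: carrier b_single_carrier)
  have "graded_group ?B (hpart ?B)"
  proof (rule graded_groupI[where \<pi> = "\<lambda>J b. b_single J (b_coeff b J)", OF abelian_group_axioms])
    show "subgroup (hpart ?B J) (add_monoid ?B)" for J
    proof (rule add.subgroupI)
      fix b assume "b \<in> hpart ?B J"
      then obtain g where g: "b = b_single J g" by (auto simp: hpart_B)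
      have "b_single J (- g) \<oplus>\<^bsub>?B\<^esub> b = \<zero>\<^bsub>?B\<^esub>" by (simp add: g b_single_add zero[of J])
      then have "\<ominus>\<^bsub>?B\<^esub> b = b_single J (- g)" using g hc by (intro minus_equality) auto
      then show "\<ominus>\<^bsub>?B\<^esub> b \<in> hpart ?B J" by (simp add: hpart_B)
    qed (auto simp: hpart_B hc b_single_add)
  next
    fix J and a b :: "zfin \<Rightarrow> 'k qgr \<Rightarrow> 'k qgr" assume "a \<in> carrier ?B" "b \<in> carrier ?B"
    then have ab: "a \<in> B_carrier" "b \<in> B_carrier" by (simp_all add: carrier)
    have "(a \<oplus>\<^bsub>?B\<^esub> b) J = (\<lambda>q\<in>A_sub. b_elem J (b_coeff a J) q + b_elem J (b_coeff b J) q)"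
      using ab by (simp add: B_algebra_def b_elem_coeff)
    then have "b_coeff (a \<oplus>\<^bsub>?B\<^esub> b) J = b_coeff a J + b_coeff b J"
      unfolding b_elem_add by (rule b_coeff_eq)
    then show "b_single J (b_coeff (a \<oplus>\<^bsub>?B\<^esub> b) J) = b_single J (b_coeff a J) \<oplus>\<^bsub>?B\<^esub> b_single J (b_coeff b J)"
      by (simp add: b_single_add)
  next
    fix J b assume "b \<in> hpart ?B J"
    then obtain g where g: "b = b_single J g" by (auto simp: hpart_B)
    have c: "b_coeff (b_single J g) I = (if I = J then g else 0)" for I
      by (rule b_coeff_eq) (simp add: b_single_def)
    show "b_single J (b_coeff b J) = b" by (simp add: g c)
    fix I assume "I \<noteq> J"
    then show "b_single I (b_coeff b I) = \<zero>\<^bsub>?B\<^esub>" by (simp add: g c zero[of I])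
  next
    fix b assume "b \<in> carrier ?B"
    then have b: "b \<in> B_carrier" by (simp add: carrier)
    have eq: "b_single J (b_coeff b J) = \<zero>\<^bsub>?B\<^esub> \<longleftrightarrow> b J = B_comp_zero" for J
      unfolding zero[of J] using b_coeff_eq_0_iff[OF b, of J] by simp
    show "finite {J. b_single J (b_coeff b J) \<noteq> \<zero>\<^bsub>?B\<^esub>}" unfolding eq using b by (simp add: B_carrier_def)
    assume "\<And>J. b_single J (b_coeff b J) = \<zero>\<^bsub>?B\<^esub>"
    then show "b = \<zero>\<^bsub>?B\<^esub>" unfolding eq by - (rule ext, simp add: B_algebra_def)
  qed (simp add: hpart_B)
  then show ?thesis
  proof (intro graded_algebra.intro graded_algebra_axioms.intro B_ring)
    fix a b :: "zfin \<Rightarrow> 'k qgr \<Rightarrow> 'k qgr" and c d :: 'k and I J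
    assume "a \<in> hpart ?B I" "b \<in> hpart ?B J"
    then obtain f g where "a = b_single I f" "b = b_single J g" by (auto simp: hpart_B)
    then have "a \<otimes>\<^bsub>?B\<^esub> b = b_single (I + J) (sqprod (elts (zfin_inter I J)) * f * g)"
      using linprod_mult[of I J, where 'k = 'k]
      by (simp only:) (rule b_single_mult_eqI, simp add: mult_ac)
    then show "a \<otimes>\<^bsub>?B\<^esub> b \<in> hpart ?B (I + J)" by (simp add: hpart_B)
  next
    fix c d :: 'k
    have scal: "scal ?B c = b_single 0 [:c:]" for c by (simp add: B_algebra_def B_scalar_single)
    show "\<one>\<^bsub>?B\<^esub> \<in> hpart ?B 0" by (simp add: hpart_B) (simp add: B_algebra_def B_scalar_single)
    show "scal ?B c \<in> hpart ?B 0" by (simp add: hpart_B scal)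
    show "scal ?B 1 = \<one>\<^bsub>?B\<^esub>" by (simp add: B_algebra_def)
    show "scal ?B (c + d) = scal ?B c \<oplus>\<^bsub>?B\<^esub> scal ?B d" by (simp add: scal b_single_add)
    show "scal ?B (c * d) = scal ?B c \<otimes>\<^bsub>?B\<^esub> scal ?B d"
      using b_single_mult_eqI[of 0 "[:c:]" 0 "[:d:]" "[:c * d:]"] by (simp add: scal mult.commute)
    fix r assume "r \<in> carrier ?B"
    then have r: "r \<in> B_carrier" by (simp add: carrier)
    show "scal ?B c \<otimes>\<^bsub>?B\<^esub> r = r \<otimes>\<^bsub>?B\<^esub> scal ?B c"
      unfolding scal
      by (rule inj_onD[OF b_embed_inj]) (simp_all add: B_algebra_def b_embed_mult r b_single_carrier mult.commute)
  qed
qed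

section \<open>The equivalence\<close>

text \<open>The path \<open>J\<^sub>i\<close> of degrees: consecutive intervals differ by the singleton \<open>i\<close>.\<close>

definition interval :: "int \<Rightarrow> zfin" where
  "interval i = Zfin {min 0 i..<max 0 i}"

lemma elts_interval: "elts (interval i) = {min 0 i..<max 0 i}"
  by (simp add: interval_def Zfin_inverse)

lemma elts_interval_diff: "elts (interval k - interval i) = {min i k..<max i k}"
  by (auto simp: minus_zfin.rep_eq elts_interval)

lemma zfin_diff_commute: "I - J = J - (I :: zfin)"
  by transfer auto

text \<open>A function \<open>s\<close> with \<open>s\<^sub>i\<^sub>+\<^sub>1 = (z + i) s\<^sub>i\<close>. It expresses the products over the intervals between \<open>i\<close> and
  \<open>k\<close> as \<open>s\<^sub>k / s\<^sub>i\<close> or \<open>s\<^sub>i / s\<^sub>k\<close>, so that the case distinction by the order of \<open>i\<close> and \<open>k\<close> is confined to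
  \<open>pshift_acoeff_ratio\<close>.\<close>

definition lin_ratio :: "int \<Rightarrow> 'k::field poly fract" where
  "lin_ratio i = to_fract (\<Prod>j\<in>{0..<i}. lin j) / to_fract (\<Prod>j\<in>{i..<0}. lin j)"

lemma prod_lin_neq_0 [simp]: "(\<Prod>j\<in>S. lin j) \<noteq> (0 :: 'k::field poly)"
  by (cases "finite S") simp_all

lemma lin_ratio_neq_0 [simp]: "lin_ratio i \<noteq> 0"
  by (simp add: lin_ratio_def)

lemma lin_ratio_step: "lin_ratio (i + 1) = to_fract (lin i) * lin_ratio i"
proof (cases "i \<ge> 0")
  case True
  then have "{0..<i + 1} = insert i {0..<i}" by auto
  then show ?thesis using True by (simp add: lin_ratio_def)
next
  case False
  then have "{i..<0} = insert i {i + 1..<0}" by auto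
  then show ?thesis using False by (simp add: lin_ratio_def)
qed

lemma lin_ratio_interval:
  assumes "i \<le> k"
  shows "lin_ratio k = to_fract (\<Prod>j\<in>{i..<k}. lin j) * lin_ratio i"
  using assms
proof (induction k rule: int_ge_induct)
  case (step k)
  then have "{i..<k + 1} = insert k {i..<k}" by auto
  then show ?case using step by (simp add: lin_ratio_step mult_ac)
qed simp

lemma pshift_acoeff_ratio:
  "to_fract (pshift i (acoeff d)) * lin_ratio (i + d) = to_fract (linprod (interval (i + d) - interval i)) * lin_ratio i"
proof (cases "d \<ge> 0")
  case True
  then show ?thesis using lin_ratio_interval[of i "i + d", where 'a = 'a]
    by (simp add: acoeff_def linprod_def elts_interval_diff)
next
  case False
  have "pshift i (acoeff d) = ((\<Prod>j\<in>{i + d..<i}. lin j) ^ 2 :: 'a poly)"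
    using pshift_acoeff[of i "i + d", where 'a = 'a] by (simp add: prod_power_distrib)
  then show ?thesis using False lin_ratio_interval[of "i + d" i, where 'a = 'a]
    by (simp add: linprod_def elts_interval_diff power2_eq_square)
qed

definition gwa_coeff :: "int \<Rightarrow> 'k::field gwa \<Rightarrow> 'k poly" where
  "gwa_coeff d a = (THE p. a = gwa_mon d p)"

lemma gwa_coeff_mon [simp]: "gwa_coeff d (gwa_mon d p) = p"
  unfolding gwa_coeff_def by (rule the_equality) auto

text \<open>The element \<open>x\<close> goes to \<open>b\<^sub>i\<close> and \<open>y\<close> to \<open>b\<^sub>i\<^sub>-\<^sub>1\<close>; the variable is shifted because \<open>z\<close> acts as \<open>Z + i\<close>
  in degree \<open>i\<close>.\<close>

definition gwa_to_B :: "int \<Rightarrow> int \<Rightarrow> 'k::field gwa \<Rightarrow> zfin \<Rightarrow> 'k qgr \<Rightarrow> 'k qgr" where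
  "gwa_to_B i d a = b_single (interval (i + d) - interval i) (pshift i (gwa_coeff d a))"

text \<open>Both sides are compared in the group algebra, after multiplication with the nonzero \<open>s\<^sub>i s\<^sub>i\<^sub>+\<^sub>d\<close>.\<close>

lemma gwa_to_B_mult:
  fixes a a' :: "'k::field_char_0 gwa"
  assumes a: "a \<in> hpart gwa_algebra d" and a': "a' \<in> hpart gwa_algebra d'"
  shows "gwa_to_B i (d + d') (a * a') = gwa_to_B i d a \<otimes>\<^bsub>B_algebra\<^esub> gwa_to_B (i + d) d' a'"
proof -
  obtain p p' where p: "a = gwa_mon d p" "a' = gwa_mon d' p'" using a a' by (auto simp: hpart_gwa)
  obtain w where w: "a * a' = gwa_mon (d + d') w"
    using gwa_homogeneous.intros(5)[OF gwa_homogeneous_mon[of d p] gwa_homogeneous_mon[of d' p']] p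
    by (auto simp: gwa_homogeneous_iff)
  let ?r = "\<lambda>i k. linprod (interval k - interval i) :: 'k poly" and ?s = "lin_ratio :: int \<Rightarrow> 'k poly fract"
  have "qcoeff (gwa_embed (a * a')) (d + d') = to_fract (p * acoeff d * pshift d (p' * acoeff d'))"
    by (simp add: p gwa_embed_mult gwa_embed_mon qmonom_mult zshift_mult zshift_to_fract qcoeff_qmonom)
  then have "w * acoeff (d + d') = p * acoeff d * pshift d (p' * acoeff d')"
    by (simp add: w gwa_embed_mon qcoeff_qmonom del: to_fract_mult)
  then have "pshift i (w * acoeff (d + d')) = pshift i (p * acoeff d * pshift d (p' * acoeff d'))" by simp
  then have eq: "pshift i w * pshift i (acoeff (d + d'))
      = pshift i p * pshift i (acoeff d) * (pshift (i + d) p' * pshift (i + d) (acoeff d'))" by simp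
  note R = pshift_acoeff_ratio[of i "d + d'", where 'a = 'k] pshift_acoeff_ratio[of i d, where 'a = 'k]
    pshift_acoeff_ratio[of "i + d" d', where 'a = 'k]
  have "to_fract (?r i (i + d + d') * pshift i w) * (?s i * ?s (i + d))
      = to_fract (pshift i w) * (to_fract (?r i (i + (d + d'))) * ?s i) * ?s (i + d)"
    by (simp add: add.assoc mult_ac)
  also have "\<dots> = to_fract (pshift i w * pshift i (acoeff (d + d'))) * ?s (i + d + d') * ?s (i + d)"
    by (simp only: R(1)[symmetric]) (simp add: add.assoc mult_ac)
  also have "\<dots> = to_fract (pshift i p) * (to_fract (pshift i (acoeff d)) * ?s (i + d))
      * (to_fract (pshift (i + d) p') * (to_fract (pshift (i + d) (acoeff d')) * ?s (i + d + d')))"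
    unfolding eq by (simp add: mult_ac)
  also have "\<dots> = to_fract (?r i (i + d) * pshift i p * (?r (i + d) (i + d + d') * pshift (i + d) p')) * (?s i * ?s (i + d))"
    unfolding R(2,3) by (simp add: mult_ac)
  finally have "?r i (i + d) * pshift i p * (?r (i + d) (i + d + d') * pshift (i + d) p') = ?r i (i + d + d') * pshift i w"
    by (simp del: to_fract_mult)
  moreover have deg: "(interval (i + d) - interval i) + (interval (i + d + d') - interval (i + d)) = interval (i + d + d') - interval i"
    by simp
  ultimately have "b_single (interval (i + d) - interval i) (pshift i p) \<otimes>\<^bsub>B_algebra\<^esub>
      b_single (interval (i + d + d') - interval (i + d)) (pshift (i + d) p')
      = b_single (interval (i + d + d') - interval i) (pshift i w)"
    using b_single_mult_eqI[of "interval (i + d) - interval i" "pshift i p"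
        "interval (i + d + d') - interval (i + d)" "pshift (i + d) p'" "pshift i w"]
    unfolding deg by blast
  then show ?thesis by (simp add: gwa_to_B_def w add.assoc) (simp add: p)
qed

text \<open>For large \<open>N\<close> the degrees \<open>- N\<close> and \<open>N\<close> of the path will do: one set is the complement of \<open>K\<close> in \<open>{- N..<0}\<close>
  together with the nonnegative part of \<open>K\<close>, the other is the complement of \<open>K\<close> in \<open>{0..<N}\<close> together with the
  negative part.\<close>

lemma interval_cover:
  "\<exists>i j. elts (interval i - K) \<inter> elts (interval j - K) = {}"
proof -
  obtain N where N: "\<And>k. k \<in> elts K \<Longrightarrow> - N \<le> k \<and> k < N" "0 \<le> N"
  proof -
    have fin: "finite (insert 0 (abs ` elts K))" by simp
    show thesis
    proof (rule that[of "Max (insert 0 (abs ` elts K)) + 1"])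
      fix k assume "k \<in> elts K"
      then have "\<bar>k\<bar> \<le> Max (insert 0 (abs ` elts K))" by (intro Max_ge[OF fin]) auto
      then show "- (Max (insert 0 (abs ` elts K)) + 1) \<le> k \<and> k < Max (insert 0 (abs ` elts K)) + 1" by linarith
    next
      show "0 \<le> Max (insert 0 (abs ` elts K)) + 1" using Max_ge[OF fin, of 0] by simp
    qed
  qed
  have "elts (interval (- N) - K) \<inter> elts (interval N - K) = {}"
    using N by (auto simp: minus_zfin.rep_eq elts_interval)
  then show ?thesis by blast
qed

lemma gwa_B_comparison:
  "graded_comparison (gwa_algebra :: ('k::field_char_0, int, 'k gwa) galgebra) B_algebra interval gwa_to_B"
proof (intro graded_comparison.intro graded_comparison_axioms.intro gwa_graded_algebra B_graded_algebra)
  fix i d :: int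
  show "bij_betw (gwa_to_B i d :: 'k gwa \<Rightarrow> _) (hpart gwa_algebra d) (hpart B_algebra (interval (i + d) - interval i))"
  proof (rule bij_betwI')
    fix a a' :: "'k gwa" assume "a \<in> hpart gwa_algebra d" "a' \<in> hpart gwa_algebra d"
    then obtain p p' where p: "a = gwa_mon d p" "a' = gwa_mon d p'" by (auto simp: hpart_gwa)
    have "pshift i p = pshift i p' \<longleftrightarrow> p = p'"
      using pshift_eq_0_iff[of i "p - p'"] by simp
    then show "gwa_to_B i d a = gwa_to_B i d a' \<longleftrightarrow> a = a'" by (simp add: gwa_to_B_def p)
  next
    fix a :: "'k gwa"
    show "gwa_to_B i d a \<in> hpart B_algebra (interval (i + d) - interval i)" by (simp add: gwa_to_B_def hpart_B)
  next
    fix b :: "zfin \<Rightarrow> 'k qgr \<Rightarrow> 'k qgr" assume "b \<in> hpart B_algebra (interval (i + d) - interval i)"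
    then obtain g where "b = b_single (interval (i + d) - interval i) g" by (auto simp: hpart_B)
    then show "\<exists>a\<in>hpart gwa_algebra d. b = gwa_to_B i d a"
      by (intro bexI[of _ "gwa_mon d (pshift (- i) g)"]) (simp_all add: gwa_to_B_def hpart_gwa)
  qed
next
  fix a a' :: "'k gwa" and d d' i
  assume a: "a \<in> hpart gwa_algebra d"
  show "gwa_to_B i d (a \<oplus>\<^bsub>gwa_algebra\<^esub> a') = gwa_to_B i d a \<oplus>\<^bsub>B_algebra\<^esub> gwa_to_B i d a'"
    if a': "a' \<in> hpart gwa_algebra d"
  proof -
    obtain p p' where p: "a = gwa_mon d p" "a' = gwa_mon d p'" using a a' by (auto simp: hpart_gwa)
    have "a \<oplus>\<^bsub>gwa_algebra\<^esub> a' = gwa_mon d (p + p')" by (simp add: p gwa_algebra_def gwa_mon_add)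
    then show ?thesis by (simp only: gwa_to_B_def b_single_add) (simp add: p)
  qed
  show "gwa_to_B i (d + d') (a \<otimes>\<^bsub>gwa_algebra\<^esub> a') = gwa_to_B i d a \<otimes>\<^bsub>B_algebra\<^esub> gwa_to_B (i + d) d' a'"
    if "a' \<in> hpart gwa_algebra d'"
    using gwa_to_B_mult[OF a that] by (simp add: gwa_algebra_def)
next
  fix i and c :: 'k
  have "gwa_const [:c:] = gwa_mon 0 [:c:]" for c :: 'k by (simp add: gwa_mon_def)
  then have *: "gwa_to_B i 0 (gwa_const [:c:]) = B_scalar c" for c :: 'k by (simp add: gwa_to_B_def B_scalar_single)
  show "gwa_to_B i 0 (scal gwa_algebra c) = scal B_algebra c"
    using * by (simp add: gwa_algebra_def B_algebra_def)
  show "gwa_to_B i 0 \<one>\<^bsub>gwa_algebra\<^esub> = (\<one>\<^bsub>B_algebra\<^esub> :: zfin \<Rightarrow> 'k qgr \<Rightarrow> 'k qgr)"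
    using *[of 1] by (simp add: gwa_algebra_def B_algebra_def flip: one_pCons)
next
  fix K
  obtain i j where ij: "elts (interval i - K) \<inter> elts (interval j - K) = {}" using interval_cover by blast
  have "bezout (sqprod (elts (interval i - K))) (sqprod (elts (interval j - K)) :: 'k poly)"
    unfolding sqprod_def
  proof (rule bezout_prod)
    fix a assume a: "a \<in> elts (interval i - K)"
    have "bezout (lin b ^ 2) (lin a ^ 2 :: 'k poly)" if "b \<in> elts (interval j - K)" for b
    proof -
      have "a \<noteq> b" using a that ij by auto
      then have "bezout (lin a ^ 2) (lin b :: 'k poly)" by (rule bezout_power2[OF bezout_lin])
      then show ?thesis by (rule bezout_power2[OF bezout_commute])
    qed
    then have "bezout (\<Prod>j\<in>elts (interval j - K). lin j ^ 2) (lin a ^ 2 :: 'k poly)" by (rule bezout_prod)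
    then show "bezout (lin a ^ 2) (\<Prod>j\<in>elts (interval j - K). lin j ^ 2 :: 'k poly)" by (rule bezout_commute)
  qed
  then obtain s t :: "'k poly" where st: "s * sqprod (elts (interval i - K)) + t * sqprod (elts (interval j - K)) = 1"
    by (auto simp: bezout_def)
  have prod: "b_single (interval l - K) g \<otimes>\<^bsub>B_algebra\<^esub> b_single (K - interval l) 1
      = b_single 0 (g * sqprod (elts (interval l - K)))" for l and g :: "'k poly"
  proof -
    have "K - interval l = interval l - K" by (rule zfin_diff_commute)
    then show ?thesis
      using b_single_mult_eqI[of "interval l - K" g "K - interval l" 1 "g * sqprod (elts (interval l - K))"]
      by (simp add: sqprod_linprod power2_eq_square mult_ac)
  qed
  show "\<exists>i j c c' e e'. c \<in> hpart B_algebra (interval i - K) \<and> c' \<in> hpart B_algebra (K - interval i) \<and>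
      e \<in> hpart B_algebra (interval j - K) \<and> e' \<in> hpart B_algebra (K - interval j) \<and>
      (\<one>\<^bsub>B_algebra\<^esub> :: zfin \<Rightarrow> 'k qgr \<Rightarrow> 'k qgr) = c \<otimes>\<^bsub>B_algebra\<^esub> c' \<oplus>\<^bsub>B_algebra\<^esub> e \<otimes>\<^bsub>B_algebra\<^esub> e'"
  proof (intro exI conjI)
    show "b_single (interval i - K) s \<in> hpart B_algebra (interval i - K)"
      "b_single (K - interval i) (1 :: 'k poly) \<in> hpart B_algebra (K - interval i)"
      "b_single (interval j - K) t \<in> hpart B_algebra (interval j - K)"
      "b_single (K - interval j) (1 :: 'k poly) \<in> hpart B_algebra (K - interval j)" by (simp_all add: hpart_B)
    show "(\<one>\<^bsub>B_algebra\<^esub> :: zfin \<Rightarrow> 'k qgr \<Rightarrow> 'k qgr)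
      = b_single (interval i - K) s \<otimes>\<^bsub>B_algebra\<^esub> b_single (K - interval i) 1 \<oplus>\<^bsub>B_algebra\<^esub>
        b_single (interval j - K) t \<otimes>\<^bsub>B_algebra\<^esub> b_single (K - interval j) 1"
      unfolding prod b_single_add st by (simp add: B_algebra_def B_scalar_single flip: one_pCons)
  qed
qed

lemma poly_lepoll:
  assumes "infinite (UNIV :: 'k::zero set)"
  shows "(UNIV :: 'k poly set) \<lesssim> (UNIV :: 'k set)"
proof -
  have "inj (coeffs :: 'k poly \<Rightarrow> _)" by (simp add: inj_def coeffs_eq_iff)
  then have "(UNIV :: 'k poly set) \<lesssim> lists (UNIV :: 'k set)" unfolding lepoll_def by auto
  also have "\<dots> \<lesssim> (UNIV :: 'k set)" using assms by (rule infinite_lists_lepoll)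
  finally show ?thesis .
qed

lemma countable_lepoll_infinite:
  assumes "countable A" "infinite K" shows "A \<lesssim> K"
proof -
  have "A \<lesssim> (UNIV :: nat set)" using assms(1) by (auto simp: countable_def lepoll_def)
  also have "\<dots> \<lesssim> K" using assms(2) by (simp add: infinite_le_lepoll)
  finally show ?thesis .
qed

theorem theorem4p2:
  fixes u :: "'k::{alg_closed_field, field_char_0} \<Rightarrow> 'u" and v :: "'k \<Rightarrow> 'v"
  assumes "inj u" and "inj v"
  shows "linearly_equivalent
    (gr_cat gwa_algebra :: (('k gwa, int, 'u) gmodule, 'u \<Rightarrow> 'u, 'k) lincat)
    (gr_cat B_algebra :: ((zfin \<Rightarrow> 'k qgr \<Rightarrow> 'k qgr, zfin, 'v) gmodule, 'v \<Rightarrow> 'v, 'k) lincat)"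
proof -
  interpret graded_comparison "gwa_algebra :: ('k, int, 'k gwa) galgebra" B_algebra interval gwa_to_B
    by (rule gwa_B_comparison)
  have K: "infinite (UNIV :: 'k set)" by (rule infinite_UNIV_char_0)
  note poly = poly_lepoll[OF K]
  have hA: "hpart (gwa_algebra :: ('k, int, 'k gwa) galgebra) i \<lesssim> (UNIV :: 'k set)" for i
    unfolding hpart_gwa by (rule lepoll_trans[OF image_lepoll poly])
  have A: "carrier (gwa_algebra :: ('k, int, 'k gwa) galgebra) \<lesssim> (UNIV :: 'k set)"
    by (intro A.carrier_lepoll[OF K _ hA] countable_lepoll_infinite[OF _ K]) auto
  have "inj elts" by (simp add: inj_def elts_inject)
  moreover have "countable (range elts)"
    by (rule countable_subset[OF _ countable_Collect_finite]) auto
  ultimately have zfin: "countable (UNIV :: zfin set)" using countable_image_inj_on by blast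
  have hB: "hpart (B_algebra :: ('k, zfin, zfin \<Rightarrow> 'k qgr \<Rightarrow> 'k qgr) galgebra) J \<lesssim> (UNIV :: 'k set)" for J
    unfolding hpart_B by (rule lepoll_trans[OF image_lepoll poly])
  have B: "carrier (B_algebra :: ('k, zfin, zfin \<Rightarrow> 'k qgr \<Rightarrow> 'k qgr) galgebra) \<lesssim> (UNIV :: 'k set)"
    by (rule B.carrier_lepoll[OF K countable_lepoll_infinite[OF zfin K] hB])
  have "(UNIV :: 'k set) \<lesssim> (UNIV :: 'u set)" "(UNIV :: 'k set) \<lesssim> (UNIV :: 'v set)"
    using assms by (auto simp: lepoll_def)
  then show ?thesis by (rule gr_cat_equivalence[OF K A B])
qed

end
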